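(* Let $\mathcal{A}$ be a free hyperplane arrangement in $V$, let $H \in \mathcal{A}$ and $\overline S=S/(\alpha_H)$. Then: (1) the following three conditions are equivalent: (a) $\mathcal{A}\setminus H$ is free; (b) $\mathrm{pd}_{\overline S}(J_{\mathcal{A}}^H)=0$; (c) $J_{\mathcal{A}}^H=S/(\alpha_H)$. (2) $\mathcal{A}^H$ is free if and only if $\mathrm{pd}_{\overline S}(J_{\mathcal{A}}^H)\le 1$.
   Context: Let $\mathbb{K}$ be a field, $V$ an $\ell$-dimensional $\mathbb{K}$-vector space, $x_1,\dots,x_\ell$ a basis of $V^*$ and $S=\mathrm{Sym}(V^* )=\mathbb{K}[x_1,\dots,x_\ell]$, with $\deg x_i=1$. An arrangement in $V$ is a finite set $\mathcal{A}$ of linear hyperplanes (through the origin) of $V$. For a hyperplane $H$, $\alpha_H\in V^*$ denotes a fixed defining linear form, and $Q(\mathcal{A})=\prod_{H\in\mathcal{A}}\alpha_H$. Let $\Omega_V^1=\bigoplus_i S\,dx_i$, $\Omega_V^2=\bigwedge^2\Omega_V^1$, and for $\alpha=\sum c_ix_i$ let $d\alpha=\sum c_i\,dx_i$. Define $$\Omega^1(\mathcal{A})=\{\omega\in \tfrac{1}{Q(\mathcal{A})}\Omega^1_V \mid Q(\mathcal{A})\,\omega\wedge d\alpha_L\in\alpha_L\Omega_V^2\ \text{for all } L\in\mathcal{A}\}.$$ The arrangement $\mathcal{A}$ is free if $\Omega^1(\mathcal{A})$ is a free $S$-module (equivalently, if $D(\mathcal{A})=\{\theta\in\bigoplus_i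 S\,\partial_{x_i}\mid \theta(\alpha_L)\in(\alpha_L)\ \forall L\in\mathcal{A}\}$ is free). For $H\in\mathcal{A}$: $\mathcal{A}\setminus H=\mathcal{A}\setminus\{H\}$ is the deletion; $\mathcal{A}^H=\{H\cap L\mid L\in\mathcal{A}\setminus H\}$ is the restriction, an arrangement in the vector space $H$, whose coordinate ring is $\overline S=S/(\alpha_H)=\mathrm{Sym}(H^* )$ (freeness of $\mathcal{A}^H$ is over $\overline S$); $\overline g$ denotes the image in $\overline S$ of $g\in S$. The residue map $\mathrm{res}^H_{\mathcal{A}}:\Omega^1(\mathcal{A})\to\overline S$ is $$\mathrm{res}^H_{\mathcal{A}}\big(f\,d\alpha_H+f_2\,d\alpha_2+\cdots+f_\ell\,d\alpha_\ell\big)=\frac{1}{Q(\mathcal{A}^H)}\,\overline{Q(\mathcal{A})f},$$ where $\alpha_H,\alpha_2,\dots,\alpha_\ell$ is any basis of $V^*$ (this is well defined, independent of the choice of $\alpha_2,\dots,\alpha_\ell$, and takes values in $\overline S$). The residue ideal $J_{\mathcal{A}}^H\subset\overline S$ of $\mathcal{A}$ along $H$ is the image of $\mathrm{res}^H_{\mathcal{A}}$. $\mathrm{pd}_{\overline S}$ denotes projective dimension over $\overline S$. *)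

theory Defs
  imports
    "HOL-Analysis.Cartesian_Space"
    "HOL-Library.Poly_Mapping"
    "HOL-Library.Extended_Nat"
    "HOL-Algebra.QuotRing"
    "Jordan_Normal_Form.Missing_VectorSpace"
begin

section \<open>Free and projective modules, projective dimension\<close>

definition free_module :: "('r, 's) ring_scheme \<Rightarrow> ('r, 'm, 't) module_scheme \<Rightarrow> bool" where
  "free_module R M \<longleftrightarrow> Module.module R M \<and>
     (\<exists>B \<subseteq> carrier M. module.lin_indpt R M B \<and> module.gen_set R M B)"

text \<open>
  Projective means: direct summand (retract) of a free module. The carrier type of the free module
  is no restriction: it contains the finitely supported functions from the carrier of \<open>M\<close> to \<open>R\<close>,
  and a retract of any free module is a retract of the free module on its own carrier.
\<close>

definition projective_module :: "('r, 's) ring_scheme \<Rightarrow> ('r, 'm) module \<Rightarrow> bool" where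
  "projective_module R M \<longleftrightarrow> Module.module R M \<and>
     (\<exists>(F :: ('r, 'm \<Rightarrow> 'r) module) i p. free_module R F \<and> mod_hom R M F i \<and> mod_hom R F M p \<and>
        (\<forall>x \<in> carrier M. p (i x) = x))"

definition projective_resolution ::
  "('r, 's) ring_scheme \<Rightarrow> ('r, 'm) module \<Rightarrow> (nat \<Rightarrow> ('r, 'p) module) \<Rightarrow>
     (nat \<Rightarrow> 'p \<Rightarrow> 'p) \<Rightarrow> ('p \<Rightarrow> 'm) \<Rightarrow> bool" where
  "projective_resolution R M P d e \<longleftrightarrow>
     (\<forall>i. projective_module R (P i)) \<and>
     (\<forall>i. mod_hom R (P (Suc i)) (P i) (d i)) \<and> mod_hom R (P 0) M e \<and>
     mod_hom.im (P 0) e = carrier M \<and>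
     mod_hom.ker (P 0) M e = mod_hom.im (P 1) (d 0) \<and>
     (\<forall>i. mod_hom.ker (P (Suc i)) (P i) (d i) = mod_hom.im (P (Suc (Suc i))) (d (Suc i)))"

text \<open>
  The least length of a projective resolution; it is \<open>\<infinity>\<close> if there is no finite one, and \<open>0\<close> for the
  zero module. HOL cannot quantify over the carrier type of the modules in the resolution. The type
  chosen here is large enough: it contains the free \<open>R\<close>-modules on all sets of cardinality up to
  \<open>max |R| |M| \<aleph>\<^sub>0\<close>, hence free resolutions of \<open>M\<close> and of all its syzygies, and by Schanuel's
  lemma these compute the projective dimension.
\<close>

definition proj_dim :: "('r, 's) ring_scheme \<Rightarrow> ('r, 'm) module \<Rightarrow> enat" where
  "proj_dim R M = Inf {enat n | n.
     \<exists>(P :: nat \<Rightarrow> ('r, ('r \<times> 'm) list \<Rightarrow> 'r) module) d e.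
       projective_resolution R M P d e \<and> (\<forall>i > n. carrier (P i) = {\<zero>\<^bsub>P i\<^esub>})}"

definition ideal_module :: "('r, 's) ring_scheme \<Rightarrow> 'r set \<Rightarrow> ('r, 'r) module" where
  "ideal_module R I = \<lparr>carrier = I, mult = mult R, one = one R, zero = zero R, add = add R,
     smult = mult R\<rparr>"


section \<open>The field of fractions of a domain\<close>

definition frac_rel :: "('r, 's) ring_scheme \<Rightarrow> (('r \<times> 'r) \<times> ('r \<times> 'r)) set" where
  "frac_rel R = {((a, b), (c, d)). a \<in> carrier R \<and> b \<in> carrier R - {\<zero>\<^bsub>R\<^esub>} \<and>
     c \<in> carrier R \<and> d \<in> carrier R - {\<zero>\<^bsub>R\<^esub>} \<and> a \<otimes>\<^bsub>R\<^esub> d = c \<otimes>\<^bsub>R\<^esub> b}"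

definition frac :: "('r, 's) ring_scheme \<Rightarrow> 'r \<Rightarrow> 'r \<Rightarrow> ('r \<times> 'r) set" where
  "frac R a b = frac_rel R `` {(a, b)}"

definition fraction_field :: "('r, 's) ring_scheme \<Rightarrow> ('r \<times> 'r) set ring" where
  "fraction_field R =
     \<lparr>carrier = {frac R a b | a b. a \<in> carrier R \<and> b \<in> carrier R - {\<zero>\<^bsub>R\<^esub>}},
      mult = (\<lambda>x y. \<Union>(a, b)\<in>x. \<Union>(c, d)\<in>y. frac R (a \<otimes>\<^bsub>R\<^esub> c) (b \<otimes>\<^bsub>R\<^esub> d)),
      one = frac R \<one>\<^bsub>R\<^esub> \<one>\<^bsub>R\<^esub>,
      zero = frac R \<zero>\<^bsub>R\<^esub> \<one>\<^bsub>R\<^esub>,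
      add = (\<lambda>x y. \<Union>(a, b)\<in>x. \<Union>(c, d)\<in>y.
               frac R (a \<otimes>\<^bsub>R\<^esub> d \<oplus>\<^bsub>R\<^esub> c \<otimes>\<^bsub>R\<^esub> b) (b \<otimes>\<^bsub>R\<^esub> d))\<rparr>"

abbreviation frac_of :: "('r, 's) ring_scheme \<Rightarrow> 'r \<Rightarrow> ('r \<times> 'r) set" where
  "frac_of R a \<equiv> frac R a \<one>\<^bsub>R\<^esub>"


section \<open>Arrangements and coordinate rings\<close>

text \<open>
  \<open>V\<close> is the coordinate space \<^typ>\<open>'k^'n\<close>, so that \<open>\<ell> = CARD('n)\<close>, and the linear form
  \<open>\<Sum>i. c\<^sub>i x\<^sub>i\<close> on \<open>V\<close> is given by its coefficient vector \<open>c\<close>. A polynomial in \<open>K[x\<^sub>i | i]\<close> is a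
  finitely supported function from exponent vectors to coefficients.
\<close>

type_synonym ('k, 'n) mpoly = "('n \<Rightarrow>\<^sub>0 nat) \<Rightarrow>\<^sub>0 'k"

definition pairing :: "'k::field^'n \<Rightarrow> 'k^'n \<Rightarrow> 'k" where
  "pairing a v = (\<Sum>i\<in>UNIV. a $ i * v $ i)"

definition const_poly :: "'k::field \<Rightarrow> ('k, 'n) mpoly" where
  "const_poly c = Poly_Mapping.single 0 c"

definition linear_poly :: "'k::field^'n \<Rightarrow> ('k, 'n) mpoly" where
  "linear_poly a = (\<Sum>i\<in>UNIV. Poly_Mapping.single (Poly_Mapping.single i 1) (a $ i))"

definition poly_ring :: "('k::field, 'n) mpoly ring" where
  "poly_ring = \<lparr>carrier = UNIV, mult = (*), one = 1, zero = 0, add = (+)\<rparr>"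

definition hyperplane :: "('k::field^'n) set \<Rightarrow> ('k^'n) set \<Rightarrow> bool" where
  "hyperplane W X \<longleftrightarrow> vec.subspace X \<and> X \<subseteq> W \<and> vec.dim W = vec.dim X + 1"

definition arrangement :: "('k::field^'n) set \<Rightarrow> ('k^'n) set set \<Rightarrow> bool" where
  "arrangement W A \<longleftrightarrow> finite A \<and> (\<forall>X\<in>A. hyperplane W X)"

text \<open>
  A fixed linear form on \<open>V\<close> whose restriction to \<open>W\<close> defines the hyperplane \<open>X\<close> of \<open>W\<close>.
\<close>

definition def_form :: "('k::field^'n) set \<Rightarrow> ('k^'n) set \<Rightarrow> 'k^'n" where
  "def_form W X = (SOME a. X = {v \<in> W. pairing a v = 0})"

text \<open>
  The following definitions describe an arrangement \<open>A\<close> in a subspace \<open>W\<close> of \<open>V\<close> whose coordinate ring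
  \<open>Sym(W\<^sup>*)\<close> is \<open>R\<close>, where \<open>pr\<close> is the canonical surjection from \<open>K[x\<^sub>i | i] = Sym(V\<^sup>*)\<close> onto \<open>R\<close>.
  They are used for \<open>W = V\<close> with \<open>R = S\<close>, and for \<open>W = H\<close> with \<open>R = S/(\<alpha>\<^sub>H)\<close>.

  A rational 1-form \<open>\<omega>\<close> on \<open>W\<close> is represented by the function taking a vector \<open>v \<in> W\<close> to the contraction
  of \<open>\<omega>\<close> with \<open>v\<close>, which lies in the fraction field of \<open>R\<close>. Thus \<open>d\<alpha>\<close> is the function \<open>\<alpha>\<close> itself with values in the
  constants, and the \<open>dx\<^sub>i\<close> are linearly independent for \<open>W = V\<close> (for \<open>W = H\<close> they still generate
  \<open>R \<otimes> H\<^sup>*\<close>). Likewise a 2-form is represented by an alternating function on pairs of vectors.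
\<close>

definition defining_poly ::
  "('r, 's) ring_scheme \<Rightarrow> (('k::field, 'n) mpoly \<Rightarrow> 'r) \<Rightarrow> ('k^'n) set \<Rightarrow> ('k^'n) set set \<Rightarrow> 'r" where
  "defining_poly R pr W A = (\<Otimes>\<^bsub>R\<^esub> X\<in>A. pr (linear_poly (def_form W X)))"

abbreviation forms1 :: "('r, 's) ring_scheme \<Rightarrow> ('k::field^'n) set \<Rightarrow>
    (('r \<times> 'r) set, 'k^'n \<Rightarrow> ('r \<times> 'r) set) module" where
  "forms1 R W \<equiv> ring.func_space (fraction_field R) W"

abbreviation forms2 :: "('r, 's) ring_scheme \<Rightarrow> ('k::field^'n) set \<Rightarrow>
    (('r \<times> 'r) set, ('k^'n) \<times> ('k^'n) \<Rightarrow> ('r \<times> 'r) set) module" where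
  "forms2 R W \<equiv> ring.func_space (fraction_field R) (W \<times> W)"

definition dform :: "('r, 's) ring_scheme \<Rightarrow> (('k::field, 'n) mpoly \<Rightarrow> 'r) \<Rightarrow> ('k^'n) set \<Rightarrow>
    'k^'n \<Rightarrow> 'k^'n \<Rightarrow> ('r \<times> 'r) set" where
  "dform R pr W a = (\<lambda>v\<in>W. frac_of R (pr (const_poly (pairing a v))))"

definition wedge :: "('r, 's) ring_scheme \<Rightarrow> ('k::field^'n) set \<Rightarrow> ('k^'n \<Rightarrow> ('r \<times> 'r) set) \<Rightarrow>
    ('k^'n \<Rightarrow> ('r \<times> 'r) set) \<Rightarrow> ('k^'n) \<times> ('k^'n) \<Rightarrow> ('r \<times> 'r) set" where
  "wedge R W \<omega> \<eta> = (\<lambda>(u, v)\<in>W \<times> W.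
     \<omega> u \<otimes>\<^bsub>fraction_field R\<^esub> \<eta> v \<ominus>\<^bsub>fraction_field R\<^esub> \<omega> v \<otimes>\<^bsub>fraction_field R\<^esub> \<eta> u)"

definition Omega1 :: "('r, 's) ring_scheme \<Rightarrow> (('k::field, 'n) mpoly \<Rightarrow> 'r) \<Rightarrow> ('k^'n) set \<Rightarrow>
    ('k^'n \<Rightarrow> ('r \<times> 'r) set) set" where
  "Omega1 R pr W = {\<Oplus>\<^bsub>forms1 R W\<^esub> i\<in>UNIV. frac_of R (f i) \<odot>\<^bsub>forms1 R W\<^esub> dform R pr W (axis i 1)
     | f. \<forall>i. f i \<in> carrier R}"

definition Omega2 :: "('r, 's) ring_scheme \<Rightarrow> (('k::field, 'n) mpoly \<Rightarrow> 'r) \<Rightarrow> ('k^'n) set \<Rightarrow>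
    (('k^'n) \<times> ('k^'n) \<Rightarrow> ('r \<times> 'r) set) set" where
  "Omega2 R pr W = {\<Oplus>\<^bsub>forms2 R W\<^esub> ij\<in>UNIV. frac_of R (f ij) \<odot>\<^bsub>forms2 R W\<^esub>
       wedge R W (dform R pr W (axis (fst ij) 1)) (dform R pr W (axis (snd ij) 1))
     | f. \<forall>ij. f ij \<in> carrier R}"

definition log_forms :: "('r, 's) ring_scheme \<Rightarrow> (('k::field, 'n) mpoly \<Rightarrow> 'r) \<Rightarrow> ('k^'n) set \<Rightarrow>
    ('k^'n) set set \<Rightarrow> ('k^'n \<Rightarrow> ('r \<times> 'r) set) set" where
  "log_forms R pr W A =
     {\<omega> \<in> {frac R \<one>\<^bsub>R\<^esub> (defining_poly R pr W A) \<odot>\<^bsub>forms1 R W\<^esub> \<eta> | \<eta>. \<eta> \<in> Omega1 R pr W}.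
       \<forall>L\<in>A. frac_of R (defining_poly R pr W A) \<odot>\<^bsub>forms2 R W\<^esub>
                  wedge R W \<omega> (dform R pr W (def_form W L))
             \<in> {frac_of R (pr (linear_poly (def_form W L))) \<odot>\<^bsub>forms2 R W\<^esub> \<zeta> | \<zeta>.
                  \<zeta> \<in> Omega2 R pr W}}"

definition log_forms_module :: "('r, 's) ring_scheme \<Rightarrow> (('k::field, 'n) mpoly \<Rightarrow> 'r) \<Rightarrow>
    ('k^'n) set \<Rightarrow> ('k^'n) set set \<Rightarrow> ('r, 'k^'n \<Rightarrow> ('r \<times> 'r) set) module" where
  "log_forms_module R pr W A =
     \<lparr>carrier = log_forms R pr W A, mult = mult (forms1 R W), one = one (forms1 R W),
      zero = zero (forms1 R W), add = add (forms1 R W),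
      smult = (\<lambda>r \<omega>. frac_of R r \<odot>\<^bsub>forms1 R W\<^esub> \<omega>)\<rparr>"

definition free_arrangement :: "('r, 's) ring_scheme \<Rightarrow> (('k::field, 'n) mpoly \<Rightarrow> 'r) \<Rightarrow>
    ('k^'n) set \<Rightarrow> ('k^'n) set set \<Rightarrow> bool" where
  "free_arrangement R pr W A \<longleftrightarrow> free_module R (log_forms_module R pr W A)"


section \<open>Restrictions and residues\<close>

abbreviation alpha :: "('k::field^'n) set \<Rightarrow> 'k^'n" where
  "alpha \<equiv> def_form UNIV"

definition restriction :: "('k::field^'n) set set \<Rightarrow> ('k^'n) set \<Rightarrow> ('k^'n) set set" where
  "restriction A H = {H \<inter> L | L. L \<in> A - {H}}"

definition Sbar :: "('k::field^'n) set \<Rightarrow> ('k, 'n) mpoly set ring" where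
  "Sbar H = poly_ring Quot (PIdl\<^bsub>poly_ring\<^esub> (linear_poly (alpha H)))"

definition proj_Sbar :: "('k::field^'n) set \<Rightarrow> ('k, 'n) mpoly \<Rightarrow> ('k, 'n) mpoly set" where
  "proj_Sbar H p = (PIdl\<^bsub>poly_ring\<^esub> (linear_poly (alpha H))) +>\<^bsub>poly_ring\<^esub> p"

text \<open>
  Below, \<open>B\<close> is a basis of \<open>V\<^sup>*\<close> containing \<open>\<alpha>\<^sub>H\<close>, and \<open>p\<close> is the polynomial \<open>Q(A) f\<^sub>H\<close>, where \<open>f\<^sub>H\<close> is the
  coefficient of \<open>\<omega>\<close> at \<open>d\<alpha>\<^sub>H\<close>.
\<close>

definition residue :: "('k::field^'n) set set \<Rightarrow> ('k^'n) set \<Rightarrow>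
    ('k^'n \<Rightarrow> (('k, 'n) mpoly \<times> ('k, 'n) mpoly) set) \<Rightarrow> ('k, 'n) mpoly set" where
  "residue A H \<omega> = (THE g. g \<in> carrier (Sbar H) \<and>
     (\<exists>B f p. vec.independent B \<and> vec.span B = UNIV \<and> alpha H \<in> B \<and>
        f \<in> B \<rightarrow> carrier (fraction_field poly_ring) \<and>
        \<omega> = (\<Oplus>\<^bsub>forms1 poly_ring UNIV\<^esub> \<beta>\<in>B.
               f \<beta> \<odot>\<^bsub>forms1 poly_ring UNIV\<^esub> dform poly_ring id UNIV \<beta>) \<and>
        frac_of poly_ring p =
          frac_of poly_ring (defining_poly poly_ring id UNIV A) \<otimes>\<^bsub>fraction_field poly_ring\<^esub> f (alpha H) \<and>
        defining_poly (Sbar H) (proj_Sbar H) H (restriction A H) \<otimes>\<^bsub>Sbar H\<^esub> g = proj_Sbar H p))"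

definition residue_ideal :: "('k::field^'n) set set \<Rightarrow> ('k^'n) set \<Rightarrow> ('k, 'n) mpoly set set" where
  "residue_ideal A H = residue A H ` log_forms poly_ring id UNIV A"

end

theory Submission
  imports Defs
begin

text \<open>
  All modules of logarithmic forms are graded, so that being projective and being free coincide for them
  (graded Nakayama lemma).

  The residue ideal \<open>J\<close> contains \<open>P\<close>, the quotient of the restriction of \<open>Q(A \ {H})\<close> to \<open>H\<close> by \<open>Q(A\<^sup>H)\<close>, and,
  for every \<open>X \<in> A\<^sup>H\<close>, an element not divisible by the form of \<open>X\<close>. As \<open>P\<close> is a product of such forms, the
  elements of \<open>J\<close> have no common factor, and \<open>J\<close> can only be invertible if it is the unit ideal. If the deletion
  is free, then \<open>J\<close> is a retract of a free module, hence the unit ideal; if \<open>J\<close> contains \<open>1\<close>, then a form of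
  residue \<open>1\<close> splits \<open>\<Omega>\<^sup>1(A)\<close>, and \<open>\<Omega>\<^sup>1(A \ {H})\<close> is projective.

  The forms without residue come from \<open>A \ {H}\<close> and can be restricted to \<open>H\<close>. This identifies the relations
  between the residues of a basis of \<open>\<Omega>\<^sup>1(A)\<close> with \<open>\<Omega>\<^sup>1(A\<^sup>H)\<close>, so by Schanuel's lemma \<open>J\<close> has projective
  dimension at most one if and only if \<open>\<Omega>\<^sup>1(A\<^sup>H)\<close> is projective.
\<close>

text \<open>Forms are replaced by the polynomial coefficient vectors left after multiplication by
  the defining polynomial. With \<open>t\<close> the form of \<open>H\<close>, this gives a chain
  \<open>t * MA'\<close> \<subseteq> \<open>MA\<close> \<subseteq> \<open>MA'\<close>: the first
  inclusion is that of the forms of the deletion in those of \<open>A\<close>, the second is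
  multiplication of forms by \<open>t\<close>. The kernel of \<open>res\<close> is
  \<open>t * MA'\<close>, the kernel of \<open>rho\<close> is \<open>MA\<close>. For free
  \<open>MA\<close>, the relations over the quotient ring between the residues of a basis are
  therefore \<open>t * MA'\<close> modulo \<open>t * MA\<close>, which is \<open>MA'\<close> modulo
  \<open>MA\<close>, which is the image of \<open>rho\<close>. The obstacle is that
  \<open>rho\<close> need not be surjective for a general arrangement. Here freeness of
  \<open>A\<close> enters: coordinates with respect to a basis turn the lifting problem into
  divisibility in a polynomial ring, and this can be checked at one hyperplane of the restriction at
  a time, where explicit lifts exist. Finiteness has an elementary source: a fixed nonzero
  polynomial carries each module of logarithmic forms into the span of finitely many of its
  elements, and in a domain this forces a dual basis to be finite up to functionals that
  vanish.\<close>

abbreviation lookup :: "('a \<Rightarrow>\<^sub>0 'b::zero) \<Rightarrow> 'a \<Rightarrow> 'b" where "lookup \<equiv> Poly_Mapping.lookup"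
abbreviation keys :: "('a \<Rightarrow>\<^sub>0 'b::zero) \<Rightarrow> 'a set" where "keys \<equiv> Poly_Mapping.keys"

section \<open>Polynomials and their grading by total degree\<close>

lemma poly_mapping_single_add_induct [case_names zero add]:
  fixes p :: "'a \<Rightarrow>\<^sub>0 'b::ab_group_add"
  assumes "P 0" and "\<And>p m c. P p \<Longrightarrow> P (p + Poly_Mapping.single m c)"
  shows "P p"
proof -
  have "\<forall>p :: 'a \<Rightarrow>\<^sub>0 'b. card (keys p) = n \<longrightarrow> P p" for n
  proof (induction n)
    case 0
    then show ?case using assms(1) by (auto simp: keys_eq_empty)
  next
    case (Suc n)
    show ?case
    proof (intro allI impI)
      fix p :: "'a \<Rightarrow>\<^sub>0 'b" assume c: "card (keys p) = Suc n"
      then obtain m where m: "m \<in> keys p" by fastforce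
      define q where "q = p - Poly_Mapping.single m (lookup p m)"
      have "keys q = keys p - {m}"
        unfolding q_def by (auto simp: in_keys_iff lookup_minus lookup_single when_def split: if_splits)
      then have "card (keys q) = n" using c m by simp
      then have "P q" using Suc by blast
      then have "P (q + Poly_Mapping.single m (lookup p m))" by (rule assms(2))
      then show "P p" by (simp add: q_def)
    qed
  qed
  then show ?thesis by blast
qed

definition mdeg :: "('n::finite \<Rightarrow>\<^sub>0 nat) \<Rightarrow> nat" where
  "mdeg m = (\<Sum>i\<in>UNIV. lookup m i)"

lemma mdeg_add: "mdeg (m + k) = mdeg m + mdeg k"
  by (simp add: mdeg_def lookup_add sum.distrib)

lemma mdeg_0 [simp]: "mdeg 0 = 0"
  by (simp add: mdeg_def)

lemma mdeg_eq_0 [simp]: "mdeg m = 0 \<longleftrightarrow> m = 0"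
  by (auto simp: mdeg_def intro: poly_mapping_eqI)

lemma mdeg_single [simp]: "mdeg (Poly_Mapping.single i n) = n"
  by (simp add: mdeg_def lookup_single when_def)

text \<open>The homogeneous component of degree \<open>d\<close>. The equation
  \<open>hc d p = p\<close> serves throughout to say that \<open>p\<close> is homogeneous of degree
  \<open>d\<close>; zero satisfies it for every \<open>d\<close>.\<close>

definition hc :: "nat \<Rightarrow> ('k::field, 'n::finite) mpoly \<Rightarrow> ('k, 'n) mpoly" where
  "hc d p = (\<Sum>m\<in>{m \<in> keys p. mdeg m = d}. Poly_Mapping.single m (lookup p m))"

lemma lookup_hc: "lookup (hc d p) m = (if mdeg m = d then lookup p m else 0)"
  by (auto simp: hc_def lookup_sum lookup_single when_def sum.delta' in_keys_iff)

lemma hc_add [simp]: "hc d (p + q) = hc d p + hc d q"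
  by (rule poly_mapping_eqI) (simp add: lookup_hc lookup_add)

lemma hc_diff [simp]: "hc d (p - q) = hc d p - hc d q"
  by (rule poly_mapping_eqI) (simp add: lookup_hc lookup_minus)

lemma hc_0 [simp]: "hc d 0 = 0"
  by (rule poly_mapping_eqI) (simp add: lookup_hc)

lemma hc_sum: "hc d (sum f I) = (\<Sum>i\<in>I. hc d (f i))"
  by (induction I rule: infinite_finite_induct) auto

lemma hc_single: "hc d (Poly_Mapping.single m c) = (if mdeg m = d then Poly_Mapping.single m c else 0)"
  by (rule poly_mapping_eqI) (auto simp: lookup_hc lookup_single when_def)

lemma hc_hc [simp]: "hc d (hc e p) = (if d = e then hc d p else 0)"
  by (rule poly_mapping_eqI) (auto simp: lookup_hc)

text \<open>Both sides are biadditive in \<open>p\<close> and \<open>q\<close>, so two single terms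
  suffice; for these only the index \<open>mdeg m\<close> contributes to the sum.\<close>

lemma hc_mult: "hc d (p * q) = (\<Sum>i\<le>d. hc i p * hc (d - i) q)"
proof (induction p rule: poly_mapping_single_add_induct)
  case zero
  then show ?case by simp
next
  case (add p m a)
  have "hc d (Poly_Mapping.single m a * q) = (\<Sum>i\<le>d. hc i (Poly_Mapping.single m a) * hc (d - i) q)"
  proof (induction q rule: poly_mapping_single_add_induct)
    case zero
    then show ?case by simp
  next
    case (add q k b)
    have "hc d (Poly_Mapping.single m a * Poly_Mapping.single k b) =
        (if mdeg m \<le> d \<and> mdeg k = d - mdeg m then Poly_Mapping.single m a * Poly_Mapping.single k b else 0)"
      by (auto simp: mult_single hc_single mdeg_add)
    also have "\<dots> = (\<Sum>i\<le>d. if mdeg m = i then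
         (if mdeg k = d - i then Poly_Mapping.single m a * Poly_Mapping.single k b else 0) else 0)"
      by (subst sum.delta') auto
    also have "\<dots> = (\<Sum>i\<le>d. hc i (Poly_Mapping.single m a) * hc (d - i) (Poly_Mapping.single k b))"
      by (rule sum.cong) (auto simp: hc_single)
    finally show ?case using add by (simp add: distrib_left sum.distrib)
  qed
  then show ?case using add by (simp add: distrib_right sum.distrib)
qed

lemma eq_0_if_hc: "(\<And>d. hc d p = 0) \<Longrightarrow> p = 0"
proof (rule poly_mapping_eqI)
  fix m assume "\<And>d. hc d p = 0"
  then have "lookup (hc (mdeg m) p) m = 0" by simp
  then show "lookup p m = lookup 0 m" by (simp add: lookup_hc)
qed

text \<open>The inserted 0 keeps the set nonempty for the zero polynomial.\<close>

definition degb :: "('k::field, 'n::finite) mpoly \<Rightarrow> nat" where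
  "degb p = Max (insert 0 (mdeg ` keys p))"

lemma hc_eq_0_if_degb: "degb p < d \<Longrightarrow> hc d p = 0"
proof (rule poly_mapping_eqI)
  fix m assume d: "degb p < d"
  show "lookup (hc d p) m = lookup 0 m"
  proof (cases "mdeg m = d \<and> m \<in> keys p")
    case True
    then have "mdeg m \<le> degb p" unfolding degb_def by (intro Max_ge) auto
    then show ?thesis using True d by simp
  qed (auto simp: lookup_hc in_keys_iff)
qed

lemma hc_mult_homog:
  assumes "hc e h = h"
  shows "hc d (p * h) = (if e \<le> d then hc (d - e) p * h else 0)"
proof -
  have *: "hc i h = (if i = e then h else 0)" for i
    using hc_hc[of i e h] assms by auto
  have "hc d (p * h) = (\<Sum>i\<le>d. if d - i = e then hc i p * h else 0)"
    unfolding hc_mult by (rule sum.cong) (auto simp: *)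
  also have "\<dots> = (\<Sum>i\<le>d. if i = d - e \<and> e \<le> d then hc i p * h else 0)"
    by (rule sum.cong) auto
  also have "\<dots> = (if e \<le> d then hc (d - e) p * h else 0)"
    by (cases "e \<le> d") auto
  finally show ?thesis .
qed

lemma homog_mult:
  assumes "hc d p = p" "hc e q = q"
  shows "hc (d + e) (p * q) = p * q"
  using hc_mult_homog[OF assms(2), of "d + e" p] assms(1) by simp

lemma const_poly_0 [simp]: "const_poly 0 = 0"
  by (simp add: const_poly_def)

lemma const_poly_1 [simp]: "const_poly 1 = 1"
  by (simp add: const_poly_def)

lemma const_poly_add: "const_poly (a + b) = const_poly a + const_poly b"
  by (simp add: const_poly_def single_add)

lemma const_poly_diff: "const_poly (a - b) = const_poly a - const_poly b"
  by (simp add: const_poly_def single_diff)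

lemma const_poly_mult: "const_poly (a * b) = const_poly a * const_poly b"
  by (simp add: const_poly_def mult_single)

lemma const_poly_sum: "const_poly (sum f I) = (\<Sum>i\<in>I. const_poly (f i))"
  by (induction I rule: infinite_finite_induct) (auto simp: const_poly_add)

lemma const_poly_inverse: "c \<noteq> 0 \<Longrightarrow> const_poly (inverse c) * const_poly c = 1"
  by (simp flip: const_poly_mult)

lemma hc_const: "hc d (const_poly c) = (if d = 0 then const_poly c else 0)"
  by (auto simp: const_poly_def hc_single)

lemma hc_0_eq_const: "hc 0 p = const_poly (lookup p 0)"
  by (rule poly_mapping_eqI) (auto simp: const_poly_def lookup_hc lookup_single when_def)

lemma const_poly_eq_0 [simp]: "const_poly c = 0 \<longleftrightarrow> c = 0"
  by (simp add: const_poly_def flip: keys_eq_empty)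

subsection \<open>Domain\<close>

text \<open>An additive weight that separates finitely many monomials stands in for a monomial
  order, as the variables carry no order. It is built one variable at a time like a positional
  numeral system: the exponent of the new variable is the last digit in base \<open>N\<close>, where
  \<open>N\<close> exceeds all its exponents in \<open>M\<close>.\<close>

lemma ex_inj_weight:
  fixes M :: "('n::finite \<Rightarrow>\<^sub>0 nat) set"
  assumes "finite M"
  shows "\<exists>w :: ('n \<Rightarrow>\<^sub>0 nat) \<Rightarrow> nat. (\<forall>m k. w (m + k) = w m + w k) \<and> inj_on w M"
proof -
  define D where "D = {(m, k). m \<in> M \<and> k \<in> M}"
  have "\<exists>w :: 'n \<Rightarrow> nat. \<forall>m\<in>M. \<forall>k\<in>M. (\<forall>i\<in>I. w i = w i) \<and>
      ((\<Sum>i\<in>I. w i * lookup m i) = (\<Sum>i\<in>I. w i * lookup k i) \<longrightarrow> (\<forall>i\<in>I. lookup m i = lookup k i))"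
    if "finite I" for I :: "'n set"
    using that
  proof (induction I rule: finite_induct)
    case empty
    then show ?case by auto
  next
    case (insert j I)
    obtain w where w: "\<And>m k. m \<in> M \<Longrightarrow> k \<in> M \<Longrightarrow> (\<Sum>i\<in>I. w i * lookup m i) = (\<Sum>i\<in>I. w i * lookup k i)
        \<Longrightarrow> \<forall>i\<in>I. lookup m i = lookup k i"
      using insert.IH by auto
    define N where "N = Suc (Max (insert 0 ((\<lambda>m. lookup m j) ` M)))"
    have N: "lookup m j < N" if "m \<in> M" for m
      unfolding N_def using that assms by (auto simp: less_Suc_eq_le intro!: Max_ge)
    define w' where "w' i = (if i = j then 1 else N * w i)" for i
    have S: "(\<Sum>i\<in>insert j I. w' i * lookup m i) = lookup m j + N * (\<Sum>i\<in>I. w i * lookup m i)" for m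
    proof -
      have "(\<Sum>i\<in>I. w' i * lookup m i) = (\<Sum>i\<in>I. N * (w i * lookup m i))"
        using insert.hyps by (intro sum.cong) (auto simp: w'_def)
      then show ?thesis using insert.hyps by (simp add: w'_def sum_distrib_left)
    qed
    show ?case
    proof (intro exI[of _ w'] ballI conjI impI refl)
      fix m k i assume m: "m \<in> M" and k: "k \<in> M" and i: "i \<in> insert j I"
        and eq: "(\<Sum>i\<in>insert j I. w' i * lookup m i) = (\<Sum>i\<in>insert j I. w' i * lookup k i)"
      let ?a = "\<Sum>i\<in>I. w i * lookup m i" and ?b = "\<Sum>i\<in>I. w i * lookup k i"
      have e: "lookup m j + N * ?a = lookup k j + N * ?b" using eq by (simp only: S)
      have "(lookup m j + N * ?a) mod N = lookup m j" "(lookup k j + N * ?b) mod N = lookup k j"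
        using N[OF m] N[OF k] by auto
      then have j: "lookup m j = lookup k j" using e by metis
      then have "?a = ?b" using e N[OF m] by auto
      then show "lookup m i = lookup k i" using w[OF m k] i j by auto
    qed
  qed
  from this[of UNIV] obtain w :: "'n \<Rightarrow> nat" where w: "\<And>m k. m \<in> M \<Longrightarrow> k \<in> M \<Longrightarrow>
      (\<Sum>i\<in>UNIV. w i * lookup m i) = (\<Sum>i\<in>UNIV. w i * lookup k i) \<Longrightarrow> m = k"
    by (auto simp: poly_mapping_eq_iff fun_eq_iff)
  show ?thesis
    by (rule exI[of _ "\<lambda>m. \<Sum>i\<in>UNIV. w i * lookup m i"])
      (auto simp: lookup_add distrib_left sum.distrib inj_on_def intro: w)
qed

text \<open>The terms of greatest weight in \<open>p\<close> and in \<open>q\<close> are unique, so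
  no other pair of terms contributes to the coefficient of their product.\<close>

lemma mpoly_mult_eq_0:
  fixes p q :: "('k::field, 'n::finite) mpoly"
  shows "p * q = 0 \<longleftrightarrow> p = 0 \<or> q = 0"
proof (rule iffI, rule ccontr)
  assume pq: "p * q = 0" and "\<not> (p = 0 \<or> q = 0)"
  then have ne: "keys p \<noteq> {}" "keys q \<noteq> {}" by (auto simp: keys_eq_empty)
  obtain w :: "('n \<Rightarrow>\<^sub>0 nat) \<Rightarrow> nat" where wa: "\<And>m k. w (m + k) = w m + w k"
    and inj: "inj_on w (keys p \<union> keys q)"
    using ex_inj_weight[of "keys p \<union> keys q"] by auto
  have mx: "\<exists>s\<in>keys f. \<forall>m\<in>keys f. w m \<le> w s" if "keys f \<noteq> {}" for f :: "('k, 'n) mpoly"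
  proof -
    have "Max (w ` keys f) \<in> w ` keys f" using that by (intro Max_in) auto
    then obtain s where "s \<in> keys f" "w s = Max (w ` keys f)" by auto
    then show ?thesis by (metis Max_ge finite_imageI finite_keys imageI)
  qed
  obtain s where s: "s \<in> keys p" "\<And>m. m \<in> keys p \<Longrightarrow> w m \<le> w s" using mx[OF ne(1)] by auto
  obtain t where t: "t \<in> keys q" "\<And>m. m \<in> keys q \<Longrightarrow> w m \<le> w t" using mx[OF ne(2)] by auto
  have uniq: "m = s \<and> k = t" if "m \<in> keys p" "k \<in> keys q" "m + k = s + t" for m k
  proof -
    have "w m + w k = w s + w t" using that(3) wa by metis
    moreover have "w m \<le> w s" "w k \<le> w t" using s t that by auto
    ultimately have "w m = w s" "w k = w t" by auto
    then show ?thesis using inj that s t by (auto simp: inj_on_def)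
  qed
  have P: "lookup p m = 0" if "m \<notin> keys p" for m using that by (simp add: in_keys_iff)
  have Q: "lookup q m = 0" if "m \<notin> keys q" for m using that by (simp add: in_keys_iff)
  have "p * q = (\<Sum>m\<in>keys p. \<Sum>k\<in>keys q. Poly_Mapping.single (m + k) (lookup p m * lookup q k))"
  proof -
    have r: "f = (\<Sum>m\<in>keys f. Poly_Mapping.single m (lookup f m))" for f :: "('k, 'n) mpoly"
      by (rule poly_mapping_eqI) (auto simp: lookup_sum lookup_single when_def sum.delta' in_keys_iff)
    have "p * q = (\<Sum>m\<in>keys p. Poly_Mapping.single m (lookup p m)) * (\<Sum>m\<in>keys q. Poly_Mapping.single m (lookup q m))"
      using r by metis
    also have "\<dots> = (\<Sum>m\<in>keys p. \<Sum>k\<in>keys q. Poly_Mapping.single (m + k) (lookup p m * lookup q k))"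
      by (simp add: sum_product mult_single)
    finally show ?thesis .
  qed
  then have "lookup (p * q) (s + t) = (\<Sum>m\<in>keys p. \<Sum>k\<in>keys q. (lookup p m * lookup q k) when m + k = s + t)"
    by (simp add: lookup_sum lookup_single)
  also have "\<dots> = (\<Sum>m\<in>keys p. \<Sum>k\<in>keys q. if m = s \<and> k = t then lookup p s * lookup q t else 0)"
    by (intro sum.cong refl) (auto simp: when_def dest: uniq)
  also have "\<dots> = (\<Sum>m\<in>keys p. if m = s then lookup p s * lookup q t else 0)"
    using t(1) by (intro sum.cong refl) auto
  also have "\<dots> = lookup p s * lookup q t" using s(1) by simp
  finally show False using pq s(1) t(1) by (simp add: in_keys_iff)
qed auto

lemma mpoly_mult_left_cancel:
  fixes p q r :: "('k::field, 'n::finite) mpoly"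
  assumes "r \<noteq> 0"
  shows "r * p = r * q \<longleftrightarrow> p = q"
proof -
  have "r * p = r * q \<longleftrightarrow> r * (p - q) = 0" by (simp add: algebra_simps)
  then show ?thesis using assms by (simp add: mpoly_mult_eq_0)
qed

lemma mpoly_dvd_mult_cancel_left:
  fixes p q r :: "('k::field, 'n::finite) mpoly"
  assumes "r \<noteq> 0"
  shows "r * p dvd r * q \<longleftrightarrow> p dvd q"
proof
  assume "r * p dvd r * q"
  then obtain s where "r * q = r * (p * s)" by (auto simp: dvd_def mult.assoc)
  then show "p dvd q" using assms by (simp add: mpoly_mult_left_cancel)
qed (rule mult_dvd_mono[OF dvd_refl])

lemma mpoly_prod_eq_0:
  fixes f :: "'i \<Rightarrow> ('k::field, 'n::finite) mpoly"
  assumes "finite I"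
  shows "prod f I = 0 \<longleftrightarrow> (\<exists>i\<in>I. f i = 0)"
  using assms by (induction I rule: finite_induct) (auto simp: mpoly_mult_eq_0)

subsection \<open>Substitution\<close>

definition subst_mono :: "('n::finite \<Rightarrow> ('k::field, 'n) mpoly) \<Rightarrow> ('n \<Rightarrow>\<^sub>0 nat) \<Rightarrow> ('k, 'n) mpoly" where
  "subst_mono f m = (\<Prod>i\<in>UNIV. f i ^ lookup m i)"

definition subst :: "('n::finite \<Rightarrow> ('k::field, 'n) mpoly) \<Rightarrow> ('k, 'n) mpoly \<Rightarrow> ('k, 'n) mpoly" where
  "subst f p = (\<Sum>m\<in>keys p. const_poly (lookup p m) * subst_mono f m)"

lemma subst_superset:
  assumes "finite M" "keys p \<subseteq> M"
  shows "subst f p = (\<Sum>m\<in>M. const_poly (lookup p m) * subst_mono f m)"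
  unfolding subst_def using assms
  by (intro sum.mono_neutral_left) (auto simp: in_keys_iff)

lemma subst_add [simp]: "subst f (p + q) = subst f p + subst f q"
proof -
  let ?M = "keys p \<union> keys q"
  have "subst f (p + q) = (\<Sum>m\<in>?M. const_poly (lookup (p + q) m) * subst_mono f m)"
    by (rule subst_superset) (use keys_add[of p q] in auto)
  moreover have "subst f p = (\<Sum>m\<in>?M. const_poly (lookup p m) * subst_mono f m)"
    by (rule subst_superset) auto
  moreover have "subst f q = (\<Sum>m\<in>?M. const_poly (lookup q m) * subst_mono f m)"
    by (rule subst_superset) auto
  ultimately show ?thesis by (simp add: lookup_add const_poly_add distrib_right sum.distrib)
qed

lemma subst_0 [simp]: "subst f 0 = 0"
  by (simp add: subst_def)

lemma subst_single: "subst f (Poly_Mapping.single m c) = const_poly c * subst_mono f m"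
  by (cases "c = 0") (auto simp: subst_def)

lemma subst_mono_add: "subst_mono f (m + k) = subst_mono f m * subst_mono f k"
  by (simp add: subst_mono_def lookup_add power_add prod.distrib)

lemma subst_mono_0 [simp]: "subst_mono f 0 = 1"
  by (simp add: subst_mono_def)

lemma subst_mono_single: "subst_mono f (Poly_Mapping.single i 1) = f i"
proof -
  have "subst_mono f (Poly_Mapping.single i 1) = (\<Prod>j\<in>UNIV. if j = i then f i else 1)"
    unfolding subst_mono_def by (rule prod.cong) (auto simp: lookup_single when_def)
  then show ?thesis by simp
qed

lemma subst_mult [simp]: "subst f (p * q) = subst f p * subst f q"
proof (induction p rule: poly_mapping_single_add_induct)
  case (add p m a)
  have "subst f (Poly_Mapping.single m a * q) = subst f (Poly_Mapping.single m a) * subst f q"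
    by (induction q rule: poly_mapping_single_add_induct)
      (auto simp: distrib_left mult_single subst_single subst_mono_add const_poly_mult)
  then show ?case using add by (simp add: distrib_right)
qed simp

lemma subst_const [simp]: "subst f (const_poly c) = const_poly c"
  by (simp add: const_poly_def[of c] subst_single)

lemma subst_1 [simp]: "subst f 1 = 1"
  using subst_const[of f 1] by simp

lemma subst_uminus [simp]: "subst f (- p) = - subst f p"
  using subst_add[of f p "- p"] by (simp add: eq_neg_iff_add_eq_0 add.commute)

lemma subst_diff [simp]: "subst f (p - q) = subst f p - subst f q"
  using subst_add[of f p "- q"] by simp

lemma subst_sum: "subst f (sum g I) = (\<Sum>i\<in>I. subst f (g i))"
  by (induction I rule: infinite_finite_induct) auto

lemma subst_prod: "subst f (prod g I) = (\<Prod>i\<in>I. subst f (g i))"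
  by (induction I rule: infinite_finite_induct) auto

lemma linear_poly_axis: "linear_poly (axis i 1) = Poly_Mapping.single (Poly_Mapping.single i 1) 1"
proof -
  have "linear_poly (axis i 1) = (\<Sum>j\<in>UNIV. if j = i then Poly_Mapping.single (Poly_Mapping.single i 1) 1 else 0)"
    unfolding linear_poly_def by (rule sum.cong) (auto simp: axis_def)
  then show ?thesis by simp
qed

lemma linear_poly_eq:
  "linear_poly a = (\<Sum>i\<in>UNIV. const_poly (a $ i) * linear_poly (axis i 1))"
  by (simp only: linear_poly_axis) (simp add: linear_poly_def const_poly_def mult_single)

lemma linear_poly_add: "linear_poly (a + b) = linear_poly a + linear_poly b"
  by (simp add: linear_poly_def single_add sum.distrib)

lemma linear_poly_diff: "linear_poly (a - b) = linear_poly a - linear_poly b"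
  by (simp add: linear_poly_def single_diff sum_subtractf)

lemma linear_poly_0 [simp]: "linear_poly 0 = 0"
  by (simp add: linear_poly_def)

lemma linear_poly_scale: "linear_poly (c *s a) = const_poly c * linear_poly a"
  by (simp add: linear_poly_def const_poly_def mult_single sum_distrib_left)

lemma lookup_linear_poly: "lookup (linear_poly a) (Poly_Mapping.single i 1) = a $ i"
proof -
  have "lookup (linear_poly a) (Poly_Mapping.single i 1) = (\<Sum>j\<in>UNIV. if j = i then a $ j else 0)"
    unfolding linear_poly_def lookup_sum
    by (rule sum.cong) (auto simp: lookup_single when_def dest: arg_cong[where f="\<lambda>m. lookup m i"])
  then show ?thesis by simp
qed

lemma linear_poly_eq_iff [simp]: "linear_poly a = linear_poly b \<longleftrightarrow> a = b"
  by (metis lookup_linear_poly vec_eq_iff)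

lemma linear_poly_eq_0 [simp]: "linear_poly a = 0 \<longleftrightarrow> a = 0"
  using linear_poly_eq_iff[of a 0] by (simp del: linear_poly_eq_iff)

lemma homog_linear_poly: "hc 1 (linear_poly a) = linear_poly a"
  by (simp add: linear_poly_def hc_sum hc_single)

subsection \<open>Pairing\<close>

lemma pairing_add_left: "pairing (a + b) v = pairing a v + pairing b v"
  by (simp add: pairing_def distrib_right sum.distrib)

lemma pairing_add_right: "pairing a (u + v) = pairing a u + pairing a v"
  by (simp add: pairing_def distrib_left sum.distrib)

lemma pairing_diff_left: "pairing (a - b) v = pairing a v - pairing b v"
  by (simp add: pairing_def left_diff_distrib sum_subtractf)

lemma pairing_diff_right: "pairing a (u - v) = pairing a u - pairing a v"
  by (simp add: pairing_def right_diff_distrib sum_subtractf)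

lemma pairing_scale_left: "pairing (c *s a) v = c * pairing a v"
  by (simp add: pairing_def sum_distrib_left mult.assoc)

lemma pairing_scale_right: "pairing a (c *s v) = c * pairing a v"
  by (simp add: pairing_def sum_distrib_left mult_ac)

lemma pairing_0_left [simp]: "pairing 0 v = 0"
  by (simp add: pairing_def)

lemma pairing_0_right [simp]: "pairing a 0 = 0"
  by (simp add: pairing_def)

lemma pairing_sum_left: "pairing (sum f I) v = (\<Sum>i\<in>I. pairing (f i) v)"
  by (induction I rule: infinite_finite_induct) (auto simp: pairing_add_left)

lemma pairing_axis_right: "pairing a (axis i c) = a $ i * c"
proof -
  have "pairing a (axis i c) = (\<Sum>j\<in>UNIV. if j = i then a $ j * c else 0)"
    unfolding pairing_def by (rule sum.cong) (auto simp: axis_def)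
  then show ?thesis by simp
qed

lemma pairing_commute: "pairing a v = pairing v a"
  by (simp add: pairing_def mult.commute)

lemma pairing_axis_left: "pairing (axis i c) v = c * v $ i"
  by (subst pairing_commute) (simp add: pairing_axis_right mult.commute)

lemmas pairing_simps = pairing_add_left pairing_add_right pairing_diff_left pairing_diff_right
  pairing_scale_left pairing_scale_right

lemma ex_pairing_eq_1:
  assumes "a \<noteq> 0"
  shows "\<exists>w. pairing a w = 1"
proof -
  obtain i where "a $ i \<noteq> 0" using assms by (auto simp: vec_eq_iff)
  then have "pairing a (axis i (inverse (a $ i))) = 1" by (simp add: pairing_axis_right)
  then show ?thesis ..
qed

lemma pairing_eq_0_imp: "(\<And>v. pairing a v = 0) \<Longrightarrow> a = 0"
  by (metis ex_pairing_eq_1 zero_neq_one)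

subsection \<open>Eliminating a linear form\<close>

lemma subst_subst: "subst f (subst g p) = subst (\<lambda>i. subst f (g i)) p"
proof -
  have pw: "subst f (q ^ n) = subst f q ^ n" for q n
    by (induction n) auto
  show ?thesis
    by (induction p rule: poly_mapping_single_add_induct)
      (auto simp: subst_single subst_mono_def subst_prod pw)
qed

lemma single_eq_prod:
  "Poly_Mapping.single m (1::'k::field) = (\<Prod>i\<in>UNIV. linear_poly (axis i 1) ^ lookup (m :: 'n::finite \<Rightarrow>\<^sub>0 nat) i)"
proof -
  have pw: "linear_poly (axis i (1::'k)) ^ n = Poly_Mapping.single (Poly_Mapping.single i n) 1" for i :: 'n and n
    by (induction n) (auto simp: linear_poly_axis mult_single simp flip: single_add)
  have "(\<Prod>i\<in>I. Poly_Mapping.single (Poly_Mapping.single i (lookup m i)) (1::'k)) =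
      Poly_Mapping.single (\<Sum>i\<in>I. Poly_Mapping.single i (lookup m i)) 1" if "finite I" for I
    using that by (induction I rule: finite_induct) (auto simp: mult_single)
  from this[of UNIV] have "(\<Prod>i\<in>UNIV. linear_poly (axis i 1) ^ lookup m i) =
      Poly_Mapping.single (\<Sum>i\<in>UNIV. Poly_Mapping.single i (lookup m i)) (1::'k)"
    by (simp add: pw)
  moreover have "(\<Sum>i\<in>UNIV. Poly_Mapping.single i (lookup m i)) = m"
    by (rule poly_mapping_eqI) (simp add: lookup_sum lookup_single when_def)
  ultimately show ?thesis by simp
qed

lemma subst_id: "subst (\<lambda>i. linear_poly (axis i 1)) p = p"
  by (induction p rule: poly_mapping_single_add_induct)
    (auto simp: subst_single subst_mono_def const_poly_def mult_single simp flip: single_eq_prod)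

lemma dvd_power_diff:
  fixes x y :: "'a::comm_ring_1"
  assumes "d dvd x - y"
  shows "d dvd x ^ n - y ^ n"
proof (induction n)
  case (Suc n)
  have "x ^ Suc n - y ^ Suc n = x * (x ^ n - y ^ n) + (x - y) * y ^ n"
    by (simp add: algebra_simps)
  then show ?case using Suc assms by (metis dvd_add dvd_mult dvd_mult2)
qed simp

lemma dvd_prod_diff:
  fixes f g :: "'i \<Rightarrow> 'a::comm_ring_1"
  assumes "\<And>i. i \<in> I \<Longrightarrow> d dvd f i - g i"
  shows "d dvd prod f I - prod g I"
  using assms
proof (induction I rule: infinite_finite_induct)
  case (insert j I)
  have "prod f (insert j I) - prod g (insert j I) = f j * (prod f I - prod g I) + (f j - g j) * prod g I"
    using insert.hyps by (simp add: algebra_simps)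
  then show ?case using insert.IH insert.prems by (simp add: dvd_add dvd_mult dvd_mult2)
qed auto

lemma dvd_sum': "(\<And>i. i \<in> I \<Longrightarrow> d dvd f i) \<Longrightarrow> d dvd (sum f I :: 'a::comm_ring_1)"
  by (rule dvd_sum)

lemma subst_congruence:
  assumes "\<And>i. d dvd f i - g i"
  shows "d dvd subst f p - subst g p"
proof -
  have "subst f p - subst g p = (\<Sum>m\<in>keys p. const_poly (lookup p m) * (subst_mono f m - subst_mono g m))"
    by (simp add: subst_def sum_subtractf right_diff_distrib)
  also have "d dvd \<dots>"
    unfolding subst_mono_def using assms
    by (intro dvd_sum' dvd_mult dvd_prod_diff dvd_power_diff) auto
  finally show ?thesis .
qed

lemma homog_power:
  assumes "hc 1 x = x"
  shows "hc n (x ^ n) = x ^ n"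
proof (induction n)
  case 0
  then show ?case using hc_const[of 0 1] by simp
next
  case (Suc n)
  then show ?case using homog_mult[OF assms Suc] by simp
qed

lemma homog_prod:
  assumes "\<And>i. i \<in> I \<Longrightarrow> hc (e i) (f i) = f i"
  shows "hc (sum e I) (prod f I) = prod f I"
  using assms
proof (induction I rule: infinite_finite_induct)
  case (insert j I)
  then show ?case using homog_mult[of "e j" "f j" "sum e I" "prod f I"] by simp
qed (use hc_const[of 0 1] in auto)

text \<open>Substituting linear forms takes a monomial to a homogeneous polynomial of the same
  degree.\<close>

lemma hc_subst:
  assumes "\<And>i. hc 1 (f i) = f i"
  shows "hc d (subst f p) = subst f (hc d p)"
proof (induction p rule: poly_mapping_single_add_induct)
  case (add p m c)
  have "hc (mdeg m) (subst_mono f m) = subst_mono f m"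
    unfolding subst_mono_def mdeg_def by (intro homog_prod homog_power assms)
  then have h: "hc (0 + mdeg m) (const_poly c * subst_mono f m) = const_poly c * subst_mono f m"
    by (intro homog_mult) (simp_all add: hc_const)
  have "hc d (subst f (Poly_Mapping.single m c)) = subst f (hc d (Poly_Mapping.single m c))"
  proof (cases "d = mdeg m")
    case True
    then show ?thesis using h by (simp add: subst_single hc_single)
  next
    case False
    then have "hc d (const_poly c * subst_mono f m) = 0"
      using hc_hc[of d "0 + mdeg m" "const_poly c * subst_mono f m"] unfolding h by simp
    then show ?thesis using False by (simp add: subst_single hc_single)
  qed
  then show ?case using add by simp
qed simp

text \<open>If \<open>al\<close> takes the value 1 at \<open>w\<close>, this is the pullback of
  polynomial functions along the projection of \<open>v\<close> to
  \<open>v - pairing al v *s w\<close>, which maps the space onto the kernel of \<open>al\<close>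
  along \<open>w\<close>.\<close>

definition elim :: "'k::field^'n \<Rightarrow> 'k^'n \<Rightarrow> ('k, 'n) mpoly \<Rightarrow> ('k, 'n) mpoly" where
  "elim al w = subst (\<lambda>i. linear_poly (axis i 1) - const_poly (w $ i) * linear_poly al)"

definition elim_pair :: "'k::field^'n \<Rightarrow> 'k^'n \<Rightarrow> bool" where
  "elim_pair al w \<longleftrightarrow> pairing al w = 1 \<or> al = 0 \<and> w = 0"

lemma elim_add [simp]: "elim al w (p + q) = elim al w p + elim al w q"
  and elim_diff [simp]: "elim al w (p - q) = elim al w p - elim al w q"
  and elim_uminus [simp]: "elim al w (- p) = - elim al w p"
  and elim_mult [simp]: "elim al w (p * q) = elim al w p * elim al w q"
  and elim_0 [simp]: "elim al w 0 = 0"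
  and elim_1 [simp]: "elim al w 1 = 1"
  and elim_const [simp]: "elim al w (const_poly c) = const_poly c"
  and elim_sum: "elim al w (sum f I) = (\<Sum>i\<in>I. elim al w (f i))"
  and elim_prod: "elim al w (prod f I) = (\<Prod>i\<in>I. elim al w (f i))"
  by (simp_all add: elim_def subst_sum subst_prod)

lemma elim_linear_poly: "elim al w (linear_poly a) = linear_poly (a - pairing a w *s al)"
proof -
  have "elim al w (linear_poly a) =
      (\<Sum>i\<in>UNIV. const_poly (a $ i) * elim al w (linear_poly (axis i 1)))"
    by (subst linear_poly_eq) (simp add: elim_sum)
  also have "\<dots> = (\<Sum>i\<in>UNIV. const_poly (a $ i) * (linear_poly (axis i 1) - const_poly (w $ i) * linear_poly al))"
    by (simp add: elim_def linear_poly_axis subst_single subst_mono_single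
        del: One_nat_def)
  also have "\<dots> = linear_poly a - const_poly (pairing a w) * linear_poly al"
    by (subst (2) linear_poly_eq)
      (simp add: right_diff_distrib sum_subtractf pairing_def const_poly_sum const_poly_mult
        sum_distrib_right mult.assoc)
  also have "\<dots> = linear_poly (a - pairing a w *s al)"
    by (simp add: linear_poly_diff linear_poly_scale)
  finally show ?thesis .
qed

lemma elim_self: "elim_pair al w \<Longrightarrow> elim al w (linear_poly al) = 0"
  by (auto simp: elim_linear_poly elim_pair_def)

lemma elim_idem [simp]:
  assumes "elim_pair al w"
  shows "elim al w (elim al w p) = elim al w p"
proof -
  have "elim al w (elim al w p) = subst (\<lambda>i. elim al w (linear_poly (axis i 1) - const_poly (w $ i) * linear_poly al)) p"
    unfolding elim_def by (rule subst_subst)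
  also have "\<dots> = elim al w p"
  proof -
    have "elim al w (linear_poly (axis i 1) - const_poly (w $ i) * linear_poly al) =
        linear_poly (axis i 1) - const_poly (w $ i) * linear_poly al" for i
      using elim_self[OF assms] by (simp add: elim_linear_poly pairing_axis_left linear_poly_diff linear_poly_scale)
    then show ?thesis by (simp add: elim_def)
  qed
  finally show ?thesis .
qed

lemma dvd_diff_elim: "linear_poly al dvd p - elim al w p"
proof -
  have "linear_poly al dvd subst (\<lambda>i. linear_poly (axis i 1)) p - elim al w p"
    unfolding elim_def by (rule subst_congruence) simp
  then show ?thesis by (simp add: subst_id)
qed

text \<open>Elimination changes a polynomial by a multiple of \<open>al\<close> and annihilates
  \<open>al\<close>. Membership in the ideal of \<open>al\<close> thus becomes an equation between
  polynomials.\<close>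

lemma elim_eq_0_iff:
  assumes "elim_pair al w"
  shows "elim al w p = 0 \<longleftrightarrow> linear_poly al dvd p"
proof
  assume "elim al w p = 0"
  then show "linear_poly al dvd p" using dvd_diff_elim[of al p w] by simp
next
  assume "linear_poly al dvd p"
  then show "elim al w p = 0" using elim_self[OF assms] by (auto simp: dvd_def)
qed

lemma elim_eq_iff:
  assumes "elim_pair al w"
  shows "elim al w p = elim al w q \<longleftrightarrow> linear_poly al dvd p - q"
  using elim_eq_0_iff[OF assms, of "p - q"] by simp

lemma elim_trivial [simp]: "elim 0 0 p = p"
  by (simp add: elim_def subst_id)

lemma hc_elim: "hc d (elim al w p) = elim al w (hc d p)"
  unfolding elim_def
proof (rule hc_subst)
  fix i
  have "hc (0 + 1) (const_poly (w $ i) * linear_poly al) = const_poly (w $ i) * linear_poly al"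
    by (intro homog_mult homog_linear_poly) (simp add: hc_const)
  then show "hc 1 (linear_poly (axis i 1) - const_poly (w $ i) * linear_poly al) =
      linear_poly (axis i 1) - const_poly (w $ i) * linear_poly al"
    using homog_linear_poly[of "axis i 1"] by simp
qed

lemma elim_dvd_mono: "p dvd q \<Longrightarrow> elim al w p dvd elim al w q"
  by (auto simp: dvd_def)

text \<open>The quotient by a nonzero linear form is the image of a ring endomorphism of a domain,
  hence itself a domain.\<close>

lemma linear_poly_prime:
  assumes "a \<noteq> 0" "linear_poly a dvd p * q"
  shows "linear_poly a dvd p \<or> linear_poly a dvd q"
proof -
  obtain w where "pairing a w = 1" using ex_pairing_eq_1[OF assms(1)] ..
  then have e: "elim_pair a w" by (simp add: elim_pair_def)
  show ?thesis
    using assms(2) by (simp add: mpoly_mult_eq_0 flip: elim_eq_0_iff[OF e])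
qed

lemma linear_poly_not_dvd_1:
  assumes "a \<noteq> 0"
  shows "\<not> linear_poly a dvd 1"
proof -
  obtain w where "pairing a w = 1" using ex_pairing_eq_1[OF assms(1)] ..
  then have e: "elim_pair a w" by (simp add: elim_pair_def)
  show ?thesis by (simp flip: elim_eq_0_iff[OF e])
qed

lemma linear_poly_prime_prod:
  assumes "a \<noteq> 0" "finite I" "linear_poly a dvd prod f I"
  shows "\<exists>i\<in>I. linear_poly a dvd f i"
  using assms(2,3)
proof (induction I rule: finite_induct)
  case empty
  then show ?case using linear_poly_not_dvd_1[OF assms(1)] by simp
next
  case (insert j I)
  then show ?case using linear_poly_prime[OF assms(1), of "f j" "prod f I"] by auto
qed

lemma linear_poly_dvd_linear_poly:
  assumes "a \<noteq> 0" "linear_poly a dvd linear_poly b"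
  shows "\<exists>c. b = c *s a"
proof -
  obtain w where "pairing a w = 1" using ex_pairing_eq_1[OF assms(1)] ..
  then have e: "elim_pair a w" by (simp add: elim_pair_def)
  have "b - pairing b w *s a = 0"
    using assms(2) unfolding elim_eq_0_iff[OF e, symmetric] elim_linear_poly by simp
  then show ?thesis by auto
qed

text \<open>The forms are primes, none dividing another, so each can be split off from
  \<open>p\<close> without affecting divisibility of the cofactor by the others.\<close>

lemma prod_linear_polys_dvd:
  assumes "finite I" "\<And>i. i \<in> I \<Longrightarrow> a i \<noteq> 0"
    and "\<And>i j. i \<in> I \<Longrightarrow> j \<in> I \<Longrightarrow> i \<noteq> j \<Longrightarrow> \<not> linear_poly (a i) dvd linear_poly (a j)"
    and "\<And>i. i \<in> I \<Longrightarrow> linear_poly (a i) dvd p"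
  shows "(\<Prod>i\<in>I. linear_poly (a i)) dvd p"
  using assms
proof (induction I arbitrary: p rule: finite_induct)
  case (insert j I)
  have "linear_poly (a j) dvd p" using insert.prems by blast
  then obtain q where q: "p = linear_poly (a j) * q" ..
  have "linear_poly (a i) dvd q" if "i \<in> I" for i
  proof -
    have "linear_poly (a i) dvd linear_poly (a j) * q" "\<not> linear_poly (a i) dvd linear_poly (a j)" "a i \<noteq> 0"
      using insert.prems insert.hyps that q by auto
    then show ?thesis using linear_poly_prime by blast
  qed
  then have "(\<Prod>i\<in>I. linear_poly (a i)) dvd q" using insert.IH[of q] insert.prems by auto
  then show ?case using insert.hyps q by (simp add: mult_dvd_mono)
qed simp

text \<open>The ideal quotient \<open>(x : b)\<close> is the unit ideal as soon as it contains a product of primes and, for each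
  of these primes, an element not divisible by it.\<close>

lemma dvd_if_quotient_coprime:
  fixes x b :: "('k::field, 'n::finite) mpoly"
  assumes "finite I" "\<And>i. i \<in> I \<Longrightarrow> a i \<noteq> 0"
    and "x dvd (\<Prod>i\<in>I. linear_poly (a i)) * b"
    and "\<And>i. i \<in> I \<Longrightarrow> \<exists>h. \<not> linear_poly (a i) dvd h \<and> x dvd h * b"
  shows "x dvd b"
  using assms
proof (induction I rule: finite_induct)
  case (insert j I)
  let ?p = "linear_poly (a j)" and ?f = "\<Prod>i\<in>I. linear_poly (a i)"
  obtain h where h: "\<not> ?p dvd h" "x dvd h * b" using insert.prems(3) by auto
  obtain s' where s': "h * b = x * s'" using h by (auto simp: dvd_def)
  obtain s where s: "?p * ?f * b = x * s" using insert.prems(2) insert.hyps by (auto simp: dvd_def)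
  have "h \<noteq> 0" using h by auto
  show ?case
  proof (cases "x = 0")
    case True
    then show ?thesis using s' \<open>h \<noteq> 0\<close> by (simp add: mpoly_mult_eq_0)
  next
    case False
    \<comment> \<open>Eliminating \<open>b\<close> from the two multiples of \<open>x\<close>: the
      prime \<open>?p\<close> divides \<open>s * h\<close> but not \<open>h\<close>, hence it
      divides \<open>s\<close> and cancels from the relation for \<open>?p * ?f * b\<close>.\<close>
    have "x * (s * h) = x * (?p * (?f * s'))"
    proof -
      have "x * (s * h) = (x * s) * h" by (simp add: mult_ac)
      also have "\<dots> = ?p * ?f * (h * b)" unfolding s[symmetric] by (simp add: mult_ac)
      also have "\<dots> = x * (?p * (?f * s'))" unfolding s' by (simp add: mult_ac)
      finally show ?thesis .
    qed
    then have "s * h = ?p * (?f * s')" using False by (simp add: mpoly_mult_left_cancel)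
    then have "?p dvd s * h" by simp
    moreover have aj: "a j \<noteq> 0" using insert.prems by auto
    ultimately have "?p dvd s" using linear_poly_prime h(1) by blast
    then obtain s'' where "s = ?p * s''" by (auto simp: dvd_def)
    then have "?p * (?f * b) = ?p * (x * s'')" using s by (simp only: mult.assoc mult.left_commute)
    then have "?f * b = x * s''" using aj by (simp add: mpoly_mult_left_cancel)
    then have "x dvd ?f * b" by simp
    then show ?thesis using insert by auto
  qed
qed simp

subsection \<open>Graded projective modules are free\<close>

lemma eq_sum_hc:
  assumes "\<And>d. D < d \<Longrightarrow> hc d p = 0"
  shows "p = (\<Sum>d\<le>D. hc d p)"
proof -
  have "p - (\<Sum>d\<le>D. hc d p) = 0"
  proof (rule eq_0_if_hc)
    fix d
    have "(\<Sum>e\<le>D. hc d (hc e p)) = (\<Sum>e\<le>D. if e = d then hc d p else 0)"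
      by (rule sum.cong) auto
    then show "hc d (p - (\<Sum>d\<le>D. hc d p)) = 0"
      using assms[of d] by (cases "d \<le> D") (auto simp: hc_sum)
  qed
  then show ?thesis by simp
qed

text \<open>The quotient ring \<open>S/(al)\<close> is represented by the polynomials fixed by the retraction \<open>sg\<close>, which eliminates
  \<open>al\<close> along \<open>w\<close>; for \<open>al = w = 0\<close> this is \<open>S\<close> itself.\<close>

locale eliminated_ring =
  fixes al w :: "'k::field^'n"
  assumes elim_pair: "elim_pair al w"
begin

abbreviation sg :: "('k, 'n) mpoly \<Rightarrow> ('k, 'n) mpoly" where
  "sg \<equiv> elim al w"

text \<open>Modules are sets of functions with values in the image of \<open>sg\<close>, on an
  arbitrary index type, so that coefficient vectors, syzygies and ideals all fit. Scalars are the
  polynomials fixed by \<open>sg\<close>, because the image of \<open>sg\<close> stands for the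
  quotient ring.\<close>

definition submod :: "('x \<Rightarrow> ('k, 'n) mpoly) set \<Rightarrow> bool" where
  "submod N \<longleftrightarrow> (\<lambda>_. 0) \<in> N \<and> (\<forall>x\<in>N. \<forall>y\<in>N. (\<lambda>v. x v + y v) \<in> N) \<and>
     (\<forall>r. \<forall>x\<in>N. sg r = r \<longrightarrow> (\<lambda>v. r * x v) \<in> N) \<and> (\<forall>x\<in>N. \<forall>v. sg (x v) = x v)"

text \<open>The bound on the degrees is uniform in \<open>v\<close>, since the index type may be
  infinite; it makes every element a finite sum of homogeneous ones.\<close>

definition graded :: "('x \<Rightarrow> ('k, 'n) mpoly) set \<Rightarrow> bool" where
  "graded N \<longleftrightarrow> (\<forall>x\<in>N. \<forall>d. (\<lambda>v. hc d (x v)) \<in> N) \<and> (\<forall>x\<in>N. \<exists>D. \<forall>d>D. \<forall>v. hc d (x v) = 0)"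

definition is_basis :: "('x \<Rightarrow> ('k, 'n) mpoly) set \<Rightarrow> ('x \<Rightarrow> ('k, 'n) mpoly) set \<Rightarrow> bool" where
  "is_basis N B \<longleftrightarrow> finite B \<and> B \<subseteq> N \<and>
     (\<forall>x\<in>N. \<exists>c. (\<forall>b. sg (c b) = c b) \<and> x = (\<lambda>v. \<Sum>b\<in>B. c b * b v)) \<and>
     (\<forall>c. (\<forall>b\<in>B. sg (c b) = c b) \<longrightarrow> (\<forall>v. (\<Sum>b\<in>B. c b * b v) = 0) \<longrightarrow> (\<forall>b\<in>B. c b = 0))"

definition linear_functional ::
  "('x \<Rightarrow> ('k, 'n) mpoly) set \<Rightarrow> (('x \<Rightarrow> ('k, 'n) mpoly) \<Rightarrow> ('k, 'n) mpoly) \<Rightarrow> bool" where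
  "linear_functional N f \<longleftrightarrow> (\<forall>x\<in>N. sg (f x) = f x) \<and>
     (\<forall>x\<in>N. \<forall>y\<in>N. f (\<lambda>v. x v + y v) = f x + f y) \<and>
     (\<forall>r. \<forall>x\<in>N. sg r = r \<longrightarrow> f (\<lambda>v. r * x v) = r * f x)"

text \<open>The dual basis criterion: such pairs of elements and functionals present
  \<open>N\<close> as a retract of the free module on \<open>I\<close>. The index set may be
  infinite, as the free module in \<open>projective_module\<close> may have infinite rank.\<close>

definition dual_basis :: "('x \<Rightarrow> ('k, 'n) mpoly) set \<Rightarrow> 'i set \<Rightarrow>
    ('i \<Rightarrow> ('x \<Rightarrow> ('k, 'n) mpoly) \<Rightarrow> ('k, 'n) mpoly) \<Rightarrow> ('i \<Rightarrow> 'x \<Rightarrow> ('k, 'n) mpoly) \<Rightarrow> bool" where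
  "dual_basis N I f n \<longleftrightarrow> (\<forall>i\<in>I. n i \<in> N \<and> linear_functional N (f i)) \<and>
     (\<forall>x\<in>N. finite {i\<in>I. f i x \<noteq> 0} \<and> x = (\<lambda>v. \<Sum>i\<in>{i\<in>I. f i x \<noteq> 0}. f i x * n i v))"

text \<open>A weak form of finite generation: a nonzero multiple of \<open>N\<close> lies in the
  span of finitely many elements of \<open>N\<close>. For logarithmic forms it can be read off from
  explicit elements.\<close>

definition almost_generated :: "('x \<Rightarrow> ('k, 'n) mpoly) set \<Rightarrow> bool" where
  "almost_generated N \<longleftrightarrow> (\<exists>E q. finite E \<and> E \<subseteq> N \<and> sg q = q \<and> q \<noteq> 0 \<and>
     (\<forall>x\<in>N. \<exists>c. (\<forall>e. sg (c e) = c e) \<and> (\<lambda>v. q * x v) = (\<lambda>v. \<Sum>e\<in>E. c e * e v)))"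

lemma sg_sum_closed: "(\<And>i. i \<in> I \<Longrightarrow> sg (f i) = f i) \<Longrightarrow> sg (sum f I) = sum f I"
  by (simp add: elim_sum)

lemma sg_hc_closed: "sg p = p \<Longrightarrow> sg (hc d p) = hc d p"
  by (simp flip: hc_elim)

lemma submod_sum:
  assumes "submod N" "finite I" "\<And>i. i \<in> I \<Longrightarrow> x i \<in> N"
  shows "(\<lambda>v. \<Sum>i\<in>I. x i v) \<in> N"
  using assms(2,3)
proof (induction I rule: finite_induct)
  case empty
  then show ?case using assms(1) by (simp add: submod_def)
next
  case (insert i I)
  then have "(\<lambda>v. x i v + (\<Sum>i\<in>I. x i v)) \<in> N" using assms(1) by (auto simp: submod_def)
  then show ?case using insert.hyps by simp
qed

lemma submod_smult: "submod N \<Longrightarrow> x \<in> N \<Longrightarrow> sg r = r \<Longrightarrow> (\<lambda>v. r * x v) \<in> N"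
  by (simp add: submod_def)

lemma submod_add: "submod N \<Longrightarrow> x \<in> N \<Longrightarrow> y \<in> N \<Longrightarrow> (\<lambda>v. x v + y v) \<in> N"
  by (simp add: submod_def)

lemma submod_0: "submod N \<Longrightarrow> (\<lambda>v. 0) \<in> N"
  by (simp add: submod_def)

lemma submod_uminus: "submod N \<Longrightarrow> x \<in> N \<Longrightarrow> (\<lambda>v. - x v) \<in> N"
  using submod_smult[of N x "- 1"] by simp

lemma submod_lincomb:
  assumes "submod N" "finite I" "\<And>i. i \<in> I \<Longrightarrow> x i \<in> N" "\<And>i. i \<in> I \<Longrightarrow> sg (c i) = c i"
  shows "(\<lambda>v. \<Sum>i\<in>I. c i * x i v) \<in> N"
  using submod_sum[OF assms(1,2), of "\<lambda>i v. c i * x i v"] submod_smult[OF assms(1)] assms(3,4) by blast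

lemma linear_functional_add:
    "linear_functional N f \<Longrightarrow> x \<in> N \<Longrightarrow> y \<in> N \<Longrightarrow> f (\<lambda>v. x v + y v) = f x + f y"
  and linear_functional_smult:
    "linear_functional N f \<Longrightarrow> x \<in> N \<Longrightarrow> sg r = r \<Longrightarrow> f (\<lambda>v. r * x v) = r * f x"
  and linear_functional_closed: "linear_functional N f \<Longrightarrow> x \<in> N \<Longrightarrow> sg (f x) = f x"
  by (simp_all add: linear_functional_def)

lemma linear_functional_0:
  assumes "submod N" "linear_functional N f"
  shows "f (\<lambda>v. 0) = 0"
  using linear_functional_smult[OF assms(2) submod_0[OF assms(1)], of 0] by simp

lemma linear_functional_lincomb:
  assumes "submod N" "linear_functional N f" "finite I"
    "\<And>i. i \<in> I \<Longrightarrow> x i \<in> N" "\<And>i. i \<in> I \<Longrightarrow> sg (c i) = c i"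
  shows "f (\<lambda>v. \<Sum>i\<in>I. c i * x i v) = (\<Sum>i\<in>I. c i * f (x i))"
  using assms(3,4,5)
proof (induction I rule: finite_induct)
  case empty
  then show ?case using linear_functional_0[OF assms(1,2)] by simp
next
  case (insert i I)
  have "(\<lambda>v. \<Sum>i\<in>I. c i * x i v) \<in> N" using insert by (intro submod_lincomb[OF assms(1)]) auto
  moreover have "(\<lambda>v. c i * x i v) \<in> N" using insert by (intro submod_smult[OF assms(1)]) auto
  ultimately have "f (\<lambda>v. c i * x i v + (\<Sum>i\<in>I. c i * x i v)) =
      f (\<lambda>v. c i * x i v) + f (\<lambda>v. \<Sum>i\<in>I. c i * x i v)"
    by (intro linear_functional_add[OF assms(2)])
  also have "f (\<lambda>v. c i * x i v) = c i * f (x i)"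
    using insert.prems by (intro linear_functional_smult[OF assms(2)]) auto
  finally show ?case using insert by simp
qed

text \<open>A functional that vanishes on the finite set \<open>E\<close> vanishes on
  \<open>q * x\<close>, hence on \<open>x\<close>, because polynomials form a domain. Only the
  functionals that are nonzero somewhere on \<open>E\<close> remain, and each element of
  \<open>E\<close> meets finitely many of them.\<close>

lemma dual_basis_finite:
  assumes N: "submod N" "almost_generated N" and d: "dual_basis N I f n"
  shows "\<exists>J\<subseteq>I. finite J \<and> (\<forall>i\<in>J. n i \<in> N \<and> linear_functional N (f i)) \<and>
           (\<forall>x\<in>N. x = (\<lambda>v. \<Sum>i\<in>J. f i x * n i v)) \<and> (\<forall>i\<in>I-J. \<forall>x\<in>N. f i x = 0)"
proof -
  obtain E q where E: "finite E" "E \<subseteq> N" "sg q = q" "q \<noteq> 0"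
    "\<And>x. x \<in> N \<Longrightarrow> \<exists>c. (\<forall>e. sg (c e) = c e) \<and> (\<lambda>v. q * x v) = (\<lambda>v. \<Sum>e\<in>E. c e * e v)"
    using N(2) unfolding almost_generated_def by blast
  define J where "J = (\<Union>e\<in>E. {i\<in>I. f i e \<noteq> 0})"
  have finJ: "finite J" unfolding J_def using E d by (auto simp: dual_basis_def)
  have z: "f i x = 0" if "i \<in> I" "i \<notin> J" "x \<in> N" for i x
  proof -
    obtain c where c: "\<And>e. sg (c e) = c e" "(\<lambda>v. q * x v) = (\<lambda>v. \<Sum>e\<in>E. c e * e v)"
      using E(5) \<open>x \<in> N\<close> by blast
    have lf: "linear_functional N (f i)" using d that by (simp add: dual_basis_def)
    have "q * f i x = f i (\<lambda>v. q * x v)" using lf that E(3) by (simp add: linear_functional_def)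
    also have "\<dots> = (\<Sum>e\<in>E. c e * f i e)" unfolding c(2)
      using E(1,2) c(1) by (intro linear_functional_lincomb[OF N(1) lf]) auto
    also have "\<dots> = 0" using that by (intro sum.neutral) (auto simp: J_def)
    finally show ?thesis using E(4) by (simp add: mpoly_mult_eq_0)
  qed
  have "x = (\<lambda>v. \<Sum>i\<in>J. f i x * n i v)" if x: "x \<in> N" for x
  proof -
    have "x = (\<lambda>v. \<Sum>i\<in>{i\<in>I. f i x \<noteq> 0}. f i x * n i v)" using d x unfolding dual_basis_def by blast
    also have "\<dots> = (\<lambda>v. \<Sum>i\<in>J. f i x * n i v)"
      using finJ z x by (intro ext sum.mono_neutral_left) (auto simp: J_def)
    finally show ?thesis .
  qed
  moreover have "J \<subseteq> I" by (auto simp: J_def)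
  ultimately show ?thesis using finJ d z by (intro exI[of _ J]) (auto simp: dual_basis_def)
qed

section \<open>Homogeneous generators and the graded Nakayama lemma\<close>

definition spanned :: "('x \<Rightarrow> ('k, 'n) mpoly) set \<Rightarrow> ('x \<Rightarrow> ('k, 'n) mpoly) set" where
  "spanned U = {\<lambda>v. \<Sum>u\<in>U. c u * u v | c. \<forall>u. sg (c u) = c u}"

lemma spanned_0: "(\<lambda>v. 0) \<in> spanned U"
  unfolding spanned_def by (rule CollectI, rule exI[of _ "\<lambda>_. 0"]) simp

lemma spanned_add:
  assumes "x \<in> spanned U" "y \<in> spanned U"
  shows "(\<lambda>v. x v + y v) \<in> spanned U"
proof -
  obtain c d where "\<And>u. sg (c u) = c u" "x = (\<lambda>v. \<Sum>u\<in>U. c u * u v)"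
    "\<And>u. sg (d u) = d u" "y = (\<lambda>v. \<Sum>u\<in>U. d u * u v)"
    using assms unfolding spanned_def by blast
  then show ?thesis
    unfolding spanned_def by (intro CollectI exI[of _ "\<lambda>u. c u + d u"]) (simp add: distrib_right sum.distrib)
qed

lemma spanned_smult:
  assumes "x \<in> spanned U" "sg r = r"
  shows "(\<lambda>v. r * x v) \<in> spanned U"
proof -
  obtain c where "\<And>u. sg (c u) = c u" "x = (\<lambda>v. \<Sum>u\<in>U. c u * u v)"
    using assms unfolding spanned_def by blast
  then show ?thesis using assms(2)
    unfolding spanned_def by (intro CollectI exI[of _ "\<lambda>u. r * c u"]) (simp add: sum_distrib_left mult.assoc)
qed

lemma spanned_base:
  assumes "finite U" "u \<in> U"
  shows "u \<in> spanned U"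
proof -
  have "u = (\<lambda>v. \<Sum>u'\<in>U. (if u' = u then 1 else 0) * u' v)"
  proof
    fix v
    have "(\<Sum>u'\<in>U. (if u' = u then 1 else 0) * u' v) = (\<Sum>u'\<in>U. if u' = u then u v else 0)"
      by (rule sum.cong) auto
    then show "u v = (\<Sum>u'\<in>U. (if u' = u then 1 else 0) * u' v)" using assms by simp
  qed
  then show ?thesis unfolding spanned_def by (intro CollectI exI[of _ "\<lambda>u'. if u' = u then 1 else 0"]) auto
qed

lemma spanned_lincomb:
  assumes "finite I" "\<And>i. i \<in> I \<Longrightarrow> x i \<in> spanned U" "\<And>i. i \<in> I \<Longrightarrow> sg (c i) = c i"
  shows "(\<lambda>v. \<Sum>i\<in>I. c i * x i v) \<in> spanned U"
  using assms
proof (induction I rule: finite_induct)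
  case empty
  then show ?case by (simp add: spanned_0)
next
  case (insert i I)
  then have "(\<lambda>v. c i * x i v + (\<Sum>i\<in>I. c i * x i v)) \<in> spanned U"
    by (intro spanned_add spanned_smult) auto
  then show ?case using insert.hyps by simp
qed

lemma spanned_subset:
  assumes "finite U" "U \<subseteq> spanned U'"
  shows "spanned U \<subseteq> spanned U'"
proof
  fix x assume "x \<in> spanned U"
  then obtain c where "\<And>u. sg (c u) = c u" "x = (\<lambda>v. \<Sum>u\<in>U. c u * u v)" unfolding spanned_def by blast
  then show "x \<in> spanned U'" using spanned_lincomb[of U "\<lambda>u. u" U' c] assms by auto
qed

definition homog_gens :: "('x \<Rightarrow> ('k, 'n) mpoly) set \<Rightarrow> ('x \<Rightarrow> ('k, 'n) mpoly) set \<Rightarrow> bool" where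
  "homog_gens N U \<longleftrightarrow> finite U \<and> U \<subseteq> N \<and> N \<subseteq> spanned U \<and> (\<forall>u\<in>U. \<exists>e. \<forall>v. hc e (u v) = u v)"

lemma ex_homog_gens:
  assumes "graded N" "finite J" "\<And>i. i \<in> J \<Longrightarrow> n i \<in> N"
    "\<And>x. x \<in> N \<Longrightarrow> \<exists>c. (\<forall>i\<in>J. sg (c i) = c i) \<and> x = (\<lambda>v. \<Sum>i\<in>J. c i * n i v)"
  shows "\<exists>U. homog_gens N U"
proof -
  have "\<forall>i\<in>J. \<exists>D. \<forall>d>D. \<forall>v. hc d (n i v) = 0" using assms(1,3) by (simp add: graded_def)
  then obtain D where D: "\<And>i d v. i \<in> J \<Longrightarrow> D i < d \<Longrightarrow> hc d (n i v) = 0" by metis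
  define U where "U = (\<Union>i\<in>J. (\<lambda>d v. hc d (n i v)) ` {..D i})"
  have fin: "finite U" using assms(2) by (simp add: U_def)
  have n: "n i \<in> spanned U" if "i \<in> J" for i
  proof -
    have "n i = (\<lambda>v. \<Sum>d\<le>D i. 1 * hc d (n i v))"
      using eq_sum_hc[of "D i"] D[OF that] by auto
    moreover have "\<dots> \<in> spanned U"
      using that by (intro spanned_lincomb spanned_base fin) (auto simp: U_def)
    ultimately show ?thesis by simp
  qed
  have "x \<in> spanned U" if "x \<in> N" for x
  proof -
    obtain c where c: "\<And>i. i \<in> J \<Longrightarrow> sg (c i) = c i" "x = (\<lambda>v. \<Sum>i\<in>J. c i * n i v)" using assms(4) \<open>x \<in> N\<close> by blast
    show ?thesis unfolding c(2) using assms(2) n c(1) by (intro spanned_lincomb) auto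
  qed
  moreover have "U \<subseteq> N" using assms(1,3) by (auto simp: U_def graded_def)
  moreover have "\<exists>e. \<forall>v. hc e (u v) = u v" if "u \<in> U" for u
    using that by (auto simp: U_def)
  ultimately show ?thesis using fin by (intro exI[of _ U]) (auto simp: homog_gens_def)
qed

text \<open>A constant term in the coefficient of \<open>u0\<close> would be invertible. The
  component of the relation in the degree of \<open>u0\<close> would then express \<open>u0\<close>
  through the other generators, against minimality.\<close>

lemma minimal_gens_relation:
  assumes U: "homog_gens N U" and min: "\<And>U'. homog_gens N U' \<Longrightarrow> card U \<le> card U'"
    and c: "\<And>u. u \<in> U \<Longrightarrow> sg (c u) = c u" "\<And>v. (\<Sum>u\<in>U. c u * u v) = 0" and u0: "u0 \<in> U"
  shows "hc 0 (c u0) = 0"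
proof (rule ccontr)
  assume nz: "hc 0 (c u0) \<noteq> 0"
  define k where "k = lookup (c u0) 0"
  have k: "hc 0 (c u0) = const_poly k" "k \<noteq> 0" using nz by (auto simp: hc_0_eq_const k_def)
  have fin: "finite U" using U by (simp add: homog_gens_def)
  obtain e where e: "\<And>u v. u \<in> U \<Longrightarrow> hc (e u) (u v) = u v"
    using U unfolding homog_gens_def by metis
  \<comment> \<open>The coefficients of the component of the relation in degree \<open>e u0\<close>;
    that of \<open>u0\<close> itself shrinks to its constant term.\<close>
  define c' where "c' u = (if u \<in> U \<and> e u \<le> e u0 then hc (e u0 - e u) (c u) else 0)" for u
  have c': "(\<Sum>u\<in>U. c' u * u v) = 0" for v
  proof -
    have "(\<Sum>u\<in>U. c' u * u v) = (\<Sum>u\<in>U. hc (e u0) (c u * u v))"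
      by (intro sum.cong refl) (auto simp: c'_def hc_mult_homog[OF e])
    also have "\<dots> = hc (e u0) (\<Sum>u\<in>U. c u * u v)" by (simp add: hc_sum)
    finally show ?thesis by (simp add: c(2))
  qed
  have sc': "sg (c' u) = c' u" for u using c(1)[of u] by (auto simp: c'_def sg_hc_closed)
  have cu0: "c' u0 = const_poly k" using u0 k by (simp add: c'_def)
  let ?i = "const_poly (inverse k) :: ('k, 'n) mpoly"
  have "u0 = (\<lambda>v. \<Sum>u\<in>U - {u0}. (- ?i * c' u) * u v)"
  proof
    fix v
    have "c' u0 * u0 v + (\<Sum>u\<in>U - {u0}. c' u * u v) = 0"
      using c'[of v] fin u0 by (simp add: sum.remove)
    then have "const_poly k * u0 v = - (\<Sum>u\<in>U - {u0}. c' u * u v)"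
      by (simp add: cu0 eq_neg_iff_add_eq_0)
    then have "?i * (const_poly k * u0 v) = ?i * - (\<Sum>u\<in>U - {u0}. c' u * u v)" by simp
    also have "?i * (const_poly k * u0 v) = u0 v"
      by (simp add: const_poly_inverse[OF k(2)] flip: mult.assoc)
    finally show "u0 v = (\<Sum>u\<in>U - {u0}. (- ?i * c' u) * u v)"
      by (simp add: sum_distrib_left sum_negf mult.assoc)
  qed
  moreover have "\<dots> \<in> spanned (U - {u0})"
    using fin sc' by (intro spanned_lincomb spanned_base) auto
  ultimately have "u0 \<in> spanned (U - {u0})" by simp
  then have "U \<subseteq> spanned (U - {u0})" using fin by (auto intro: spanned_base)
  then have "spanned U \<subseteq> spanned (U - {u0})" by (rule spanned_subset[OF fin])
  then have "N \<subseteq> spanned (U - {u0})" using U by (auto simp: homog_gens_def)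
  then have "homog_gens N (U - {u0})" using U by (auto simp: homog_gens_def)
  then have "card U \<le> card (U - {u0})" by (rule min)
  then show False using card_Diff1_less[OF fin u0] by simp
qed

text \<open>For a minimal set \<open>U\<close> of homogeneous generators the dual basis yields a
  section \<open>s\<close> of the map from the free module on \<open>U\<close> onto
  \<open>N\<close>. The idempotent \<open>E\<close>, the identity minus \<open>s\<close> after this
  map, fixes every relation \<open>c\<close>, and its columns are relations, so its entries have no
  constant term. Hence \<open>c = E c\<close> forces all components of \<open>c\<close> to vanish,
  degree by degree.\<close>

lemma graded_projective_free:
  assumes N: "submod N" "graded N" "almost_generated N" and d: "dual_basis N I f n"
  shows "\<exists>B. is_basis N B"
proof -
  obtain J where J: "finite J" "\<And>i. i \<in> J \<Longrightarrow> n i \<in> N" "\<And>i. i \<in> J \<Longrightarrow> linear_functional N (f i)"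
    "\<And>x. x \<in> N \<Longrightarrow> x = (\<lambda>v. \<Sum>i\<in>J. f i x * n i v)"
    using dual_basis_finite[OF N(1,3) d] by auto
  have "\<exists>U. homog_gens N U"
  proof (rule ex_homog_gens[OF N(2) J(1,2)])
    fix x assume x: "x \<in> N"
    show "\<exists>c. (\<forall>i\<in>J. sg (c i) = c i) \<and> x = (\<lambda>v. \<Sum>i\<in>J. c i * n i v)"
      by (intro exI[of _ "\<lambda>i. f i x"] conjI J(4)[OF x]) (use J(3) x in \<open>auto simp: linear_functional_def\<close>)
  qed auto
  then obtain U where U: "homog_gens N U" and min: "\<And>U'. homog_gens N U' \<Longrightarrow> card U \<le> card U'"
    using arg_min_natI[of "homog_gens N" _ card] arg_min_nat_le[of "homog_gens N" _ card] by blast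
  have fin: "finite U" and UN: "U \<subseteq> N" and gen: "N \<subseteq> spanned U" using U by (auto simp: homog_gens_def)
  have "\<forall>i\<in>J. \<exists>b. (\<forall>u. sg (b u) = b u) \<and> n i = (\<lambda>v. \<Sum>u\<in>U. b u * u v)"
    using gen J(2) unfolding spanned_def by blast
  from bchoice[OF this] obtain b where
    b': "\<forall>i\<in>J. (\<forall>u. sg (b i u) = b i u) \<and> n i = (\<lambda>v. \<Sum>u\<in>U. b i u * u v)" ..
  have b: "sg (b i u) = b i u" "n i v = (\<Sum>u\<in>U. b i u * u v)" if "i \<in> J" for i u v
    using bspec[OF b' that, THEN conjunct1, THEN spec, of u]
      fun_cong[OF bspec[OF b' that, THEN conjunct2], of v] .
  define s where "s x u = (\<Sum>i\<in>J. f i x * b i u)" for x u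
  have s_closed: "sg (s x u) = s x u" if "x \<in> N" for x u
    unfolding s_def using that b J(3) by (intro sg_sum_closed) (auto simp: linear_functional_def)
  have s_section: "(\<Sum>u\<in>U. s x u * u v) = x v" if x: "x \<in> N" for x v
  proof -
    have "(\<Sum>u\<in>U. s x u * u v) = (\<Sum>u\<in>U. \<Sum>i\<in>J. f i x * (b i u * u v))"
      by (simp add: s_def sum_distrib_right mult.assoc)
    also have "\<dots> = (\<Sum>i\<in>J. \<Sum>u\<in>U. f i x * (b i u * u v))" by (rule sum.swap)
    also have "\<dots> = (\<Sum>i\<in>J. f i x * n i v)"
      by (rule sum.cong) (simp_all add: b(2) sum_distrib_left)
    also have "\<dots> = x v" using fun_cong[OF J(4)[OF x], of v, symmetric] .
    finally show ?thesis .
  qed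
  have "c u = 0" if c: "\<forall>u\<in>U. sg (c u) = c u" "\<forall>v. (\<Sum>u\<in>U. c u * u v) = 0" and "u \<in> U" for c u
  proof -
    define E where "E u v = (if u = v then 1 else 0) - s v u" for u v
    have E0: "hc 0 (E u v) = 0" if "u \<in> U" "v \<in> U" for u v
    proof (rule minimal_gens_relation[OF U min _ _ that(1), where c="\<lambda>u. E u v"])
      fix x
      have "(\<Sum>u\<in>U. E u v * u x) = (\<Sum>u\<in>U. (if u = v then v x else 0)) - (\<Sum>u\<in>U. s v u * u x)"
        by (auto simp: E_def left_diff_distrib sum_subtractf intro!: sum.cong)
      also have "\<dots> = 0" using s_section[of v x] that UN fin by auto
      finally show "(\<Sum>u\<in>U. E u v * u x) = 0" .
    next
      fix u show "sg (E u v) = E u v" using s_closed[of v u] that UN by (auto simp: E_def)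
    qed
    \<comment> \<open>The section only sees the sum of the \<open>c v * v\<close>, which is
      zero.\<close>
    have fixc: "c u = (\<Sum>v\<in>U. E u v * c v)" if "u \<in> U" for u
    proof -
      have "(\<Sum>v\<in>U. s v u * c v) = (\<Sum>v\<in>U. \<Sum>i\<in>J. b i u * (c v * f i v))"
        by (simp add: s_def sum_distrib_left sum_distrib_right mult_ac)
      also have "\<dots> = (\<Sum>i\<in>J. \<Sum>v\<in>U. b i u * (c v * f i v))" by (rule sum.swap)
      also have "\<dots> = (\<Sum>i\<in>J. b i u * (\<Sum>v\<in>U. c v * f i v))" by (simp add: sum_distrib_left)
      also have "\<dots> = 0"
      proof (intro sum.neutral ballI)
        fix i assume i: "i \<in> J"
        have "(\<Sum>v\<in>U. c v * f i v) = f i (\<lambda>x. \<Sum>v\<in>U. c v * v x)"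
          using c(1) UN fin by (intro linear_functional_lincomb[OF N(1) J(3)[OF i], symmetric]) auto
        also have "\<dots> = 0" using c(2) linear_functional_0[OF N(1) J(3)[OF i]] by simp
        finally show "b i u * (\<Sum>v\<in>U. c v * f i v) = 0" by simp
      qed
      finally have z: "(\<Sum>v\<in>U. s v u * c v) = 0" .
      have "(\<Sum>v\<in>U. E u v * c v) = (\<Sum>v\<in>U. if u = v then c u else 0) - (\<Sum>v\<in>U. s v u * c v)"
        by (auto simp: E_def left_diff_distrib sum_subtractf intro!: sum.cong)
      then show ?thesis using z that fin by simp
    qed
    have vanish: "\<forall>u\<in>U. \<forall>d<k. hc d (c u) = 0" for k
    proof (induction k)
      case (Suc k)
      show ?case
      proof (intro ballI allI impI)
        fix u d assume u: "u \<in> U" and d: "d < Suc k"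
        have "hc d (c u) = (\<Sum>v\<in>U. \<Sum>i\<le>d. hc i (E u v) * hc (d - i) (c v))"
          by (subst fixc[OF u]) (simp add: hc_sum hc_mult)
        also have "\<dots> = 0"
        proof (intro sum.neutral ballI)
          fix v i assume v: "v \<in> U" and i: "i \<in> {..d}"
          show "hc i (E u v) * hc (d - i) (c v) = 0"
          proof (cases "i = 0")
            case True
            then show ?thesis using E0[OF u v] by simp
          next
            case False
            then have "d - i < k" using d i by auto
            then show ?thesis using Suc v by simp
          qed
        qed
        finally show "hc d (c u) = 0" .
      qed
    qed simp
    show "c u = 0"
    proof (rule eq_0_if_hc)
      show "hc d (c u) = 0" for d using vanish[of "Suc d"] \<open>u \<in> U\<close> by simp
    qed
  qed
  then have indep: "\<forall>c. (\<forall>u\<in>U. sg (c u) = c u) \<longrightarrow> (\<forall>v. (\<Sum>u\<in>U. c u * u v) = 0) \<longrightarrow> (\<forall>u\<in>U. c u = 0)"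
    by simp
  have "\<forall>x\<in>N. \<exists>c. (\<forall>u. sg (c u) = c u) \<and> x = (\<lambda>v. \<Sum>u\<in>U. c u * u v)"
  proof
    fix x assume "x \<in> N"
    with gen have "x \<in> spanned U" ..
    then show "\<exists>c. (\<forall>u. sg (c u) = c u) \<and> x = (\<lambda>v. \<Sum>u\<in>U. c u * u v)"
      unfolding spanned_def mem_Collect_eq by (simp only: conj_commute)
  qed
  then have "is_basis N U"
    unfolding is_basis_def by (intro conjI fin UN indep)
  then show ?thesis ..
qed

end

subsection \<open>Logarithmic forms with denominators cleared\<close>

text \<open>The contraction of the 1-form with coefficients \<open>x i\<close> by the constant
  vector field \<open>v\<close>.\<close>

definition ctr :: "('n \<Rightarrow> ('k::field, 'n::finite) mpoly) \<Rightarrow> 'k^'n \<Rightarrow> ('k, 'n) mpoly" where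
  "ctr x v = (\<Sum>i\<in>UNIV. const_poly (v $ i) * x i)"

lemma ctr_add_left: "ctr (\<lambda>i. x i + y i) v = ctr x v + ctr y v"
  by (simp add: ctr_def distrib_left sum.distrib)

lemma ctr_diff_left: "ctr (\<lambda>i. x i - y i) v = ctr x v - ctr y v"
  by (simp add: ctr_def right_diff_distrib sum_subtractf)

lemma ctr_smult: "ctr (\<lambda>i. r * x i) v = r * ctr x v"
  by (simp add: ctr_def sum_distrib_left mult_ac)

lemma ctr_0 [simp]: "ctr (\<lambda>i. 0) v = 0"
  by (simp add: ctr_def)

lemma ctr_add_right: "ctr x (u + v) = ctr x u + ctr x v"
  by (simp add: ctr_def const_poly_add distrib_right sum.distrib)

lemma ctr_diff_right: "ctr x (u - v) = ctr x u - ctr x v"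
  by (simp add: ctr_def const_poly_diff left_diff_distrib sum_subtractf)

lemma ctr_scale: "ctr x (c *s v) = const_poly c * ctr x v"
  by (simp add: ctr_def const_poly_mult sum_distrib_left mult.assoc)

lemma ctr_axis [simp]: "ctr x (axis i 1) = x i"
proof -
  have "ctr x (axis i 1) = (\<Sum>j\<in>UNIV. if j = i then x i else 0)"
    unfolding ctr_def by (rule sum.cong) (auto simp: axis_def)
  then show ?thesis by simp
qed

lemma ctr_const: "ctr (\<lambda>i. p * const_poly (a $ i)) v = p * const_poly (pairing a v)"
  by (simp add: ctr_def pairing_def const_poly_sum const_poly_mult sum_distrib_left mult_ac)

lemma hc_const_mult: "hc d (const_poly c * p) = const_poly c * hc d p"
  using hc_mult_homog[of 0 "const_poly c" d p] by (simp add: hc_const mult.commute)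

lemma hc_ctr: "hc d (ctr x v) = ctr (\<lambda>i. hc d (x i)) v"
  by (simp add: ctr_def hc_sum hc_const_mult)

lemma elim_ctr: "elim al w (ctr x v) = ctr (\<lambda>i. elim al w (x i)) v"
  by (simp add: ctr_def elim_sum)

lemma ctr_of_linear:
  assumes "\<And>u v. g (u + v) = g u + g v" "\<And>c v. g (c *s v) = const_poly c * g v"
  shows "ctr (\<lambda>i. g (axis i 1)) v = g v"
proof -
  have g0: "g 0 = 0" using assms(2)[of 0 0] by simp
  have "g (\<Sum>i\<in>I. v $ i *s axis i 1) = (\<Sum>i\<in>I. const_poly (v $ i) * g (axis i 1))" if "finite I" for I
    using that by (induction I rule: finite_induct) (simp_all add: assms g0)
  from this[of UNIV] show ?thesis unfolding ctr_def basis_expansion by simp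
qed

text \<open>Quotients by \<open>d\<close> are unique in a domain, so they again depend linearly on
  \<open>v\<close> and come from a coefficient vector.\<close>

lemma ctr_quotient:
  assumes d: "d \<noteq> 0" and add: "\<And>u v. g (u + v) = g u + g v" and scale: "\<And>c v. g (c *s v) = const_poly c * g v"
    and dvd: "\<And>v. d dvd g v"
  shows "\<exists>x. \<forall>v. d * ctr x v = g v"
proof -
  have "\<forall>v. \<exists>p. d * p = g v" using dvd by (metis dvd_def)
  from choice[OF this] obtain f where f: "\<And>v. d * f v = g v" by blast
  have "ctr (\<lambda>i. f (axis i 1)) v = f v" for v
  proof (rule ctr_of_linear)
    fix u v
    have "d * f (u + v) = d * (f u + f v)" by (simp add: f add distrib_left)
    then show "f (u + v) = f u + f v" using d by (simp add: mpoly_mult_left_cancel)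
  next
    fix c v
    have "d * f (c *s v) = d * (const_poly c * f v)" by (simp add: f scale mult.left_commute[of d])
    then show "f (c *s v) = const_poly c * f v" using d by (simp add: mpoly_mult_left_cancel)
  qed
  then show ?thesis using f by (intro exI[of _ "\<lambda>i. f (axis i 1)"]) simp
qed

lemma linear_poly_dvd_hc:
  assumes "linear_poly a dvd p"
  shows "linear_poly a dvd hc d p"
proof -
  obtain q where "p = q * linear_poly a" using assms by (metis dvd_def mult.commute)
  then show ?thesis using hc_mult_homog[OF homog_linear_poly, of d q a] by simp
qed

context eliminated_ring
begin

text \<open>The coefficient vectors of \<open>Q(A) \<omega>\<close> for \<open>\<omega>\<close> logarithmic: as \<open>al\<^sub>L\<close> vanishes on \<open>L\<close>, the condition on
  \<open>Q(A) \<omega> \<and> d al\<^sub>L\<close> only concerns the contraction with vectors of \<open>L\<close>.\<close>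

definition logv :: "('k^'n) set set \<Rightarrow> (('k^'n) set \<Rightarrow> 'k^'n) \<Rightarrow> ('n \<Rightarrow> ('k, 'n) mpoly) set" where
  "logv A a = {x. (\<forall>i. sg (x i) = x i) \<and> ctr x w = 0 \<and>
     (\<forall>L\<in>A. \<forall>v\<in>L. sg (linear_poly (a L)) dvd ctr x v)}"

lemma sg_ctr_closed: "(\<And>i. sg (x i) = x i) \<Longrightarrow> sg (ctr x v) = ctr x v"
  by (simp add: elim_ctr)

lemma submod_logv: "submod (logv A a)"
  unfolding submod_def logv_def by (auto simp: ctr_add_left ctr_smult)

text \<open>Every condition is a divisibility by a linear form, also after elimination, and the
  homogeneous components of a multiple of a linear form are multiples of it.\<close>

lemma graded_logv: "graded (logv A a)"
  unfolding graded_def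
proof (intro conjI ballI allI)
  fix x d assume x: "x \<in> logv A a"
  show "(\<lambda>i. hc d (x i)) \<in> logv A a"
    using x unfolding logv_def
    by (auto simp: sg_hc_closed elim_linear_poly simp flip: hc_ctr intro: linear_poly_dvd_hc)
next
  fix x :: "'n \<Rightarrow> ('k, 'n) mpoly"
  show "\<exists>D. \<forall>d>D. \<forall>i. hc d (x i) = 0"
  proof (intro exI allI impI)
    fix d i assume "(\<Sum>i\<in>UNIV. degb (x i)) < d"
    moreover have "degb (x i) \<le> (\<Sum>i\<in>UNIV. degb (x i))" by (rule member_le_sum) auto
    ultimately show "hc d (x i) = 0" by (intro hc_eq_0_if_degb) simp
  qed
qed

text \<open>With \<open>q\<close> the product of the reduced forms, the vectors \<open>e i\<close>
  represent \<open>q\<close> times (\<open>dx_i\<close> minus \<open>w $ i\<close> times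
  \<open>d al\<close>). The correction makes the contraction with \<open>w\<close> vanish, and
  \<open>q * x\<close> is the combination of the \<open>e i\<close> with the entries of
  \<open>x\<close> as coefficients.\<close>

lemma almost_generated_logv:
  assumes "finite A" "\<And>L. L \<in> A \<Longrightarrow> sg (linear_poly (a L)) \<noteq> 0"
  shows "almost_generated (logv A a)"
proof -
  define q where "q = (\<Prod>L\<in>A. sg (linear_poly (a L)))"
  have q: "sg q = q" "q \<noteq> 0"
    using assms by (auto simp: q_def elim_prod elim_pair mpoly_prod_eq_0)
  define e where "e i j = q * const_poly ((axis i 1 - w $ i *s al) $ j)" for i j
  have ctr_e: "ctr (e i) v = q * const_poly (pairing (axis i 1 - w $ i *s al) v)" for i v
    unfolding e_def by (rule ctr_const)
  have w1: "pairing al w * w $ i = w $ i" for i using elim_pair by (auto simp: elim_pair_def)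
  have eN: "e i \<in> logv A a" for i
    unfolding logv_def
  proof (intro CollectI conjI ballI allI)
    show "sg (e i j) = e i j" for j by (simp add: e_def q)
    have "pairing (axis i 1 - w $ i *s al) w = 0" using w1[of i]
      by (simp add: pairing_diff_left pairing_scale_left pairing_axis_left mult.commute[of "w $ i"])
    then show "ctr (e i) w = 0" by (simp add: ctr_e)
    fix L v assume "L \<in> A"
    then show "sg (linear_poly (a L)) dvd ctr (e i) v"
      unfolding ctr_e q_def using assms(1) by (intro dvd_mult2 dvd_prodI)
  qed
  have "(\<lambda>j. q * x j) \<in> spanned (range e)" if x: "x \<in> logv A a" for x
  proof -
    have "q * x j = (\<Sum>i\<in>UNIV. x i * e i j)" for j
    proof -
      have "(\<Sum>i\<in>UNIV. x i * e i j) = q * (\<Sum>i\<in>UNIV. const_poly (axis i 1 $ j) * x i)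
          - q * const_poly (al $ j) * ctr x w"
        by (simp add: e_def const_poly_diff const_poly_mult right_diff_distrib sum_subtractf ctr_def
            sum_distrib_left mult_ac)
      also have "(\<Sum>i\<in>UNIV. const_poly (axis i 1 $ j) * x i) = (\<Sum>i\<in>UNIV. if i = j then x j else 0)"
        by (rule sum.cong) (auto simp: axis_def)
      finally show ?thesis using x by (simp add: logv_def)
    qed
    then have "(\<lambda>j. q * x j) = (\<lambda>j. \<Sum>i\<in>UNIV. x i * e i j)" by blast
    also have "\<dots> \<in> spanned (range e)"
      using x by (intro spanned_lincomb spanned_base) (auto simp: logv_def)
    finally show ?thesis .
  qed
  then have "\<exists>c. (\<forall>u. sg (c u) = c u) \<and> (\<lambda>v. q * x v) = (\<lambda>v. \<Sum>u\<in>range e. c u * u v)"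
    if "x \<in> logv A a" for x
    using that unfolding spanned_def mem_Collect_eq by (simp only: conj_commute)
  then show ?thesis
    unfolding almost_generated_def
    by (intro exI[of _ "range e"] exI[of _ q] conjI ballI) (use q eN in auto)
qed

lemma logv_projective_free:
  assumes "finite A" "\<And>L. L \<in> A \<Longrightarrow> sg (linear_poly (a L)) \<noteq> 0" "dual_basis (logv A a) I f n"
  shows "\<exists>B. is_basis (logv A a) B"
  by (rule graded_projective_free[OF submod_logv graded_logv almost_generated_logv[OF assms(1,2)] assms(3)])

lemma is_basis_indep:
  assumes "is_basis N B" "\<And>b. b \<in> B \<Longrightarrow> sg (c b) = c b" "\<And>v. (\<Sum>b\<in>B. c b * b v) = 0" "b \<in> B"
  shows "c b = 0"
proof -
  have "\<forall>c. (\<forall>b\<in>B. sg (c b) = c b) \<longrightarrow> (\<forall>v. (\<Sum>b\<in>B. c b * b v) = 0) \<longrightarrow> (\<forall>b\<in>B. c b = 0)"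
    using assms(1) unfolding is_basis_def by (elim conjE) assumption
  from this[rule_format, of c] assms(2-4) show ?thesis by simp
qed

lemma is_basis_coords:
  assumes "submod N" "is_basis N B"
  shows "\<exists>f. (\<forall>b\<in>B. linear_functional N (f b)) \<and> (\<forall>x\<in>N. \<forall>v. x v = (\<Sum>b\<in>B. f b x * b v))"
proof -
  have B: "finite B" "B \<subseteq> N" using assms(2) by (auto simp: is_basis_def)
  have ex: "\<forall>x\<in>N. \<exists>c. (\<forall>b. sg (c b) = c b) \<and> x = (\<lambda>v. \<Sum>b\<in>B. c b * b v)"
    using assms(2) by (simp add: is_basis_def)
  from bchoice[OF this] obtain g where
    g: "\<forall>x\<in>N. (\<forall>b. sg (g x b) = g x b) \<and> x = (\<lambda>v. \<Sum>b\<in>B. g x b * b v)" ..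
  have gc: "sg (g x b) = g x b" if "x \<in> N" for x b using g that by blast
  have gx: "x v = (\<Sum>b\<in>B. g x b * b v)" if "x \<in> N" for x v
    using fun_cong[OF bspec[OF g that, THEN conjunct2], of v] .
  have uniq: "g x b = c b" if "x \<in> N" "\<And>b. sg (c b) = c b" "\<And>v. x v = (\<Sum>b\<in>B. c b * b v)" "b \<in> B" for x c b
  proof -
    have "(\<Sum>b\<in>B. (g x b - c b) * b v) = 0" for v
      using gx[OF that(1), of v] that(3)[of v] by (simp add: left_diff_distrib sum_subtractf)
    then have "g x b - c b = 0"
      using gc[OF that(1)] that(2,4) by (intro is_basis_indep[OF assms(2), of "\<lambda>b. g x b - c b"]) simp_all
    then show ?thesis by simp
  qed
  have "linear_functional N (\<lambda>x. g x b)" if b: "b \<in> B" for b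
    unfolding linear_functional_def
  proof (intro conjI ballI allI impI)
    fix x y assume x: "x \<in> N" and y: "y \<in> N"
    show "g (\<lambda>v. x v + y v) b = g x b + g y b"
    proof (rule uniq[OF submod_add[OF assms(1) x y] _ _ b])
      show "sg (g x b + g y b) = g x b + g y b" for b by (simp add: gc[OF x] gc[OF y])
      show "x v + y v = (\<Sum>b\<in>B. (g x b + g y b) * b v)" for v
        by (simp add: distrib_right sum.distrib flip: gx[OF x, of v] gx[OF y, of v])
    qed
  next
    fix x r assume x: "x \<in> N" and r: "sg r = r"
    show "g (\<lambda>v. r * x v) b = r * g x b"
    proof (rule uniq[OF submod_smult[OF assms(1) x r] _ _ b])
      show "sg (r * g x b) = r * g x b" for b by (simp add: gc[OF x] r)
      show "r * x v = (\<Sum>b\<in>B. r * g x b * b v)" for v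
        by (simp add: mult.assoc flip: gx[OF x, of v] sum_distrib_left)
    qed
  qed (rule gc)
  then show ?thesis using gx by (intro exI[of _ "\<lambda>b x. g x b"] conjI ballI allI)
qed

lemma is_basis_coords_unique:
  assumes "submod N" "is_basis N B" "\<And>b. b \<in> B \<Longrightarrow> linear_functional N (f b)"
    "\<And>x v. x \<in> N \<Longrightarrow> x v = (\<Sum>b\<in>B. f b x * b v)"
    and "\<And>b. b \<in> B \<Longrightarrow> sg (c b) = c b" "b \<in> B"
  shows "f b (\<lambda>v. \<Sum>b\<in>B. c b * b v) = c b"
proof -
  have B: "finite B" "B \<subseteq> N" using assms(2) by (auto simp: is_basis_def)
  let ?x = "\<lambda>v. \<Sum>b\<in>B. c b * b v"
  have x: "?x \<in> N" using submod_lincomb[OF assms(1) B(1), of "\<lambda>b. b" c] B assms(5) by auto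
  have "(\<Sum>b\<in>B. (f b ?x - c b) * b v) = 0" for v
    using assms(4)[OF x, of v] by (simp add: left_diff_distrib sum_subtractf)
  moreover have "\<forall>b\<in>B. sg (f b ?x - c b) = f b ?x - c b"
    using assms(5) linear_functional_closed[OF assms(3) x] by simp
  ultimately have "f b ?x - c b = 0"
    using assms(6) by (intro is_basis_indep[OF assms(2), of "\<lambda>b. f b ?x - c b"]) simp_all
  then show ?thesis by simp
qed

end

global_interpretation V: eliminated_ring "0 :: 'k::field^'n" 0
  by unfold_locales (simp add: elim_pair_def)

subsection \<open>Restriction and residue\<close>

lemma const_mult_dvd_iff:
  assumes "c \<noteq> 0"
  shows "const_poly c * p dvd q \<longleftrightarrow> p dvd q"
proof
  assume "p dvd q"
  then have "const_poly c * p dvd const_poly c * q" by (intro mult_dvd_mono dvd_refl)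
  moreover have "q = const_poly (inverse c) * (const_poly c * q)"
    by (simp add: const_poly_inverse[OF assms] flip: mult.assoc)
  then have "const_poly c * q dvd q" by (metis dvd_triv_right)
  ultimately show "const_poly c * p dvd q" by (rule dvd_trans)
qed (rule dvd_mult_right)

lemma ctr_right_0 [simp]: "ctr x 0 = 0"
  by (simp add: ctr_def)

lemma V_logv: "x \<in> V.logv A a \<longleftrightarrow> (\<forall>L\<in>A. \<forall>v\<in>L. linear_poly (a L) dvd ctr x v)"
  by (simp add: V.logv_def)

text \<open>The forms enter only through their zero sets. Those in \<open>b\<close> are forms on the
  whole space that cut out the members of the restriction inside \<open>H\<close>; they are chosen
  independently of \<open>a\<close>, whence the constants \<open>cf\<close> below. The vector
  \<open>w\<close> spans a complement of \<open>H\<close>.\<close>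

locale restricted_arrangement = eliminated_ring al w for al w :: "'k::field^'n" +
  fixes A :: "('k^'n) set set" and H :: "('k^'n) set" and a b :: "('k^'n) set \<Rightarrow> 'k^'n"
  assumes finA: "finite A" and HA: "H \<in> A" and aH: "a H = al" and alw: "pairing al w = 1"
    and mem_A: "L \<in> A \<Longrightarrow> v \<in> L \<longleftrightarrow> pairing (a L) v = 0"
    and a_nz: "L \<in> A \<Longrightarrow> a L \<noteq> 0"
    and mem_AH: "X \<in> restriction A H \<Longrightarrow> v \<in> X \<longleftrightarrow> v \<in> H \<and> pairing (b X) v = 0"
begin

abbreviation A' where "A' \<equiv> A - {H}"
abbreviation AH where "AH \<equiv> restriction A H"
abbreviation t where "t \<equiv> linear_poly al"

definition a' where "a' L = a L - pairing (a L) w *s al"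
definition b' where "b' X = b X - pairing (b X) w *s al"

lemma sg_a: "sg (linear_poly (a L)) = linear_poly (a' L)"
  by (simp add: elim_linear_poly a'_def)

lemma sg_b: "sg (linear_poly (b X)) = linear_poly (b' X)"
  by (simp add: elim_linear_poly b'_def)

lemma sg_a' [simp]: "sg (linear_poly (a' L)) = linear_poly (a' L)"
  using elim_pair by (metis elim_idem sg_a)

lemma sg_b' [simp]: "sg (linear_poly (b' L)) = linear_poly (b' L)"
  using elim_pair by (metis elim_idem sg_b)

lemma mem_H: "v \<in> H \<longleftrightarrow> pairing al v = 0"
  using mem_A[OF HA] aH by simp

lemma al_nz: "al \<noteq> 0"
  using alw by auto

lemma t_nz: "t \<noteq> 0"
  using al_nz by simp

lemma sg_t [simp]: "sg t = 0"
  by (rule elim_self[OF elim_pair])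

lemma sg_eq_0: "sg p = 0 \<longleftrightarrow> t dvd p"
  by (rule elim_eq_0_iff[OF elim_pair])

lemma a'_w: "pairing (a' L) w = 0"
  by (simp add: a'_def pairing_simps alw)

lemma b'_w: "pairing (b' X) w = 0"
  by (simp add: b'_def pairing_simps alw)

lemma a'_H: "v \<in> H \<Longrightarrow> pairing (a' L) v = pairing (a L) v"
  by (simp add: a'_def pairing_simps mem_H)

lemma b'_H: "v \<in> H \<Longrightarrow> pairing (b' X) v = pairing (b X) v"
  by (simp add: b'_def pairing_simps mem_H)

lemma proj_in_H: "v - pairing al v *s w \<in> H"
  by (simp add: mem_H pairing_simps alw)

lemma form_eq_0I:
  assumes "\<And>v. v \<in> H \<Longrightarrow> pairing c v = 0" "pairing c w = 0"
  shows "c = 0"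
proof (rule pairing_eq_0_imp)
  fix v show "pairing c v = 0"
    using assms(1)[OF proj_in_H[of v]] assms(2) by (simp add: pairing_simps)
qed

lemma mem_A': "L \<in> A' \<Longrightarrow> H \<inter> L \<in> AH"
  by (auto simp: restriction_def)

lemma AH_cases: "X \<in> AH \<Longrightarrow> \<exists>L\<in>A'. X = H \<inter> L"
  by (auto simp: restriction_def)

lemma finAH: "finite AH"
proof -
  have "AH = (\<lambda>L. H \<inter> L) ` A'" by (auto simp: restriction_def)
  then show ?thesis using finA by simp
qed

lemma a'_nz:
  assumes "L \<in> A'"
  shows "a' L \<noteq> 0"
proof
  assume "a' L = 0"
  then have e: "a L = pairing (a L) w *s al" by (simp add: a'_def)
  moreover have "a L \<noteq> 0" using a_nz assms by simp
  ultimately have nz: "pairing (a L) w \<noteq> 0" by auto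
  have "v \<in> L \<longleftrightarrow> v \<in> H" for v
  proof -
    have "pairing (a L) v = pairing (a L) w * pairing al v"
      using arg_cong[OF e, of "\<lambda>c. pairing c v"] by (simp add: pairing_simps)
    then show ?thesis using mem_A[of L v] mem_H[of v] assms nz by simp
  qed
  then have "L = H" by blast
  then show False using assms by simp
qed

text \<open>The forms of \<open>L\<close> and \<open>H\<close> are independent as the hyperplanes
  differ. The vector \<open>w1\<close> lies in \<open>L\<close> and can replace \<open>w\<close> as
  a complement of \<open>H\<close>.\<close>

lemma ex_frame:
  assumes "L \<in> A'"
  obtains v w1 where "v \<in> H" "pairing (a L) v = 1" "pairing al w1 = 1" "pairing (a L) w1 = 0"
proof -
  obtain u where u: "pairing (a' L) u = 1" using ex_pairing_eq_1[OF a'_nz[OF assms]] ..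
  define v where "v = u - pairing al u *s w"
  have v: "v \<in> H" unfolding v_def by (rule proj_in_H)
  have "pairing (a' L) v = 1" using u by (simp add: v_def pairing_simps a'_w)
  then have av: "pairing (a L) v = 1" using a'_H[OF v] by simp
  show ?thesis
    by (rule that[of v "w - pairing (a L) w *s v"]) (use v av in \<open>auto simp: pairing_simps alw mem_H\<close>)
qed

text \<open>Two linear forms on \<open>H\<close> with the same zero set are proportional; both
  reduced forms vanish at \<open>w\<close>, so the proportionality extends from \<open>H\<close> to
  the whole space.\<close>

lemma a'_eq_b':
  assumes L: "L \<in> A'"
  shows "\<exists>c. c \<noteq> 0 \<and> a' L = c *s b' (H \<inter> L)"
proof -
  let ?X = "H \<inter> L"
  have X: "?X \<in> AH" by (rule mem_A'[OF L])
  have iff: "pairing (b' ?X) v = 0 \<longleftrightarrow> pairing (a' L) v = 0" if "v \<in> H" for v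
    using mem_AH[OF X, of v] mem_A[of L v] L that by (simp add: a'_H b'_H)
  have "b' ?X \<noteq> 0"
  proof
    assume "b' ?X = 0"
    then have "a' L = 0" using iff by (intro form_eq_0I a'_w) simp
    then show False using a'_nz[OF L] by simp
  qed
  then obtain u where u: "pairing (b' ?X) u = 1" using ex_pairing_eq_1 by blast
  define v0 where "v0 = u - pairing al u *s w"
  have v0: "v0 \<in> H" "pairing (b' ?X) v0 = 1"
    using proj_in_H u by (auto simp: v0_def pairing_simps b'_w)
  define c where "c = pairing (a' L) v0"
  have "a' L - c *s b' ?X = 0"
  proof (rule form_eq_0I)
    fix v assume v: "v \<in> H"
    let ?v = "v - pairing (b' ?X) v *s v0"
    have "?v \<in> H" using v v0 by (simp add: mem_H pairing_simps)
    then have "pairing (a' L) ?v = 0" using iff[of ?v] v0 by (simp add: pairing_simps)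
    then show "pairing (a' L - c *s b' ?X) v = 0" by (simp add: pairing_simps c_def mult.commute)
  qed (simp add: pairing_simps a'_w b'_w)
  then have "a' L = c *s b' ?X" by simp
  moreover have "c \<noteq> 0" using iff[OF v0(1)] v0(2) by (simp add: c_def)
  ultimately show ?thesis by blast
qed

lemma b'_nz: "X \<in> AH \<Longrightarrow> b' X \<noteq> 0"
  using AH_cases a'_eq_b' a'_nz by fastforce

lemma b'_dvd_iff: "L \<in> A' \<Longrightarrow> linear_poly (a' L) dvd p \<longleftrightarrow> linear_poly (b' (H \<inter> L)) dvd p"
  using a'_eq_b'[of L] by (auto simp: linear_poly_scale const_mult_dvd_iff)

lemma b'_distinct:
  assumes X: "X \<in> AH" and Y: "Y \<in> AH" and d: "linear_poly (b' X) dvd linear_poly (b' Y)"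
  shows "X = Y"
proof -
  obtain c where c: "b' Y = c *s b' X" using linear_poly_dvd_linear_poly[OF b'_nz[OF X] d] ..
  then have "c \<noteq> 0" using b'_nz[OF Y] by auto
  then have "v \<in> Y \<longleftrightarrow> v \<in> X" for v
    using mem_AH[OF X, of v] mem_AH[OF Y, of v] c b'_H[of v X] b'_H[of v Y] by (auto simp: pairing_simps)
  then show ?thesis by blast
qed

lemma a_distinct:
  assumes X: "X \<in> A" and Y: "Y \<in> A" and d: "linear_poly (a X) dvd linear_poly (a Y)"
  shows "X = Y"
proof -
  obtain c where c: "a Y = c *s a X" using linear_poly_dvd_linear_poly[OF a_nz[OF X] d] ..
  then have "c \<noteq> 0" using a_nz[OF Y] by auto
  then have "v \<in> Y \<longleftrightarrow> v \<in> X" for v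
    using mem_A[OF X, of v] mem_A[OF Y, of v] c by (auto simp: pairing_simps)
  then show ?thesis by blast
qed

text \<open>The defining polynomial of the deletion, not of \<open>A\<close>: the factor
  \<open>t\<close> is kept apart, since \<open>sg\<close> annihilates it. Then \<open>sQ\<close> is
  its restriction to \<open>H\<close>, and \<open>QH\<close> is a defining polynomial of the
  restricted arrangement.\<close>

definition Q where "Q = (\<Prod>L\<in>A'. linear_poly (a L))"
definition sQ where "sQ = (\<Prod>L\<in>A'. linear_poly (a' L))"
definition QH where "QH = (\<Prod>X\<in>AH. linear_poly (b' X))"

lemma sg_Q: "sg Q = sQ"
  by (simp add: Q_def sQ_def elim_prod sg_a)

lemma sQ_nz: "sQ \<noteq> 0"
  unfolding sQ_def using finA a'_nz by (auto simp: mpoly_prod_eq_0)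

lemma QH_nz: "QH \<noteq> 0"
  unfolding QH_def using finAH b'_nz by (auto simp: mpoly_prod_eq_0)

lemma sg_QH [simp]: "sg QH = QH"
  by (simp add: QH_def elim_prod)

lemma QH_dvdI: "(\<And>X. X \<in> AH \<Longrightarrow> linear_poly (b' X) dvd p) \<Longrightarrow> QH dvd p"
  unfolding QH_def using finAH b'_nz b'_distinct by (intro prod_linear_polys_dvd) auto

lemma QH_dvd_sQ: "QH dvd sQ"
proof (rule QH_dvdI)
  fix X assume "X \<in> AH"
  then obtain L where L: "L \<in> A'" "X = H \<inter> L" using AH_cases by blast
  have "linear_poly (a' L) dvd sQ" unfolding sQ_def using finA L by (intro dvd_prodI) auto
  then show "linear_poly (b' X) dvd sQ" using b'_dvd_iff L by simp
qed

text \<open>Up to a nonzero constant, \<open>P\<close> contains the form of each \<open>X\<close>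
  with an exponent one less than the number of members of the deletion that meet \<open>H\<close> in
  \<open>X\<close>.\<close>

definition P where "P = (SOME P. sQ = QH * P)"

lemma P: "sQ = QH * P"
proof -
  from QH_dvd_sQ have "\<exists>P. sQ = QH * P" unfolding dvd_def .
  then show ?thesis unfolding P_def by (rule someI_ex)
qed

lemma P_nz: "P \<noteq> 0"
  using sQ_nz by (auto simp: P)

lemma sg_closed_if_mult:
  assumes "q \<noteq> 0" "sg q = q" "sg (q * p) = q * p"
  shows "sg p = p"
proof -
  have "q * sg p = q * p" using assms(2,3) by simp
  then show ?thesis using assms(1) by (simp add: mpoly_mult_left_cancel)
qed

lemma sg_P [simp]: "sg P = P"
proof (rule sg_closed_if_mult[OF QH_nz sg_QH])
  show "sg (QH * P) = QH * P"
    unfolding P[symmetric] sg_Q[symmetric] by (rule elim_idem[OF elim_pair])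
qed

definition cf where "cf L = (SOME c. c \<noteq> 0 \<and> a' L = c *s b' (H \<inter> L))"

lemma cf_nz: "L \<in> A' \<Longrightarrow> cf L \<noteq> 0"
  and a'_cf: "L \<in> A' \<Longrightarrow> a' L = cf L *s b' (H \<inter> L)"
  unfolding cf_def using someI_ex[OF a'_eq_b'] by simp_all

lemma a_decomp:
  assumes "L \<in> A'"
  shows "a L = pairing (a L) w *s al + cf L *s b' (H \<inter> L)"
proof -
  have "pairing (a L) w *s al + a' L = a L" by (simp add: a'_def)
  from this[unfolded a'_cf[OF assms]] show ?thesis ..
qed

section \<open>Localization at a member of the restricted arrangement\<close>

lemma ex_normal_vector:
  assumes "X \<in> AH"
  obtains v where "v \<in> H" "pairing (b' X) v = 1"
proof -
  obtain u where "pairing (b' X) u = 1" using ex_pairing_eq_1[OF b'_nz[OF assms]] ..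
  then show ?thesis
    using proj_in_H by (intro that[of "u - pairing al u *s w"]) (auto simp: pairing_simps b'_w)
qed

text \<open>The hyperplanes other than \<open>H\<close> through the codimension-two space
  \<open>X\<close>; together with \<open>H\<close> they form the localization of \<open>A\<close> at
  \<open>X\<close>. Correspondingly \<open>Q\<close> splits into a local factor \<open>Pi X\<close>
  and a cofactor \<open>rest X\<close>.\<close>

definition flat_forms where "flat_forms X = {L \<in> A'. H \<inter> L = X}"
definition Pi where "Pi X = (\<Prod>L\<in>flat_forms X. linear_poly (a L))"
definition rest where "rest X = (\<Prod>L\<in>A' - flat_forms X. linear_poly (a L))"

lemma fin_flat: "finite (flat_forms X)"
  using finA by (simp add: flat_forms_def)

lemma flat_nonempty: "X \<in> AH \<Longrightarrow> flat_forms X \<noteq> {}"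
  using AH_cases by (auto simp: flat_forms_def)

lemma Q_split: "Q = Pi X * rest X"
  unfolding Q_def Pi_def rest_def using finA
  by (subst mult.commute, intro prod.subset_diff) (auto simp: flat_forms_def)

lemma sg_Pi: "\<exists>c. c \<noteq> 0 \<and> sg (Pi X) = const_poly c * linear_poly (b' X) ^ card (flat_forms X)"
proof -
  have "\<exists>c. c \<noteq> 0 \<and> (\<Prod>L\<in>I. linear_poly (a' L)) = const_poly c * linear_poly (b' X) ^ card I"
    if "finite I" "I \<subseteq> flat_forms X" for I
    using that
  proof (induction I rule: finite_induct)
    case empty
    then show ?case by (intro exI[of _ 1]) simp
  next
    case (insert L I)
    then obtain c where c: "c \<noteq> 0" "(\<Prod>L\<in>I. linear_poly (a' L)) = const_poly c * linear_poly (b' X) ^ card I"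
      by auto
    obtain d where d: "d \<noteq> 0" "a' L = d *s b' X"
      using a'_eq_b'[of L] insert.prems by (auto simp: flat_forms_def)
    show ?case using insert.hyps c d
      by (intro exI[of _ "d * c"]) (simp add: linear_poly_scale const_poly_mult mult_ac)
  qed
  from this[OF fin_flat order_refl] show ?thesis by (simp add: Pi_def elim_prod sg_a)
qed

text \<open>A hyperplane not through \<open>X\<close> meets \<open>H\<close> in a different member
  of the restriction. This makes \<open>sg (rest X)\<close> a multiplier that is harmless locally at
  \<open>X\<close>.\<close>

lemma b'_not_dvd_rest:
  assumes X: "X \<in> AH"
  shows "\<not> linear_poly (b' X) dvd sg (rest X)"
proof
  assume "linear_poly (b' X) dvd sg (rest X)"
  then have "linear_poly (b' X) dvd (\<Prod>L\<in>A' - flat_forms X. linear_poly (a' L))"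
    by (simp add: rest_def elim_prod sg_a)
  then obtain L where L: "L \<in> A' - flat_forms X" "linear_poly (b' X) dvd linear_poly (a' L)"
    using linear_poly_prime_prod[OF b'_nz[OF X], of "A' - flat_forms X" "\<lambda>L. linear_poly (a' L)"] finA
    by auto
  have "linear_poly (a' L) dvd linear_poly (b' (H \<inter> L))" using b'_dvd_iff L by auto
  then have "linear_poly (b' X) dvd linear_poly (b' (H \<inter> L))" using L(2) by (rule dvd_trans[rotated])
  moreover have "H \<inter> L \<in> AH" using mem_A' L by blast
  ultimately have "X = H \<inter> L" using b'_distinct[OF X] by blast
  then show False using L by (auto simp: flat_forms_def)
qed

lemma b'_not_dvd: "X \<in> AH \<Longrightarrow> Y \<in> AH \<Longrightarrow> X \<noteq> Y \<Longrightarrow> \<not> linear_poly (b' X) dvd linear_poly (b' Y)"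
  using b'_distinct by blast

section \<open>Divisibility of the restrictions of logarithmic forms\<close>

abbreviation MA where "MA \<equiv> V.logv A a"
abbreviation MA' where "MA' \<equiv> V.logv A' a"
abbreviation N where "N \<equiv> logv AH b"

lemma Pi_dvdI:
  assumes "\<And>L. L \<in> flat_forms X \<Longrightarrow> linear_poly (a L) dvd p"
  shows "Pi X dvd p"
  unfolding Pi_def using assms a_nz a_distinct fin_flat
  by (intro prod_linear_polys_dvd) (auto simp: flat_forms_def)

lemma sg_Pi_dvd:
  assumes "sg (Pi X) dvd p"
  shows "linear_poly (b' X) ^ card (flat_forms X) dvd p"
proof -
  obtain c where "c \<noteq> 0" "sg (Pi X) = const_poly c * linear_poly (b' X) ^ card (flat_forms X)"
    using sg_Pi by blast
  then show ?thesis using assms by (simp add: const_mult_dvd_iff)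
qed

text \<open>A vector of \<open>X\<close> lies in all hyperplanes through \<open>X\<close> at once,
  so the whole product \<open>Pi X\<close> divides the contraction before restriction to
  \<open>H\<close>.\<close>

lemma restrict_dvd_flat:
  assumes x: "x \<in> MA'" and v: "v \<in> X"
  shows "linear_poly (b' X) ^ card (flat_forms X) dvd sg (ctr x v)"
proof (rule sg_Pi_dvd, rule elim_dvd_mono, rule Pi_dvdI)
  fix L assume "L \<in> flat_forms X"
  then have "L \<in> A'" "v \<in> L" using v by (auto simp: flat_forms_def)
  then show "linear_poly (a L) dvd ctr x v" using x by (auto simp: V_logv)
qed

text \<open>Contracting with the Euler field of the rank-two localization at \<open>X\<close> gains the full product of
  the forms through \<open>X\<close>.\<close>

lemma restrict_dvd:
  assumes x: "x \<in> MA'" and X: "X \<in> AH" and u: "u \<in> H"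
  shows "linear_poly (b' X) ^ (card (flat_forms X) - 1) dvd sg (ctr x u)"
proof -
  obtain v where v: "v \<in> H" "pairing (b' X) v = 1" using ex_normal_vector[OF X] .
  obtain m where m: "card (flat_forms X) = Suc m"
    using flat_nonempty[OF X] fin_flat[of X] by (metis card_gt_0_iff gr0_conv_Suc)
  let ?be = "linear_poly (b' X)"
  \<comment> \<open>The contracted field is \<open>t\<close> times \<open>w\<close> plus
    \<open>?be\<close> times \<open>v\<close>. Its multiple by \<open>c2\<close> is \<open>t\<close>
    times the vector \<open>c2 *s w - ?c1 *s v\<close>, which lies in \<open>L\<close>, plus
    \<open>linear_poly (a L)\<close> times \<open>v\<close>.\<close>
  have "Pi X dvd t * ctr x w + ?be * ctr x v"
  proof (rule Pi_dvdI)
    fix L assume "L \<in> flat_forms X"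
    then have L: "L \<in> A'" "H \<inter> L = X" by (auto simp: flat_forms_def)
    then have LA: "L \<in> A" by simp
    let ?c1 = "pairing (a L) w"
    define c2 where "c2 = cf L"
    have c2: "c2 \<noteq> 0" using cf_nz[OF L(1)] by (simp add: c2_def)
    have dec: "a L = ?c1 *s al + c2 *s b' X"
      using a_decomp[OF L(1)] unfolding L(2) c2_def .
    have "pairing (a L) v = c2"
      using arg_cong[OF dec, of "\<lambda>c. pairing c v"] v by (simp add: pairing_simps mem_H)
    then have "c2 *s w - ?c1 *s v \<in> L" using mem_A[OF LA] by (simp add: pairing_simps)
    then have d: "linear_poly (a L) dvd ctr x (c2 *s w - ?c1 *s v)" using x L by (auto simp: V_logv)
    have "linear_poly (a L) = const_poly ?c1 * t + const_poly c2 * ?be"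
      using arg_cong[OF dec, of linear_poly] by (simp add: linear_poly_add linear_poly_scale)
    then have "const_poly c2 * (t * ctr x w + ?be * ctr x v) =
        t * ctr x (c2 *s w - ?c1 *s v) + linear_poly (a L) * ctr x v"
      by (simp add: ctr_diff_right ctr_scale algebra_simps)
    then have "linear_poly (a L) dvd const_poly c2 * (t * ctr x w + ?be * ctr x v)"
      using d by simp
    then show "linear_poly (a L) dvd t * ctr x w + ?be * ctr x v"
      by (rule dvd_trans) (simp add: const_mult_dvd_iff[OF c2])
  qed
  then have "sg (Pi X) dvd sg (t * ctr x w + ?be * ctr x v)" by (rule elim_dvd_mono)
  \<comment> \<open>Elimination removes the summand with \<open>t\<close>, and one factor
    \<open>?be\<close> cancels: this is the loss of one in the exponent.\<close>
  then have "?be ^ Suc m dvd ?be * sg (ctr x v)"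
    using sg_Pi_dvd[of X] m by simp
  then have dv: "?be ^ m dvd sg (ctr x v)"
    using b'_nz[OF X] by (simp add: mpoly_dvd_mult_cancel_left)
  let ?k = "pairing (b' X) u"
  have "u - ?k *s v \<in> X"
    using u v b'_H[of "u - ?k *s v" X] mem_AH[OF X] by (simp add: mem_H pairing_simps)
  then have "?be ^ Suc m dvd sg (ctr x (u - ?k *s v))" using restrict_dvd_flat[OF x] m by metis
  then have "?be ^ m dvd sg (ctr x (u - ?k *s v))" by (simp add: dvd_mult_right)
  moreover have "sg (ctr x u) = sg (ctr x (u - ?k *s v)) + const_poly ?k * sg (ctr x v)"
    by (simp add: ctr_diff_right ctr_scale)
  ultimately show ?thesis using dv m by simp
qed

text \<open>Up to a constant, \<open>sQ\<close> is the power of \<open>b' X\<close> belonging to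
  \<open>X\<close> times \<open>sg (rest X)\<close>. It is also \<open>QH * P\<close>, and
  \<open>QH\<close> contributes one factor \<open>b' X\<close>, which stays in the first claim and
  is cancelled in the second.\<close>

lemma P_dvd_rest:
  assumes X: "X \<in> AH"
  shows "linear_poly (b' X) * P dvd linear_poly (b' X) ^ card (flat_forms X) * sg (rest X)"
    "P dvd linear_poly (b' X) ^ (card (flat_forms X) - 1) * sg (rest X)"
proof -
  obtain c where c: "c \<noteq> 0" "sg (Pi X) = const_poly c * linear_poly (b' X) ^ card (flat_forms X)"
    using sg_Pi by blast
  have "linear_poly (b' X) dvd QH" unfolding QH_def using finAH X by (intro dvd_prodI)
  then have "linear_poly (b' X) * P dvd sQ" by (simp add: P mult_dvd_mono)
  also have "sQ = const_poly c * (linear_poly (b' X) ^ card (flat_forms X) * sg (rest X))"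
    unfolding sg_Q[symmetric] Q_split[of X] by (simp add: c mult.assoc)
  also have "\<dots> dvd linear_poly (b' X) ^ card (flat_forms X) * sg (rest X)"
    by (simp add: const_mult_dvd_iff[OF c(1)])
  finally show 1: "linear_poly (b' X) * P dvd linear_poly (b' X) ^ card (flat_forms X) * sg (rest X)" .
  obtain m where m: "card (flat_forms X) = Suc m"
    using flat_nonempty[OF X] fin_flat[of X] by (metis card_gt_0_iff gr0_conv_Suc)
  show "P dvd linear_poly (b' X) ^ (card (flat_forms X) - 1) * sg (rest X)"
    using 1 b'_nz[OF X] by (simp add: m mult.assoc mpoly_dvd_mult_cancel_left)
qed

text \<open>A local-global principle on \<open>H\<close>: as \<open>sQ\<close> is a product of forms
  of the restriction, only these primes can obstruct the divisibility, and each is dealt with by its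
  own multiplier \<open>h\<close>.\<close>

lemma dvd_if_locally:
  assumes "x dvd sQ * p" "\<And>X. X \<in> AH \<Longrightarrow> \<exists>h. \<not> linear_poly (b' X) dvd h \<and> x dvd h * p"
  shows "x dvd p"
proof (rule dvd_if_quotient_coprime[of A' a'])
  fix L assume L: "L \<in> A'"
  show "\<exists>h. \<not> linear_poly (a' L) dvd h \<and> x dvd h * p"
    using assms(2)[OF mem_A'[OF L]] b'_dvd_iff[OF L] by blast
qed (use finA a'_nz assms(1) in \<open>auto simp: sQ_def\<close>)

text \<open>At \<open>X\<close>, the exponent of \<open>b' X\<close> in \<open>P\<close> is exactly
  the one provided by \<open>restrict_dvd\<close>.\<close>

lemma P_dvd_restrict:
  assumes x: "x \<in> MA'" and v: "v \<in> H"
  shows "P dvd sg (ctr x v)"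
proof (rule dvd_if_locally)
  show "P dvd sQ * sg (ctr x v)" by (simp add: P)
next
  fix X assume X: "X \<in> AH"
  have "P dvd linear_poly (b' X) ^ (card (flat_forms X) - 1) * sg (rest X)" by (rule P_dvd_rest[OF X])
  also have "\<dots> dvd sg (ctr x v) * sg (rest X)" by (intro mult_dvd_mono restrict_dvd x X v) simp
  finally show "\<exists>h. \<not> linear_poly (b' X) dvd h \<and> P dvd h * sg (ctr x v)"
    using b'_not_dvd_rest[OF X] by (auto simp: mult.commute)
qed

text \<open>At \<open>X\<close> itself the full exponent is available for vectors of
  \<open>X\<close>. At any other \<open>Y\<close> the form of \<open>X\<close> is prime to that of
  \<open>Y\<close> and serves as the multiplier.\<close>

lemma bP_dvd_restrict:
  assumes x: "x \<in> MA'" and X: "X \<in> AH" and v: "v \<in> X"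
  shows "linear_poly (b' X) * P dvd sg (ctr x v)"
proof (rule dvd_if_locally)
  have "linear_poly (b' X) dvd QH" unfolding QH_def using finAH X by (intro dvd_prodI)
  then show "linear_poly (b' X) * P dvd sQ * sg (ctr x v)" by (simp add: P mult_dvd_mono)
next
  fix Y assume Y: "Y \<in> AH"
  show "\<exists>h. \<not> linear_poly (b' Y) dvd h \<and> linear_poly (b' X) * P dvd h * sg (ctr x v)"
  proof (cases "Y = X")
    case True
    have "linear_poly (b' X) * P dvd linear_poly (b' X) ^ card (flat_forms X) * sg (rest X)"
      by (rule P_dvd_rest[OF X])
    also have "\<dots> dvd sg (ctr x v) * sg (rest X)" by (intro mult_dvd_mono restrict_dvd_flat x v) simp
    finally show ?thesis using b'_not_dvd_rest[OF X] True by (auto simp: mult.commute)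
  next
    case False
    have "v \<in> H" using v mem_AH[OF X] by blast
    then have "linear_poly (b' X) * P dvd linear_poly (b' X) * sg (ctr x v)"
      using P_dvd_restrict[OF x] by (simp add: mult_dvd_mono)
    then show ?thesis using b'_not_dvd[OF Y X False] by blast
  qed
qed

lemma form_eqI:
  assumes "ctr x w = ctr y w" "\<And>v. v \<in> H \<Longrightarrow> ctr x v = ctr y v"
  shows "x = y"
proof
  fix i
  have "ctr x v = ctr y v" for v
    using assms(2)[OF proj_in_H[of v]] assms(1) by (simp add: ctr_diff_right ctr_scale)
  from this[of "axis i 1"] show "x i = y i" by simp
qed

text \<open>Restriction to \<open>H\<close>; the factor \<open>P\<close> accounts for the change of denominator from \<open>Q(A')\<close> to \<open>Q(A\<^sup>H)\<close>.\<close>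

definition rho :: "('n \<Rightarrow> ('k, 'n) mpoly) \<Rightarrow> 'n \<Rightarrow> ('k, 'n) mpoly" where
  "rho x = (SOME y. y \<in> N \<and> (\<forall>v\<in>H. P * ctr y v = sg (ctr x v)))"

text \<open>The quotient by \<open>P\<close> is first formed for all vectors by composing with the
  projection to \<open>H\<close> along \<open>w\<close>. Cancelling \<open>P\<close> shows that it
  is linear, and the projection kills \<open>w\<close>, which gives the normalization required in
  \<open>N\<close>.\<close>

lemma rho:
  assumes x: "x \<in> MA'"
  shows "rho x \<in> N" "\<And>v. v \<in> H \<Longrightarrow> P * ctr (rho x) v = sg (ctr x v)"
proof -
  let ?pi = "\<lambda>v. v - pairing al v *s w"
  define g where "g v = (SOME p. P * p = sg (ctr x (?pi v)))" for v
  have g: "P * g v = sg (ctr x (?pi v))" for v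
  proof -
    from P_dvd_restrict[OF x proj_in_H[of v]] have "\<exists>p. P * p = sg (ctr x (?pi v))"
      unfolding dvd_def by (simp only: eq_commute)
    then show ?thesis unfolding g_def by (rule someI_ex)
  qed
  have pi_add: "?pi (u + v) = ?pi u + ?pi v" for u v
    by (simp add: pairing_simps vec.scale_left_distrib)
  have pi_scale: "?pi (c *s v) = c *s ?pi v" for c v
    by (simp add: pairing_simps vec.scale_right_diff_distrib)
  define y where "y i = g (axis i 1)" for i
  have ctr_y: "ctr y v = g v" for v
    unfolding y_def
  proof (rule ctr_of_linear)
    fix u v
    have "P * g (u + v) = P * (g u + g v)" unfolding distrib_left g pi_add by (simp add: ctr_add_right)
    then show "g (u + v) = g u + g v" using P_nz by (simp add: mpoly_mult_left_cancel)
  next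
    fix c v
    have "P * g (c *s v) = P * (const_poly c * g v)"
      unfolding mult.left_commute[of P] g pi_scale by (simp add: ctr_scale)
    then show "g (c *s v) = const_poly c * g v" using P_nz by (simp add: mpoly_mult_left_cancel)
  qed
  have spec: "P * ctr y v = sg (ctr x v)" if "v \<in> H" for v
    using g[of v] that by (simp add: ctr_y mem_H)
  have "y \<in> N"
    unfolding logv_def
  proof (intro CollectI conjI ballI allI)
    fix i show "sg (y i) = y i"
      unfolding y_def by (rule sg_closed_if_mult[OF P_nz sg_P]) (simp add: g elim_pair)
  next
    have "P * ctr y w = 0" by (simp add: ctr_y g alw)
    then show "ctr y w = 0" using P_nz by (simp add: mpoly_mult_eq_0)
  next
    fix X v assume X: "X \<in> AH" and v: "v \<in> X"
    have vH: "v \<in> H" using v mem_AH[OF X] by blast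
    have "P * linear_poly (b' X) dvd P * ctr y v"
      unfolding spec[OF vH] using bP_dvd_restrict[OF x X v] by (simp add: mult.commute)
    then show "sg (linear_poly (b X)) dvd ctr y v"
      using P_nz by (simp add: mpoly_dvd_mult_cancel_left sg_b)
  qed
  then have "y \<in> N \<and> (\<forall>v\<in>H. P * ctr y v = sg (ctr x v))" using spec by simp
  from someI[of "\<lambda>y. y \<in> N \<and> (\<forall>v\<in>H. P * ctr y v = sg (ctr x v))", OF this]
  have *: "rho x \<in> N \<and> (\<forall>v\<in>H. P * ctr (rho x) v = sg (ctr x v))"
    unfolding rho_def .
  then show "rho x \<in> N" ..
  show "P * ctr (rho x) v = sg (ctr x v)" if "v \<in> H" for v using * that by simp
qed

lemma rho_eqI:
  assumes "x \<in> MA'" "ctr y w = 0" "\<And>v. v \<in> H \<Longrightarrow> P * ctr y v = sg (ctr x v)"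
  shows "rho x = y"
proof (rule form_eqI)
  show "ctr (rho x) w = ctr y w" using rho(1)[OF assms(1)] assms(2) by (simp add: logv_def)
  show "ctr (rho x) v = ctr y v" if "v \<in> H" for v
  proof -
    have "P * ctr (rho x) v = P * ctr y v" using rho(2)[OF assms(1) that] assms(3)[OF that] by simp
    then show ?thesis by (simp add: mpoly_mult_left_cancel[OF P_nz])
  qed
qed

section \<open>Kernels of the restriction map and of the residue map\<close>

lemma MA_subset: "x \<in> MA \<Longrightarrow> x \<in> MA'"
  by (auto simp: V_logv)

lemma MA_iff: "x \<in> MA \<longleftrightarrow> x \<in> MA' \<and> (\<forall>v\<in>H. t dvd ctr x v)"
  using HA aH by (auto simp: V_logv)

lemma rho_eq_0: "x \<in> MA' \<Longrightarrow> rho x = (\<lambda>_. 0) \<longleftrightarrow> x \<in> MA"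
proof
  assume x: "x \<in> MA'" and "rho x = (\<lambda>_. 0)"
  then have "sg (ctr x v) = 0" if "v \<in> H" for v using rho(2)[OF x that] by simp
  then show "x \<in> MA" using x by (simp add: MA_iff sg_eq_0)
next
  assume x: "x \<in> MA'" and "x \<in> MA"
  then have "sg (ctr x v) = 0" if "v \<in> H" for v using that by (simp add: MA_iff sg_eq_0)
  then show "rho x = (\<lambda>_. 0)" by (intro rho_eqI x) auto
qed

lemma rho_add:
  assumes "x \<in> MA'" "y \<in> MA'"
  shows "rho (\<lambda>i. x i + y i) = (\<lambda>i. rho x i + rho y i)"
  using assms rho[OF assms(1)] rho[OF assms(2)] V.submod_add[OF V.submod_logv assms]
  by (intro rho_eqI) (auto simp: ctr_add_left logv_def distrib_left)

lemma rho_smult: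
  assumes "x \<in> MA'"
  shows "rho (\<lambda>i. r * x i) = (\<lambda>i. sg r * rho x i)"
proof (rule rho_eqI)
  show "(\<lambda>i. r * x i) \<in> MA'" using V.submod_smult[OF V.submod_logv assms] by simp
  show "ctr (\<lambda>i. sg r * rho x i) w = 0" using rho[OF assms] by (simp add: ctr_smult logv_def)
  show "P * ctr (\<lambda>i. sg r * rho x i) v = sg (ctr (\<lambda>i. r * x i) v)" if "v \<in> H" for v
    using rho(2)[OF assms that] by (simp add: ctr_smult mult.left_commute)
qed

text \<open>Modulo \<open>t\<close> the contraction with \<open>w\<close> does not change when
  \<open>w\<close> is replaced by another vector on which \<open>al\<close> is 1. One such vector
  lies in \<open>L\<close>, and the logarithmic condition along \<open>L\<close> applies to
  it.\<close>

lemma QH_dvd_residue: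
  assumes x: "x \<in> MA"
  shows "QH dvd sg (ctr x w)"
proof (rule QH_dvdI)
  fix X assume "X \<in> AH"
  then obtain L where L: "L \<in> A'" "X = H \<inter> L" using AH_cases by blast
  then have LA: "L \<in> A" by simp
  obtain v w1 where w1: "pairing al w1 = 1" "pairing (a L) w1 = 0" using ex_frame[OF L(1)] by blast
  then have "w1 \<in> L" "w - w1 \<in> H" using mem_A[OF LA] by (auto simp: mem_H pairing_simps alw)
  then have "linear_poly (a L) dvd ctr x w1" "t dvd ctr x (w - w1)"
    using x LA V_logv[of x A a] MA_iff[of x] by blast+
  then have "linear_poly (a L) dvd ctr x w1" "t dvd ctr x w - ctr x w1"
    by (simp_all add: ctr_diff_right)
  then have "linear_poly (a' L) dvd sg (ctr x w1)" "sg (ctr x w) = sg (ctr x w1)"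
    using elim_dvd_mono[of _ _ al w] elim_eq_iff[OF elim_pair] by (auto simp flip: sg_a)
  then show "linear_poly (b' X) dvd sg (ctr x w)" using b'_dvd_iff[OF L(1)] L by simp
qed

definition res :: "('n \<Rightarrow> ('k, 'n) mpoly) \<Rightarrow> ('k, 'n) mpoly" where
  "res x = (SOME r. QH * r = sg (ctr x w))"

lemma res:
  assumes "x \<in> MA"
  shows "QH * res x = sg (ctr x w)"
proof -
  from QH_dvd_residue[OF assms] have "\<exists>r. QH * r = sg (ctr x w)"
    unfolding dvd_def by (simp only: eq_commute)
  then show ?thesis unfolding res_def by (rule someI_ex)
qed

lemma res_eqI:
  assumes "x \<in> MA" "QH * r = sg (ctr x w)"
  shows "res x = r"
proof -
  have "QH * res x = QH * r" using res[OF assms(1)] assms(2) by simp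
  then show ?thesis by (simp add: mpoly_mult_left_cancel[OF QH_nz])
qed

lemma sg_res: "x \<in> MA \<Longrightarrow> sg (res x) = res x"
  by (rule sg_closed_if_mult[OF QH_nz sg_QH]) (simp add: res elim_pair)

lemma res_add: "x \<in> MA \<Longrightarrow> y \<in> MA \<Longrightarrow> res (\<lambda>i. x i + y i) = res x + res y"
  using V.submod_add[OF V.submod_logv, of x A a y]
  by (intro res_eqI) (auto simp: ctr_add_left distrib_left res)

lemma res_smult:
  assumes "x \<in> MA"
  shows "res (\<lambda>i. r * x i) = sg r * res x"
proof (rule res_eqI)
  show "(\<lambda>i. r * x i) \<in> MA" using V.submod_smult[OF V.submod_logv assms] by simp
  show "QH * (sg r * res x) = sg (ctr (\<lambda>i. r * x i) w)"
    using res[OF assms] by (simp add: ctr_smult mult.left_commute)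
qed

lemma res_zero: "res (\<lambda>i. 0) = 0"
  using V.submod_0[OF V.submod_logv, of A a] by (intro res_eqI) auto

lemma res_lincomb:
  assumes "finite I" "\<And>i. i \<in> I \<Longrightarrow> x i \<in> MA"
  shows "res (\<lambda>j. \<Sum>i\<in>I. c i * x i j) = (\<Sum>i\<in>I. sg (c i) * res (x i))"
  using assms
proof (induction I rule: finite_induct)
  case (insert i I)
  have "(\<lambda>j. \<Sum>i\<in>I. c i * x i j) \<in> MA" using insert by (intro V.submod_lincomb[OF V.submod_logv]) auto
  moreover have "(\<lambda>j. c i * x i j) \<in> MA" using insert by (intro V.submod_smult[OF V.submod_logv]) auto
  ultimately have "res (\<lambda>j. c i * x i j + (\<Sum>i\<in>I. c i * x i j)) = res (\<lambda>j. c i * x i j) + res (\<lambda>j. \<Sum>i\<in>I. c i * x i j)"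
    by (rule res_add[rotated])
  then show ?case using insert by (simp add: res_smult)
qed (simp add: res_zero)

lemma t_mult_MA:
  assumes x: "x \<in> MA'"
  shows "(\<lambda>i. t * x i) \<in> MA" "res (\<lambda>i. t * x i) = 0"
proof -
  show m: "(\<lambda>i. t * x i) \<in> MA"
    unfolding MA_iff using V.submod_smult[OF V.submod_logv x] by (simp add: ctr_smult)
  show "res (\<lambda>i. t * x i) = 0" by (rule res_eqI[OF m]) (simp add: ctr_smult)
qed

text \<open>Vanishing of the residue makes \<open>t\<close> divide the contraction with
  \<open>w\<close>, and the condition along \<open>H\<close> does so for the vectors of
  \<open>H\<close>. Hence \<open>t\<close> divides all entries; the conditions along the other
  hyperplanes survive division because their forms are prime to \<open>t\<close>.\<close>

lemma res_eq_0:
  assumes x: "x \<in> MA" and r: "res x = 0"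
  shows "\<exists>y\<in>MA'. x = (\<lambda>i. t * y i)"
proof -
  have tw: "t dvd ctr x w" using res[OF x] r by (simp add: sg_eq_0)
  have "t dvd ctr x v" for v
  proof -
    have "t dvd ctr x (v - pairing al v *s w) + const_poly (pairing al v) * ctr x w"
      using x proj_in_H tw by (intro dvd_add dvd_mult) (auto simp: MA_iff)
    then show ?thesis by (simp add: ctr_diff_right ctr_scale)
  qed
  from this[of "axis i 1" for i] have "\<forall>i. \<exists>y. x i = t * y" by (simp add: dvd_def)
  then obtain y where y: "\<And>i. x i = t * y i" by metis
  have "y \<in> MA'"
    unfolding V_logv
  proof (intro ballI)
    fix L v assume L: "L \<in> A'" and v: "v \<in> L"
    then have LA: "L \<in> A" by simp
    have "ctr x v = t * ctr y v" using y ctr_smult[of t y v] by (simp add: fun_eq_iff ctr_def)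
    then have "linear_poly (a L) dvd t * ctr y v" using x LA v by (metis V_logv)
    moreover have "\<not> linear_poly (a L) dvd t" using a_distinct[OF LA HA] L aH by auto
    ultimately show "linear_poly (a L) dvd ctr y v" using linear_poly_prime[OF a_nz[OF LA]] by blast
  qed
  then show ?thesis using y by auto
qed

end

subsection \<open>The residue ideal and the syzygies of its generators\<close>

lemma ctr_const1: "ctr (\<lambda>i. const_poly (a $ i)) v = const_poly (pairing a v)"
  using ctr_const[of 1 a v] by simp

context eliminated_ring
begin

lemma dual_basisI_finite:
  assumes "finite I" "\<And>i. i \<in> I \<Longrightarrow> n i \<in> M" "\<And>i. i \<in> I \<Longrightarrow> linear_functional M (f i)"
    "\<And>x v. x \<in> M \<Longrightarrow> x v = (\<Sum>i\<in>I. f i x * n i v)"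
  shows "dual_basis M I f n"
  unfolding dual_basis_def
proof (intro conjI ballI)
  fix x assume x: "x \<in> M"
  show "finite {i \<in> I. f i x \<noteq> 0}" using assms(1) by simp
  show "x = (\<lambda>v. \<Sum>i\<in>{i \<in> I. f i x \<noteq> 0}. f i x * n i v)"
  proof
    fix v
    have "x v = (\<Sum>i\<in>I. f i x * n i v)" by (rule assms(4)[OF x])
    also have "\<dots> = (\<Sum>i\<in>{i \<in> I. f i x \<noteq> 0}. f i x * n i v)"
      using assms(1) by (intro sum.mono_neutral_right) auto
    finally show "x v = (\<Sum>i\<in>{i \<in> I. f i x \<noteq> 0}. f i x * n i v)" .
  qed
qed (use assms(2,3) in auto)

definition lin_iso :: "(('x \<Rightarrow> ('k, 'n) mpoly) \<Rightarrow> 'y \<Rightarrow> ('k, 'n) mpoly) \<Rightarrow>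
    ('x \<Rightarrow> ('k, 'n) mpoly) set \<Rightarrow> ('y \<Rightarrow> ('k, 'n) mpoly) set \<Rightarrow> bool" where
  "lin_iso F K M \<longleftrightarrow> bij_betw F K M \<and>
     (\<forall>x\<in>K. \<forall>y\<in>K. F (\<lambda>v. x v + y v) = (\<lambda>v. F x v + F y v)) \<and>
     (\<forall>r. \<forall>x\<in>K. sg r = r \<longrightarrow> F (\<lambda>v. r * x v) = (\<lambda>v. r * F x v))"

lemma lin_iso_add: "lin_iso F K M \<Longrightarrow> x \<in> K \<Longrightarrow> y \<in> K \<Longrightarrow> F (\<lambda>v. x v + y v) = (\<lambda>v. F x v + F y v)"
  and lin_iso_smult: "lin_iso F K M \<Longrightarrow> x \<in> K \<Longrightarrow> sg r = r \<Longrightarrow> F (\<lambda>v. r * x v) = (\<lambda>v. r * F x v)"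
  by (simp_all add: lin_iso_def)

lemma is_basis_rep:
  assumes "is_basis M B" "x \<in> M"
  shows "\<exists>c. (\<forall>b. sg (c b) = c b) \<and> x = (\<lambda>v. \<Sum>b\<in>B. c b * b v)"
proof -
  have "\<forall>x\<in>M. \<exists>c. (\<forall>b. sg (c b) = c b) \<and> x = (\<lambda>v. \<Sum>b\<in>B. c b * b v)"
    using assms(1) unfolding is_basis_def by (elim conjE) assumption
  then show ?thesis using assms(2) by (rule bspec)
qed

lemma lin_iso_inv:
  assumes K: "submod K" and F: "lin_iso F K M"
  shows "lin_iso (inv_into K F) M K"
proof -
  let ?G = "inv_into K F"
  have bij: "bij_betw F K M" using F by (simp add: lin_iso_def)
  have G: "?G y \<in> K" "F (?G y) = y" if "y \<in> M" for y
    using bij_betw_inv_into_right[OF bij that] bij_betw_apply[OF bij_betw_inv_into[OF bij] that] by auto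
  have GF: "?G (F x) = x" if "x \<in> K" for x using bij_betw_inv_into_left[OF bij that] .
  show ?thesis
    unfolding lin_iso_def
  proof (intro conjI ballI allI impI)
    show "bij_betw ?G M K" by (rule bij_betw_inv_into[OF bij])
  next
    fix x y assume x: "x \<in> M" and y: "y \<in> M"
    have "F (\<lambda>v. ?G x v + ?G y v) = (\<lambda>v. x v + y v)"
      using F G[OF x] G[OF y] by (simp add: lin_iso_def)
    then show "?G (\<lambda>v. x v + y v) = (\<lambda>v. ?G x v + ?G y v)"
      using GF[OF submod_add[OF K G(1)[OF x] G(1)[OF y]]] by simp
  next
    fix r x assume x: "x \<in> M" and r: "sg r = r"
    have "F (\<lambda>v. r * ?G x v) = (\<lambda>v. r * x v)"
      using F G[OF x] r by (simp add: lin_iso_def)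
    then show "?G (\<lambda>v. r * x v) = (\<lambda>v. r * ?G x v)"
      using GF[OF submod_smult[OF K G(1)[OF x] r]] by simp
  qed
qed

lemma lin_iso_lincomb:
  assumes K: "submod K" and F: "lin_iso F K M"
    and I: "finite I" "\<And>i. i \<in> I \<Longrightarrow> x i \<in> K" "\<And>i. i \<in> I \<Longrightarrow> sg (c i) = c i"
  shows "F (\<lambda>v. \<Sum>i\<in>I. c i * x i v) = (\<lambda>v. \<Sum>i\<in>I. c i * F (x i) v)"
  using I
proof (induction I rule: finite_induct)
  case empty
  show ?case using lin_iso_smult[OF F submod_0[OF K], of 0] by simp
next
  case (insert i I)
  have "(\<lambda>v. \<Sum>i\<in>I. c i * x i v) \<in> K" using insert by (intro submod_lincomb[OF K]) auto
  moreover have "(\<lambda>v. c i * x i v) \<in> K" using insert by (intro submod_smult[OF K]) auto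
  ultimately have "F (\<lambda>v. c i * x i v + (\<Sum>i\<in>I. c i * x i v)) =
      (\<lambda>v. F (\<lambda>v. c i * x i v) v + F (\<lambda>v. \<Sum>i\<in>I. c i * x i v) v)"
    by (intro lin_iso_add[OF F])
  moreover have "F (\<lambda>v. c i * x i v) = (\<lambda>v. c i * F (x i) v)"
    using insert.prems by (intro lin_iso_smult[OF F]) auto
  ultimately show ?case using insert by simp
qed

lemma lin_iso_is_basis:
  assumes K: "submod K" and F: "lin_iso F K M" and B: "is_basis K B"
  shows "is_basis M (F ` B)"
proof -
  have inj: "inj_on F K" and im: "F ` K = M" using F by (auto simp: lin_iso_def bij_betw_def)
  have fin: "finite B" and BK: "B \<subseteq> K" using B by (auto simp: is_basis_def)
  have injB: "inj_on F B" using inj BK by (rule inj_on_subset)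
  have F0: "F (\<lambda>v. 0) = (\<lambda>v. 0)" using lin_iso_lincomb[OF K F, of "{}"] by simp
  show ?thesis
    unfolding is_basis_def
  proof (intro conjI ballI allI impI)
    show "finite (F ` B)" "F ` B \<subseteq> M" using fin BK im by auto
  next
    fix y assume "y \<in> M"
    then obtain x where x: "x \<in> K" "y = F x" using im by blast
    from is_basis_rep[OF B x(1)] obtain c where
      c': "(\<forall>b. sg (c b) = c b) \<and> x = (\<lambda>v. \<Sum>b\<in>B. c b * b v)" ..
    note c = spec[OF conjunct1[OF c']] conjunct2[OF c']
    have "y = (\<lambda>v. \<Sum>b\<in>B. c b * F b v)"
      unfolding x(2) c(2) using fin BK c(1) by (intro lin_iso_lincomb[OF K F]) auto
    also have "\<dots> = (\<lambda>v. \<Sum>b\<in>F ` B. c (inv_into B F b) * b v)"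
      using injB by (simp add: sum.reindex)
    finally show "\<exists>c. (\<forall>b. sg (c b) = c b) \<and> y = (\<lambda>v. \<Sum>b\<in>F ` B. c b * b v)"
      using c(1) by (intro exI[of _ "\<lambda>b. c (inv_into B F b)"]) simp
  next
    fix c b' assume c: "\<forall>b\<in>F ` B. sg (c b) = c b" "\<forall>v. (\<Sum>b\<in>F ` B. c b * b v) = 0" and b': "b' \<in> F ` B"
    obtain b where b: "b \<in> B" "b' = F b" using b' by blast
    have "F (\<lambda>v. \<Sum>b\<in>B. c (F b) * b v) = (\<lambda>v. \<Sum>b\<in>B. c (F b) * F b v)"
      using fin BK c(1) by (intro lin_iso_lincomb[OF K F]) auto
    also have "\<dots> = (\<lambda>v. 0)"
      using c(2) injB by (simp add: sum.reindex)
    finally have "F (\<lambda>v. \<Sum>b\<in>B. c (F b) * b v) = F (\<lambda>v. 0)" unfolding F0 .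
    moreover have "(\<lambda>v. \<Sum>b\<in>B. c (F b) * b v) \<in> K"
      using fin BK c(1) by (intro submod_lincomb[OF K]) auto
    ultimately have z: "(\<lambda>v. \<Sum>b\<in>B. c (F b) * b v) = (\<lambda>v. 0)"
      using submod_0[OF K] by (rule inj_onD[OF inj])
    have "c (F b) = 0"
    proof (rule is_basis_indep[OF B, of "\<lambda>b. c (F b)"])
      show "(\<Sum>b\<in>B. c (F b) * b v) = 0" for v using fun_cong[OF z, of v] .
    qed (use c(1) b(1) in auto)
    then show "c b' = 0" using b(2) by simp
  qed
qed

lemma lin_iso_dual_basis:
  assumes K: "submod K" and F: "lin_iso F K M" and d: "dual_basis K I f n"
  shows "dual_basis M I (\<lambda>i y. f i (inv_into K F y)) (\<lambda>i. F (n i))"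
proof -
  let ?G = "inv_into K F"
  have bij: "bij_betw F K M" using F by (simp add: lin_iso_def)
  have GK: "?G y \<in> K" and FG: "F (?G y) = y" if "y \<in> M" for y
    using bij_betw_inv_into_right[OF bij that] bij_betw_apply[OF bij_betw_inv_into[OF bij] that] by auto
  have G: "lin_iso ?G M K" by (rule lin_iso_inv[OF K F])
  have nK: "n i \<in> K" and lf: "linear_functional K (f i)" if "i \<in> I" for i
    using d that by (auto simp: dual_basis_def)
  show ?thesis
    unfolding dual_basis_def
  proof (intro conjI ballI)
    fix i assume i: "i \<in> I"
    show "F (n i) \<in> M" using bij_betw_apply[OF bij nK[OF i]] .
    show "linear_functional M (\<lambda>y. f i (?G y))"
      unfolding linear_functional_def
    proof (intro conjI ballI allI impI)
      fix x assume "x \<in> M"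
      then show "sg (f i (?G x)) = f i (?G x)" using GK lf[OF i] by (simp add: linear_functional_def)
    next
      fix x y assume "x \<in> M" "y \<in> M"
      then show "f i (?G (\<lambda>v. x v + y v)) = f i (?G x) + f i (?G y)"
        using G linear_functional_add[OF lf[OF i] GK GK] by (simp add: lin_iso_def)
    next
      fix r x assume "x \<in> M" "sg r = r"
      then show "f i (?G (\<lambda>v. r * x v)) = r * f i (?G x)"
        using G linear_functional_smult[OF lf[OF i] GK] by (simp add: lin_iso_def)
    qed
  next
    fix y assume y: "y \<in> M"
    let ?J = "{i \<in> I. f i (?G y) \<noteq> 0}"
    have "finite ?J \<and> ?G y = (\<lambda>v. \<Sum>i\<in>?J. f i (?G y) * n i v)"
      using d unfolding dual_basis_def by (elim conjE) (rule bspec[OF _ GK[OF y]])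
    note * = conjunct1[OF this] conjunct2[OF this]
    show "finite ?J" by fact
    have "y = F (?G y)" using FG[OF y] ..
    also have "\<dots> = F (\<lambda>v. \<Sum>i\<in>?J. f i (?G y) * n i v)" using *(2) by (rule arg_cong)
    also have "\<dots> = (\<lambda>v. \<Sum>i\<in>?J. f i (?G y) * F (n i) v)"
      using *(1) nK linear_functional_closed[OF lf GK[OF y]] by (intro lin_iso_lincomb[OF K F]) auto
    finally show "y = (\<lambda>v. \<Sum>i\<in>?J. f i (?G y) * F (n i) v)" .
  qed
qed

end

section \<open>Elements of the residue ideal and a criterion for the unit ideal\<close>

context restricted_arrangement
begin

abbreviation J where "J \<equiv> res ` MA"

lemma N_free_if_projective: "dual_basis N I f n \<Longrightarrow> \<exists>B. is_basis N B"
  by (rule logv_projective_free) (use finAH b'_nz in \<open>auto simp: sg_b\<close>)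

lemma MA'_free_if_projective: "V.dual_basis MA' I f n \<Longrightarrow> \<exists>B. V.is_basis MA' B"
  by (rule V.logv_projective_free) (use finA a_nz in auto)

lemma res_lincomb_set:
  assumes "finite B" "\<And>b. b \<in> B \<Longrightarrow> b \<in> MA"
  shows "res (\<lambda>j. \<Sum>b\<in>B. c b * b j) = (\<Sum>b\<in>B. sg (c b) * res b)"
  using assms by (rule res_lincomb)

lemma t_cancel: "(\<And>i. t * x i = t * y i) \<Longrightarrow> x = y"
  using t_nz by (auto simp: mpoly_mult_left_cancel)

lemma J_lincomb:
  assumes "finite I" "\<And>i. i \<in> I \<Longrightarrow> m i \<in> J" "\<And>i. i \<in> I \<Longrightarrow> sg (c i) = c i"
  shows "(\<Sum>i\<in>I. c i * m i) \<in> J"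
proof -
  have "\<forall>i\<in>I. \<exists>x. x \<in> MA \<and> m i = res x" using assms(2) by blast
  from bchoice[OF this] obtain x where x: "\<forall>i\<in>I. x i \<in> MA \<and> m i = res (x i)" ..
  have "(\<Sum>i\<in>I. c i * m i) = res (\<lambda>j. \<Sum>i\<in>I. c i * x i j)"
    using res_lincomb[OF assms(1), of x c] x assms(3) by simp
  moreover have "(\<lambda>j. \<Sum>i\<in>I. c i * x i j) \<in> MA"
    using x by (intro V.submod_lincomb[OF V.submod_logv assms(1)]) auto
  ultimately show ?thesis by simp
qed

text \<open>This is the residue of \<open>d al\<close> divided by \<open>al\<close>, whose
  coefficient vector is \<open>Q\<close> times that of \<open>al\<close> once the full defining
  polynomial \<open>t * Q\<close> is cleared.\<close>

lemma P_in_J: "P \<in> J"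
proof -
  let ?x = "\<lambda>i. Q * const_poly (al $ i)"
  have x: "?x \<in> MA"
    unfolding V_logv ctr_const
  proof (intro ballI)
    fix L v assume L: "L \<in> A" and v: "v \<in> L"
    show "linear_poly (a L) dvd Q * const_poly (pairing al v)"
    proof (cases "L = H")
      case True
      then show ?thesis using v by (simp add: mem_H)
    next
      case False
      then have "linear_poly (a L) dvd Q" unfolding Q_def using L finA by (intro dvd_prodI) auto
      then show ?thesis by simp
    qed
  qed
  have "res ?x = P" by (rule res_eqI[OF x]) (simp add: ctr_const alw sg_Q P)
  then show ?thesis using imageI[OF x, of res] by simp
qed

lemma QH_split: "X \<in> AH \<Longrightarrow> QH = linear_poly (b' X) * (\<Prod>Y\<in>AH - {X}. linear_poly (b' Y))"
  unfolding QH_def using finAH by (simp add: prod.remove)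

lemma b'_not_dvd_others:
  assumes "X \<in> AH"
  shows "\<not> linear_poly (b' X) dvd (\<Prod>Y\<in>AH - {X}. linear_poly (b' Y))"
  using linear_poly_prime_prod[OF b'_nz[OF assms], of "AH - {X}" "\<lambda>Y. linear_poly (b' Y)"]
    finAH b'_not_dvd[OF assms] by auto

lemma flat_mult_rest:
  assumes L: "L \<in> A'" and p: "L \<in> flat_forms X \<Longrightarrow> linear_poly (a L) dvd p"
  shows "linear_poly (a L) dvd rest X * p"
proof (cases "L \<in> flat_forms X")
  case False
  then have "linear_poly (a L) dvd rest X" unfolding rest_def using L finA by (intro dvd_prodI) auto
  then show ?thesis by simp
qed (use p in simp)

lemma pairing_decomp:
  assumes "L \<in> flat_forms X"
  shows "pairing (a L) v = pairing (a L) w * pairing al v + cf L * pairing (b' X) v"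
    "linear_poly (a L) = const_poly (pairing (a L) w) * t + const_poly (cf L) * linear_poly (b' X)"
    "cf L \<noteq> 0"
proof -
  have L: "L \<in> A'" "H \<inter> L = X" using assms by (auto simp: flat_forms_def)
  note dec = a_decomp[OF L(1), unfolded L(2)]
  show "pairing (a L) v = pairing (a L) w * pairing al v + cf L * pairing (b' X) v"
    using arg_cong[OF dec, of "\<lambda>c. pairing c v"] by (simp add: pairing_simps)
  show "linear_poly (a L) = const_poly (pairing (a L) w) * t + const_poly (cf L) * linear_poly (b' X)"
    using arg_cong[OF dec, of linear_poly] by (simp add: linear_poly_add linear_poly_scale)
  show "cf L \<noteq> 0" using cf_nz L(1) by blast
qed

text \<open>Along \<open>X\<close> the form \<open>(b' X dal - al db' X)\<close> divided by the forms through \<open>X\<close> is logarithmic.\<close>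

lemma local_residue:
  assumes X: "X \<in> AH"
  shows "\<exists>r\<in>J. \<not> linear_poly (b' X) dvd r"
proof -
  let ?be = "linear_poly (b' X)"
  define x where "x = (\<lambda>i. rest X * (?be * const_poly (al $ i) - t * const_poly (b' X $ i)))"
  have cx: "ctr x v = rest X * (?be * const_poly (pairing al v) - t * const_poly (pairing (b' X) v))" for v
    by (simp only: x_def ctr_smult ctr_diff_left ctr_const1)
  have x: "x \<in> MA"
    unfolding V_logv
  proof (intro ballI)
    fix L v assume L: "L \<in> A" and v: "v \<in> L"
    show "linear_poly (a L) dvd ctr x v"
    proof (cases "L = H")
      case True
      then show ?thesis using v aH by (simp add: cx mem_H)
    next
      case False
      then have LA: "L \<in> A'" using L by simp
      show ?thesis
        unfolding cx
      proof (rule flat_mult_rest[OF LA])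
        assume f: "L \<in> flat_forms X"
        let ?c1 = "pairing (a L) w" and ?c2 = "cf L"
        have z: "?c1 * pairing al v + ?c2 * pairing (b' X) v = 0"
          using pairing_decomp(1)[OF f, of v] v mem_A[OF L] by simp
        \<comment> \<open>After \<open>?c2 * ?be\<close> is replaced by the form of \<open>L\<close>
          minus \<open>?c1 * t\<close>, the part that is not a multiple of this form is the value of
          the form at \<open>v\<close>, which is zero on \<open>L\<close>.\<close>
        have "const_poly ?c2 * (?be * const_poly (pairing al v) - t * const_poly (pairing (b' X) v)) =
            linear_poly (a L) * const_poly (pairing al v) - t * const_poly (?c1 * pairing al v + ?c2 * pairing (b' X) v)"
          unfolding pairing_decomp(2)[OF f] by (simp add: const_poly_add const_poly_mult algebra_simps)
        also have "\<dots> = linear_poly (a L) * const_poly (pairing al v)" unfolding z by simp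
        finally have "linear_poly (a L) dvd const_poly ?c2 * (?be * const_poly (pairing al v) - t * const_poly (pairing (b' X) v))"
          by simp
        then show "linear_poly (a L) dvd ?be * const_poly (pairing al v) - t * const_poly (pairing (b' X) v)"
          by (rule dvd_trans) (simp add: const_mult_dvd_iff[OF pairing_decomp(3)[OF f]])
      qed
    qed
  qed
  have "QH * res x = ?be * sg (rest X)" using res[OF x] by (simp add: cx alw b'_w mult.commute)
  then have "?be * ((\<Prod>Y\<in>AH - {X}. linear_poly (b' Y)) * res x) = ?be * sg (rest X)"
    unfolding QH_split[OF X] by (simp add: mult.assoc)
  then have "(\<Prod>Y\<in>AH - {X}. linear_poly (b' Y)) * res x = sg (rest X)"
    using b'_nz[OF X] by (simp add: mpoly_mult_left_cancel)
  then have "\<not> ?be dvd res x" using b'_not_dvd_rest[OF X] by (metis dvd_mult)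
  then show ?thesis using x by blast
qed

text \<open>An invertible ideal containing elements without common factor is the unit ideal.\<close>

lemma one_in_J:
  assumes I: "finite I" "\<And>i. i \<in> I \<Longrightarrow> m i \<in> J"
    and f: "\<And>i x. i \<in> I \<Longrightarrow> x \<in> J \<Longrightarrow> sg (f i x) = f i x"
      "\<And>i x y. i \<in> I \<Longrightarrow> x \<in> J \<Longrightarrow> y \<in> J \<Longrightarrow> f i x * y = f i y * x"
    and P_eq: "P = (\<Sum>i\<in>I. f i P * m i)"
  shows "1 \<in> J"
proof -
  \<comment> \<open>By the exchange rule, \<open>f i\<close> is multiplication by the fraction of
    \<open>f i P\<close> by \<open>P\<close>. It takes polynomial values also at elements of
    \<open>J\<close> prime to any given \<open>b' X\<close>, so no factor of \<open>P\<close>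
    survives in the denominator.\<close>
  have "P dvd f i P" if i: "i \<in> I" for i
  proof (rule dvd_if_locally)
    show "P dvd sQ * f i P" by (simp add: P)
  next
    fix X assume "X \<in> AH"
    then obtain r where r: "r \<in> J" "\<not> linear_poly (b' X) dvd r" using local_residue by blast
    have "f i P * r = f i r * P" by (rule f(2)[OF i P_in_J r(1)])
    then have "P dvd r * f i P" by (simp add: mult.commute)
    then show "\<exists>h. \<not> linear_poly (b' X) dvd h \<and> P dvd h * f i P" using r(2) by blast
  qed
  then have "\<forall>i\<in>I. \<exists>g. f i P = P * g" by (simp add: dvd_def)
  from bchoice[OF this] obtain g where g: "\<forall>i\<in>I. f i P = P * g i" ..
  have "P * 1 = P * (\<Sum>i\<in>I. g i * m i)"
    using P_eq g by (simp add: sum_distrib_left mult.assoc)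
  then have 1: "1 = (\<Sum>i\<in>I. g i * m i)" by (rule iffD1[OF mpoly_mult_left_cancel[OF P_nz]])
  have "sg (g i) = g i" if i: "i \<in> I" for i
    using f(1)[OF i P_in_J] unfolding bspec[OF g i] by (rule sg_closed_if_mult[OF P_nz sg_P])
  then show ?thesis unfolding 1 using I by (intro J_lincomb) auto
qed

section \<open>The residue ideal and freeness of the deletion\<close>

lemma V_linear_functional_t:
  "V.linear_functional M f \<Longrightarrow> x \<in> M \<Longrightarrow> f (\<lambda>i. r * x i) = r * f x"
  by (rule V.linear_functional_smult) auto

lemma sg_diff: "\<exists>e. p = sg p + t * e"
proof -
  have "t dvd p - sg p" by (rule dvd_diff_elim)
  then obtain e where "p - sg p = t * e" ..
  then show ?thesis by (intro exI[of _ e]) (simp add: algebra_simps)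
qed

text \<open>As modules over the image of \<open>sg\<close>, the free module \<open>MA\<close> splits off \<open>t * MA\<close>; this makes \<open>J\<close> a retract of
  the reduction of \<open>MA'\<close> modulo \<open>t\<close>.\<close>

lemma one_in_J_if_deletion_free:
  assumes B: "V.is_basis MA B" and G: "V.is_basis MA' G"
  shows "1 \<in> J"
proof -
  obtain c where c: "\<And>b. b \<in> B \<Longrightarrow> V.linear_functional MA (c b)" "\<And>x v. x \<in> MA \<Longrightarrow> x v = (\<Sum>b\<in>B. c b x * b v)"
    using V.is_basis_coords[OF V.submod_logv B] by blast
  obtain d where d: "\<And>g. g \<in> G \<Longrightarrow> V.linear_functional MA' (d g)" "\<And>x v. x \<in> MA' \<Longrightarrow> x v = (\<Sum>g\<in>G. d g x * g v)"
    using V.is_basis_coords[OF V.submod_logv G] by blast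
  have fin: "finite B" "finite G" and sub: "\<And>b. b \<in> B \<Longrightarrow> b \<in> MA" "\<And>g. g \<in> G \<Longrightarrow> g \<in> MA'"
    using B G by (auto simp: V.is_basis_def)
  let ?t = "\<lambda>x i. t * x i"
  have resx: "res x = (\<Sum>b\<in>B. sg (c b x) * res b)" if "x \<in> MA" for x
  proof -
    have "x = (\<lambda>v. \<Sum>b\<in>B. c b x * b v)" using c(2)[OF that] by (rule ext)
    then have "res x = res (\<lambda>v. \<Sum>b\<in>B. c b x * b v)" by (rule arg_cong)
    then show ?thesis using res_lincomb_set[OF fin(1) sub(1)] by simp
  qed
  have d0: "sg (d g x) = 0" if "g \<in> G" "x \<in> MA" "res x = 0" for g x
  proof -
    from res_eq_0[OF that(2,3)] obtain y where "y \<in> MA'" "x = ?t y" by (rule bexE)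
    then show ?thesis using V_linear_functional_t[OF d(1)[OF that(1)], of y t] by simp
  qed
  \<comment> \<open>The coordinate \<open>d g\<close> on \<open>MA'\<close> induces a map on
    \<open>J\<close> after reduction modulo \<open>t\<close>: by \<open>d0\<close> it does not
    depend on the form chosen with residue \<open>r\<close>, because forms without residue are
    \<open>t\<close> times elements of \<open>MA'\<close>.\<close>
  define f where "f g r = sg (d g (SOME x. x \<in> MA \<and> res x = r))" for g r
  have f_res: "f g (res x) = sg (d g x)" if g: "g \<in> G" and x: "x \<in> MA" for g x
  proof -
    define y where "y = (SOME y. y \<in> MA \<and> res y = res x)"
    have y: "y \<in> MA \<and> res y = res x" unfolding y_def by (rule someI[of _ x]) (use x in simp)
    let ?z = "\<lambda>i. y i + - 1 * x i"
    have z1: "(\<lambda>i. - 1 * x i) \<in> MA" by (rule V.submod_smult[OF V.submod_logv x]) simp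
    have z: "?z \<in> MA" using V.submod_add[OF V.submod_logv _ z1] y by blast
    have "res ?z = 0" using res_add[OF _ z1, of y] res_smult[OF x, of "- 1"] y by simp
    then have "sg (d g ?z) = 0" using d0[OF g z] by simp
    moreover have "d g ?z = d g y + - 1 * d g x"
      using V.linear_functional_add[OF d(1)[OF g], of y "\<lambda>i. - 1 * x i"] V_linear_functional_t[OF d(1)[OF g], of x "- 1"]
        y x z1 MA_subset by simp
    ultimately show ?thesis by (simp add: f_def y_def)
  qed
  have "\<forall>p. \<exists>e. p = sg p + t * e" using sg_diff by blast
  then obtain e where e: "\<And>p. p = sg p + t * e p" by metis
  define k where "k b g = sg (c b (?t g))" for b g
  \<comment> \<open>The retraction at \<open>g\<close>. The reduced coordinates \<open>k b g\<close>
    of \<open>t * g\<close> are a relation between the residues of \<open>B\<close>, by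
    \<open>k0\<close>; what remains of the coordinates is divisible by \<open>t\<close>, and
    \<open>m g\<close> is the residue of the quotient.\<close>
  define m where "m g = (\<Sum>b\<in>B. sg (e (c b (?t g))) * res b)" for g
  have k0: "(\<Sum>b\<in>B. k b g * res b) = 0" if "g \<in> G" for g
    using resx[of "?t g"] t_mult_MA[OF sub(2)[OF that]] by (simp add: k_def)
  show ?thesis
  proof (rule one_in_J[OF fin(2), of m f])
    show "m g \<in> J" if "g \<in> G" for g
      unfolding m_def using sub(1) fin(1) elim_pair by (intro J_lincomb) auto
    show "sg (f g r) = f g r" for g r using elim_pair by (simp add: f_def)
    show "f g r * s = f g s * r" if g: "g \<in> G" and r: "r \<in> J" and s: "s \<in> J" for g r s
    proof -
      obtain x y where x: "x \<in> MA" "r = res x" and y: "y \<in> MA" "s = res y" using r s by blast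
      let ?z = "\<lambda>i. s * x i + - r * y i"
      have zx: "(\<lambda>i. s * x i) \<in> MA" "(\<lambda>i. - r * y i) \<in> MA"
        using V.submod_smult[OF V.submod_logv x(1), of s] V.submod_smult[OF V.submod_logv y(1), of "- r"]
        by simp_all
      have z: "?z \<in> MA" by (rule V.submod_add[OF V.submod_logv zx])
      have "res ?z = 0" unfolding res_add[OF zx] res_smult[OF x(1)] res_smult[OF y(1)]
        using sg_res[OF x(1)] sg_res[OF y(1)] x y by (simp add: mult.commute)
      then have "sg (d g ?z) = 0" by (rule d0[OF g z])
      moreover have "d g ?z = s * d g x + - r * d g y"
        using V.linear_functional_add[OF d(1)[OF g] MA_subset[OF zx(1)] MA_subset[OF zx(2)]]
          V_linear_functional_t[OF d(1)[OF g] MA_subset[OF x(1)], of s]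
          V_linear_functional_t[OF d(1)[OF g] MA_subset[OF y(1)], of "- r"] by simp
      ultimately show ?thesis using f_res[OF g x(1)] f_res[OF g y(1)] sg_res[OF x(1)] sg_res[OF y(1)] x y
        by (simp add: mult.commute)
    qed
    obtain x where x: "x \<in> MA" "P = res x" using P_in_J by blast
    \<comment> \<open>The coordinates of \<open>t * x\<close> are computed through the basis
      \<open>G\<close>. Their leading part vanishes modulo \<open>t\<close>, so that
      \<open>t\<close> can be cancelled; the terms with \<open>k b g\<close> disappear later when
      residues are taken.\<close>
    have cb: "c b x = (\<Sum>g\<in>G. e (d g x) * k b g + d g x * e (c b (?t g)))" if b: "b \<in> B" for b
    proof -
      have tg: "?t g \<in> MA" if "g \<in> G" for g using t_mult_MA[OF sub(2)[OF that]] by simp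
      have "t * c b x = c b (?t x)" using V_linear_functional_t[OF c(1)[OF b] x(1), of t] by simp
      also have "?t x = (\<lambda>v. \<Sum>g\<in>G. d g x * ?t g v)"
        by (simp add: d(2)[OF MA_subset[OF x(1)]] sum_distrib_left mult.left_commute)
      also have "c b \<dots> = (\<Sum>g\<in>G. d g x * c b (?t g))"
        using tg by (intro V.linear_functional_lincomb[OF V.submod_logv c(1)[OF b] fin(2)]) auto
      finally have 1: "t * c b x = (\<Sum>g\<in>G. d g x * c b (?t g))" .
      then have "sg (t * c b x) = sg (\<Sum>g\<in>G. d g x * c b (?t g))" by simp
      then have 2: "(\<Sum>g\<in>G. sg (d g x) * k b g) = 0" by (simp add: elim_sum k_def)
      have "d g x * c b (?t g) = sg (d g x) * k b g + t * (e (d g x) * k b g + d g x * e (c b (?t g)))" for g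
      proof -
        have "d g x * c b (?t g) = d g x * (k b g + t * e (c b (?t g)))"
          using e[of "c b (?t g)"] by (simp add: k_def)
        also have "\<dots> = d g x * k b g + t * (d g x * e (c b (?t g)))" by (simp add: algebra_simps)
        also have "d g x * k b g = (sg (d g x) + t * e (d g x)) * k b g" using e[of "d g x"] by simp
        finally show ?thesis by (simp add: algebra_simps)
      qed
      then have "t * c b x = (\<Sum>g\<in>G. sg (d g x) * k b g) + t * (\<Sum>g\<in>G. e (d g x) * k b g + d g x * e (c b (?t g)))"
        unfolding 1 sum_distrib_left sum.distrib[symmetric] by simp
      then show ?thesis using 2 t_nz by (simp add: mpoly_mult_left_cancel)
    qed
    have "P = (\<Sum>b\<in>B. sg (c b x) * res b)" using resx[OF x(1)] x(2) by simp
    also have "\<dots> = (\<Sum>b\<in>B. \<Sum>g\<in>G. sg (e (d g x)) * (k b g * res b) + sg (d g x) * (sg (e (c b (?t g))) * res b))"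
      by (intro sum.cong refl)
        (simp add: cb elim_sum k_def elim_pair sum_distrib_right distrib_right mult.assoc)
    also have "\<dots> = (\<Sum>g\<in>G. \<Sum>b\<in>B. sg (e (d g x)) * (k b g * res b) + sg (d g x) * (sg (e (c b (?t g))) * res b))"
      by (rule sum.swap)
    also have "\<dots> = (\<Sum>g\<in>G. sg (e (d g x)) * (\<Sum>b\<in>B. k b g * res b) + sg (d g x) * m g)"
      by (simp add: sum.distrib sum_distrib_left m_def)
    also have "\<dots> = (\<Sum>g\<in>G. f g P * m g)"
      using k0 f_res[OF _ x(1)] x(2) by (intro sum.cong refl) simp
    finally show "P = (\<Sum>g\<in>G. f g P * m g)" .
  qed
qed

text \<open>Let \<open>x0\<close> have residue 1. Each basis element \<open>b\<close> is
  \<open>res b * x0\<close> plus \<open>t\<close> times some \<open>y b\<close> in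
  \<open>MA'\<close>. Expanding \<open>t * z\<close> in the basis and dividing by \<open>t\<close>
  shows that \<open>x0\<close> and the \<open>y b\<close> are the elements of a finite dual basis of
  \<open>MA'\<close>.\<close>

lemma deletion_free_if_one_in_J:
  assumes B: "V.is_basis MA B" and one: "1 \<in> J"
  shows "\<exists>G. V.is_basis MA' G"
proof -
  obtain c where c: "\<And>b. b \<in> B \<Longrightarrow> V.linear_functional MA (c b)" "\<And>x v. x \<in> MA \<Longrightarrow> x v = (\<Sum>b\<in>B. c b x * b v)"
    using V.is_basis_coords[OF V.submod_logv B] by blast
  have fin: "finite B" and sub: "\<And>b. b \<in> B \<Longrightarrow> b \<in> MA"
    using B by (auto simp: V.is_basis_def)
  obtain x0 where x0: "x0 \<in> MA" "res x0 = 1" using one by force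
  let ?t = "\<lambda>x i. t * x i"
  have "\<exists>y\<in>MA'. (\<lambda>i. b i + - res b * x0 i) = ?t y" if b: "b \<in> B" for b
  proof (rule res_eq_0)
    have m: "(\<lambda>i. - res b * x0 i) \<in> MA" using V.submod_smult[OF V.submod_logv x0(1), of "- res b"] by simp
    show "(\<lambda>i. b i + - res b * x0 i) \<in> MA" by (rule V.submod_add[OF V.submod_logv sub[OF b] m])
    show "res (\<lambda>i. b i + - res b * x0 i) = 0"
      unfolding res_add[OF sub[OF b] m] res_smult[OF x0(1)] using sg_res[OF sub[OF b]] x0(2) by simp
  qed
  then have "\<forall>b\<in>B. \<exists>y. y \<in> MA' \<and> (\<forall>i. b i = t * y i + res b * x0 i)"
    by (fastforce simp: fun_eq_iff diff_eq_eq)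
  from bchoice[OF this] obtain y where y: "\<forall>b\<in>B. y b \<in> MA' \<and> (\<forall>i. b i = t * y b i + res b * x0 i)" ..
  \<comment> \<open>The coefficient of \<open>x0\<close> in the expansion of \<open>t * z\<close> is
    divisible by \<open>t\<close>, because modulo \<open>t\<close> it is the residue of
    \<open>t * z\<close>, which is zero.\<close>
  define u where "u z = (SOME p. t * p = (\<Sum>b\<in>B. c b (?t z) * res b))" for z
  have u: "t * u z = (\<Sum>b\<in>B. c b (?t z) * res b)" if z: "z \<in> MA'" for z
  proof -
    have "sg (\<Sum>b\<in>B. c b (?t z) * res b) = res (\<lambda>v. \<Sum>b\<in>B. c b (?t z) * b v)"
      using sub sg_res[OF sub] res_lincomb_set[OF fin sub] by (simp add: elim_sum)
    also have "(\<lambda>v. \<Sum>b\<in>B. c b (?t z) * b v) = ?t z"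
      by (rule ext) (rule c(2)[OF t_mult_MA(1)[OF z], symmetric])
    also have "res (?t z) = 0" by (rule t_mult_MA(2)[OF z])
    finally have "t dvd (\<Sum>b\<in>B. c b (?t z) * res b)" by (simp add: sg_eq_0)
    then have "\<exists>p. t * p = (\<Sum>b\<in>B. c b (?t z) * res b)" unfolding dvd_def by (simp only: eq_commute)
    then show ?thesis unfolding u_def by (rule someI_ex)
  qed
  have c_add: "c b (?t (\<lambda>v. z v + z' v)) = c b (?t z) + c b (?t z')" if "b \<in> B" "z \<in> MA'" "z' \<in> MA'" for b z z'
    using V.linear_functional_add[OF c(1)[OF that(1)] t_mult_MA(1)[OF that(2)] t_mult_MA(1)[OF that(3)]]
    by (simp add: distrib_left)
  have c_smult: "c b (?t (\<lambda>v. r * z v)) = r * c b (?t z)" if "b \<in> B" "z \<in> MA'" for b z r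
    using V_linear_functional_t[OF c(1)[OF that(1)] t_mult_MA(1)[OF that(2)], of r]
    by (simp add: mult.left_commute)
  have u_lin: "V.linear_functional MA' u"
    unfolding V.linear_functional_def
  proof (intro conjI ballI allI impI)
    fix z z' assume z: "z \<in> MA'" "z' \<in> MA'"
    have "t * u (\<lambda>v. z v + z' v) = (\<Sum>b\<in>B. (c b (?t z) + c b (?t z')) * res b)"
      unfolding u[OF V.submod_add[OF V.submod_logv z]] using c_add z by (intro sum.cong refl) simp
    also have "\<dots> = t * (u z + u z')"
      by (simp add: distrib_right sum.distrib distrib_left u z)
    finally show "u (\<lambda>v. z v + z' v) = u z + u z'" by (simp add: mpoly_mult_left_cancel[OF t_nz])
  next
    fix r z assume z: "z \<in> MA'"
    have rz: "(\<lambda>v. r * z v) \<in> MA'" by (rule V.submod_smult[OF V.submod_logv z]) simp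
    have "t * u (\<lambda>v. r * z v) = (\<Sum>b\<in>B. r * c b (?t z) * res b)"
      unfolding u[OF rz] using c_smult z by (intro sum.cong refl) simp
    also have "\<dots> = t * (r * u z)"
      unfolding mult.left_commute[of t] u[OF z] by (simp add: sum_distrib_left mult.assoc)
    finally show "u (\<lambda>v. r * z v) = r * u z" by (simp add: mpoly_mult_left_cancel[OF t_nz])
  qed simp
  have c_lin: "V.linear_functional MA' (\<lambda>z. c b (?t z))" if "b \<in> B" for b
    unfolding V.linear_functional_def using c_add[OF that] c_smult[OF that] by simp
  have z_eq: "z v = (\<Sum>b\<in>B. c b (?t z) * y b v) + u z * x0 v" if z: "z \<in> MA'" for z v
  proof -
    have "t * z v = (\<Sum>b\<in>B. c b (?t z) * b v)" using c(2)[OF t_mult_MA(1)[OF z], of v] by simp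
    also have "\<dots> = (\<Sum>b\<in>B. c b (?t z) * (t * y b v + res b * x0 v))"
      using y by (intro sum.cong refl) simp
    also have "\<dots> = t * (\<Sum>b\<in>B. c b (?t z) * y b v) + (t * u z) * x0 v"
      unfolding u[OF z] by (simp add: distrib_left sum.distrib sum_distrib_left sum_distrib_right mult_ac)
    finally have "t * z v = t * ((\<Sum>b\<in>B. c b (?t z) * y b v) + u z * x0 v)" by (simp add: algebra_simps)
    then show ?thesis by (simp add: mpoly_mult_left_cancel[OF t_nz])
  qed
  have "V.dual_basis MA' (insert None (Some ` B)) (case_option u (\<lambda>b z. c b (?t z))) (case_option x0 y)"
  proof (rule V.dual_basisI_finite)
    show "z v = (\<Sum>i\<in>insert None (Some ` B). case_option u (\<lambda>b z. c b (?t z)) i z * case_option x0 y i v)"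
      if "z \<in> MA'" for z v
      using z_eq[OF that, of v] fin by (simp add: sum.reindex add.commute)
  qed (use fin u_lin c_lin y MA_subset[OF x0(1)] in auto)
  then show ?thesis by (rule MA'_free_if_projective)
qed

section \<open>Surjectivity of the restriction map\<close>

lemma elim_power: "elim al w (p ^ n) = elim al w p ^ n"
  by (induction n) auto

text \<open>Multiplication by \<open>Q\<close> makes any vector logarithmic along the deletion;
  after restriction the surplus is \<open>sQ = QH * P\<close>, of which \<open>P\<close> is absorbed
  by \<open>rho\<close>.\<close>

lemma lift_global:
  assumes th: "th \<in> N"
  shows "\<exists>y\<in>MA'. rho y = (\<lambda>i. QH * th i)"
proof
  let ?y = "\<lambda>i. Q * th i"
  show y: "?y \<in> MA'"
    unfolding V_logv ctr_smult Q_def using finA by (intro ballI dvd_mult2 dvd_prodI) auto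
  have s: "sg (ctr th v) = ctr th v" for v using th by (intro sg_ctr_closed) (simp add: logv_def)
  show "rho ?y = (\<lambda>i. QH * th i)"
  proof (rule rho_eqI[OF y])
    show "ctr (\<lambda>i. QH * th i) w = 0" using th by (simp add: ctr_smult logv_def)
    show "P * ctr (\<lambda>i. QH * th i) v = sg (ctr ?y v)" for v
      unfolding ctr_smult elim_mult s sg_Q P by (simp add: mult_ac)
  qed
qed

text \<open>The vector \<open>u\<close> is projected to \<open>X\<close> along \<open>w\<close> and
  \<open>v\<close>. On vectors of \<open>X\<close> the contraction of \<open>th\<close> is divisible
  by the form of \<open>X\<close>, so \<open>G\<close> is the part of \<open>th\<close> along
  \<open>X\<close> divided by this form.\<close>

lemma ctr_of_linear_on_H:
  assumes th: "th \<in> N" and X: "X \<in> AH" and v: "v \<in> H" "pairing (b' X) v = 1"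
  shows "\<exists>G. \<forall>u. linear_poly (b' X) * ctr G u = ctr th (u - pairing al u *s w - pairing (b' X) u *s v)"
proof (rule ctr_quotient)
  let ?be = "linear_poly (b' X)"
  let ?pi = "\<lambda>u. u - pairing al u *s w - pairing (b' X) u *s v"
  have pi_add: "?pi (u + u') = ?pi u + ?pi u'" for u u'
    by (simp add: pairing_simps vec.scale_left_distrib)
  have pi_scale: "?pi (c *s u) = c *s ?pi u" for c u
    by (simp add: pairing_simps vec.scale_right_diff_distrib)
  show "?be \<noteq> 0" using b'_nz[OF X] by simp
  show "ctr th (?pi (u + u')) = ctr th (?pi u) + ctr th (?pi u')" for u u'
    unfolding pi_add ctr_add_right ..
  show "ctr th (?pi (c *s u)) = const_poly c * ctr th (?pi u)" for c u
    unfolding pi_scale ctr_scale ..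
  fix u
  have "?pi u \<in> H" using v by (simp add: mem_H pairing_simps alw)
  then have "?pi u \<in> X" using mem_AH[OF X, of "?pi u"] b'_H[of "?pi u" X] v by (simp add: pairing_simps b'_w)
  then show "?be dvd ctr th (?pi u)" using th X unfolding logv_def by (auto simp: sg_b)
qed

text \<open>Along \<open>X\<close> the form \<open>th\<close> consists of \<open>?be\<close> times
  \<open>G\<close> and of \<open>ctr th v\<close> times \<open>d ?be\<close>. The first part lifts
  with the factor \<open>Pi X\<close>. For the second, \<open>Pi X = ?be * p0 + t * q0\<close>
  suggests the lift \<open>p0\<close> times \<open>d ?be\<close> plus \<open>q0\<close> times
  \<open>d al\<close>: on each hyperplane through \<open>X\<close> the two differentials are
  proportional, and the contraction multiplied by \<open>t\<close> becomes a multiple of the form of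
  \<open>L\<close>.\<close>

lemma lift_local:
  assumes th: "th \<in> N" and X: "X \<in> AH"
  shows "\<exists>h. \<exists>y\<in>MA'. \<not> linear_poly (b' X) dvd h \<and> sg h = h \<and> rho y = (\<lambda>i. h * th i)"
proof -
  let ?be = "linear_poly (b' X)" and ?h = "\<Prod>Y\<in>AH - {X}. linear_poly (b' Y)"
  obtain v where v: "v \<in> H" "pairing (b' X) v = 1" using ex_normal_vector[OF X] .
  obtain m where m: "card (flat_forms X) = Suc m"
    using flat_nonempty[OF X] fin_flat[of X] by (metis card_gt_0_iff gr0_conv_Suc)
  obtain C where C: "C \<noteq> 0" "sg (Pi X) = const_poly C * ?be ^ Suc m" using sg_Pi[of X] m by auto
  define p0 where "p0 = const_poly C * ?be ^ m"
  have sp0: "sg p0 = p0" by (simp add: p0_def add: elim_power)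
  have "t dvd Pi X - sg (Pi X)" by (rule dvd_diff_elim)
  then obtain q0 where q0: "Pi X - sg (Pi X) = t * q0" ..
  have Pi_eq: "Pi X = ?be * p0 + t * q0" using q0 C by (simp add: p0_def algebra_simps)
  obtain G where G: "\<And>u. ?be * ctr G u = ctr th (u - pairing al u *s w - pairing (b' X) u *s v)"
    using ctr_of_linear_on_H[OF th X v] by blast
  have sth: "sg (ctr th u) = ctr th u" for u using th by (intro sg_ctr_closed) (simp add: logv_def)
  define x where "x = (\<lambda>i. Pi X * G i + ctr th v * (p0 * const_poly (b' X $ i) + q0 * const_poly (al $ i)))"
  have cx: "ctr x u = Pi X * ctr G u + ctr th v * (p0 * const_poly (pairing (b' X) u) + q0 * const_poly (pairing al u))" for u
    unfolding x_def by (simp only: ctr_add_left ctr_smult ctr_const1)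
  define y where "y = (\<lambda>i. rest X * x i)"
  have cy: "ctr y u = rest X * ctr x u" for u unfolding y_def by (rule ctr_smult)
  have y: "y \<in> MA'"
    unfolding V_logv cy
  proof (intro ballI flat_mult_rest, assumption)
    fix L u assume L: "L \<in> A'" and u: "u \<in> L" and f: "L \<in> flat_forms X"
    then have LA: "L \<in> A" by simp
    let ?c1 = "pairing (a L) w" and ?c2 = "cf L" and ?p = "pairing (b' X) u" and ?q = "pairing al u"
    have z: "?c1 * ?q + ?c2 * ?p = 0"
      using pairing_decomp(1)[OF f, of u] u mem_A[OF LA] by simp
    have d1: "linear_poly (a L) dvd Pi X" unfolding Pi_def using fin_flat f by (rule dvd_prodI)
    have "const_poly ?c2 * (t * (p0 * const_poly ?p + q0 * const_poly ?q)) =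
        const_poly ?c2 * const_poly ?q * Pi X - p0 * const_poly ?q * linear_poly (a L)
        + p0 * t * const_poly (?c1 * ?q + ?c2 * ?p)"
      unfolding pairing_decomp(2)[OF f] Pi_eq by (simp add: const_poly_add const_poly_mult algebra_simps)
    also have "linear_poly (a L) dvd \<dots>" unfolding z using d1 by simp
    finally have "linear_poly (a L) dvd t * (p0 * const_poly ?p + q0 * const_poly ?q)"
      by (rule dvd_trans) (simp add: const_mult_dvd_iff[OF pairing_decomp(3)[OF f]])
    moreover have "\<not> linear_poly (a L) dvd t" using a_distinct[OF LA HA] L aH by auto
    ultimately have "linear_poly (a L) dvd p0 * const_poly ?p + q0 * const_poly ?q"
      using linear_poly_prime[OF a_nz[OF LA]] by blast
    then show "linear_poly (a L) dvd ctr x u" unfolding cx using d1 by simp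
  qed
  \<comment> \<open>Both sides are \<open>sQ\<close>. So the surplus factor
    \<open>p0 * sg (rest X)\<close> of the lift is \<open>P\<close>, which \<open>rho\<close>
    removes, times the product of the forms of the other members of the restriction.\<close>
  have "?be * (?h * P) = sg (Pi X) * sg (rest X)"
    using sg_Q Q_split[of X] QH_split[OF X] P by (simp add: mult.assoc)
  also have "\<dots> = ?be * (p0 * sg (rest X))" by (simp add: C p0_def mult_ac)
  finally have hP: "?h * P = p0 * sg (rest X)" using b'_nz[OF X] by (simp add: mpoly_mult_left_cancel)
  have "rho y = (\<lambda>i. ?h * th i)"
  proof (rule rho_eqI[OF y])
    show "ctr (\<lambda>i. ?h * th i) w = 0" using th by (simp add: ctr_smult logv_def)
    fix u assume u: "u \<in> H"
    let ?p = "pairing (b' X) u"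
    have G': "?be * sg (ctr G u) = ctr th (u - ?p *s v)"
      using arg_cong[OF G[of u], of sg] u by (simp add: mem_H sth)
    have "sg (ctr x u) = const_poly C * ?be ^ m * (?be * sg (ctr G u)) + ctr th v * (p0 * const_poly ?p)"
      using u by (simp add: cx C sth sp0 mem_H mult_ac)
    also have "\<dots> = p0 * (ctr th (u - ?p *s v) + const_poly ?p * ctr th v)"
      unfolding G' by (simp add: p0_def algebra_simps)
    also have "ctr th (u - ?p *s v) + const_poly ?p * ctr th v = ctr th u"
      by (simp add: ctr_diff_right ctr_scale)
    finally have "sg (ctr y u) = (p0 * sg (rest X)) * ctr th u" by (simp add: cy mult_ac)
    then show "P * ctr (\<lambda>i. ?h * th i) u = sg (ctr y u)"
      unfolding ctr_smult hP[symmetric] by (simp add: mult_ac)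
  qed
  moreover have "sg ?h = ?h" by (simp add: elim_prod)
  ultimately show ?thesis using y b'_not_dvd_others[OF X] by blast
qed

text \<open>Coordinatewise with respect to a basis of \<open>MA\<close>, it suffices to lift enough multiples of \<open>th\<close>.\<close>

lemma rho_surj:
  assumes B: "V.is_basis MA B" and th: "th \<in> N"
  shows "\<exists>y\<in>MA'. rho y = th"
proof -
  obtain c where c: "\<And>b. b \<in> B \<Longrightarrow> V.linear_functional MA (c b)" "\<And>x v. x \<in> MA \<Longrightarrow> x v = (\<Sum>b\<in>B. c b x * b v)"
    using V.is_basis_coords[OF V.submod_logv B] by blast
  have fin: "finite B" and sub: "\<And>b. b \<in> B \<Longrightarrow> b \<in> MA"
    using B by (auto simp: V.is_basis_def)
  let ?t = "\<lambda>x i. t * x i"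
  obtain y0 where y0: "y0 \<in> MA'" "rho y0 = (\<lambda>i. QH * th i)" using lift_global[OF th] by (rule bexE)
  \<comment> \<open>At \<open>X\<close>, the combination \<open>h * y0 - QH * y\<close> restricts to
    zero, hence lies in \<open>MA\<close>. The coordinates of its product with \<open>t\<close> are
    therefore multiples of \<open>t\<close>, and elimination leaves a congruence that makes
    \<open>QH\<close> divide \<open>h\<close> times the reduced coordinate.\<close>
  have "QH dvd sg (c b (?t y0))" if b: "b \<in> B" for b
  proof (rule dvd_if_locally)
    show "QH dvd sQ * sg (c b (?t y0))" by (simp add: P)
  next
    fix X assume X: "X \<in> AH"
    obtain h y where y: "y \<in> MA'" and h: "\<not> linear_poly (b' X) dvd h" and sh: "sg h = h"
      and rh: "rho y = (\<lambda>i. h * th i)"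
      using lift_local[OF th X] by (elim exE bexE conjE) (rule that)
    have hy: "(\<lambda>i. h * y0 i) \<in> MA'" "(\<lambda>i. - QH * y i) \<in> MA'"
      using V.submod_smult[OF V.submod_logv y0(1), of h] V.submod_smult[OF V.submod_logv y, of "- QH"] by simp_all
    let ?z = "\<lambda>i. h * y0 i + - QH * y i"
    have z': "?z \<in> MA'" by (rule V.submod_add[OF V.submod_logv hy])
    have "rho ?z = (\<lambda>_. 0)"
      unfolding rho_add[OF hy] rho_smult[OF y0(1)] rho_smult[OF y] y0(2) rh by (simp add: sh mult_ac)
    then have z: "?z \<in> MA" using rho_eq_0[OF z'] by blast
    have "c b (?t ?z) = t * c b ?z" by (rule V_linear_functional_t[OF c(1)[OF b] z])
    moreover have "?t ?z = (\<lambda>i. h * ?t y0 i + - QH * ?t y i)" by (simp add: algebra_simps)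
    moreover have "c b \<dots> = h * c b (?t y0) + - QH * c b (?t y)"
    proof -
      have m: "(\<lambda>i. h * ?t y0 i) \<in> MA" "(\<lambda>i. - QH * ?t y i) \<in> MA"
        using V.submod_smult[OF V.submod_logv t_mult_MA(1)[OF y0(1)], of h]
          V.submod_smult[OF V.submod_logv t_mult_MA(1)[OF y], of "- QH"] by simp_all
      show ?thesis
        unfolding V.linear_functional_add[OF c(1)[OF b] m]
          V_linear_functional_t[OF c(1)[OF b] t_mult_MA(1)[OF y0(1)]]
          V_linear_functional_t[OF c(1)[OF b] t_mult_MA(1)[OF y]] ..
    qed
    ultimately have "t * c b ?z = h * c b (?t y0) + - QH * c b (?t y)" by simp
    then have "sg (t * c b ?z) = sg (h * c b (?t y0) + - QH * c b (?t y))" by simp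
    then have "h * sg (c b (?t y0)) = QH * sg (c b (?t y))" by (simp add: sh)
    then show "\<exists>h. \<not> linear_poly (b' X) dvd h \<and> QH dvd h * sg (c b (?t y0))" using h by (metis dvd_triv_left)
  qed
  then have "\<forall>b\<in>B. \<exists>k. sg (c b (?t y0)) = QH * k" by (simp add: dvd_def)
  from bchoice[OF this] obtain k where k: "\<forall>b\<in>B. sg (c b (?t y0)) = QH * k b" ..
  \<comment> \<open>The reduced coordinates of \<open>t * y0\<close>, divided by \<open>QH\<close>.
    Multiplied by \<open>QH\<close>, the residue of \<open>?z\<close> is that of
    \<open>t * y0\<close>, hence zero; so \<open>?z\<close> is \<open>t * y\<close>, and this
    \<open>y\<close> is the desired lift.\<close>
  let ?z = "\<lambda>i. \<Sum>b\<in>B. k b * b i"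
  have z: "?z \<in> MA" using sub by (intro V.submod_lincomb[OF V.submod_logv fin]) auto
  have tz: "?t y0 = (\<lambda>v. \<Sum>b\<in>B. c b (?t y0) * b v)"
    by (rule ext) (rule c(2)[OF t_mult_MA(1)[OF y0(1)]])
  have "QH * res ?z = (\<Sum>b\<in>B. sg (QH * k b) * res b)"
    using res_lincomb_set[OF fin sub, of k] by (simp add: sum_distrib_left mult.assoc)
  also have "\<dots> = (\<Sum>b\<in>B. sg (c b (?t y0)) * res b)"
  proof (rule sum.cong[OF refl])
    fix b assume b: "b \<in> B"
    show "sg (QH * k b) * res b = sg (c b (?t y0)) * res b"
      unfolding bspec[OF k b, symmetric] elim_idem[OF elim_pair] ..
  qed
  also have "\<dots> = res (\<lambda>v. \<Sum>b\<in>B. c b (?t y0) * b v)"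
    using res_lincomb_set[OF fin sub, of "\<lambda>b. c b (?t y0)"] by simp
  also have "\<dots> = 0" unfolding tz[symmetric] by (rule t_mult_MA(2)[OF y0(1)])
  finally have "res ?z = 0" using QH_nz by (simp add: mpoly_mult_eq_0)
  from res_eq_0[OF z this] obtain y where y: "y \<in> MA'" "?z = ?t y" by (rule bexE)
  have "\<forall>p. \<exists>e. p = sg p + t * e" using sg_diff by blast
  from choice[OF this] obtain e where e: "\<And>p. p = sg p + t * e p" by blast
  let ?e = "\<lambda>i. \<Sum>b\<in>B. e (c b (?t y0)) * b i"
  have eMA: "?e \<in> MA" using sub by (intro V.submod_lincomb[OF V.submod_logv fin]) auto
  have Qy: "(\<lambda>i. QH * y i) \<in> MA'" by (rule V.submod_smult[OF V.submod_logv y(1)]) simp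
  \<comment> \<open>The unreduced part of the coordinates contributes \<open>?e\<close>, an element
    of \<open>MA\<close>, which restricts to zero. Hence \<open>y0\<close> and \<open>QH * y\<close>
    have the same restriction.\<close>
  have "y0 i = QH * y i + ?e i" for i
  proof -
    have "t * y0 i = (\<Sum>b\<in>B. c b (?t y0) * b i)" by (rule c(2)[OF t_mult_MA(1)[OF y0(1)]])
    also have "\<dots> = (\<Sum>b\<in>B. (QH * k b + t * e (c b (?t y0))) * b i)"
    proof (rule sum.cong[OF refl])
      fix b assume "b \<in> B"
      then have "c b (?t y0) = QH * k b + t * e (c b (?t y0))" using e[of "c b (?t y0)"] k by simp
      then show "c b (?t y0) * b i = (QH * k b + t * e (c b (?t y0))) * b i" by (rule arg_cong)
    qed
    also have "\<dots> = QH * ?z i + t * ?e i"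
      by (simp add: distrib_right sum.distrib sum_distrib_left mult.assoc)
    also have "?z i = t * y i" using fun_cong[OF y(2), of i] .
    finally have "t * y0 i = t * (QH * y i + ?e i)" by (simp add: algebra_simps)
    then show ?thesis by (simp add: mpoly_mult_left_cancel[OF t_nz])
  qed
  then have "y0 = (\<lambda>i. QH * y i + ?e i)" by (rule ext)
  then have "rho y0 = rho (\<lambda>i. QH * y i + ?e i)" by (rule arg_cong)
  also have "\<dots> = (\<lambda>i. QH * rho y i + 0)"
    unfolding rho_add[OF Qy MA_subset[OF eMA]] rho_smult[OF y(1)]
    using rho_eq_0[OF MA_subset[OF eMA]] eMA by simp
  finally have *: "(\<lambda>i. QH * th i) = (\<lambda>i. QH * rho y i)" using y0(2) by simp
  have "QH * th i = QH * rho y i" for i using fun_cong[OF *, of i] .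
  then have "rho y = th" by (auto simp: mpoly_mult_left_cancel[OF QH_nz])
  then show ?thesis using y(1) by blast
qed

section \<open>Syzygies of the residues as logarithmic forms of the restriction\<close>

definition syzygies :: "('n \<Rightarrow> ('k, 'n) mpoly) set \<Rightarrow> (('n \<Rightarrow> ('k, 'n) mpoly) \<Rightarrow> ('k, 'n) mpoly) set" where
  "syzygies B = {k. (\<forall>b. sg (k b) = k b) \<and> (\<forall>b. b \<notin> B \<longrightarrow> k b = 0) \<and> (\<Sum>b\<in>B. k b * res b) = 0}"

lemma submod_syzygies: "submod (syzygies B)"
  unfolding submod_def syzygies_def
  by (auto simp: distrib_right sum.distrib mult.assoc simp flip: sum_distrib_left)

text \<open>A relation between the residues makes the corresponding combination of the basis
  residue-free, hence \<open>t\<close> times an element of \<open>MA'\<close>; that element is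
  taken.\<close>

definition syz_form :: "('n \<Rightarrow> ('k, 'n) mpoly) set \<Rightarrow> (('n \<Rightarrow> ('k, 'n) mpoly) \<Rightarrow> ('k, 'n) mpoly) \<Rightarrow>
    'n \<Rightarrow> ('k, 'n) mpoly" where
  "syz_form B k = (SOME y. y \<in> MA' \<and> (\<lambda>i. \<Sum>b\<in>B. k b * b i) = (\<lambda>i. t * y i))"

text \<open>Injective: if the quotient \<open>y\<close> lies in \<open>MA\<close>, the coordinates
  \<open>k b\<close> of \<open>t * y\<close> are multiples of \<open>t\<close>, but they are fixed
  by \<open>sg\<close>, hence zero. Surjective: for a lift \<open>y\<close> of \<open>th\<close>,
  the reduced coordinates of \<open>t * y\<close> form a syzygy, and the parts dropped change
  \<open>y\<close> only by an element of \<open>MA\<close>.\<close>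

theorem syzygies_iso:
  assumes B: "V.is_basis MA B"
  shows "lin_iso (\<lambda>k. rho (syz_form B k)) (syzygies B) N"
proof -
  obtain c where c: "\<And>b. b \<in> B \<Longrightarrow> V.linear_functional MA (c b)" "\<And>x v. x \<in> MA \<Longrightarrow> x v = (\<Sum>b\<in>B. c b x * b v)"
    using V.is_basis_coords[OF V.submod_logv B] by blast
  have fin: "finite B" and sub: "\<And>b. b \<in> B \<Longrightarrow> b \<in> MA"
    using B by (auto simp: V.is_basis_def)
  let ?t = "\<lambda>x i. t * x i"
  have cu: "c b (\<lambda>v. \<Sum>b\<in>B. k b * b v) = k b" if "b \<in> B" for b k
    using V.is_basis_coords_unique[OF V.submod_logv B c _ that, of k] by simp
  have sf: "syz_form B k \<in> MA'" "\<And>i. (\<Sum>b\<in>B. k b * b i) = t * syz_form B k i" if k: "k \<in> syzygies B" for k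
  proof -
    let ?z = "\<lambda>i. \<Sum>b\<in>B. k b * b i"
    have z: "?z \<in> MA" using sub by (intro V.submod_lincomb[OF V.submod_logv fin]) auto
    have "res ?z = 0" using res_lincomb_set[OF fin sub, of k] k by (simp add: syzygies_def)
    from res_eq_0[OF z this] obtain y where "y \<in> MA'" "?z = ?t y" by (rule bexE)
    then have "y \<in> MA' \<and> ?z = ?t y" ..
    from someI[of "\<lambda>y. y \<in> MA' \<and> ?z = ?t y", OF this]
    have *: "syz_form B k \<in> MA' \<and> ?z = ?t (syz_form B k)" unfolding syz_form_def .
    show "syz_form B k \<in> MA'" using * ..
    show "(\<Sum>b\<in>B. k b * b i) = t * syz_form B k i" for i using fun_cong[OF conjunct2[OF *], of i] .
  qed
  have sf_eq: "syz_form B k = y" if k: "k \<in> syzygies B" and y: "\<And>i. (\<Sum>b\<in>B. k b * b i) = t * y i" for k y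
    by (rule t_cancel) (simp add: y flip: sf(2)[OF k])
  have sf_add: "syz_form B (\<lambda>b. k b + k' b) = (\<lambda>i. syz_form B k i + syz_form B k' i)"
    if k: "k \<in> syzygies B" and k': "k' \<in> syzygies B" for k k'
    using submod_add[OF submod_syzygies k k']
    by (rule sf_eq) (simp add: distrib_right sum.distrib sf(2)[OF k] sf(2)[OF k'] distrib_left)
  have sf_smult: "syz_form B (\<lambda>b. r * k b) = (\<lambda>i. r * syz_form B k i)"
    if k: "k \<in> syzygies B" and r: "sg r = r" for k r
  proof (rule sf_eq[OF submod_smult[OF submod_syzygies k r]])
    show "(\<Sum>b\<in>B. r * k b * b i) = t * (r * syz_form B k i)" for i
      unfolding mult.assoc sum_distrib_left[symmetric] sf(2)[OF k] by (rule mult.left_commute)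
  qed
  have add: "rho (syz_form B (\<lambda>b. k b + k' b)) = (\<lambda>i. rho (syz_form B k) i + rho (syz_form B k') i)"
    if "k \<in> syzygies B" "k' \<in> syzygies B" for k k'
    unfolding sf_add[OF that] by (rule rho_add[OF sf(1)[OF that(1)] sf(1)[OF that(2)]])
  have smult: "rho (syz_form B (\<lambda>b. r * k b)) = (\<lambda>i. r * rho (syz_form B k) i)"
    if k: "k \<in> syzygies B" and r: "sg r = r" for k r
    unfolding sf_smult[OF that] rho_smult[OF sf(1)[OF k]] r ..
  have ker: "k = (\<lambda>b. 0)" if k: "k \<in> syzygies B" and 0: "rho (syz_form B k) = (\<lambda>_. 0)" for k
  proof
    fix b
    have m: "syz_form B k \<in> MA" using 0 rho_eq_0[OF sf(1)[OF k]] by simp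
    show "k b = 0"
    proof (cases "b \<in> B")
      case True
      have "k b = c b (\<lambda>v. \<Sum>b\<in>B. k b * b v)" by (rule cu[OF True, symmetric])
      also have "\<dots> = c b (?t (syz_form B k))" by (simp only: sf(2)[OF k])
      also have "\<dots> = t * c b (syz_form B k)" by (rule V_linear_functional_t[OF c(1)[OF True] m])
      finally have "sg (k b) = 0" by simp
      then show ?thesis using k by (simp add: syzygies_def)
    next
      case False
      then show ?thesis using k by (simp add: syzygies_def)
    qed
  qed
  have inj: "inj_on (\<lambda>k. rho (syz_form B k)) (syzygies B)"
  proof (rule inj_onI)
    fix k k' assume k: "k \<in> syzygies B" and k': "k' \<in> syzygies B"
      and eq: "rho (syz_form B k) = rho (syz_form B k')"
    have m: "(\<lambda>b. - 1 * k' b) \<in> syzygies B" by (rule submod_smult[OF submod_syzygies k']) simp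
    have m': "rho (syz_form B (\<lambda>b. - 1 * k' b)) = (\<lambda>i. - 1 * rho (syz_form B k') i)"
      by (rule smult[OF k']) simp
    have "rho (syz_form B (\<lambda>b. k b + - 1 * k' b)) = (\<lambda>_. 0)"
      unfolding add[OF k m] m' eq by simp
    then have "(\<lambda>b. k b + - 1 * k' b) = (\<lambda>b. 0)" by (rule ker[OF submod_add[OF submod_syzygies k m]])
    then show "k = k'" by (auto simp: fun_eq_iff)
  qed
  have "\<exists>k\<in>syzygies B. th = rho (syz_form B k)" if th: "th \<in> N" for th
  proof -
    from rho_surj[OF B th] obtain y where y: "y \<in> MA'" "rho y = th" by (rule bexE)
    have "\<forall>p. \<exists>e. p = sg p + t * e" using sg_diff by blast
    from choice[OF this] obtain e where e: "\<And>p. p = sg p + t * e p" by blast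
    define k where "k b = (if b \<in> B then sg (c b (?t y)) else 0)" for b
    have tz: "?t y = (\<lambda>v. \<Sum>b\<in>B. c b (?t y) * b v)" by (rule ext) (rule c(2)[OF t_mult_MA(1)[OF y(1)]])
    have "(\<Sum>b\<in>B. k b * res b) = res (\<lambda>v. \<Sum>b\<in>B. c b (?t y) * b v)"
      using res_lincomb_set[OF fin sub, of "\<lambda>b. c b (?t y)"] by (simp add: k_def)
    also have "\<dots> = 0" unfolding tz[symmetric] by (rule t_mult_MA(2)[OF y(1)])
    finally have k: "k \<in> syzygies B" using elim_pair by (auto simp: syzygies_def k_def)
    let ?e = "\<lambda>i. \<Sum>b\<in>B. e (c b (?t y)) * b i"
    have eMA: "?e \<in> MA" using sub by (intro V.submod_lincomb[OF V.submod_logv fin]) auto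
    have "y i = syz_form B k i + ?e i" for i
    proof -
      have "t * y i = (\<Sum>b\<in>B. c b (?t y) * b i)" by (rule c(2)[OF t_mult_MA(1)[OF y(1)]])
      also have "\<dots> = (\<Sum>b\<in>B. (k b + t * e (c b (?t y))) * b i)"
      proof (rule sum.cong[OF refl])
        fix b assume "b \<in> B"
        then have "c b (?t y) = k b + t * e (c b (?t y))" using e[of "c b (?t y)"] by (simp add: k_def)
        then show "c b (?t y) * b i = (k b + t * e (c b (?t y))) * b i" by (rule arg_cong)
      qed
      also have "\<dots> = (\<Sum>b\<in>B. k b * b i) + t * ?e i"
        by (simp add: distrib_right sum.distrib sum_distrib_left mult.assoc)
      also have "\<dots> = t * (syz_form B k i + ?e i)" by (simp add: sf(2)[OF k] distrib_left)
      finally show ?thesis by (simp add: mpoly_mult_left_cancel[OF t_nz])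
    qed
    then have "y = (\<lambda>i. syz_form B k i + ?e i)" by (rule ext)
    then have "rho y = rho (\<lambda>i. syz_form B k i + ?e i)" by (rule arg_cong)
    also have "\<dots> = rho (syz_form B k)"
      unfolding rho_add[OF sf(1)[OF k] MA_subset[OF eMA]]
      using rho_eq_0[OF MA_subset[OF eMA]] eMA by simp
    finally show ?thesis using k y(2) by blast
  qed
  then have "(\<lambda>k. rho (syz_form B k)) ` syzygies B = N"
    using rho(1)[OF sf(1)] by auto
  then show ?thesis
    unfolding lin_iso_def bij_betw_def using inj add smult by simp
qed

end

subsection \<open>Modules over a coordinate ring\<close>

lemma (in module) lincomb_extend:
  assumes "finite T" "A \<subseteq> T" "T \<subseteq> carrier M" "a \<in> T \<rightarrow> carrier R" "\<And>c. c \<in> T - A \<Longrightarrow> a c = \<zero>"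
  shows "lincomb a T = lincomb a A"
  unfolding lincomb_def using assms
  by (intro M.add.finprod_mono_neutral_cong_right) (auto simp: subset_iff Pi_iff)

lemma (in module) lincomb_unique:
  assumes "lin_indpt C" "C \<subseteq> carrier M" "finite A" "A \<subseteq> C" "a \<in> A \<rightarrow> carrier R" "b \<in> A \<rightarrow> carrier R"
    and "lincomb a A = lincomb b A" "c \<in> A"
  shows "a c = b c"
proof (rule ccontr)
  assume ne: "a c \<noteq> b c"
  have AM: "A \<subseteq> carrier M" using assms by blast
  have "lincomb (\<lambda>v. a v \<ominus> b v) A = lincomb a A \<ominus>\<^bsub>M\<^esub> lincomb b A"
    by (rule lincomb_diff[OF assms(3) AM assms(5,6)])
  also have "\<dots> = \<zero>\<^bsub>M\<^esub>"
    using lincomb_closed[OF AM assms(6)] by (simp add: assms(7) M.r_neg a_minus_def)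
  finally have "lin_dep C"
  proof (intro lin_dep_crit[OF assms(3,4) _ assms(8)])
    show "(\<lambda>v. a v \<ominus> b v) \<in> A \<rightarrow> carrier R" using assms(5,6) by auto
    show "a c \<ominus> b c \<noteq> \<zero>"
    proof
      assume "a c \<ominus> b c = \<zero>"
      then have "a c = b c" using assms(5,6,8) by (auto simp: Pi_iff)
      then show False using ne by contradiction
    qed
  qed
  then show False using assms(1) by contradiction
qed

text \<open>The basis may be infinite. One finite expansion is chosen for each element; on a common
  finite support expansions are unique, which gives linearity of the coordinates.\<close>

lemma (in module) free_coords:
  assumes C: "C \<subseteq> carrier M" "lin_indpt C" "span C = carrier M"
  shows "\<exists>f. (\<forall>c\<in>C. \<forall>x\<in>carrier M. f c x \<in> carrier R) \<and>
    (\<forall>c\<in>C. \<forall>x\<in>carrier M. \<forall>y\<in>carrier M. f c (x \<oplus>\<^bsub>M\<^esub> y) = f c x \<oplus> f c y) \<and>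
    (\<forall>c\<in>C. \<forall>r\<in>carrier R. \<forall>x\<in>carrier M. f c (r \<odot>\<^bsub>M\<^esub> x) = r \<otimes> f c x) \<and>
    (\<forall>x\<in>carrier M. finite {c \<in> C. f c x \<noteq> \<zero>} \<and> x = lincomb (\<lambda>c. f c x) {c \<in> C. f c x \<noteq> \<zero>})"
proof -
  have "\<forall>x\<in>carrier M. \<exists>p. finite (fst p) \<and> fst p \<subseteq> C \<and> snd p \<in> fst p \<rightarrow> carrier R \<and> x = lincomb (snd p) (fst p)"
  proof
    fix x assume "x \<in> carrier M"
    then have "x \<in> span C" using C(3) by simp
    then obtain a A where "finite A" "A \<subseteq> C" "a \<in> A \<rightarrow> carrier R" "x = lincomb a A" unfolding span_def by auto
    then show "\<exists>p. finite (fst p) \<and> fst p \<subseteq> C \<and> snd p \<in> fst p \<rightarrow> carrier R \<and> x = lincomb (snd p) (fst p)"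
      by (intro exI[of _ "(A, a)"]) simp
  qed
  from bchoice[OF this] obtain p where p: "\<And>x. x \<in> carrier M \<Longrightarrow>
      finite (fst (p x)) \<and> fst (p x) \<subseteq> C \<and> snd (p x) \<in> fst (p x) \<rightarrow> carrier R \<and> x = lincomb (snd (p x)) (fst (p x))"
    by blast
  define f where "f c x = (if c \<in> fst (p x) then snd (p x) c else \<zero>)" for c x
  have fR: "f c x \<in> carrier R" if "x \<in> carrier M" for c x
    using p[OF that] by (auto simp: f_def)
  have frep: "x = lincomb (\<lambda>c. f c x) T" if x: "x \<in> carrier M" and T: "finite T" "fst (p x) \<subseteq> T" "T \<subseteq> C" for x T
  proof -
    have "lincomb (\<lambda>c. f c x) T = lincomb (\<lambda>c. f c x) (fst (p x))"
      using T C(1) fR[OF x] by (intro lincomb_extend) (auto simp: f_def)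
    also have "\<dots> = lincomb (snd (p x)) (fst (p x))"
      using p[OF x] C(1) by (intro lincomb_cong) (auto simp: f_def)
    finally show ?thesis using p[OF x] by metis
  qed
  have uniq: "f c x = g c" if x: "x \<in> carrier M" and T: "finite T" "T \<subseteq> C" and g: "g \<in> C \<rightarrow> carrier R"
    "\<And>c. c \<in> C - T \<Longrightarrow> g c = \<zero>" "x = lincomb g T" and c: "c \<in> C" for x T g c
  proof -
    let ?T = "insert c (T \<union> fst (p x))"
    have T': "finite ?T" "?T \<subseteq> C" using T p[OF x] c by auto
    have "lincomb g ?T = lincomb g T"
      using T' C(1) g by (intro lincomb_extend) auto
    have "lincomb (\<lambda>c. f c x) ?T = x" by (rule frep[OF x T'(1) _ T'(2), symmetric]) auto
    also have "x = lincomb g T" by (rule g(3))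
    also have "\<dots> = lincomb g ?T" by (rule \<open>lincomb g ?T = lincomb g T\<close>[symmetric])
    finally have e: "lincomb (\<lambda>c. f c x) ?T = lincomb g ?T" .
    have "(\<lambda>c. f c x) \<in> ?T \<rightarrow> carrier R" "g \<in> ?T \<rightarrow> carrier R" using fR[OF x] g T' by auto
    from lincomb_unique[OF C(2,1) T' this e] show ?thesis by simp
  qed
  have finsup: "finite {c \<in> C. f c x \<noteq> \<zero>}" if x: "x \<in> carrier M" for x
    by (rule finite_subset[of _ "fst (p x)"]) (use p[OF x] in \<open>auto simp: f_def\<close>)
  show ?thesis
  proof (intro exI[of _ f] conjI ballI)
    fix c x assume "c \<in> C" "x \<in> carrier M" then show "f c x \<in> carrier R" using fR by simp
  next
    fix c x y assume c: "c \<in> C" and x: "x \<in> carrier M" and y: "y \<in> carrier M"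
    let ?T = "fst (p x) \<union> fst (p y)"
    have T: "finite ?T" "?T \<subseteq> C" using p[OF x] p[OF y] by auto
    have ex: "lincomb (\<lambda>c. f c x) ?T = x" by (rule frep[OF x T(1) _ T(2), symmetric]) simp
    have ey: "lincomb (\<lambda>c. f c y) ?T = y" by (rule frep[OF y T(1) _ T(2), symmetric]) simp
    have "lincomb (\<lambda>c. f c x \<oplus> f c y) ?T = lincomb (\<lambda>c. f c x) ?T \<oplus>\<^bsub>M\<^esub> lincomb (\<lambda>c. f c y) ?T"
      using T C(1) fR[OF x] fR[OF y] by (intro lincomb_sum) auto
    then have "x \<oplus>\<^bsub>M\<^esub> y = lincomb (\<lambda>c. f c x \<oplus> f c y) ?T" unfolding ex ey ..
    from uniq[OF _ T _ _ this c] show "f c (x \<oplus>\<^bsub>M\<^esub> y) = f c x \<oplus> f c y"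
      using x y fR[OF x] fR[OF y] by (auto simp: f_def)
  next
    fix c r x assume c: "c \<in> C" and r: "r \<in> carrier R" and x: "x \<in> carrier M"
    let ?T = "fst (p x)"
    have T: "finite ?T" "?T \<subseteq> C" using p[OF x] by auto
    have ex: "lincomb (\<lambda>c. f c x) ?T = x" by (rule frep[OF x T(1) _ T(2), symmetric]) simp
    have "lincomb (\<lambda>c. r \<otimes> f c x) ?T = r \<odot>\<^bsub>M\<^esub> lincomb (\<lambda>c. f c x) ?T"
      using T C(1) fR[OF x] r by (intro lincomb_smult) auto
    then have "r \<odot>\<^bsub>M\<^esub> x = lincomb (\<lambda>c. r \<otimes> f c x) ?T" unfolding ex ..
    from uniq[OF _ T _ _ this c] show "f c (r \<odot>\<^bsub>M\<^esub> x) = r \<otimes> f c x"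
      using x r fR[OF x] by (auto simp: f_def)
  next
    fix x assume x: "x \<in> carrier M"
    let ?T = "fst (p x)"
    have T: "finite ?T" "?T \<subseteq> C" using p[OF x] by auto
    show "finite {c \<in> C. f c x \<noteq> \<zero>}" by (rule finsup[OF x])
    have "lincomb (\<lambda>c. f c x) ?T = lincomb (\<lambda>c. f c x) {c \<in> C. f c x \<noteq> \<zero>}"
      using T C(1) fR[OF x] by (intro lincomb_extend) (auto simp: f_def)
    then show "x = lincomb (\<lambda>c. f c x) {c \<in> C. f c x \<noteq> \<zero>}" using frep[OF x T(1) order_refl T(2)] by simp
  qed
qed

lemma (in mod_hom) hom_lincomb:
  assumes "finite I" "\<And>i. i \<in> I \<Longrightarrow> x i \<in> carrier M" "\<And>i. i \<in> I \<Longrightarrow> c i \<in> carrier R"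
  shows "f (\<Oplus>\<^bsub>M\<^esub>i\<in>I. c i \<odot>\<^bsub>M\<^esub> x i) = (\<Oplus>\<^bsub>N\<^esub>i\<in>I. c i \<odot>\<^bsub>N\<^esub> f (x i))"
  using assms
proof (induction I rule: finite_induct)
  case (insert i I)
  have "(\<Oplus>\<^bsub>M\<^esub>i\<in>I. c i \<odot>\<^bsub>M\<^esub> x i) \<in> carrier M" using insert by (intro M.M.finsum_closed) auto
  then show ?case using insert by (simp add: Pi_iff)
qed simp

text \<open>An abstract ring identified with the image of \<open>sg\<close> through
  \<open>pr\<close>. It covers the polynomial ring, where \<open>pr\<close> is the identity, and the
  quotient by the form of \<open>H\<close>, where \<open>pr\<close> takes cosets.\<close>

locale ring_rep = eliminated_ring al w for al w :: "'k::field^'n" +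
  fixes R :: "'r ring" (structure) and pr :: "('k, 'n) mpoly \<Rightarrow> 'r"
  assumes carrier_R: "carrier R = range pr"
    and pr_add: "pr (p + q) = pr p \<oplus> pr q"
    and pr_mult: "pr (p * q) = pr p \<otimes> pr q"
    and pr_1: "pr 1 = \<one>"
    and pr_0: "pr 0 = \<zero>"
    and pr_eq: "pr p = pr q \<longleftrightarrow> sg p = sg q"
begin

lemma pr_closed [simp, intro]: "pr p \<in> carrier R"
  by (simp add: carrier_R)

lemma pr_sg [simp]: "pr (sg p) = pr p"
  using elim_pair by (simp add: pr_eq)

definition rep where "rep r = sg (SOME p. pr p = r)"

lemma pr_rep [simp]: "r \<in> carrier R \<Longrightarrow> pr (rep r) = r"
  unfolding rep_def carrier_R by (auto simp: someI[of "\<lambda>q. pr q = pr _"])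

lemma sg_rep [simp]: "sg (rep r) = rep r"
  using elim_pair by (simp add: rep_def)

lemma rep_pr [simp]: "rep (pr p) = sg p"
proof -
  have "pr (rep (pr p)) = pr p" by simp
  then show ?thesis unfolding pr_eq by simp
qed

lemma cring_R: "cring R"
proof (rule cringI)
  show "abelian_group R"
  proof (rule abelian_groupI)
    fix x assume "x \<in> carrier R"
    then obtain p where "x = pr p" by (auto simp: carrier_R)
    then have "pr (- p) \<oplus> x = \<zero>" by (simp flip: pr_add pr_0)
    then show "\<exists>y\<in>carrier R. y \<oplus> x = \<zero>" by blast
  qed (auto simp: carrier_R simp flip: pr_add pr_0 intro!: arg_cong[of _ _ pr])
  show "comm_monoid R"
    by (rule comm_monoidI) (auto simp: carrier_R mult_ac simp flip: pr_mult pr_1)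
qed (auto simp: carrier_R distrib_right simp flip: pr_mult pr_add)

sublocale R: cring R
  by (rule cring_R)

lemma rep_add: "r \<in> carrier R \<Longrightarrow> s \<in> carrier R \<Longrightarrow> rep (r \<oplus> s) = rep r + rep s"
  by (auto simp: carrier_R simp flip: pr_add)

lemma rep_mult: "r \<in> carrier R \<Longrightarrow> s \<in> carrier R \<Longrightarrow> rep (r \<otimes> s) = rep r * rep s"
  by (auto simp: carrier_R simp flip: pr_mult)

lemma rep_1 [simp]: "rep \<one> = 1"
  by (simp flip: pr_1)

lemma rep_0 [simp]: "rep \<zero> = 0"
  by (simp flip: pr_0)

lemma rep_eq_0: "r \<in> carrier R \<Longrightarrow> rep r = 0 \<longleftrightarrow> r = \<zero>"
  by (metis pr_rep rep_0 pr_0)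

lemma pr_eq_0: "pr p = \<zero> \<longleftrightarrow> sg p = 0"
  by (simp add: pr_eq flip: pr_0)

lemma one_neq_zero: "\<one> \<noteq> \<zero>"
  by (simp add: pr_eq flip: pr_1 pr_0)

lemma domain_R: "domain R"
  by unfold_locales
    (use one_neq_zero in \<open>auto simp: carrier_R pr_eq_0 mpoly_mult_eq_0 simp flip: pr_mult\<close>)

lemma pr_uminus: "pr (- p) = \<ominus> pr p"
proof -
  have "pr (- p) \<oplus> pr p = \<zero>" by (simp flip: pr_add pr_0)
  then show ?thesis by (intro R.minus_equality[symmetric]) auto
qed

lemma pr_minus: "pr (p - q) = pr p \<ominus> pr q"
  using pr_add[of p "- q"] by (simp add: a_minus_def pr_uminus)

lemma pr_prod: "pr (\<Prod>i\<in>I. f i) = (\<Otimes>i\<in>I. pr (f i))"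
  by (induction I rule: infinite_finite_induct) (auto simp: pr_1 pr_mult Pi_iff R.finprod_infinite)

end

text \<open>An abstract module described by a concrete set \<open>N\<close> of polynomial functions;
  the module axioms are derived from the description. Freeness can then be moved between both
  sides.\<close>

locale module_rep = ring_rep al w R pr for al w :: "'k::field^'n" and R :: "'r ring" (structure) and pr +
  fixes M :: "('r, 'm, 't) module_scheme" and N :: "('x \<Rightarrow> ('k, 'n) mpoly) set" and h :: "('x \<Rightarrow> ('k, 'n) mpoly) \<Rightarrow> 'm"
  assumes submod_N: "submod N" and bij_h: "bij_betw h N (carrier M)"
    and h_add: "x \<in> N \<Longrightarrow> y \<in> N \<Longrightarrow> h (\<lambda>v. x v + y v) = h x \<oplus>\<^bsub>M\<^esub> h y"
    and h_smult: "x \<in> N \<Longrightarrow> sg r = r \<Longrightarrow> h (\<lambda>v. r * x v) = pr r \<odot>\<^bsub>M\<^esub> h x"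
    and h_0: "h (\<lambda>v. 0) = \<zero>\<^bsub>M\<^esub>"
begin

lemma h_closed [simp]: "x \<in> N \<Longrightarrow> h x \<in> carrier M"
  using bij_h by (auto simp: bij_betw_def)

lemma h_surj: "y \<in> carrier M \<Longrightarrow> \<exists>x\<in>N. y = h x"
  using bij_h by (auto simp: bij_betw_def)

lemma h_eq: "x \<in> N \<Longrightarrow> y \<in> N \<Longrightarrow> h x = h y \<longleftrightarrow> x = y"
  using bij_h by (auto simp: bij_betw_def inj_on_def)

lemma h_smult_rep:
  assumes "x \<in> N" "r \<in> carrier R"
  shows "r \<odot>\<^bsub>M\<^esub> h x = h (\<lambda>v. rep r * x v)"
  using h_smult[OF assms(1), of "rep r"] assms(2) by simp

lemma smult_N: "x \<in> N \<Longrightarrow> sg r = r \<Longrightarrow> (\<lambda>v. r * x v) \<in> N"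
  by (rule submod_smult[OF submod_N])

lemma module_M: "Module.module R M"
proof (rule moduleI[OF cring_R])
  show "abelian_group M"
  proof (rule abelian_groupI)
    fix x y assume "x \<in> carrier M" "y \<in> carrier M"
    then obtain a b where ab: "a \<in> N" "b \<in> N" and xy: "x = h a" "y = h b" using h_surj by blast
    show "x \<oplus>\<^bsub>M\<^esub> y \<in> carrier M" unfolding xy h_add[OF ab, symmetric]
      by (rule h_closed[OF submod_add[OF submod_N ab]])
    show "x \<oplus>\<^bsub>M\<^esub> y = y \<oplus>\<^bsub>M\<^esub> x"
      unfolding xy h_add[OF ab, symmetric] h_add[OF ab(2,1), symmetric] by (simp add: add.commute)
    fix z assume "z \<in> carrier M"
    then obtain c where c: "c \<in> N" "z = h c" using h_surj by blast
    show "x \<oplus>\<^bsub>M\<^esub> y \<oplus>\<^bsub>M\<^esub> z = x \<oplus>\<^bsub>M\<^esub> (y \<oplus>\<^bsub>M\<^esub> z)"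
      using ab c xy submod_add[OF submod_N] by (simp add: add.assoc flip: h_add)
  next
    show "\<zero>\<^bsub>M\<^esub> \<in> carrier M" using h_closed[OF submod_0[OF submod_N]] by (simp add: h_0)
  next
    fix x assume "x \<in> carrier M"
    then obtain a where a: "a \<in> N" and x: "x = h a" using h_surj by blast
    show "\<zero>\<^bsub>M\<^esub> \<oplus>\<^bsub>M\<^esub> x = x"
      unfolding x h_0[symmetric] h_add[OF submod_0[OF submod_N] a, symmetric] by simp
    have m: "(\<lambda>v. - a v) \<in> N" by (rule submod_uminus[OF submod_N a])
    have "h (\<lambda>v. - a v) \<oplus>\<^bsub>M\<^esub> x = \<zero>\<^bsub>M\<^esub>"
      unfolding x h_0[symmetric] h_add[OF m a, symmetric] by simp
    then show "\<exists>y\<in>carrier M. y \<oplus>\<^bsub>M\<^esub> x = \<zero>\<^bsub>M\<^esub>" using h_closed[OF m] by blast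
  qed
next
  fix r x assume r: "r \<in> carrier R" and "x \<in> carrier M"
  then obtain a where a: "a \<in> N" and x: "x = h a" using h_surj by blast
  show "r \<odot>\<^bsub>M\<^esub> x \<in> carrier M" unfolding x h_smult_rep[OF a r] using smult_N[OF a] by simp
  fix s assume s: "s \<in> carrier R"
  have rs: "r \<oplus> s \<in> carrier R" "r \<otimes> s \<in> carrier R" using r s by auto
  show "(r \<oplus> s) \<odot>\<^bsub>M\<^esub> x = r \<odot>\<^bsub>M\<^esub> x \<oplus>\<^bsub>M\<^esub> s \<odot>\<^bsub>M\<^esub> x"
    unfolding x h_smult_rep[OF a r] h_smult_rep[OF a s] h_smult_rep[OF a rs(1)]
    using smult_N[OF a] by (simp add: rep_add r s distrib_right flip: h_add)
  show "(r \<otimes> s) \<odot>\<^bsub>M\<^esub> x = r \<odot>\<^bsub>M\<^esub> (s \<odot>\<^bsub>M\<^esub> x)"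
    unfolding x h_smult_rep[OF a s] h_smult_rep[OF a rs(2)] h_smult_rep[OF smult_N[OF a sg_rep] r]
    by (simp add: rep_mult r s mult.assoc)
next
  fix r x y assume r: "r \<in> carrier R" and "x \<in> carrier M" "y \<in> carrier M"
  then obtain a b where ab: "a \<in> N" "b \<in> N" and xy: "x = h a" "y = h b" using h_surj by blast
  have m: "(\<lambda>v. rep r * a v) \<in> N" "(\<lambda>v. rep r * b v) \<in> N" using smult_N ab by auto
  show "r \<odot>\<^bsub>M\<^esub> (x \<oplus>\<^bsub>M\<^esub> y) = r \<odot>\<^bsub>M\<^esub> x \<oplus>\<^bsub>M\<^esub> r \<odot>\<^bsub>M\<^esub> y"
    unfolding xy h_add[OF ab, symmetric] h_smult_rep[OF ab(1) r] h_smult_rep[OF ab(2) r]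
      h_smult_rep[OF submod_add[OF submod_N ab] r] h_add[OF m, symmetric]
    by (simp add: distrib_left)
next
  fix x assume "x \<in> carrier M"
  then obtain a where a: "a \<in> N" and x: "x = h a" using h_surj by blast
  show "\<one> \<odot>\<^bsub>M\<^esub> x = x" unfolding x h_smult_rep[OF a R.one_closed] by simp
qed

sublocale M: Module.module R M
  by (rule module_M)

lemma h_lincomb:
  assumes "finite I" "\<And>i. i \<in> I \<Longrightarrow> x i \<in> N" "\<And>i. i \<in> I \<Longrightarrow> sg (c i) = c i"
  shows "h (\<lambda>v. \<Sum>i\<in>I. c i * x i v) = (\<Oplus>\<^bsub>M\<^esub>i\<in>I. pr (c i) \<odot>\<^bsub>M\<^esub> h (x i))"
  using assms
proof (induction I rule: finite_induct)
  case (insert i I)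
  have m: "(\<lambda>v. c i * x i v) \<in> N" using insert by (intro smult_N) auto
  have s: "(\<lambda>v. \<Sum>i\<in>I. c i * x i v) \<in> N" using insert by (intro submod_lincomb[OF submod_N]) auto
  have "h (\<lambda>v. \<Sum>i\<in>insert i I. c i * x i v) = h (\<lambda>v. c i * x i v) \<oplus>\<^bsub>M\<^esub> h (\<lambda>v. \<Sum>i\<in>I. c i * x i v)"
    unfolding h_add[OF m s, symmetric] using insert.hyps by simp
  then show ?case using insert by (simp add: h_smult Pi_iff)
qed (simp add: h_0)

lemma free_if_is_basis:
  assumes B: "is_basis N B"
  shows "free_module R M"
proof -
  have fin: "finite B" and BN: "\<And>b. b \<in> B \<Longrightarrow> b \<in> N" using B by (auto simp: is_basis_def)
  have inj: "inj_on h B" using h_eq BN by (auto simp: inj_on_def)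
  have hB: "finite (h ` B)" "h ` B \<subseteq> carrier M" using fin BN by auto
  have lc: "M.lincomb a (h ` B) = h (\<lambda>v. \<Sum>b\<in>B. rep (a (h b)) * b v)" if a: "a \<in> h ` B \<rightarrow> carrier R" for a
  proof -
    have "M.lincomb a (h ` B) = (\<Oplus>\<^bsub>M\<^esub>b\<in>B. a (h b) \<odot>\<^bsub>M\<^esub> h b)"
      unfolding M.lincomb_def using a BN by (intro M.add.finprod_reindex inj) (auto simp: Pi_iff)
    also have "\<dots> = (\<Oplus>\<^bsub>M\<^esub>b\<in>B. pr (rep (a (h b))) \<odot>\<^bsub>M\<^esub> h b)"
      using a BN by (intro M.finsum_cong') (auto simp: Pi_iff)
    also have "\<dots> = h (\<lambda>v. \<Sum>b\<in>B. rep (a (h b)) * b v)" using fin BN by (intro h_lincomb[symmetric]) auto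
    finally show ?thesis .
  qed
  have "M.span (h ` B) = carrier M"
  proof (intro equalityI subsetI)
    fix y assume "y \<in> carrier M"
    then obtain x where x: "x \<in> N" "y = h x" using h_surj by blast
    from is_basis_rep[OF B x(1)] obtain c where
      c: "(\<forall>b. sg (c b) = c b) \<and> x = (\<lambda>v. \<Sum>b\<in>B. c b * b v)" ..
    define a where "a z = pr (c (inv_into B h z))" for z
    have "M.lincomb a (h ` B) = h (\<lambda>v. \<Sum>b\<in>B. rep (a (h b)) * b v)"
      by (rule lc) (auto simp: a_def)
    also have "(\<lambda>v. \<Sum>b\<in>B. rep (a (h b)) * b v) = (\<lambda>v. \<Sum>b\<in>B. c b * b v)"
      using c inj by (simp add: a_def)
    finally have "y = M.lincomb a (h ` B)" using x(2) conjunct2[OF c] by simp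
    then show "y \<in> M.span (h ` B)" using hB unfolding M.finite_span[OF hB] by (auto simp: a_def)
  qed (use M.span_is_subset2[OF hB(2)] in blast)
  moreover have "M.lin_indpt (h ` B)"
  proof (rule M.finite_lin_indpt2[OF hB], intro ballI)
    fix a z assume a: "a \<in> h ` B \<rightarrow> carrier R" "M.lincomb a (h ` B) = \<zero>\<^bsub>M\<^esub>" and "z \<in> h ` B"
    then obtain b where b: "b \<in> B" "z = h b" by blast
    let ?c = "\<lambda>b. rep (a (h b))"
    have "(\<lambda>v. \<Sum>b\<in>B. ?c b * b v) \<in> N" using fin BN by (intro submod_lincomb[OF submod_N]) auto
    moreover have "h (\<lambda>v. \<Sum>b\<in>B. ?c b * b v) = h (\<lambda>v. 0)" using a(2) lc[OF a(1)] h_0 by simp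
    ultimately have z: "(\<lambda>v. \<Sum>b\<in>B. ?c b * b v) = (\<lambda>v. 0)" using h_eq submod_0[OF submod_N] by blast
    have "?c b = 0"
    proof (rule is_basis_indep[OF B, of ?c])
      show "(\<Sum>b\<in>B. ?c b * b v) = 0" for v using fun_cong[OF z, of v] .
    qed (use b in auto)
    then show "a z = \<zero>" using a(1) b rep_eq_0 by blast
  qed
  ultimately show ?thesis unfolding free_module_def using module_M hB by blast
qed

text \<open>A given basis \<open>C\<close> might be infinite. The finitely many elements that span
  \<open>q * N\<close> involve only a finite part \<open>C0\<close> of it; for \<open>c\<close>
  outside \<open>C0\<close>, the multiple \<open>q * c\<close> would lie in the span of
  \<open>C0\<close>, against independence.\<close>

lemma is_basis_if_free:
  assumes N: "almost_generated N" and "free_module R M"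
  shows "\<exists>B. is_basis N B"
proof -
  obtain C where C: "C \<subseteq> carrier M" "M.lin_indpt C" "M.span C = carrier M"
    using assms(2) by (auto simp: free_module_def)
  obtain E q where E: "finite E" "E \<subseteq> N" "sg q = q" "q \<noteq> 0"
    "\<And>x. x \<in> N \<Longrightarrow> \<exists>c. (\<forall>e. sg (c e) = c e) \<and> (\<lambda>v. q * x v) = (\<lambda>v. \<Sum>e\<in>E. c e * e v)"
    using N unfolding almost_generated_def by blast
  have "\<forall>e\<in>E. \<exists>D. finite D \<and> D \<subseteq> C \<and> h e \<in> M.span D"
  proof
    fix e assume "e \<in> E"
    then have "h e \<in> M.span C" using E(2) C(3) by auto
    then obtain a D where "finite D" "D \<subseteq> C" "a \<in> D \<rightarrow> carrier R" "h e = M.lincomb a D" unfolding M.span_def by auto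
    then show "\<exists>D. finite D \<and> D \<subseteq> C \<and> h e \<in> M.span D" unfolding M.span_def by blast
  qed
  from bchoice[OF this] obtain D where D: "\<And>e. e \<in> E \<Longrightarrow> finite (D e) \<and> D e \<subseteq> C \<and> h e \<in> M.span (D e)" by blast
  define C0 where "C0 = (\<Union>e\<in>E. D e)"
  have C0: "finite C0" "C0 \<subseteq> C" unfolding C0_def using D E(1) by auto
  have C0M: "C0 \<subseteq> carrier M" using C0 C by blast
  have hE: "h e \<in> M.span C0" if "e \<in> E" for e
    using D[OF that] M.span_is_monotone[of "D e" C0] that by (auto simp: C0_def)
  interpret sp: LinearCombinations.submodule R "M.span C0" M by (rule M.span_is_submodule[OF C0M])
  have "C \<subseteq> C0"
  proof (rule ccontr)
    assume "\<not> C \<subseteq> C0"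
    then obtain c where c: "c \<in> C" "c \<notin> C0" by blast
    then obtain x where x: "x \<in> N" "c = h x" using h_surj C(1) by blast
    from E(5)[OF x(1)] obtain k where
      k: "(\<forall>e. sg (k e) = k e) \<and> (\<lambda>v. q * x v) = (\<lambda>v. \<Sum>e\<in>E. k e * e v)" ..
    have "pr q \<odot>\<^bsub>M\<^esub> c = h (\<lambda>v. \<Sum>e\<in>E. k e * e v)"
      unfolding x(2) h_smult[OF x(1) E(3), symmetric] conjunct2[OF k] ..
    also have "\<dots> = (\<Oplus>\<^bsub>M\<^esub>e\<in>E. pr (k e) \<odot>\<^bsub>M\<^esub> h e)"
      using E(1,2) k by (intro h_lincomb) auto
    also have "\<dots> \<in> M.span C0"
    proof -
      have "(\<Oplus>\<^bsub>M\<^esub>e\<in>E'. pr (k e) \<odot>\<^bsub>M\<^esub> h e) \<in> M.span C0" if "finite E'" "E' \<subseteq> E" for E'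
        using that
      proof (induction E' rule: finite_induct)
        case (insert e E')
        then have "(\<lambda>e. pr (k e) \<odot>\<^bsub>M\<^esub> h e) \<in> E' \<rightarrow> carrier M" "pr (k e) \<odot>\<^bsub>M\<^esub> h e \<in> carrier M" using E(2) by auto
        then show ?case using insert hE by simp
      qed simp
      then show ?thesis using E(1) by blast
    qed
    finally obtain a where a: "a \<in> C0 \<rightarrow> carrier R" "pr q \<odot>\<^bsub>M\<^esub> c = M.lincomb a C0"
      unfolding M.finite_span[OF C0(1) C0M] by blast
    let ?T = "insert c C0"
    have T: "finite ?T" "?T \<subseteq> C" using C0 c by auto
    define a1 where "a1 v = (if v = c then pr q else \<zero>)" for v
    define a2 where "a2 v = (if v = c then \<zero> else a v)" for v
    have a12: "a1 \<in> ?T \<rightarrow> carrier R" "a2 \<in> ?T \<rightarrow> carrier R" using a by (auto simp: a1_def a2_def)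
    have "M.lincomb a1 ?T = M.lincomb a1 {c}"
      using T C(1) a12 by (intro M.lincomb_extend) (auto simp: a1_def)
    also have "\<dots> = pr q \<odot>\<^bsub>M\<^esub> c"
      using c C(1) by (auto simp: M.lincomb_def a1_def)
    also have "\<dots> = M.lincomb a2 C0"
      unfolding a(2) using c C0M a(1) by (intro M.lincomb_cong) (auto simp: a2_def)
    also have "\<dots> = M.lincomb a2 ?T"
      using T C(1) a12 by (intro M.lincomb_extend[symmetric]) (auto simp: a2_def)
    finally have "a1 c = a2 c"
      by (intro M.lincomb_unique[OF C(2,1) T a12]) auto
    then show False using E(3,4) by (simp add: a1_def a2_def pr_eq_0)
  qed
  then have finC: "finite C" using C0(1) finite_subset by blast
  define g where "g = inv_into N h"
  have g: "g y \<in> N" "h (g y) = y" if "y \<in> carrier M" for y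
    using bij_h that unfolding g_def by (auto simp: bij_betw_def inv_into_into f_inv_into_f)
  have injg: "inj_on g C" using g C(1) by (metis inj_on_inverseI subsetD)
  have "is_basis N (g ` C)"
    unfolding is_basis_def
  proof (intro conjI ballI allI impI)
    show "finite (g ` C)" "g ` C \<subseteq> N" using finC g C(1) by auto
  next
    fix x assume x: "x \<in> N"
    then have "h x \<in> M.span C" using C(3) by simp
    then obtain a where a: "a \<in> C \<rightarrow> carrier R" "h x = M.lincomb a C" unfolding M.finite_span[OF finC C(1)] by blast
    let ?c = "\<lambda>b. rep (a (h b))"
    have "h (\<lambda>v. \<Sum>c\<in>C. rep (a c) * g c v) = (\<Oplus>\<^bsub>M\<^esub>c\<in>C. pr (rep (a c)) \<odot>\<^bsub>M\<^esub> h (g c))"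
      using finC g C(1) by (intro h_lincomb) auto
    also have "\<dots> = h x"
      unfolding a(2) M.lincomb_def using a(1) g C(1) by (intro M.finsum_cong') (auto simp: Pi_iff subset_iff)
    finally have e: "h (\<lambda>v. \<Sum>c\<in>C. rep (a c) * g c v) = h x" .
    have "(\<lambda>v. \<Sum>c\<in>C. rep (a c) * g c v) \<in> N"
      using g C(1) by (intro submod_lincomb[OF submod_N finC]) auto
    from e[unfolded h_eq[OF this x]] have "x = (\<lambda>v. \<Sum>c\<in>C. rep (a c) * g c v)" ..
    also have "\<dots> = (\<lambda>v. \<Sum>b\<in>g ` C. ?c b * b v)"
      using injg g C(1) by (auto simp: sum.reindex intro!: ext sum.cong)
    finally show "\<exists>c. (\<forall>b. sg (c b) = c b) \<and> x = (\<lambda>v. \<Sum>b\<in>g ` C. c b * b v)"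
      by (intro exI[of _ ?c]) simp
  next
    fix k b assume k: "\<forall>b\<in>g ` C. sg (k b) = k b" "\<forall>v. (\<Sum>b\<in>g ` C. k b * b v) = 0" and "b \<in> g ` C"
    then obtain c where c: "c \<in> C" "b = g c" by blast
    have "(\<Oplus>\<^bsub>M\<^esub>c\<in>C. pr (k (g c)) \<odot>\<^bsub>M\<^esub> c) = (\<Oplus>\<^bsub>M\<^esub>c\<in>C. pr (k (g c)) \<odot>\<^bsub>M\<^esub> h (g c))"
      using g C(1) by (intro M.finsum_cong') auto
    also have "\<dots> = h (\<lambda>v. \<Sum>c\<in>C. k (g c) * g c v)"
      using finC g C(1) k(1) by (intro h_lincomb[symmetric]) auto
    also have "(\<lambda>v. \<Sum>c\<in>C. k (g c) * g c v) = (\<lambda>v. 0)"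
      using k(2) injg by (simp add: sum.reindex)
    finally have z: "M.lincomb (\<lambda>c. pr (k (g c))) C = M.lincomb (\<lambda>c. \<zero>) C"
      using C(1) by (simp add: M.lincomb_def h_0 subset_iff cong: M.finsum_cong)
    have "pr (k (g c)) = \<zero>"
      by (rule M.lincomb_unique[OF C(2,1) finC order_refl _ _ z c(1)]) auto
    then show "k b = 0" using k(1) c by (simp add: pr_eq_0)
  qed
  then show ?thesis ..
qed

end

subsection \<open>Projective resolutions of length at most one\<close>

lemma Inf_enat_mem: "A \<noteq> {} \<Longrightarrow> Inf A \<in> (A :: enat set)"
  unfolding Inf_enat_def by (auto intro: LeastI)

section \<open>Dual bases of abstract projective modules\<close>

context ring_rep
begin

text \<open>The dual basis criterion for an abstract module. The functionals take their values among
  the polynomials fixed by \<open>sg\<close>, ready for use in \<open>dual_basis\<close>.\<close>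

definition pdual :: "('r, 'm, 't) module_scheme \<Rightarrow> 'i set \<Rightarrow> ('i \<Rightarrow> 'm \<Rightarrow> ('k, 'n) mpoly) \<Rightarrow> ('i \<Rightarrow> 'm) \<Rightarrow> bool" where
  "pdual M I f n \<longleftrightarrow> (\<forall>i\<in>I. n i \<in> carrier M) \<and>
     (\<forall>i\<in>I. \<forall>x\<in>carrier M. sg (f i x) = f i x) \<and>
     (\<forall>i\<in>I. \<forall>x\<in>carrier M. \<forall>y\<in>carrier M. f i (x \<oplus>\<^bsub>M\<^esub> y) = f i x + f i y) \<and>
     (\<forall>i\<in>I. \<forall>r\<in>carrier R. \<forall>x\<in>carrier M. f i (r \<odot>\<^bsub>M\<^esub> x) = rep r * f i x) \<and>
     (\<forall>x\<in>carrier M. finite {i\<in>I. f i x \<noteq> 0} \<and>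
        x = (\<Oplus>\<^bsub>M\<^esub>i\<in>{i\<in>I. f i x \<noteq> 0}. pr (f i x) \<odot>\<^bsub>M\<^esub> n i))"

lemma pdualD:
  assumes "pdual M I f n"
  shows "i \<in> I \<Longrightarrow> n i \<in> carrier M"
    "i \<in> I \<Longrightarrow> x \<in> carrier M \<Longrightarrow> sg (f i x) = f i x"
    "i \<in> I \<Longrightarrow> x \<in> carrier M \<Longrightarrow> y \<in> carrier M \<Longrightarrow> f i (x \<oplus>\<^bsub>M\<^esub> y) = f i x + f i y"
    "i \<in> I \<Longrightarrow> r \<in> carrier R \<Longrightarrow> x \<in> carrier M \<Longrightarrow> f i (r \<odot>\<^bsub>M\<^esub> x) = rep r * f i x"
    "x \<in> carrier M \<Longrightarrow> finite {i\<in>I. f i x \<noteq> 0}"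
    "x \<in> carrier M \<Longrightarrow> x = (\<Oplus>\<^bsub>M\<^esub>i\<in>{i\<in>I. f i x \<noteq> 0}. pr (f i x) \<odot>\<^bsub>M\<^esub> n i)"
  using assms unfolding pdual_def by blast+

text \<open>The coordinates of the free module are composed with the inclusion, and the basis is
  mapped by the retraction.\<close>

lemma pdual_if_projective:
  assumes "projective_module R P"
  shows "\<exists>(I :: ('m \<Rightarrow> 'r) set) f n. pdual (P :: ('r, 'm) module) I f n"
proof -
  obtain F :: "('r, 'm \<Rightarrow> 'r) module" and i p where F: "free_module R F" and i: "mod_hom R P F i"
    and p: "mod_hom R F P p" and pi: "\<And>x. x \<in> carrier P \<Longrightarrow> p (i x) = x"
    using assms unfolding projective_module_def by blast
  interpret F: Module.module R F using F by (simp add: free_module_def)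
  interpret i: mod_hom R P F i by (rule i)
  interpret p: mod_hom R F P p by (rule p)
  obtain C where C: "C \<subseteq> carrier F" "F.lin_indpt C" "F.span C = carrier F"
    using F by (auto simp: free_module_def)
  obtain g where g: "\<And>c x. c \<in> C \<Longrightarrow> x \<in> carrier F \<Longrightarrow> g c x \<in> carrier R"
    "\<And>c x y. c \<in> C \<Longrightarrow> x \<in> carrier F \<Longrightarrow> y \<in> carrier F \<Longrightarrow> g c (x \<oplus>\<^bsub>F\<^esub> y) = g c x \<oplus> g c y"
    "\<And>c r x. c \<in> C \<Longrightarrow> r \<in> carrier R \<Longrightarrow> x \<in> carrier F \<Longrightarrow> g c (r \<odot>\<^bsub>F\<^esub> x) = r \<otimes> g c x"
    "\<And>x. x \<in> carrier F \<Longrightarrow> finite {c \<in> C. g c x \<noteq> \<zero>} \<and> x = F.lincomb (\<lambda>c. g c x) {c \<in> C. g c x \<noteq> \<zero>}"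
    using F.free_coords[OF C] by blast
  define f where "f c x = rep (g c (i x))" for c x
  have f0: "f c x = 0 \<longleftrightarrow> g c (i x) = \<zero>" if "c \<in> C" "x \<in> carrier P" for c x
    using g(1)[OF that(1)] that(2) by (simp add: f_def rep_eq_0)
  have "pdual P C f p"
    unfolding pdual_def
  proof (intro conjI ballI)
    fix x assume x: "x \<in> carrier P"
    have eq: "{c \<in> C. f c x \<noteq> 0} = {c \<in> C. g c (i x) \<noteq> \<zero>}" using f0 x by auto
    have gx: "finite {c \<in> C. g c (i x) \<noteq> \<zero>}"
      "i x = F.lincomb (\<lambda>c. g c (i x)) {c \<in> C. g c (i x) \<noteq> \<zero>}"
      using g(4)[of "i x"] x by auto
    then show "finite {c \<in> C. f c x \<noteq> 0}" by (simp add: eq)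
    have "x = p (i x)" using pi[OF x] ..
    also have "\<dots> = p (F.lincomb (\<lambda>c. g c (i x)) {c \<in> C. g c (i x) \<noteq> \<zero>})" using gx(2) by simp
    also have "\<dots> = (\<Oplus>\<^bsub>P\<^esub>c\<in>{c \<in> C. g c (i x) \<noteq> \<zero>}. g c (i x) \<odot>\<^bsub>P\<^esub> p c)"
      unfolding F.lincomb_def using gx(1) C(1) g(1) x by (intro p.hom_lincomb) auto
    also have "\<dots> = (\<Oplus>\<^bsub>P\<^esub>c\<in>{c \<in> C. f c x \<noteq> 0}. pr (f c x) \<odot>\<^bsub>P\<^esub> p c)"
      unfolding eq using g(1) x C(1) by (intro i.M.M.finsum_cong') (auto simp: f_def)
    finally show "x = (\<Oplus>\<^bsub>P\<^esub>c\<in>{c \<in> C. f c x \<noteq> 0}. pr (f c x) \<odot>\<^bsub>P\<^esub> p c)" .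
  qed (use C(1) g in \<open>auto simp: f_def rep_add rep_mult\<close>)
  then show ?thesis by blast
qed

definition semilinear :: "('r, 'm, 't) module_scheme \<Rightarrow> ('m \<Rightarrow> 'a \<Rightarrow> ('k, 'n) mpoly) \<Rightarrow> bool" where
  "semilinear M g \<longleftrightarrow> (\<forall>x\<in>carrier M. \<forall>y\<in>carrier M. g (x \<oplus>\<^bsub>M\<^esub> y) = (\<lambda>v. g x v + g y v)) \<and>
     (\<forall>r\<in>carrier R. \<forall>x\<in>carrier M. g (r \<odot>\<^bsub>M\<^esub> x) = (\<lambda>v. rep r * g x v))"

lemma semilinear_lincomb:
  assumes M: "Module.module R M" and g: "semilinear M g"
    and "finite I" "\<And>i. i \<in> I \<Longrightarrow> sg (c i) = c i" "\<And>i. i \<in> I \<Longrightarrow> x i \<in> carrier M"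
  shows "g (\<Oplus>\<^bsub>M\<^esub>i\<in>I. pr (c i) \<odot>\<^bsub>M\<^esub> x i) = (\<lambda>v. \<Sum>i\<in>I. c i * g (x i) v)"
proof -
  interpret M: Module.module R M by (rule M)
  show ?thesis
    using assms(3-)
  proof (induction I rule: finite_induct)
    case empty
    have "g (\<zero> \<odot>\<^bsub>M\<^esub> \<zero>\<^bsub>M\<^esub>) = (\<lambda>v. rep \<zero> * g \<zero>\<^bsub>M\<^esub> v)"
      using g unfolding semilinear_def by (meson R.zero_closed M.zero_closed)
    then show ?case by simp
  next
    case (insert i I)
    have s: "(\<Oplus>\<^bsub>M\<^esub>i\<in>I. pr (c i) \<odot>\<^bsub>M\<^esub> x i) \<in> carrier M" using insert by (intro M.finsum_closed) auto
    have m: "pr (c i) \<odot>\<^bsub>M\<^esub> x i \<in> carrier M" using insert by simp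
    have "(\<Oplus>\<^bsub>M\<^esub>i\<in>insert i I. pr (c i) \<odot>\<^bsub>M\<^esub> x i) = pr (c i) \<odot>\<^bsub>M\<^esub> x i \<oplus>\<^bsub>M\<^esub> (\<Oplus>\<^bsub>M\<^esub>i\<in>I. pr (c i) \<odot>\<^bsub>M\<^esub> x i)"
      using insert by (simp add: Pi_iff)
    moreover have "g (pr (c i) \<odot>\<^bsub>M\<^esub> x i \<oplus>\<^bsub>M\<^esub> (\<Oplus>\<^bsub>M\<^esub>i\<in>I. pr (c i) \<odot>\<^bsub>M\<^esub> x i)) =
        (\<lambda>v. g (pr (c i) \<odot>\<^bsub>M\<^esub> x i) v + g (\<Oplus>\<^bsub>M\<^esub>i\<in>I. pr (c i) \<odot>\<^bsub>M\<^esub> x i) v)"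
      using g m s by (simp add: semilinear_def)
    moreover have "g (pr (c i) \<odot>\<^bsub>M\<^esub> x i) = (\<lambda>v. c i * g (x i) v)"
      using g insert.prems by (simp add: semilinear_def)
    ultimately show ?case using insert by simp
  qed
qed

text \<open>The elements \<open>y i\<close> may be prescribed freely: this is the extension of an
  assignment on the dual basis to a linear map. The supports vary with the argument and are enlarged
  to a common finite set.\<close>

lemma semilinear_pdual:
  assumes M: "Module.module R M" and d: "pdual M I f n"
  shows "semilinear M (\<lambda>x v. \<Sum>i\<in>{i\<in>I. f i x \<noteq> 0}. f i x * y i v)"
proof -
  interpret M: Module.module R M by (rule M)
  have T: "(\<Sum>i\<in>{i\<in>I. f i x \<noteq> 0}. f i x * y i v) = (\<Sum>i\<in>T. f i x * y i v)"
    if "finite T" "{i\<in>I. f i x \<noteq> 0} \<subseteq> T" "T \<subseteq> I" for x v T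
    using that by (intro sum.mono_neutral_left) auto
  show ?thesis
    unfolding semilinear_def
  proof (intro conjI ballI ext)
    fix x z v assume x: "x \<in> carrier M" and z: "z \<in> carrier M"
    let ?T = "{i\<in>I. f i x \<noteq> 0} \<union> {i\<in>I. f i z \<noteq> 0}"
    have fin: "finite ?T" using pdualD(5)[OF d x] pdualD(5)[OF d z] by simp
    have a: "f i (x \<oplus>\<^bsub>M\<^esub> z) = f i x + f i z" if "i \<in> I" for i using pdualD(3)[OF d that x z] .
    have s: "{i\<in>I. f i (x \<oplus>\<^bsub>M\<^esub> z) \<noteq> 0} \<subseteq> ?T" by (auto simp: a)
    show "(\<Sum>i\<in>{i\<in>I. f i (x \<oplus>\<^bsub>M\<^esub> z) \<noteq> 0}. f i (x \<oplus>\<^bsub>M\<^esub> z) * y i v) =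
        (\<Sum>i\<in>{i\<in>I. f i x \<noteq> 0}. f i x * y i v) + (\<Sum>i\<in>{i\<in>I. f i z \<noteq> 0}. f i z * y i v)"
      using T[OF fin s, of v] T[OF fin, of x v] T[OF fin, of z v]
      by (auto simp: a distrib_right simp flip: sum.distrib intro!: sum.cong)
  next
    fix r x v assume r: "r \<in> carrier R" and x: "x \<in> carrier M"
    have fin: "finite {i\<in>I. f i x \<noteq> 0}" using pdualD(5)[OF d x] .
    have a: "f i (r \<odot>\<^bsub>M\<^esub> x) = rep r * f i x" if "i \<in> I" for i using pdualD(4)[OF d that r x] .
    have s: "{i\<in>I. f i (r \<odot>\<^bsub>M\<^esub> x) \<noteq> 0} \<subseteq> {i\<in>I. f i x \<noteq> 0}" by (auto simp: a)
    show "(\<Sum>i\<in>{i\<in>I. f i (r \<odot>\<^bsub>M\<^esub> x) \<noteq> 0}. f i (r \<odot>\<^bsub>M\<^esub> x) * y i v) =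
        rep r * (\<Sum>i\<in>{i\<in>I. f i x \<noteq> 0}. f i x * y i v)"
      unfolding T[OF fin s Collect_restrict] sum_distrib_left
      by (intro sum.cong refl) (simp add: a mult.assoc)
  qed
qed

section \<open>Evaluation at generators, and Schanuel's lemma\<close>

definition evalm :: "('r, 'm, 't) module_scheme \<Rightarrow> 'a set \<Rightarrow> ('a \<Rightarrow> 'm) \<Rightarrow> ('a \<Rightarrow> ('k, 'n) mpoly) \<Rightarrow> 'm" where
  "evalm M B y k = (\<Oplus>\<^bsub>M\<^esub>b\<in>B. pr (k b) \<odot>\<^bsub>M\<^esub> y b)"

lemma evalm_closed:
  assumes "Module.module R M" "\<And>b. b \<in> B \<Longrightarrow> y b \<in> carrier M"
  shows "evalm M B y k \<in> carrier M"
proof -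
  interpret M: Module.module R M by fact
  show ?thesis unfolding evalm_def using assms(2) by (intro M.finsum_closed) auto
qed

lemma evalm_add:
  assumes "Module.module R M" "\<And>b. b \<in> B \<Longrightarrow> y b \<in> carrier M"
  shows "evalm M B y (\<lambda>b. k b + k' b) = evalm M B y k \<oplus>\<^bsub>M\<^esub> evalm M B y k'"
proof -
  interpret M: Module.module R M by fact
  have "evalm M B y (\<lambda>b. k b + k' b) = (\<Oplus>\<^bsub>M\<^esub>b\<in>B. pr (k b) \<odot>\<^bsub>M\<^esub> y b \<oplus>\<^bsub>M\<^esub> pr (k' b) \<odot>\<^bsub>M\<^esub> y b)"
    unfolding evalm_def using assms(2) by (intro M.finsum_cong') (auto simp: pr_add M.smult_l_distr)
  then show ?thesis unfolding evalm_def using assms(2) by (simp add: M.finsum_addf Pi_iff)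
qed

lemma evalm_smult:
  assumes "Module.module R M" "\<And>b. b \<in> B \<Longrightarrow> y b \<in> carrier M" "finite B"
  shows "evalm M B y (\<lambda>b. r * k b) = pr r \<odot>\<^bsub>M\<^esub> evalm M B y k"
proof -
  interpret M: Module.module R M by fact
  have "evalm M B y (\<lambda>b. r * k b) = (\<Oplus>\<^bsub>M\<^esub>b\<in>B. pr r \<odot>\<^bsub>M\<^esub> (pr (k b) \<odot>\<^bsub>M\<^esub> y b))"
    unfolding evalm_def using assms(2) by (intro M.finsum_cong') (auto simp: pr_mult M.smult_assoc1)
  then show ?thesis unfolding evalm_def using assms(2,3) by (simp add: M.finsum_smult_ldistr Pi_iff)
qed

lemma evalm_lincomb:
  assumes M: "Module.module R M" and y: "\<And>b. b \<in> B \<Longrightarrow> y b \<in> carrier M" and "finite B" "finite I"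
  shows "evalm M B y (\<lambda>b. \<Sum>i\<in>I. c i * k i b) = (\<Oplus>\<^bsub>M\<^esub>i\<in>I. pr (c i) \<odot>\<^bsub>M\<^esub> evalm M B y (k i))"
  using assms(4)
proof (induction I rule: finite_induct)
  case empty
  interpret M: Module.module R M by fact
  show ?case unfolding evalm_def using y by (simp add: pr_0 M.add.finprod_one_eqI)
next
  case (insert i I)
  interpret M: Module.module R M by fact
  have "evalm M B y (\<lambda>b. \<Sum>i\<in>insert i I. c i * k i b) = evalm M B y (\<lambda>b. c i * k i b + (\<Sum>i\<in>I. c i * k i b))"
    using insert.hyps by simp
  also have "\<dots> = evalm M B y (\<lambda>b. c i * k i b) \<oplus>\<^bsub>M\<^esub> evalm M B y (\<lambda>b. \<Sum>i\<in>I. c i * k i b)"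
    by (rule evalm_add[OF M]) (rule y)
  also have "evalm M B y (\<lambda>b. c i * k i b) = pr (c i) \<odot>\<^bsub>M\<^esub> evalm M B y (k i)"
    by (rule evalm_smult[OF M _ assms(3)]) (rule y)
  also have "pr (c i) \<odot>\<^bsub>M\<^esub> evalm M B y (k i) \<oplus>\<^bsub>M\<^esub> evalm M B y (\<lambda>b. \<Sum>i\<in>I. c i * k i b) =
      (\<Oplus>\<^bsub>M\<^esub>i\<in>insert i I. pr (c i) \<odot>\<^bsub>M\<^esub> evalm M B y (k i))"
    unfolding insert.IH using insert.hyps evalm_closed[OF M, of B y] y by (simp add: Pi_iff)
  finally show ?case .
qed


text \<open>The kernel of the evaluation on the free module on \<open>B\<close>. Coefficients vanish
  outside \<open>B\<close>, as otherwise arbitrary values there would enlarge the kernel.\<close>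

definition relations :: "('r, 'm, 't) module_scheme \<Rightarrow> 'a set \<Rightarrow> ('a \<Rightarrow> 'm) \<Rightarrow> ('a \<Rightarrow> ('k, 'n) mpoly) set" where
  "relations M B y = {k. (\<forall>b. sg (k b) = k b) \<and> (\<forall>b. b \<notin> B \<longrightarrow> k b = 0) \<and> evalm M B y k = \<zero>\<^bsub>M\<^esub>}"

definition generates :: "('r, 'm, 't) module_scheme \<Rightarrow> 'a set \<Rightarrow> ('a \<Rightarrow> 'm) \<Rightarrow> bool" where
  "generates M B y \<longleftrightarrow> (\<forall>b\<in>B. y b \<in> carrier M) \<and>
     (\<forall>z\<in>carrier M. \<exists>k. (\<forall>b. sg (k b) = k b) \<and> (\<forall>b. b \<notin> B \<longrightarrow> k b = 0) \<and> evalm M B y k = z)"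

text \<open>Schanuel's lemma: the relations between generators of \<open>M\<close> are a retract of \<open>P1 \<oplus> R^B\<close>.\<close>

lemma schanuel:
  assumes finB: "finite B" and gen: "generates M B y"
    and e: "mod_hom R P0 M e" "e ` carrier P0 = carrier M"
    and d: "mod_hom R P1 P0 d" "inj_on d (carrier P1)" "{x \<in> carrier P0. e x = \<zero>\<^bsub>M\<^esub>} = d ` carrier P1"
    and d0: "pdual P0 I0 f0 n0" and d1: "pdual P1 I1 f1 n1"
  shows "\<exists>f n. dual_basis (relations M B y) (Inl ` I1 \<union> Inr ` B) f n"
proof -
  interpret e: mod_hom R P0 M e by (rule e(1))
  interpret d: mod_hom R P1 P0 d by (rule d(1))
  have Mm: "Module.module R M" and P0m: "Module.module R P0" and P1m: "Module.module R P1"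
    by (rule e.N.module_axioms e.M.module_axioms d.M.module_axioms)+
  let ?pi = "evalm M B y"
  have yM: "y b \<in> carrier M" if "b \<in> B" for b using gen that by (simp add: generates_def)
  have pi_add: "?pi (\<lambda>v. k v + k' v) = ?pi k \<oplus>\<^bsub>M\<^esub> ?pi k'" for k k'
    by (rule evalm_add[OF Mm]) (rule yM)
  have pi_smult: "?pi (\<lambda>v. r * k v) = pr r \<odot>\<^bsub>M\<^esub> ?pi k" for r k
    by (rule evalm_smult[OF Mm _ finB]) (rule yM)
  have pi_lincomb: "?pi (\<lambda>v. \<Sum>i\<in>I. c i * k i v) = (\<Oplus>\<^bsub>M\<^esub>i\<in>I. pr (c i) \<odot>\<^bsub>M\<^esub> ?pi (k i))" if "finite I" for I c k
    by (rule evalm_lincomb[OF Mm _ finB that]) (rule yM)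
  define Fr where "Fr = {k :: 'a \<Rightarrow> ('k, 'n) mpoly. (\<forall>b. sg (k b) = k b) \<and> (\<forall>b. b \<notin> B \<longrightarrow> k b = 0)}"
  have "\<forall>i\<in>I0. \<exists>k. k \<in> Fr \<and> ?pi k = e (n0 i)"
    using gen pdualD(1)[OF d0] e.f_im unfolding generates_def Fr_def by blast
  from bchoice[OF this] obtain y0 where y0: "\<And>i. i \<in> I0 \<Longrightarrow> y0 i \<in> Fr" "\<And>i. i \<in> I0 \<Longrightarrow> ?pi (y0 i) = e (n0 i)"
    by blast
  \<comment> \<open>Projectivity of \<open>P0\<close> lifts \<open>e\<close> to a map into the free
    module on \<open>B\<close>. The map \<open>bm\<close> below goes the other way and lifts the
    evaluation through \<open>e\<close>.\<close>
  define a where "a x = (\<lambda>v. \<Sum>i\<in>{i\<in>I0. f0 i x \<noteq> 0}. f0 i x * y0 i v)" for x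
  have a_lin: "semilinear P0 a" unfolding a_def by (rule semilinear_pdual[OF P0m d0])
  have a_Fr: "a x \<in> Fr" if "x \<in> carrier P0" for x
    using y0(1) pdualD(2)[OF d0 _ that] unfolding Fr_def a_def
    by (auto simp: elim_sum intro!: sum.cong sum.neutral)
  have pi_a: "?pi (a x) = e x" if x: "x \<in> carrier P0" for x
  proof -
    let ?S = "{i\<in>I0. f0 i x \<noteq> 0}"
    have fin: "finite ?S" by (rule pdualD(5)[OF d0 x])
    have "?pi (a x) = (\<Oplus>\<^bsub>M\<^esub>i\<in>?S. pr (f0 i x) \<odot>\<^bsub>M\<^esub> ?pi (y0 i))"
      unfolding a_def by (rule pi_lincomb[OF fin])
    also have "\<dots> = (\<Oplus>\<^bsub>M\<^esub>i\<in>?S. pr (f0 i x) \<odot>\<^bsub>M\<^esub> e (n0 i))"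
      using y0(2) pdualD(1)[OF d0] by (intro e.N.M.finsum_cong') auto
    also have "\<dots> = e (\<Oplus>\<^bsub>P0\<^esub>i\<in>?S. pr (f0 i x) \<odot>\<^bsub>P0\<^esub> n0 i)"
      using fin pdualD(1)[OF d0] by (intro e.hom_lincomb[symmetric]) auto
    also have "\<dots> = e x" using pdualD(6)[OF d0 x] by simp
    finally show ?thesis .
  qed
  have "\<forall>b\<in>B. \<exists>z. z \<in> carrier P0 \<and> e z = y b" using yM e(2) by (metis imageE)
  from bchoice[OF this] obtain z where z: "\<And>b. b \<in> B \<Longrightarrow> z b \<in> carrier P0" "\<And>b. b \<in> B \<Longrightarrow> e (z b) = y b" by blast
  define bm where "bm = evalm P0 B z"
  have bmP0: "bm k \<in> carrier P0" for k unfolding bm_def by (rule evalm_closed[OF P0m]) (rule z(1))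
  have bm_add: "bm (\<lambda>v. k v + k' v) = bm k \<oplus>\<^bsub>P0\<^esub> bm k'" for k k'
    unfolding bm_def by (rule evalm_add[OF P0m]) (rule z(1))
  have bm_smult: "bm (\<lambda>v. r * k v) = pr r \<odot>\<^bsub>P0\<^esub> bm k" for r k
    unfolding bm_def by (rule evalm_smult[OF P0m _ finB]) (rule z(1))
  have e_bm: "e (bm k) = ?pi k" for k
  proof -
    have "e (bm k) = (\<Oplus>\<^bsub>M\<^esub>b\<in>B. pr (k b) \<odot>\<^bsub>M\<^esub> e (z b))"
      unfolding bm_def evalm_def using finB z(1) by (intro e.hom_lincomb) auto
    also have "\<dots> = ?pi k" unfolding evalm_def using z(2) yM by (intro e.N.M.finsum_cong') auto
    finally show ?thesis .
  qed
  let ?K = "relations M B y"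
  \<comment> \<open>For a relation \<open>k\<close> the element \<open>bm k\<close> is killed by
    \<open>e\<close>, hence comes from a unique element of \<open>P1\<close>.\<close>
  define u where "u k = inv_into (carrier P1) d (bm k)" for k
  have u: "u k \<in> carrier P1" "d (u k) = bm k" if "k \<in> ?K" for k
  proof -
    have "bm k \<in> d ` carrier P1" using d(3) bmP0 e_bm that by (auto simp: relations_def)
    then show "u k \<in> carrier P1" "d (u k) = bm k" unfolding u_def by (auto intro: inv_into_into f_inv_into_f)
  qed
  have u_eq: "u k = x" if "k \<in> ?K" "x \<in> carrier P1" "d x = bm k" for k x
    by (rule inj_onD[OF d(2)]) (use u[OF that(1)] that(2,3) in simp_all)
  define del where "del b v = (if v = b then 1 else 0 :: ('k, 'n) mpoly)" for b v :: 'a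
  define f where "f i k = (case i of Inl i \<Rightarrow> f1 i (u k) | Inr b \<Rightarrow> k b)" for i k
  \<comment> \<open>A relation decomposes as \<open>a (d (u k))\<close> plus the difference of
    \<open>k\<close> and \<open>a (bm k)\<close>. The first summand is expanded with the dual basis
    of \<open>P1\<close>, the second with the unit vectors of the free module on
    \<open>B\<close>.\<close>
  define n where "n i = (case i of Inl i \<Rightarrow> a (d (n1 i)) | Inr b \<Rightarrow> (\<lambda>v. del b v + - 1 * a (z b) v))" for i
  have K_sub: "k \<in> Fr" if "k \<in> ?K" for k using that by (simp add: relations_def Fr_def)
  have subK: "submod ?K"
    unfolding submod_def
  proof (intro conjI ballI allI impI)
    show "(\<lambda>_. 0) \<in> ?K" using pi_smult[of 0 "\<lambda>_. 0"] evalm_closed[OF Mm, of B y] yM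
      by (simp add: relations_def pr_0)
  next
    fix k k' assume "k \<in> ?K" "k' \<in> ?K"
    then show "(\<lambda>v. k v + k' v) \<in> ?K" by (simp add: relations_def pi_add)
  next
    fix r k assume "k \<in> ?K" "sg r = r"
    then show "(\<lambda>v. r * k v) \<in> ?K" by (simp add: relations_def pi_smult)
  qed (simp add: relations_def)
  have pi_del: "?pi (del b) = y b" if b: "b \<in> B" for b
  proof -
    have "?pi (del b) = (\<Oplus>\<^bsub>M\<^esub>b'\<in>B. if b = b' then y b' else \<zero>\<^bsub>M\<^esub>)"
      unfolding evalm_def using yM by (intro e.N.M.finsum_cong') (auto simp: del_def pr_1 pr_0)
    then show ?thesis using b finB yM by (simp add: e.N.M.finsum_singleton Pi_iff)
  qed
  have nK: "n i \<in> ?K" if "i \<in> Inl ` I1 \<union> Inr ` B" for i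
    using that
  proof
    assume "i \<in> Inl ` I1"
    then obtain j where j: "j \<in> I1" "i = Inl j" by blast
    have dP: "d (n1 j) \<in> carrier P0" using pdualD(1)[OF d1 j(1)] by simp
    have "d (n1 j) \<in> {x \<in> carrier P0. e x = \<zero>\<^bsub>M\<^esub>}" using d(3) pdualD(1)[OF d1 j(1)] by blast
    then show ?thesis using a_Fr[OF dP] pi_a[OF dP] j(2) by (simp add: n_def relations_def Fr_def)
  next
    assume "i \<in> Inr ` B"
    then obtain b where b: "b \<in> B" "i = Inr b" by blast
    have "?pi (\<lambda>v. del b v + - 1 * a (z b) v) = y b \<oplus>\<^bsub>M\<^esub> pr (- 1) \<odot>\<^bsub>M\<^esub> y b"
      unfolding pi_add pi_smult pi_del[OF b(1)] pi_a[OF z(1)[OF b(1)]] z(2)[OF b(1)] ..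
    also have "\<dots> = \<zero>\<^bsub>M\<^esub>"
      using yM[OF b(1)] by (simp add: pr_uminus pr_1 e.N.smult_l_minus e.N.M.r_neg)
    finally show ?thesis using a_Fr[OF z(1)[OF b(1)]] b by (auto simp: n_def relations_def Fr_def del_def)
  qed
  have f_lin: "linear_functional ?K (f i)" if "i \<in> Inl ` I1 \<union> Inr ` B" for i
    using that
  proof
    assume "i \<in> Inl ` I1"
    then obtain j where j: "j \<in> I1" "i = Inl j" by blast
    show ?thesis
      unfolding linear_functional_def
    proof (intro conjI ballI allI impI)
      fix k assume "k \<in> ?K"
      then show "sg (f i k) = f i k" using pdualD(2)[OF d1 j(1)] u by (simp add: f_def j(2))
    next
      fix k k' assume k: "k \<in> ?K" and k': "k' \<in> ?K"
      have "u (\<lambda>v. k v + k' v) = u k \<oplus>\<^bsub>P1\<^esub> u k'"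
        using submod_add[OF subK k k'] u[OF k] u[OF k']
        by (intro u_eq) (auto simp: bm_add)
      then show "f i (\<lambda>v. k v + k' v) = f i k + f i k'"
        using pdualD(3)[OF d1 j(1)] u(1)[OF k] u(1)[OF k'] by (simp add: f_def j(2))
    next
      fix r k assume k: "k \<in> ?K" and r: "sg r = r"
      have "u (\<lambda>v. r * k v) = pr r \<odot>\<^bsub>P1\<^esub> u k"
        using submod_smult[OF subK k r] u[OF k]
        by (intro u_eq) (auto simp: bm_smult)
      then show "f i (\<lambda>v. r * k v) = r * f i k"
        using pdualD(4)[OF d1 j(1), of "pr r"] u(1)[OF k] r by (simp add: f_def j(2))
    qed
  next
    assume "i \<in> Inr ` B"
    then show ?thesis by (auto simp: linear_functional_def f_def relations_def)
  qed
  have "dual_basis ?K (Inl ` I1 \<union> Inr ` B) f n"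
    unfolding dual_basis_def
  proof (intro conjI ballI)
    fix k assume k: "k \<in> ?K"
    let ?S1 = "{i\<in>I1. f1 i (u k) \<noteq> 0}" and ?T = "{i \<in> Inl ` I1 \<union> Inr ` B. f i k \<noteq> 0}"
    have fin1: "finite ?S1" by (rule pdualD(5)[OF d1 u(1)[OF k]])
    have sub: "?T \<subseteq> Inl ` ?S1 \<union> Inr ` B" by (auto simp: f_def)
    show "finite ?T" by (rule finite_subset[OF sub]) (use fin1 finB in auto)
    have kc: "sg (k b) = k b" "b \<notin> B \<Longrightarrow> k b = 0" for b using k by (auto simp: relations_def)
    show "k = (\<lambda>v. \<Sum>i\<in>?T. f i k * n i v)"
    proof
      fix v
      have "a (d (u k)) v = a (d (\<Oplus>\<^bsub>P1\<^esub>i\<in>?S1. pr (f1 i (u k)) \<odot>\<^bsub>P1\<^esub> n1 i)) v"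
        using pdualD(6)[OF d1 u(1)[OF k]] by simp
      also have "\<dots> = (\<Sum>i\<in>?S1. f1 i (u k) * a (d (n1 i)) v)"
        using semilinear_lincomb[OF P1m, of "\<lambda>x. a (d x)" ?S1 "\<lambda>i. f1 i (u k)" n1] a_lin fin1
          pdualD(1,2)[OF d1] u(1)[OF k] by (simp add: semilinear_def)
      finally have 1: "a (bm k) v = (\<Sum>i\<in>?S1. f1 i (u k) * a (d (n1 i)) v)" using u(2)[OF k] by simp
      have 2: "a (bm k) v = (\<Sum>b\<in>B. k b * a (z b) v)"
        unfolding bm_def evalm_def using semilinear_lincomb[OF P0m a_lin finB, of k z] kc z(1) by simp
      have 3: "k v = (\<Sum>b\<in>B. k b * del b v)"
      proof -
        have "(\<Sum>b\<in>B. k b * del b v) = (\<Sum>b\<in>B. if b = v then k v else 0)"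
          by (rule sum.cong) (auto simp: del_def)
        then show ?thesis using finB kc(2)[of v] by auto
      qed
      have "(\<Sum>i\<in>?T. f i k * n i v) = (\<Sum>i\<in>Inl ` ?S1 \<union> Inr ` B. f i k * n i v)"
        using sub fin1 finB by (intro sum.mono_neutral_left) auto
      also have "\<dots> = (\<Sum>i\<in>Inl ` ?S1. f i k * n i v) + (\<Sum>i\<in>Inr ` B. f i k * n i v)"
        using fin1 finB by (intro sum.union_disjoint) auto
      also have "(\<Sum>i\<in>Inl ` ?S1. f i k * n i v) = a (bm k) v"
        by (subst sum.reindex) (auto simp: f_def n_def 1)
      also have "(\<Sum>i\<in>Inr ` B. f i k * n i v) = k v - a (bm k) v"
        by (subst sum.reindex) (auto simp: f_def n_def 2 right_diff_distrib sum_subtractf simp flip: 3)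
      finally show "k v = (\<Sum>i\<in>?T. f i k * n i v)" by simp
    qed
  qed (use nK f_lin in auto)
  then show ?thesis by blast
qed

section \<open>Projective dimension zero and one\<close>

lemma proj_dim_leD:
  assumes "proj_dim R (M :: ('r, 'm) module) \<le> enat n"
  shows "\<exists>(P :: nat \<Rightarrow> ('r, ('r \<times> 'm) list \<Rightarrow> 'r) module) d e.
    projective_resolution R M P d e \<and> (\<forall>i>n. carrier (P i) = {\<zero>\<^bsub>P i\<^esub>})"
proof -
  let ?Q = "\<lambda>n. \<exists>(P :: nat \<Rightarrow> ('r, ('r \<times> 'm) list \<Rightarrow> 'r) module) d e.
    projective_resolution R M P d e \<and> (\<forall>i>n. carrier (P i) = {\<zero>\<^bsub>P i\<^esub>})"
  let ?S = "{enat n | n. ?Q n}"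
  have le: "Inf ?S \<le> enat n" using assms by (simp only: proj_dim_def)
  then have "?S \<noteq> {}" unfolding Inf_enat_def by (auto split: if_splits)
  then have "Inf ?S \<in> ?S" by (rule Inf_enat_mem)
  then obtain m where m: "Inf ?S = enat m" "?Q m" by blast
  have "m \<le> n" using le unfolding m(1) by simp
  from m(2) show ?thesis
  proof (elim exE conjE, intro exI conjI)
    fix P :: "nat \<Rightarrow> ('r, ('r \<times> 'm) list \<Rightarrow> 'r) module" and d e
    assume "\<forall>i>m. carrier (P i) = {\<zero>\<^bsub>P i\<^esub>}"
    then show "\<forall>i>n. carrier (P i) = {\<zero>\<^bsub>P i\<^esub>}" using \<open>m \<le> n\<close> by auto
  qed
qed

lemma proj_dim_leI:
  assumes "projective_resolution R M (P :: nat \<Rightarrow> ('r, ('r \<times> 'm) list \<Rightarrow> 'r) module) d e"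
    "\<And>i. i > n \<Longrightarrow> carrier (P i) = {\<zero>\<^bsub>P i\<^esub>}"
  shows "proj_dim R (M :: ('r, 'm) module) \<le> enat n"
  unfolding proj_dim_def using assms by (intro Inf_lower CollectI exI[of _ n]) auto

lemma mod_hom_inj:
  assumes f: "mod_hom R M M' f" and ker: "{x \<in> carrier M. f x = \<zero>\<^bsub>M'\<^esub>} \<subseteq> {\<zero>\<^bsub>M\<^esub>}"
  shows "inj_on f (carrier M)"
proof (rule inj_onI)
  interpret mod_hom R M M' f by (rule f)
  fix x y assume x: "x \<in> carrier M" and y: "y \<in> carrier M" and eq: "f x = f y"
  have "f (x \<ominus>\<^bsub>M\<^esub> y) = \<zero>\<^bsub>M'\<^esub>" using x y eq by (simp add: N.M.r_neg N.M.minus_eq)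
  then have "x \<ominus>\<^bsub>M\<^esub> y = \<zero>\<^bsub>M\<^esub>" using ker x y by auto
  then show "x = y" using x y by simp
qed

text \<open>In a resolution of length zero the augmentation is bijective, so the dual basis of
  \<open>P 0\<close> is carried over to \<open>M\<close>.\<close>

lemma proj_dim_0_dual:
  assumes "proj_dim R (M :: ('r, 'm) module) = 0"
  shows "\<exists>(I :: ((('r \<times> 'm) list \<Rightarrow> 'r) \<Rightarrow> 'r) set) f n. pdual M I f n"
proof -
  have "proj_dim R M \<le> enat 0" using assms by (simp add: zero_enat_def)
  from proj_dim_leD[OF this] obtain P :: "nat \<Rightarrow> ('r, ('r \<times> 'm) list \<Rightarrow> 'r) module" and d e where
    res: "projective_resolution R M P d e" and 0: "\<And>i. i > 0 \<Longrightarrow> carrier (P i) = {\<zero>\<^bsub>P i\<^esub>}" by blast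
  have proj: "projective_module R (P 0)" and e: "mod_hom R (P 0) M e" and d: "mod_hom R (P (Suc 0)) (P 0) (d 0)"
    and im: "mod_hom.im (P 0) e = carrier M" and ker: "mod_hom.ker (P 0) M e = mod_hom.im (P 1) (d 0)"
    using res unfolding projective_resolution_def by blast+
  interpret e: mod_hom R "P 0" M e by (rule e)
  interpret d: mod_hom R "P (Suc 0)" "P 0" "d 0" by (rule d)
  have "{x \<in> carrier (P 0). e x = \<zero>\<^bsub>M\<^esub>} = d 0 ` carrier (P (Suc 0))"
    using ker by (simp add: e.ker_def d.im_def)
  also have "\<dots> \<subseteq> {\<zero>\<^bsub>P 0\<^esub>}" using 0[of "Suc 0"] by simp
  finally have inj: "inj_on e (carrier (P 0))" by (rule mod_hom_inj[OF e])
  obtain I :: "((('r \<times> 'm) list \<Rightarrow> 'r) \<Rightarrow> 'r) set" and f n where d0: "pdual (P 0) I f n"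
    using pdual_if_projective[OF proj] by blast
  define u where "u = inv_into (carrier (P 0)) e"
  have im': "e ` carrier (P 0) = carrier M" using im by (simp add: e.im_def)
  have u: "u x \<in> carrier (P 0)" "e (u x) = x" if "x \<in> carrier M" for x
    using inv_into_into[of x e "carrier (P 0)"] f_inv_into_f[of x e "carrier (P 0)"] that
    unfolding im' u_def by blast+
  have u_eq: "u x = z" if "x \<in> carrier M" "z \<in> carrier (P 0)" "e z = x" for x z
    by (rule inj_onD[OF inj]) (use u[OF that(1)] that(2,3) in simp_all)
  have "pdual M I (\<lambda>i x. f i (u x)) (\<lambda>i. e (n i))"
    unfolding pdual_def
  proof (intro conjI ballI)
    fix i x y assume i: "i \<in> I" and x: "x \<in> carrier M" and y: "y \<in> carrier M"
    have "u (x \<oplus>\<^bsub>M\<^esub> y) = u x \<oplus>\<^bsub>P 0\<^esub> u y" using u[OF x] u[OF y] x y by (intro u_eq) auto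
    then show "f i (u (x \<oplus>\<^bsub>M\<^esub> y)) = f i (u x) + f i (u y)"
      using pdualD(3)[OF d0 i u(1)[OF x] u(1)[OF y]] by simp
  next
    fix i r x assume i: "i \<in> I" and r: "r \<in> carrier R" and x: "x \<in> carrier M"
    have "u (r \<odot>\<^bsub>M\<^esub> x) = r \<odot>\<^bsub>P 0\<^esub> u x" using u[OF x] r x by (intro u_eq) auto
    then show "f i (u (r \<odot>\<^bsub>M\<^esub> x)) = rep r * f i (u x)"
      using pdualD(4)[OF d0 i r u(1)[OF x]] by simp
  next
    fix x assume x: "x \<in> carrier M"
    let ?S = "{i \<in> I. f i (u x) \<noteq> 0}"
    show fin: "finite ?S" by (rule pdualD(5)[OF d0 u(1)[OF x]])
    have "x = e (\<Oplus>\<^bsub>P 0\<^esub>i\<in>?S. pr (f i (u x)) \<odot>\<^bsub>P 0\<^esub> n i)"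
      using pdualD(6)[OF d0 u(1)[OF x]] u(2)[OF x] by simp
    also have "\<dots> = (\<Oplus>\<^bsub>M\<^esub>i\<in>?S. pr (f i (u x)) \<odot>\<^bsub>M\<^esub> e (n i))"
      using fin pdualD(1)[OF d0] by (intro e.hom_lincomb) auto
    finally show "x = (\<Oplus>\<^bsub>M\<^esub>i\<in>?S. pr (f i (u x)) \<odot>\<^bsub>M\<^esub> e (n i))" .
  qed (use pdualD(1,2)[OF d0] u in auto)
  then show ?thesis by blast
qed

text \<open>As the module in degree two is zero, the first differential is injective, which is the
  situation of Schanuel's lemma.\<close>

lemma proj_dim_le_1_dual:
  assumes "proj_dim R (M :: ('r, 'm) module) \<le> 1" "finite (B :: 'a set)" "generates M B y"
  shows "\<exists>(I :: (((('r \<times> 'm) list \<Rightarrow> 'r) \<Rightarrow> 'r) + 'a) set) f n. dual_basis (relations M B y) I f n"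
proof -
  have "proj_dim R M \<le> enat 1" using assms by (simp add: one_enat_def)
  from proj_dim_leD[OF this] obtain P :: "nat \<Rightarrow> ('r, ('r \<times> 'm) list \<Rightarrow> 'r) module" and d e where
    res: "projective_resolution R M P d e" and 0: "\<And>i. i > 1 \<Longrightarrow> carrier (P i) = {\<zero>\<^bsub>P i\<^esub>}" by blast
  have proj: "projective_module R (P 0)" "projective_module R (P (Suc 0))" and e: "mod_hom R (P 0) M e"
    and d: "mod_hom R (P (Suc 0)) (P 0) (d 0)" "mod_hom R (P (Suc (Suc 0))) (P (Suc 0)) (d (Suc 0))"
    and im: "mod_hom.im (P 0) e = carrier M" and ker: "mod_hom.ker (P 0) M e = mod_hom.im (P 1) (d 0)"
    "mod_hom.ker (P (Suc 0)) (P 0) (d 0) = mod_hom.im (P (Suc (Suc 0))) (d (Suc 0))"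
    using res unfolding projective_resolution_def by blast+
  interpret e: mod_hom R "P 0" M e by (rule e)
  interpret d0: mod_hom R "P (Suc 0)" "P 0" "d 0" by (rule d(1))
  interpret d1: mod_hom R "P (Suc (Suc 0))" "P (Suc 0)" "d (Suc 0)" by (rule d(2))
  have "{x \<in> carrier (P (Suc 0)). d 0 x = \<zero>\<^bsub>P 0\<^esub>} = d (Suc 0) ` carrier (P (Suc (Suc 0)))"
    using ker(2) by (simp add: d0.ker_def d1.im_def)
  also have "\<dots> \<subseteq> {\<zero>\<^bsub>P (Suc 0)\<^esub>}" using 0[of "Suc (Suc 0)"] by simp
  finally have inj: "inj_on (d 0) (carrier (P (Suc 0)))" by (rule mod_hom_inj[OF d(1)])
  obtain I0 :: "((('r \<times> 'm) list \<Rightarrow> 'r) \<Rightarrow> 'r) set" and f0 n0 where p0: "pdual (P 0) I0 f0 n0"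
    using pdual_if_projective[OF proj(1)] by blast
  obtain I1 :: "((('r \<times> 'm) list \<Rightarrow> 'r) \<Rightarrow> 'r) set" and f1 n1 where p1: "pdual (P (Suc 0)) I1 f1 n1"
    using pdual_if_projective[OF proj(2)] by blast
  have "{x \<in> carrier (P 0). e x = \<zero>\<^bsub>M\<^esub>} = d 0 ` carrier (P (Suc 0))"
    using ker(1) by (simp add: e.ker_def d0.im_def)
  moreover have "e ` carrier (P 0) = carrier M" using im by (simp add: e.im_def)
  ultimately show ?thesis using schanuel[OF assms(2,3) e _ d(1) inj _ p0 p1] by blast
qed

section \<open>Free modules of finite rank and an explicit resolution\<close>

definition delta :: "'a \<Rightarrow> 'a \<Rightarrow> ('k, 'n) mpoly" where
  "delta x v = (if v = x then 1 else 0)"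

lemma sum_delta:
  assumes "finite X"
  shows "(\<Sum>x\<in>X. c x * delta x v) = (if v \<in> X then c v else 0)"
proof -
  have "(\<Sum>x\<in>X. c x * delta x v) = (\<Sum>x\<in>X. if x = v then c v else 0)"
    by (rule sum.cong) (auto simp: delta_def)
  then show ?thesis using assms by simp
qed

lemma inj_delta: "inj_on delta X"
  by (rule inj_onI) (auto simp: delta_def fun_eq_iff split: if_splits)

lemma free_func_space:
  assumes X: "finite X"
  shows "free_module R (R.func_space X)"
proof -
  define N where "N = {k. (\<forall>x. sg (k x) = k x) \<and> (\<forall>x. x \<notin> X \<longrightarrow> k x = 0)}"
  interpret module_rep al w R pr "R.func_space X" N "\<lambda>k. \<lambda>x\<in>X. pr (k x)"
  proof unfold_locales
    show "submod N" by (auto simp: submod_def N_def)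
    show "bij_betw (\<lambda>k. \<lambda>x\<in>X. pr (k x)) N (carrier (R.func_space X))"
    proof (rule bij_betw_byWitness[where f' = "\<lambda>r x. if x \<in> X then rep (r x) else 0"])
      show "\<forall>k\<in>N. (\<lambda>x. if x \<in> X then rep ((\<lambda>x\<in>X. pr (k x)) x) else 0) = k"
        by (auto simp: N_def fun_eq_iff)
      show "\<forall>r\<in>carrier (R.func_space X). (\<lambda>x\<in>X. pr (if x \<in> X then rep (r x) else 0)) = r"
        by (auto simp: R.func_space_def fun_eq_iff PiE_iff extensional_def)
    qed (auto simp: N_def R.func_space_def)
  qed (auto simp: R.func_space_def pr_add pr_mult pr_0 fun_eq_iff)
  have "is_basis N (delta ` X)"
    unfolding is_basis_def
  proof (intro conjI ballI allI impI)
    show "finite (delta ` X)" using X by simp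
    show "delta ` X \<subseteq> N" by (auto simp: N_def delta_def)
  next
    fix k assume k: "k \<in> N"
    have "k = (\<lambda>v. \<Sum>x\<in>X. k x * delta x v)" using k by (auto simp: sum_delta[OF X] N_def)
    also have "\<dots> = (\<lambda>v. \<Sum>b\<in>delta ` X. k (inv_into X delta b) * b v)"
      by (simp add: sum.reindex[OF inj_delta] inj_delta)
    finally show "\<exists>c. (\<forall>b. sg (c b) = c b) \<and> k = (\<lambda>v. \<Sum>b\<in>delta ` X. c b * b v)"
      using k by (intro exI[of _ "\<lambda>b. k (inv_into X delta b)"]) (auto simp: N_def)
  next
    fix c b assume c: "\<forall>v. (\<Sum>b\<in>delta ` X. c b * b v) = 0" and "b \<in> delta ` X"
    then obtain x where x: "x \<in> X" "b = delta x" by blast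
    have "(\<Sum>y\<in>X. c (delta y) * delta y x) = 0"
      using spec[OF c, of x] by (simp add: sum.reindex[OF inj_delta])
    then show "c b = 0" using x by (simp add: sum_delta[OF X])
  qed
  then show ?thesis by (rule free_if_is_basis)
qed

text \<open>The free module in \<open>projective_module\<close> must consist of functions on the
  carrier type of the given module. It is therefore indexed by the unit vectors \<open>?D\<close>
  instead of by \<open>X\<close>; both index sets correspond bijectively.\<close>

lemma projective_func_space:
  assumes X: "finite X"
  shows "projective_module R (R.func_space X)"
proof -
  let ?del = "\<lambda>x. \<lambda>z\<in>X. if z = x then \<one> else \<zero>"
  let ?D = "?del ` X"
  have inj: "inj_on ?del X"
  proof (rule inj_onI)
    fix x y assume "x \<in> X" "y \<in> X" "?del x = ?del y"
    from fun_cong[OF this(3), of x] this(1) show "x = y" using one_neq_zero by (auto split: if_splits)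
  qed
  let ?i = "\<lambda>f. \<lambda>g\<in>?D. f (inv_into X ?del g)" and ?p = "\<lambda>f. \<lambda>x\<in>X. f (?del x)"
  have mX: "Module.module R (R.func_space X)" "Module.module R (R.func_space ?D)"
    by (rule R.func_space_is_module)+
  have inv: "g \<in> ?D \<Longrightarrow> inv_into X ?del g \<in> X" for g by (rule inv_into_into)
  have "mod_hom R (R.func_space X) (R.func_space ?D) ?i"
    unfolding mod_hom_def mod_hom_axioms_def module_hom_def using mX inv
    by (auto simp: R.func_space_def fun_eq_iff PiE_iff simp del: image_eqI)
  moreover have "mod_hom R (R.func_space ?D) (R.func_space X) ?p"
    unfolding mod_hom_def mod_hom_axioms_def module_hom_def using mX
    by (auto simp: R.func_space_def fun_eq_iff PiE_iff)
  moreover have "?p (?i f) = f" if "f \<in> carrier (R.func_space X)" for f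
  proof
    fix x show "?p (?i f) x = f x"
      using that inv_into_f_f[OF inj, of x] by (cases "x \<in> X") (auto simp: R.func_space_def PiE_iff extensional_def)
  qed
  moreover have "free_module R (R.func_space ?D)" by (rule free_func_space) (use X in simp)
  ultimately show ?thesis
    unfolding projective_module_def using mX(1) by blast
qed

text \<open>The resolution has the free module on \<open>B\<close> in degree 0, the free module on
  \<open>C\<close> in degree 1 and zero above; the basis property of \<open>C\<close> gives
  exactness. If \<open>C\<close> is empty, the term in degree 1 vanishes as well.\<close>

lemma proj_dim_if_relations_free:
  fixes M :: "('r, 'm) module"
  assumes M: "Module.module R M" and B: "finite (B :: 'a set)" and gen: "generates M B y"
    and C: "is_basis (relations M B y) C"
  shows "proj_dim R M \<le> 1" "C = {} \<Longrightarrow> proj_dim R M = 0"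
proof -
  interpret M: Module.module R M by (rule M)
  have finC: "finite C" and CK: "\<And>c. c \<in> C \<Longrightarrow> c \<in> relations M B y" using C by (auto simp: is_basis_def)
  have yM: "y b \<in> carrier M" if "b \<in> B" for b using gen that by (simp add: generates_def)
  \<comment> \<open>The type of lists is prescribed by \<open>proj_dim\<close>. As \<open>B\<close>
    and \<open>C\<close> are finite, lists of different lengths suffice to name their elements, and
    the entries are irrelevant.\<close>
  define lst :: "nat \<Rightarrow> ('r \<times> 'm) list" where "lst i = replicate i undefined" for i
  have "inj lst" by (rule injI) (metis length_replicate lst_def)
  obtain i0 where i0: "bij_betw i0 B {0..<card B}" using ex_bij_betw_finite_nat[OF B] by blast
  obtain i1 where i1: "bij_betw i1 C {0..<card C}" using ex_bij_betw_finite_nat[OF finC] by blast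
  define be where "be b = lst (i0 b)" for b
  define ga where "ga c = lst (i1 c)" for c
  have inj_be: "inj_on be B" using i0 \<open>inj lst\<close> unfolding be_def by (auto simp: inj_on_def bij_betw_def)
  have inj_ga: "inj_on ga C" using i1 \<open>inj lst\<close> unfolding ga_def by (auto simp: inj_on_def bij_betw_def)
  define X where "X i = (if i = 0 then be ` B else if i = 1 then ga ` C else {})" for i :: nat
  define P where "P i = R.func_space (X i)" for i
  have finX: "finite (X i)" for i using B finC by (simp add: X_def)
  have Pm: "Module.module R (P i)" for i unfolding P_def by (rule R.func_space_is_module)
  define coef where "coef k = (\<lambda>b. if b \<in> B then rep (k (be b)) else 0)" for k
  define e where "e k = evalm M B y (coef k)" for k
  define d where "d i s = (if i = (0::nat) then \<lambda>x\<in>be ` B. pr (\<Sum>c\<in>C. rep (s (ga c)) * c (inv_into B be x))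
      else \<zero>\<^bsub>P i\<^esub>)" for i s
  have P_closed: "k (be b) \<in> carrier R" if "k \<in> carrier (P 0)" "b \<in> B" for k b
    using that by (auto simp: P_def X_def R.func_space_def)
  have P1_closed: "s (ga c) \<in> carrier R" if "s \<in> carrier (P (Suc 0))" "c \<in> C" for s c
    using that by (auto simp: P_def X_def R.func_space_def)
  have coef_add: "coef (k \<oplus>\<^bsub>P 0\<^esub> k') = (\<lambda>b. coef k b + coef k' b)" if "k \<in> carrier (P 0)" "k' \<in> carrier (P 0)" for k k'
    using P_closed[OF that(1)] P_closed[OF that(2)]
    by (auto simp: coef_def P_def X_def R.func_space_def fun_eq_iff rep_add)
  have coef_smult: "coef (r \<odot>\<^bsub>P 0\<^esub> k) = (\<lambda>b. rep r * coef k b)" if "k \<in> carrier (P 0)" "r \<in> carrier R" for k r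
    using P_closed[OF that(1)] that(2)
    by (auto simp: coef_def P_def X_def R.func_space_def fun_eq_iff rep_mult)
  have e_hom: "mod_hom R (P 0) M e"
    unfolding mod_hom_def mod_hom_axioms_def module_hom_def
  proof (intro conjI Pm M CollectI ballI allI impI)
    show "e \<in> carrier (P 0) \<rightarrow> carrier M" unfolding e_def using evalm_closed[OF M, of B y] yM by blast
    show "e (k \<oplus>\<^bsub>P 0\<^esub> k') = e k \<oplus>\<^bsub>M\<^esub> e k'" if "k \<in> carrier (P 0) \<and> k' \<in> carrier (P 0)" for k k'
      unfolding e_def coef_add[OF conjunct1[OF that] conjunct2[OF that]] by (rule evalm_add[OF M]) (rule yM)
    show "e (r \<odot>\<^bsub>P 0\<^esub> k) = r \<odot>\<^bsub>M\<^esub> e k" if "r \<in> carrier R \<and> k \<in> carrier (P 0)" for r k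
      unfolding e_def coef_smult[OF conjunct2[OF that] conjunct1[OF that]]
      using evalm_smult[OF M _ B, of y "rep r" "coef k"] yM that by simp
  qed
  have d0_val: "d 0 s (be b) = pr (\<Sum>c\<in>C. rep (s (ga c)) * c b)" if "b \<in> B" for s b
    using that inj_be by (simp add: d_def)
  have d0_closed: "d 0 s \<in> carrier (P 0)" for s
    by (auto simp: d_def P_def X_def R.func_space_def)
  have P0_eqI: "k = k'" if "k \<in> carrier (P 0)" "k' \<in> carrier (P 0)" "\<And>b. b \<in> B \<Longrightarrow> k (be b) = k' (be b)" for k k'
  proof
    fix x show "k x = k' x"
      using that by (cases "x \<in> be ` B") (auto simp: P_def X_def R.func_space_def PiE_iff extensional_def)
  qed
  have d_hom: "mod_hom R (P (Suc i)) (P i) (d i)" for i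
  proof (cases "i = 0")
    case True
    have "mod_hom R (P (Suc 0)) (P 0) (d 0)"
      unfolding mod_hom_def mod_hom_axioms_def module_hom_def
    proof (intro conjI Pm CollectI ballI allI impI)
      interpret P0: Module.module R "P 0" by (rule Pm)
      interpret P1: Module.module R "P (Suc 0)" by (rule Pm)
      show "d 0 \<in> carrier (P (Suc 0)) \<rightarrow> carrier (P 0)" using d0_closed by blast
      show "d 0 (s \<oplus>\<^bsub>P (Suc 0)\<^esub> s') = d 0 s \<oplus>\<^bsub>P 0\<^esub> d 0 s'"
        if "s \<in> carrier (P (Suc 0)) \<and> s' \<in> carrier (P (Suc 0))" for s s'
      proof (rule P0_eqI[OF d0_closed])
        show "d 0 s \<oplus>\<^bsub>P 0\<^esub> d 0 s' \<in> carrier (P 0)" using d0_closed by simp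
        fix b assume b: "b \<in> B"
        have r: "rep ((s \<oplus>\<^bsub>P (Suc 0)\<^esub> s') (ga c)) = rep (s (ga c)) + rep (s' (ga c))" if "c \<in> C" for c
          using that P1_closed \<open>s \<in> _ \<and> s' \<in> _\<close> by (auto simp: P_def X_def R.func_space_def rep_add)
        have "d 0 (s \<oplus>\<^bsub>P (Suc 0)\<^esub> s') (be b) = pr (\<Sum>c\<in>C. (rep (s (ga c)) + rep (s' (ga c))) * c b)"
          unfolding d0_val[OF b] by (rule arg_cong[of _ _ pr], rule sum.cong) (simp_all add: r)
        also have "\<dots> = d 0 s (be b) \<oplus> d 0 s' (be b)"
          unfolding d0_val[OF b] by (simp add: distrib_right sum.distrib pr_add)
        also have "\<dots> = (d 0 s \<oplus>\<^bsub>P 0\<^esub> d 0 s') (be b)" using b by (simp add: P_def X_def R.func_space_def)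
        finally show "d 0 (s \<oplus>\<^bsub>P (Suc 0)\<^esub> s') (be b) = (d 0 s \<oplus>\<^bsub>P 0\<^esub> d 0 s') (be b)" .
      qed
      show "d 0 (r \<odot>\<^bsub>P (Suc 0)\<^esub> s) = r \<odot>\<^bsub>P 0\<^esub> d 0 s" if "r \<in> carrier R \<and> s \<in> carrier (P (Suc 0))" for r s
      proof (rule P0_eqI[OF d0_closed])
        show "r \<odot>\<^bsub>P 0\<^esub> d 0 s \<in> carrier (P 0)" using d0_closed that by simp
        fix b assume b: "b \<in> B"
        have r: "rep ((r \<odot>\<^bsub>P (Suc 0)\<^esub> s) (ga c)) = rep r * rep (s (ga c))" if "c \<in> C" for c
          using that P1_closed \<open>r \<in> _ \<and> s \<in> _\<close> by (auto simp: P_def X_def R.func_space_def rep_mult)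
        have "d 0 (r \<odot>\<^bsub>P (Suc 0)\<^esub> s) (be b) = pr (\<Sum>c\<in>C. (rep r * rep (s (ga c))) * c b)"
          unfolding d0_val[OF b] by (rule arg_cong[of _ _ pr], rule sum.cong) (simp_all add: r)
        also have "\<dots> = pr (rep r * (\<Sum>c\<in>C. rep (s (ga c)) * c b))"
          by (simp add: sum_distrib_left mult.assoc)
        also have "\<dots> = r \<otimes> d 0 s (be b)"
          unfolding d0_val[OF b] using that by (simp add: pr_mult)
        also have "\<dots> = (r \<odot>\<^bsub>P 0\<^esub> d 0 s) (be b)" using b by (simp add: P_def X_def R.func_space_def)
        finally show "d 0 (r \<odot>\<^bsub>P (Suc 0)\<^esub> s) (be b) = (r \<odot>\<^bsub>P 0\<^esub> d 0 s) (be b)" .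
      qed
    qed
    then show ?thesis using True by simp
  next
    case False
    interpret Pi: Module.module R "P i" by (rule Pm)
    show ?thesis
      unfolding mod_hom_def mod_hom_axioms_def module_hom_def using False Pm by (auto simp: d_def)
  qed
  interpret e: mod_hom R "P 0" M e by (rule e_hom)
  have trivial: "carrier (P (Suc (Suc i))) = {\<zero>\<^bsub>P (Suc (Suc i))\<^esub>}" for i
    by (auto simp: P_def X_def R.func_space_def)
  have K: "coef k \<in> relations M B y \<longleftrightarrow> e k = \<zero>\<^bsub>M\<^esub>" for k
    by (auto simp: relations_def coef_def e_def)
  have of_coef: "k (be b) = pr (coef k b)" if "k \<in> carrier (P 0)" "b \<in> B" for k b
    using P_closed[OF that] that(2) by (simp add: coef_def)
  have coef_d: "coef (d 0 s) = (\<lambda>b. \<Sum>c\<in>C. rep (s (ga c)) * c b)" for s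
  proof
    fix b
    have c0: "sg (c b) = c b" "b \<notin> B \<Longrightarrow> c b = 0" if "c \<in> C" for c using CK[OF that] by (auto simp: relations_def)
    show "coef (d 0 s) b = (\<Sum>c\<in>C. rep (s (ga c)) * c b)"
    proof (cases "b \<in> B")
      case True
      then show ?thesis using c0(1) by (auto simp: coef_def d0_val elim_sum intro!: sum.cong)
    next
      case False
      then have "(\<Sum>c\<in>C. rep (s (ga c)) * c b) = 0" using c0(2)[OF _ False]
        by (intro sum.neutral ballI) (metis mult_zero_right)
      then show ?thesis using False by (simp add: coef_def)
    qed
  qed
  have "submod (relations M B y)"
    unfolding submod_def
  proof (intro conjI ballI allI impI)
    show "(\<lambda>_. 0) \<in> relations M B y"
      using evalm_smult[OF M _ B, of y 0 "\<lambda>_. 0"] evalm_closed[OF M, of B y] yM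
      by (simp add: relations_def pr_0)
  next
    fix k k' assume "k \<in> relations M B y" "k' \<in> relations M B y"
    then show "(\<lambda>v. k v + k' v) \<in> relations M B y"
      using evalm_add[OF M, of B y k k'] yM by (simp add: relations_def)
  next
    fix r k assume "k \<in> relations M B y" "sg r = r"
    then show "(\<lambda>v. r * k v) \<in> relations M B y"
      using evalm_smult[OF M _ B, of y r k] yM by (simp add: relations_def)
  qed (simp add: relations_def)
  note subK = this
  have ker_e: "mod_hom.ker (P 0) M e = mod_hom.im (P 1) (d 0)"
  proof -
    have "{k \<in> carrier (P 0). e k = \<zero>\<^bsub>M\<^esub>} = d 0 ` carrier (P (Suc 0))"
    proof (intro equalityI subsetI)
      fix k assume "k \<in> {k \<in> carrier (P 0). e k = \<zero>\<^bsub>M\<^esub>}"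
      then have k: "k \<in> carrier (P 0)" "coef k \<in> relations M B y" by (auto simp: K)
      from is_basis_rep[OF C k(2)] obtain s where
        s: "(\<forall>c. sg (s c) = s c) \<and> coef k = (\<lambda>b. \<Sum>c\<in>C. s c * c b)" ..
      define s' where "s' = (\<lambda>x\<in>ga ` C. pr (s (inv_into C ga x)))"
      have s': "s' \<in> carrier (P (Suc 0))" by (auto simp: s'_def P_def X_def R.func_space_def)
      have "d 0 s' = k"
      proof (rule P0_eqI[OF d0_closed k(1)])
        fix b assume b: "b \<in> B"
        have "d 0 s' (be b) = pr (\<Sum>c\<in>C. s c * c b)"
          unfolding d0_val[OF b] s'_def using s inj_ga
          by (intro arg_cong[of _ _ pr] sum.cong) auto
        also have "\<dots> = k (be b)"
          unfolding of_coef[OF k(1) b] using fun_cong[OF conjunct2[OF s], of b] by simp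
        finally show "d 0 s' (be b) = k (be b)" .
      qed
      then show "k \<in> d 0 ` carrier (P (Suc 0))" using s' by blast
    next
      fix k assume "k \<in> d 0 ` carrier (P (Suc 0))"
      then obtain s where k: "k = d 0 s" by blast
      have "(\<lambda>b. \<Sum>c\<in>C. rep (s (ga c)) * c b) \<in> relations M B y"
        using CK by (intro submod_lincomb[OF subK finC]) auto
      then show "k \<in> {k \<in> carrier (P 0). e k = \<zero>\<^bsub>M\<^esub>}"
        using d0_closed unfolding k by (simp add: coef_d flip: K)
    qed
    then show ?thesis
      by (simp add: mod_hom.ker_def[OF e_hom] mod_hom.im_def[OF d_hom])
  qed
  have inj_d: "{s \<in> carrier (P (Suc 0)). d 0 s = \<zero>\<^bsub>P 0\<^esub>} = {\<zero>\<^bsub>P (Suc 0)\<^esub>}"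
  proof (intro equalityI subsetI)
    fix s assume "s \<in> {s \<in> carrier (P (Suc 0)). d 0 s = \<zero>\<^bsub>P 0\<^esub>}"
    then have s: "s \<in> carrier (P (Suc 0))" "d 0 s = \<zero>\<^bsub>P 0\<^esub>" by auto
    have z: "(\<Sum>c\<in>C. rep (s (ga c)) * c b) = 0" for b
    proof -
      have "coef (d 0 s) b = 0" unfolding s(2) by (auto simp: coef_def P_def X_def R.func_space_def)
      then show ?thesis by (simp add: coef_d)
    qed
    have "s (ga c) = \<zero>" if "c \<in> C" for c
    proof -
      have "rep (s (ga c)) = 0"
        using that z by (intro is_basis_indep[OF C, of "\<lambda>c. rep (s (ga c))"]) auto
      then show ?thesis using P1_closed[OF s(1) that] by (simp add: rep_eq_0)
    qed
    then show "s \<in> {\<zero>\<^bsub>P (Suc 0)\<^esub>}"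
      using s(1) by (auto simp: P_def X_def R.func_space_def fun_eq_iff PiE_iff extensional_def)
  next
    interpret d: mod_hom R "P (Suc 0)" "P 0" "d 0" by (rule d_hom)
    fix s assume "s \<in> {\<zero>\<^bsub>P (Suc 0)\<^esub>}"
    then show "s \<in> {s \<in> carrier (P (Suc 0)). d 0 s = \<zero>\<^bsub>P 0\<^esub>}" by simp
  qed
  have res: "projective_resolution R M P d e"
    unfolding projective_resolution_def
  proof (intro conjI allI)
    show "projective_module R (P i)" for i unfolding P_def by (rule projective_func_space[OF finX])
    show "mod_hom R (P (Suc i)) (P i) (d i)" for i by (rule d_hom)
    show "mod_hom R (P 0) M e" by (rule e_hom)
    show "mod_hom.ker (P 0) M e = mod_hom.im (P 1) (d 0)" by (rule ker_e)
    have "e ` carrier (P 0) = carrier M"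
    proof (intro equalityI subsetI)
      fix z assume "z \<in> carrier M"
      then obtain k where k: "\<And>b. sg (k b) = k b" "\<And>b. b \<notin> B \<Longrightarrow> k b = 0" "evalm M B y k = z"
        using gen unfolding generates_def by blast
      define k' where "k' = (\<lambda>x\<in>be ` B. pr (k (inv_into B be x)))"
      have "k' \<in> carrier (P 0)" by (auto simp: k'_def P_def X_def R.func_space_def)
      moreover have "coef k' = k" using k inj_be by (auto simp: coef_def k'_def fun_eq_iff)
      ultimately show "z \<in> e ` carrier (P 0)" using k(3) by (auto simp: e_def)
    qed auto
    then show "mod_hom.im (P 0) e = carrier M" by (simp add: e.im_def)
    fix i
    interpret d: mod_hom R "P (Suc i)" "P i" "d i" by (rule d_hom)
    interpret d': mod_hom R "P (Suc (Suc i))" "P (Suc i)" "d (Suc i)" by (rule d_hom)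
    have "d.ker = {\<zero>\<^bsub>P (Suc i)\<^esub>}"
    proof (cases "i = 0")
      case True
      then show ?thesis unfolding d.ker_def using inj_d by simp
    next
      case False
      then have "carrier (P (Suc i)) = {\<zero>\<^bsub>P (Suc i)\<^esub>}" using trivial[of "i - 1"] by simp
      then show ?thesis unfolding d.ker_def using d.f0_is_0 by auto
    qed
    moreover have "d'.im = {\<zero>\<^bsub>P (Suc i)\<^esub>}" using trivial[of i] by (simp add: d'.im_def)
    ultimately show "d.ker = d'.im" by simp
  qed
  have "carrier (P i) = {\<zero>\<^bsub>P i\<^esub>}" if "i > 1" for i
  proof -
    have "i = Suc (Suc (i - 2))" using that by simp
    then show ?thesis using trivial[of "i - 2"] by simp
  qed
  from proj_dim_leI[OF res this] show "proj_dim R M \<le> 1" by (simp add: one_enat_def)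
  assume C0: "C = {}"
  have "proj_dim R M \<le> enat 0"
  proof (rule proj_dim_leI[OF res])
    show "carrier (P i) = {\<zero>\<^bsub>P i\<^esub>}" if "i > 0" for i
      using that C0 by (auto simp: P_def X_def R.func_space_def)
  qed
  then show "proj_dim R M = 0" by (simp flip: zero_enat_def)
qed

end

subsection \<open>Fractions and logarithmic forms\<close>

lemma (in cring) func_space_finsum:
  assumes "finite I" "\<And>i. i \<in> I \<Longrightarrow> g i \<in> carrier (func_space W)"
  shows "(\<Oplus>\<^bsub>func_space W\<^esub>i\<in>I. g i) = (\<lambda>v\<in>W. \<Oplus>i\<in>I. g i v)"
  using assms
proof (induction I rule: finite_induct)
  case empty
  interpret F: Module.module R "func_space W" by (rule func_space_is_module)
  have "(\<Oplus>\<^bsub>func_space W\<^esub>i\<in>{}. g i) = \<zero>\<^bsub>func_space W\<^esub>" by simp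
  then show ?case by (simp add: func_space_def)
next
  case (insert i I)
  interpret F: Module.module R "func_space W" by (rule func_space_is_module)
  have IH: "(\<Oplus>\<^bsub>func_space W\<^esub>i\<in>I. g i) = (\<lambda>v\<in>W. \<Oplus>i\<in>I. g i v)" by (rule insert.IH) (rule insert.prems, simp)
  have "(\<Oplus>\<^bsub>func_space W\<^esub>i\<in>insert i I. g i) = g i \<oplus>\<^bsub>func_space W\<^esub> (\<Oplus>\<^bsub>func_space W\<^esub>i\<in>I. g i)"
    using insert.hyps insert.prems by (intro F.finsum_insert) auto
  also have "\<dots> = g i \<oplus>\<^bsub>func_space W\<^esub> (\<lambda>v\<in>W. \<Oplus>i\<in>I. g i v)" unfolding IH ..
  also have "\<dots> = (\<lambda>v\<in>W. g i v \<oplus> (\<Oplus>i\<in>I. g i v))"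
    by (auto simp: func_space_def)
  also have "\<dots> = (\<lambda>v\<in>W. \<Oplus>i\<in>insert i I. g i v)"
  proof (rule restrict_ext)
    fix v assume v: "v \<in> W"
    have "g j v \<in> carrier R" if "j \<in> insert i I" for j
      using insert.prems[OF that] v by (auto simp: func_space_def)
    then show "g i v \<oplus> (\<Oplus>i\<in>I. g i v) = (\<Oplus>i\<in>insert i I. g i v)"
      using insert.hyps by (simp add: Pi_iff)
  qed
  finally show ?case .
qed

context ring_rep
begin

abbreviation FF where "FF \<equiv> fraction_field R"

definition fr where "fr p q = frac R (pr p) (pr q)"

lemma mem_frac_rel: "((pr a, pr b), (pr c, pr d)) \<in> frac_rel R \<longleftrightarrow>
    sg b \<noteq> 0 \<and> sg d \<noteq> 0 \<and> sg (a * d) = sg (c * b)"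
  by (simp add: frac_rel_def pr_eq_0 pr_eq flip: pr_mult)

lemma equiv_frac_rel: "equiv (carrier R \<times> (carrier R - {\<zero>})) (frac_rel R)"
proof (rule equivI)
  show "frac_rel R \<subseteq> (carrier R \<times> (carrier R - {\<zero>})) \<times> (carrier R \<times> (carrier R - {\<zero>}))"
    by (auto simp: frac_rel_def)
  show "refl_on (carrier R \<times> (carrier R - {\<zero>})) (frac_rel R)"
    by (auto simp: refl_on_def frac_rel_def)
  show "sym (frac_rel R)"
    by (auto simp: sym_def frac_rel_def)
  show "trans (frac_rel R)"
  proof (rule transI)
    fix x y z assume xy: "(x, y) \<in> frac_rel R" and yz: "(y, z) \<in> frac_rel R"
    have mem: "fst x \<in> carrier R" "snd x \<in> carrier R" "fst y \<in> carrier R" "snd y \<in> carrier R"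
      "fst z \<in> carrier R" "snd z \<in> carrier R" using xy yz by (auto simp: frac_rel_def)
    obtain a b c d e f where "fst x = pr a" "snd x = pr b" "fst y = pr c" "snd y = pr d" "fst z = pr e" "snd z = pr f"
      using mem unfolding carrier_R by blast
    then have xyz: "x = (pr a, pr b)" "y = (pr c, pr d)" "z = (pr e, pr f)" by (auto simp: prod_eq_iff)
    have 1: "sg b \<noteq> 0" "sg d \<noteq> 0" "sg (a * d) = sg (c * b)" and 2: "sg f \<noteq> 0" "sg (c * f) = sg (e * d)"
      using xy yz unfolding xyz mem_frac_rel by auto
    have "sg d * (sg a * sg f) = sg (a * d) * sg f" by (simp add: mult_ac)
    also have "\<dots> = sg (c * f) * sg b" unfolding 1(3) by (simp add: mult_ac)
    also have "\<dots> = sg d * (sg e * sg b)" unfolding 2(2) by (simp add: mult_ac)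
    finally have "sg a * sg f = sg e * sg b" using 1(2) by (simp add: mpoly_mult_left_cancel)
    then show "(x, z) \<in> frac_rel R" unfolding xyz mem_frac_rel using 1 2 by simp
  qed
qed

lemma fr_eq:
  assumes "sg b \<noteq> 0" "sg d \<noteq> 0"
  shows "fr a b = fr c d \<longleftrightarrow> sg (a * d) = sg (c * b)"
proof -
  have "fr a b = fr c d \<longleftrightarrow> ((pr a, pr b), (pr c, pr d)) \<in> frac_rel R"
    unfolding fr_def frac_def using assms
    by (intro eq_equiv_class_iff[OF equiv_frac_rel]) (auto simp: pr_eq_0)
  then show ?thesis using assms by (simp add: mem_frac_rel)
qed

lemma mem_fr:
  assumes b: "sg b \<noteq> 0" and x: "x \<in> fr a b"
  obtains c d where "x = (pr c, pr d)" "sg d \<noteq> 0" "fr c d = fr a b"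
proof -
  have r: "((pr a, pr b), x) \<in> frac_rel R" using x by (simp add: fr_def frac_def)
  then have "fst x \<in> carrier R" "snd x \<in> carrier R" by (auto simp: frac_rel_def)
  then obtain c d where "fst x = pr c" "snd x = pr d" unfolding carrier_R by (elim imageE)
  then have xcd: "x = (pr c, pr d)" by (simp add: prod_eq_iff)
  have d: "sg d \<noteq> 0" and e: "sg (a * d) = sg (c * b)" using r unfolding xcd mem_frac_rel by simp_all
  have "fr a b = fr c d" by (rule iffD2[OF fr_eq[OF b d] e])
  from that[OF xcd d this[symmetric]] show ?thesis .
qed

lemma fr_self:
  assumes "sg b \<noteq> 0"
  shows "(pr a, pr b) \<in> fr a b"
  using assms by (simp add: fr_def frac_def mem_frac_rel)

text \<open>The operations of \<open>fraction_field\<close> are unions over all representatives. For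
  an operation compatible with equivalence this is a union of a nonempty constant family.\<close>

lemma fr_binop:
  assumes b: "sg b \<noteq> 0" and d: "sg d \<noteq> 0"
    and cong: "\<And>a' b' c' d'. sg b' \<noteq> 0 \<Longrightarrow> sg d' \<noteq> 0 \<Longrightarrow> fr a' b' = fr a b \<Longrightarrow> fr c' d' = fr c d \<Longrightarrow>
      F (pr a') (pr b') (pr c') (pr d') = z"
  shows "(\<Union>(x, y)\<in>fr a b. \<Union>(x', y')\<in>fr c d. F x y x' y') = z"
proof -
  have F: "F (fst p) (snd p) (fst q) (snd q) = z" if p: "p \<in> fr a b" and q: "q \<in> fr c d" for p q
  proof -
    obtain a' b' where 1: "p = (pr a', pr b')" "sg b' \<noteq> 0" "fr a' b' = fr a b" by (rule mem_fr[OF b p])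
    obtain c' d' where 2: "q = (pr c', pr d')" "sg d' \<noteq> 0" "fr c' d' = fr c d" by (rule mem_fr[OF d q])
    show ?thesis unfolding 1(1) 2(1) fst_conv snd_conv by (rule cong[OF 1(2) 2(2) 1(3) 2(3)])
  qed
  have "(\<Union>(x, y)\<in>fr a b. \<Union>(x', y')\<in>fr c d. F x y x' y') = (\<Union>p\<in>fr a b. \<Union>q\<in>fr c d. F (fst p) (snd p) (fst q) (snd q))"
    by (simp add: case_prod_unfold)
  also have "\<dots> = (\<Union>p\<in>fr a b. \<Union>q\<in>fr c d. z)" by (intro SUP_cong refl F)
  also have "\<dots> = z" using fr_self[OF b, of a] fr_self[OF d, of c] by (simp add: ex_in_conv[symmetric]) blast
  finally show ?thesis .
qed

lemma fr_mult:
  assumes "sg b \<noteq> 0" "sg d \<noteq> 0"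
  shows "fr a b \<otimes>\<^bsub>FF\<^esub> fr c d = fr (a * c) (b * d)"
  unfolding fraction_field_def
proof (simp, rule fr_binop[OF assms])
  fix a' b' c' d' assume b': "sg b' \<noteq> 0" "sg d' \<noteq> 0" and eq: "fr a' b' = fr a b" "fr c' d' = fr c d"
  have 1: "sg a' * sg b = sg a * sg b'" "sg c' * sg d = sg c * sg d'" using eq b' assms by (auto simp: fr_eq)
  have "sg a' * sg c' * (sg b * sg d) = (sg a' * sg b) * (sg c' * sg d)" by (simp add: mult_ac)
  also have "\<dots> = sg a * sg c * (sg b' * sg d')" unfolding 1 by (simp add: mult_ac)
  finally have "fr (a' * c') (b' * d') = fr (a * c) (b * d)"
    using b' assms by (simp add: fr_eq mpoly_mult_eq_0)
  then show "frac R (pr a' \<otimes> pr c') (pr b' \<otimes> pr d') = fr (a * c) (b * d)" by (simp add: fr_def pr_mult)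
qed

lemma fr_add:
  assumes "sg b \<noteq> 0" "sg d \<noteq> 0"
  shows "fr a b \<oplus>\<^bsub>FF\<^esub> fr c d = fr (a * d + c * b) (b * d)"
  unfolding fraction_field_def
proof (simp, rule fr_binop[OF assms])
  fix a' b' c' d' assume b': "sg b' \<noteq> 0" "sg d' \<noteq> 0" and eq: "fr a' b' = fr a b" "fr c' d' = fr c d"
  have 1: "sg a' * sg b = sg a * sg b'" "sg c' * sg d = sg c * sg d'" using eq b' assms by (auto simp: fr_eq)
  have "(sg a' * sg d' + sg c' * sg b') * (sg b * sg d) = (sg a' * sg b) * sg d' * sg d + (sg c' * sg d) * sg b' * sg b"
    by (simp add: algebra_simps)
  also have "\<dots> = (sg a * sg d + sg c * sg b) * (sg b' * sg d')" unfolding 1 by (simp add: algebra_simps)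
  finally have "fr (a' * d' + c' * b') (b' * d') = fr (a * d + c * b) (b * d)"
    using b' assms by (simp add: fr_eq mpoly_mult_eq_0)
  then show "frac R (pr a' \<otimes> pr d' \<oplus> pr c' \<otimes> pr b') (pr b' \<otimes> pr d') = fr (a * d + c * b) (b * d)"
    by (simp add: fr_def pr_mult pr_add)
qed

lemma carrier_FF: "carrier FF = {fr p q | p q. sg q \<noteq> 0}"
proof (intro equalityI subsetI)
  fix x assume "x \<in> carrier FF"
  then obtain a b where x: "x = frac R a b" "a \<in> carrier R" "b \<in> carrier R" "b \<noteq> \<zero>"
    by (auto simp: fraction_field_def)
  obtain p q where pq: "a = pr p" "b = pr q" using x(2,3) unfolding carrier_R by (elim imageE)
  show "x \<in> {fr p q | p q. sg q \<noteq> 0}"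
    using x(4) unfolding x(1) pq fr_def by (simp add: pr_eq_0) blast
next
  fix x assume "x \<in> {fr p q | p q. sg q \<noteq> 0}"
  then obtain p q where x: "x = fr p q" "sg q \<noteq> 0" by blast
  show "x \<in> carrier FF"
    unfolding x(1) fr_def fraction_field_def using x(2)
    by (simp, intro exI[of _ "pr p"] exI[of _ "pr q"]) (simp add: pr_eq_0 carrier_R)
qed

lemma FF_E:
  assumes "x \<in> carrier FF"
  obtains p q where "x = fr p q" "sg q \<noteq> 0"
  using assms unfolding carrier_FF by blast

lemma one_FF: "\<one>\<^bsub>FF\<^esub> = fr 1 1" and zero_FF: "\<zero>\<^bsub>FF\<^esub> = fr 0 1"
  unfolding fraction_field_def fr_def by (simp_all add: pr_1 pr_0)

lemma fr_closed [simp, intro]: "sg q \<noteq> 0 \<Longrightarrow> fr p q \<in> carrier FF"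
  by (auto simp: carrier_FF)

lemma cring_FF: "cring FF"
proof (rule cringI)
  show "abelian_group FF"
  proof (rule abelian_groupI)
    fix x assume "x \<in> carrier FF"
    then obtain p q where x: "x = fr p q" and q: "sg q \<noteq> 0" by (auto simp: carrier_FF)
    have "fr (- p) q \<oplus>\<^bsub>FF\<^esub> x = \<zero>\<^bsub>FF\<^esub>"
      unfolding x zero_FF using q by (simp add: fr_add fr_eq mpoly_mult_eq_0)
    then show "\<exists>y\<in>carrier FF. y \<oplus>\<^bsub>FF\<^esub> x = \<zero>\<^bsub>FF\<^esub>" using q by blast
  qed (simp_all add: zero_FF, (elim FF_E, simp add: fr_add fr_eq mpoly_mult_eq_0 algebra_simps)+)
  show "comm_monoid FF"
    by (rule comm_monoidI)
      ((elim FF_E)?, simp add: one_FF fr_mult fr_eq mpoly_mult_eq_0 mult_ac)+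
qed (elim FF_E, simp add: fr_mult fr_add fr_eq mpoly_mult_eq_0 algebra_simps)

sublocale FF: cring FF
  by (rule cring_FF)

lemma fr_uminus: "sg q \<noteq> 0 \<Longrightarrow> \<ominus>\<^bsub>FF\<^esub> fr p q = fr (- p) q"
  by (rule FF.minus_equality) (auto simp: fr_add fr_eq zero_FF mpoly_mult_eq_0)

lemma fr_add1: "fr p 1 \<oplus>\<^bsub>FF\<^esub> fr q 1 = fr (p + q) 1"
  by (simp add: fr_add)

lemma fr_mult1: "fr p 1 \<otimes>\<^bsub>FF\<^esub> fr q 1 = fr (p * q) 1"
  by (simp add: fr_mult)

lemma fr_eq1: "fr p 1 = fr q 1 \<longleftrightarrow> sg p = sg q"
  by (simp add: fr_eq)

lemma fr_sum1: "(\<Oplus>\<^bsub>FF\<^esub>i\<in>I. fr (p i) 1) = fr (\<Sum>i\<in>I. p i) 1"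
proof (induction I rule: infinite_finite_induct)
  case (insert i I)
  then show ?case by (simp add: fr_add1 Pi_iff)
qed (auto simp: zero_FF FF.finsum_infinite)

lemma frac_of_pr: "frac_of R (pr p) = fr p 1"
  by (simp add: fr_def pr_1)

lemma frac_of_rep: "r \<in> carrier R \<Longrightarrow> frac_of R r = fr (rep r) 1"
  by (simp add: fr_def pr_1)

section \<open>Regular forms of degree one and two\<close>

lemma dform_eq: "dform R pr W a = (\<lambda>v\<in>W. fr (const_poly (pairing a v)) 1)"
  by (simp add: dform_def frac_of_pr)

lemma smult_forms: "c \<odot>\<^bsub>FF.func_space W\<^esub> x = (\<lambda>v\<in>W. c \<otimes>\<^bsub>FF\<^esub> x v)"
  by (simp add: FF.func_space_def)

text \<open>A regular form is given by its contractions. On a proper subspace several coefficient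
  vectors \<open>p\<close> describe the same form, since the \<open>dx_i\<close> are dependent
  there.\<close>

lemma Omega1_eq: "Omega1 R pr W = {\<lambda>v\<in>W. fr (ctr p v) 1 | p. True}"
proof -
  have *: "(\<Oplus>\<^bsub>forms1 R W\<^esub>i\<in>UNIV. frac_of R (f i) \<odot>\<^bsub>forms1 R W\<^esub> dform R pr W (axis i 1)) =
      (\<lambda>v\<in>W. fr (ctr (\<lambda>i. rep (f i)) v) 1)" if f: "\<And>i. f i \<in> carrier R" for f
  proof -
    have "(\<Oplus>\<^bsub>forms1 R W\<^esub>i\<in>UNIV. frac_of R (f i) \<odot>\<^bsub>forms1 R W\<^esub> dform R pr W (axis i 1)) =
        (\<lambda>v\<in>W. \<Oplus>\<^bsub>FF\<^esub>i\<in>UNIV. (frac_of R (f i) \<odot>\<^bsub>forms1 R W\<^esub> dform R pr W (axis i 1)) v)"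
      by (rule FF.func_space_finsum) (auto simp: smult_forms dform_eq frac_of_rep f fr_mult1 FF.func_space_def)
    also have "\<dots> = (\<lambda>v\<in>W. fr (ctr (\<lambda>i. rep (f i)) v) 1)"
      by (rule restrict_ext)
        (simp add: smult_forms dform_eq frac_of_rep f fr_mult1 fr_sum1 ctr_def pairing_axis_left mult.commute)
    finally show ?thesis .
  qed
  show ?thesis
  proof (intro equalityI subsetI)
    fix x assume "x \<in> Omega1 R pr W"
    then show "x \<in> {\<lambda>v\<in>W. fr (ctr p v) 1 | p. True}" unfolding Omega1_def using * by auto
  next
    fix x assume "x \<in> {\<lambda>v\<in>W. fr (ctr p v) 1 | p. True}"
    then obtain p where p: "x = (\<lambda>v\<in>W. fr (ctr p v) 1)" by blast
    have "x = (\<lambda>v\<in>W. fr (ctr (\<lambda>i. rep (pr (p i))) v) 1)"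
      unfolding p by (rule restrict_ext) (simp add: fr_eq1 elim_ctr elim_pair)
    then show "x \<in> Omega1 R pr W"
      unfolding Omega1_def by (intro CollectI exI[of _ "\<lambda>i. pr (p i)"]) (simp add: *)
  qed
qed

lemma wedge_fr:
  assumes "u \<in> W" "v \<in> W" "x u = fr p q" "x v = fr p' q" "sg q \<noteq> 0"
  shows "wedge R W x (dform R pr W a) (u, v) = fr (p * const_poly (pairing a v) - p' * const_poly (pairing a u)) q"
proof -
  have "wedge R W x (dform R pr W a) (u, v) =
      fr (p * const_poly (pairing a v)) q \<ominus>\<^bsub>FF\<^esub> fr (p' * const_poly (pairing a u)) q"
    using assms by (simp add: wedge_def dform_eq fr_mult)
  also have "\<dots> = fr (p * const_poly (pairing a v) - p' * const_poly (pairing a u)) q"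
    using assms(5) by (simp add: a_minus_def fr_uminus fr_add fr_eq mpoly_mult_eq_0 algebra_simps)
  finally show ?thesis .
qed

text \<open>The value at \<open>(u, v)\<close> of the sum of \<open>p (i, j)\<close> times the wedge
  product of \<open>dx_i\<close> and \<open>dx_j\<close>, taken over all ordered pairs.\<close>

definition two_form :: "('n \<times> 'n \<Rightarrow> ('k, 'n) mpoly) \<Rightarrow> 'k^'n \<Rightarrow> 'k^'n \<Rightarrow> ('k, 'n) mpoly" where
  "two_form p u v = (\<Sum>ij\<in>UNIV. p ij * const_poly (u $ fst ij * v $ snd ij - v $ fst ij * u $ snd ij))"

lemma Omega2_eq: "Omega2 R pr W = {\<lambda>(u, v)\<in>W \<times> W. fr (two_form p u v) 1 | p. True}"
proof -
  have wd: "wedge R W (dform R pr W (axis i 1)) (dform R pr W (axis j 1)) (u, v) =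
      fr (const_poly (u $ i * v $ j - v $ i * u $ j)) 1" if "u \<in> W" "v \<in> W" for i j u v
    using wedge_fr[OF that, of "dform R pr W (axis i 1)" "const_poly (u $ i)" 1 "const_poly (v $ i)" "axis j 1"] that
    by (simp add: dform_eq pairing_axis_left const_poly_diff const_poly_mult)
  have wd_ext: "wedge R W x y \<in> extensional (W \<times> W)" for x y by (simp add: wedge_def)
  have *: "(\<Oplus>\<^bsub>forms2 R W\<^esub>ij\<in>UNIV. frac_of R (f ij) \<odot>\<^bsub>forms2 R W\<^esub>
       wedge R W (dform R pr W (axis (fst ij) 1)) (dform R pr W (axis (snd ij) 1))) =
      (\<lambda>(u, v)\<in>W \<times> W. fr (two_form (\<lambda>ij. rep (f ij)) u v) 1)" if f: "\<And>ij. f ij \<in> carrier R" for f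
  proof -
    have "(\<Oplus>\<^bsub>forms2 R W\<^esub>ij\<in>UNIV. frac_of R (f ij) \<odot>\<^bsub>forms2 R W\<^esub>
       wedge R W (dform R pr W (axis (fst ij) 1)) (dform R pr W (axis (snd ij) 1))) =
      (\<lambda>uv\<in>W \<times> W. \<Oplus>\<^bsub>FF\<^esub>ij\<in>UNIV. (frac_of R (f ij) \<odot>\<^bsub>forms2 R W\<^esub>
       wedge R W (dform R pr W (axis (fst ij) 1)) (dform R pr W (axis (snd ij) 1))) uv)"
      by (rule FF.func_space_finsum) (auto simp: smult_forms wd frac_of_rep f fr_mult1 FF.func_space_def)
    also have "\<dots> = (\<lambda>(u, v)\<in>W \<times> W. fr (two_form (\<lambda>ij. rep (f ij)) u v) 1)"
      by (rule restrict_ext) (auto simp: smult_forms wd frac_of_rep f fr_mult1 fr_sum1 two_form_def)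
    finally show ?thesis .
  qed
  show ?thesis
  proof (intro equalityI subsetI)
    fix x assume "x \<in> Omega2 R pr W"
    then show "x \<in> {\<lambda>(u, v)\<in>W \<times> W. fr (two_form p u v) 1 | p. True}" unfolding Omega2_def using * by auto
  next
    fix x assume "x \<in> {\<lambda>(u, v)\<in>W \<times> W. fr (two_form p u v) 1 | p. True}"
    then obtain p where p: "x = (\<lambda>(u, v)\<in>W \<times> W. fr (two_form p u v) 1)" by blast
    have "x = (\<lambda>(u, v)\<in>W \<times> W. fr (two_form (\<lambda>ij. rep (pr (p ij))) u v) 1)"
      unfolding p by (rule restrict_ext) (clarsimp simp: fr_eq1 two_form_def elim_sum elim_pair)
    then show "x \<in> Omega2 R pr W"
      unfolding Omega2_def by (intro CollectI exI[of _ "\<lambda>ij. pr (p ij)"]) (simp add: *)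
  qed
qed

end

text \<open>The space \<open>W\<close> is the kernel of \<open>al\<close>. For \<open>al = 0\<close>
  this is the whole space, so the arrangement, its deletion and its restriction are treated
  together.\<close>

locale arrangement_rep = ring_rep al w R pr for al w :: "'k::field^'n" and R :: "'r ring" (structure) and pr +
  fixes W :: "('k^'n) set" and A :: "('k^'n) set set"
  assumes mem_W: "v \<in> W \<longleftrightarrow> pairing al v = 0"
    and finite_A: "finite A"
    and mem_L: "L \<in> A \<Longrightarrow> v \<in> L \<longleftrightarrow> v \<in> W \<and> pairing (def_form W L) v = 0"
    and form_nz: "L \<in> A \<Longrightarrow> sg (linear_poly (def_form W L)) \<noteq> 0"
begin

abbreviation QA where "QA \<equiv> \<Prod>L\<in>A. linear_poly (def_form W L)"

definition to_form :: "('n \<Rightarrow> ('k, 'n) mpoly) \<Rightarrow> 'k^'n \<Rightarrow> ('r \<times> 'r) set" where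
  "to_form x = (\<lambda>v\<in>W. fr (ctr x v) QA)"

lemma defining_poly_eq: "defining_poly R pr W A = pr QA"
  by (simp add: defining_poly_def pr_prod)

lemma sg_QA: "sg QA \<noteq> 0"
  using finite_A form_nz by (simp add: elim_prod mpoly_prod_eq_0)

definition pi where "pi v = v - pairing al v *s w"

lemma pi_W: "pi v \<in> W"
  using elim_pair by (auto simp: pi_def mem_W pairing_simps elim_pair_def)

lemma pi_id: "v \<in> W \<Longrightarrow> pi v = v"
  by (simp add: pi_def mem_W)

lemma pi_w: "pi w = 0"
  using elim_pair by (auto simp: pi_def elim_pair_def)

lemma pi_add: "pi (u + v) = pi u + pi v"
  by (simp add: pi_def pairing_simps vec.scale_left_distrib)

lemma pi_scale: "pi (c *s v) = c *s pi v"
  by (simp add: pi_def pairing_simps vec.scale_right_diff_distrib)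

lemma form_eqI_W:
  assumes "ctr x w = 0" "ctr y w = 0" "\<And>v. v \<in> W \<Longrightarrow> ctr x v = ctr y v"
  shows "x = y"
proof
  fix i
  have "ctr x v = ctr y v" for v
    using assms(3)[OF pi_W[of v]] assms(1,2) by (simp add: pi_def ctr_diff_right ctr_scale)
  from this[of "axis i 1"] show "x i = y i" by simp
qed

lemma ex_normal_W:
  assumes "L \<in> A"
  obtains u where "u \<in> W" "pairing (def_form W L) u = 1"
proof -
  let ?a = "def_form W L"
  have "?a - pairing ?a w *s al \<noteq> 0" using form_nz[OF assms] by (simp add: elim_linear_poly)
  then obtain u where u: "pairing (?a - pairing ?a w *s al) u = 1" using ex_pairing_eq_1 by blast
  have "pairing ?a (pi u) = 1" using u by (simp add: pi_def pairing_simps mult.commute)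
  then show ?thesis using pi_W that by blast
qed

lemma to_form_val: "v \<in> W \<Longrightarrow> to_form x v = fr (ctr x v) QA"
  by (simp add: to_form_def)

lemma scaled_wedge:
  assumes "u \<in> W" "v \<in> W"
  shows "(frac_of R (defining_poly R pr W A) \<odot>\<^bsub>forms2 R W\<^esub> wedge R W (to_form x) (dform R pr W a)) (u, v) =
    fr (ctr x u * const_poly (pairing a v) - ctr x v * const_poly (pairing a u)) 1"
proof -
  have "wedge R W (to_form x) (dform R pr W a) (u, v) =
      fr (ctr x u * const_poly (pairing a v) - ctr x v * const_poly (pairing a u)) QA"
    using assms sg_QA by (intro wedge_fr) (auto simp: to_form_val)
  then show ?thesis
    using assms sg_QA by (simp add: smult_forms defining_poly_eq frac_of_pr fr_mult fr_eq mult.commute)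
qed

text \<open>Evaluating the 2-form at \<open>(u, v)\<close> with \<open>u\<close> normalized by the
  form of \<open>L\<close> and \<open>v\<close> in \<open>L\<close> gives one direction. Conversely,
  the part of \<open>x\<close> along \<open>L\<close> is divisible by the form of \<open>L\<close>,
  and wedging the quotient with its differential gives the required regular 2-form; the part of
  \<open>x\<close> proportional to this differential drops out of the wedge product.\<close>

lemma log_condition:
  assumes L: "L \<in> A"
  shows "frac_of R (defining_poly R pr W A) \<odot>\<^bsub>forms2 R W\<^esub> wedge R W (to_form x) (dform R pr W (def_form W L))
       \<in> {frac_of R (pr (linear_poly (def_form W L))) \<odot>\<^bsub>forms2 R W\<^esub> z | z. z \<in> Omega2 R pr W} \<longleftrightarrow>
     (\<forall>v\<in>L. sg (linear_poly (def_form W L)) dvd sg (ctr x v))"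
    (is "?lhs \<in> ?R \<longleftrightarrow> _")
proof
  let ?a = "def_form W L"
  assume "?lhs \<in> ?R"
  then obtain p where p: "?lhs = frac_of R (pr (linear_poly ?a)) \<odot>\<^bsub>forms2 R W\<^esub> (\<lambda>(u, v)\<in>W \<times> W. fr (two_form p u v) 1)"
    unfolding Omega2_eq by blast
  show "\<forall>v\<in>L. sg (linear_poly ?a) dvd sg (ctr x v)"
  proof
    fix v assume "v \<in> L"
    then have v: "v \<in> W" "pairing ?a v = 0" using mem_L[OF L] by auto
    obtain u where u: "u \<in> W" "pairing ?a u = 1" using ex_normal_W[OF L] .
    have "fr (ctr x u * const_poly (pairing ?a v) - ctr x v * const_poly (pairing ?a u)) 1 =
        fr (linear_poly ?a * two_form p u v) 1"
      using fun_cong[OF p, of "(u, v)"] u(1) v(1)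
      unfolding scaled_wedge[OF u(1) v(1)] by (simp add: smult_forms frac_of_pr fr_mult1)
    then have "- sg (ctr x v) = sg (linear_poly ?a) * sg (two_form p u v)"
      using u v by (simp add: fr_eq1)
    then show "sg (linear_poly ?a) dvd sg (ctr x v)" by (metis dvd_minus_iff dvd_triv_left)
  qed
next
  let ?a = "def_form W L"
  assume d: "\<forall>v\<in>L. sg (linear_poly ?a) dvd sg (ctr x v)"
  obtain u0 where u0: "u0 \<in> W" "pairing ?a u0 = 1" using ex_normal_W[OF L] .
  let ?l = "sg (linear_poly ?a)"
  \<comment> \<open>The contraction of \<open>x\<close> with the component of \<open>v\<close> in
    \<open>L\<close>, after projection to \<open>W\<close> along \<open>w\<close> and then to
    \<open>L\<close> along \<open>u0\<close>.\<close>
  define g where "g v = sg (ctr x (pi v - pairing ?a (pi v) *s u0))" for v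
  have "?l dvd g v" for v
    unfolding g_def using d mem_L[OF L] pi_W[of v] u0
    by (auto simp: mem_W pairing_simps)
  then have "\<exists>K. \<forall>v. ?l * ctr K v = g v"
    by (intro ctr_quotient form_nz[OF L])
      (auto simp: g_def pi_add pi_scale pairing_simps ctr_add_right ctr_diff_right ctr_scale
        const_poly_add const_poly_mult algebra_simps)
  then obtain K where K: "\<And>v. ?l * ctr K v = g v" by blast
  \<comment> \<open>The coefficients of the wedge product of \<open>K\<close> with the differential
    of the form of \<open>L\<close>.\<close>
  define p where "p ij = K (fst ij) * const_poly (?a $ snd ij)" for ij
  have tf: "two_form p u v = ctr K u * const_poly (pairing ?a v) - ctr K v * const_poly (pairing ?a u)" for u v
  proof -
    have s: "(\<Sum>ij\<in>UNIV. K (fst ij) * const_poly (?a $ snd ij) * const_poly (u $ fst ij * v $ snd ij)) =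
        ctr K u * const_poly (pairing ?a v)" for u v
    proof -
      have "(\<Sum>ij\<in>UNIV. K (fst ij) * const_poly (?a $ snd ij) * const_poly (u $ fst ij * v $ snd ij)) =
          (\<Sum>i\<in>UNIV. \<Sum>j\<in>UNIV. K i * const_poly (?a $ j) * const_poly (u $ i * v $ j))"
        by (simp add: sum.cartesian_product case_prod_beta)
      also have "\<dots> = ctr K u * const_poly (pairing ?a v)"
        by (simp add: ctr_def pairing_def const_poly_sum const_poly_mult sum_product mult_ac)
      finally show ?thesis .
    qed
    show ?thesis
      unfolding two_form_def p_def const_poly_diff right_diff_distrib sum_subtractf s
      by (simp add: s[of v u])
  qed
  have "?lhs = frac_of R (pr (linear_poly ?a)) \<odot>\<^bsub>forms2 R W\<^esub> (\<lambda>(u, v)\<in>W \<times> W. fr (two_form p u v) 1)"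
  proof (rule extensionalityI[of _ "W \<times> W"])
    fix uv assume "uv \<in> W \<times> W"
    then obtain u v where uv: "uv = (u, v)" "u \<in> W" "v \<in> W" by blast
    have gW: "g v = sg (ctr x v) - const_poly (pairing ?a v) * sg (ctr x u0)" if "v \<in> W" for v
      using that by (simp add: g_def pi_id ctr_diff_right ctr_scale)
    have "sg (linear_poly ?a * two_form p u v) =
        sg ((?l * ctr K u) * const_poly (pairing ?a v) - (?l * ctr K v) * const_poly (pairing ?a u))"
      unfolding tf using elim_pair by (simp add: right_diff_distrib mult.assoc)
    also have "\<dots> = sg (ctr x u * const_poly (pairing ?a v) - ctr x v * const_poly (pairing ?a u))"
      unfolding K gW[OF uv(2)] gW[OF uv(3)] using elim_pair by (simp add: algebra_simps)
    finally have "fr (ctr x u * const_poly (pairing ?a v) - ctr x v * const_poly (pairing ?a u)) 1 =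
        fr (linear_poly ?a * two_form p u v) 1" by (simp add: fr_eq1)
    then show "?lhs uv = (frac_of R (pr (linear_poly ?a)) \<odot>\<^bsub>forms2 R W\<^esub> (\<lambda>(u, v)\<in>W \<times> W. fr (two_form p u v) 1)) uv"
      unfolding uv(1) scaled_wedge[OF uv(2,3)] using uv by (simp add: smult_forms frac_of_pr fr_mult1)
  qed (simp_all add: smult_forms)
  then show "?lhs \<in> ?R" unfolding Omega2_eq by blast
qed

abbreviation LV where "LV \<equiv> logv A (def_form W)"

text \<open>Among the coefficient vectors of a form on \<open>W\<close>, exactly one is fixed by
  \<open>sg\<close> and has contraction zero with \<open>w\<close>. It is obtained from any other by
  composing with the projection to \<open>W\<close> and eliminating \<open>al\<close>.\<close>

lemma log_forms_eq: "log_forms R pr W A = to_form ` LV"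
proof (intro equalityI subsetI)
  fix x assume "x \<in> log_forms R pr W A"
  then obtain p where x: "x = frac R \<one> (defining_poly R pr W A) \<odot>\<^bsub>forms1 R W\<^esub> (\<lambda>v\<in>W. fr (ctr p v) 1)"
    and cond: "\<forall>L\<in>A. frac_of R (defining_poly R pr W A) \<odot>\<^bsub>forms2 R W\<^esub> wedge R W x (dform R pr W (def_form W L))
       \<in> {frac_of R (pr (linear_poly (def_form W L))) \<odot>\<^bsub>forms2 R W\<^esub> z | z. z \<in> Omega2 R pr W}"
    unfolding log_forms_def Omega1_eq by blast
  define y where "y i = sg (ctr p (pi (axis i 1)))" for i
  have cy: "ctr y v = sg (ctr p (pi v))" for v
    unfolding y_def by (rule ctr_of_linear) (simp_all add: pi_add pi_scale ctr_add_right ctr_scale)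
  have xy: "x = to_form y"
    unfolding x to_form_def using sg_QA elim_pair
    by (auto simp: smult_forms fun_eq_iff cy pi_id defining_poly_eq fr_eq fr_mult
        simp flip: pr_1 fr_def)
  have "y \<in> LV"
    unfolding logv_def
  proof (intro CollectI conjI ballI allI)
    show "sg (y i) = y i" for i using elim_pair by (simp add: y_def)
    show "ctr y w = 0" by (simp add: cy pi_w)
    fix L v assume L: "L \<in> A" and v: "v \<in> L"
    have "sg (linear_poly (def_form W L)) dvd sg (ctr y v)"
      using cond L v log_condition[OF L, of y] unfolding xy by blast
    then show "sg (linear_poly (def_form W L)) dvd ctr y v" using elim_pair by (simp add: cy)
  qed
  then show "x \<in> to_form ` LV" using xy by blast
next
  fix x assume "x \<in> to_form ` LV"
  then obtain y where y: "y \<in> LV" and x: "x = to_form y" by blast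
  have sy: "sg (ctr y v) = ctr y v" for v using y by (intro sg_ctr_closed) (simp add: logv_def)
  have "x = frac R \<one> (defining_poly R pr W A) \<odot>\<^bsub>forms1 R W\<^esub> (\<lambda>v\<in>W. fr (ctr y v) 1)"
    unfolding x to_form_def using sg_QA
    by (auto simp: smult_forms fun_eq_iff defining_poly_eq fr_mult simp flip: pr_1 fr_def)
  moreover have "(\<lambda>v\<in>W. fr (ctr y v) 1) \<in> Omega1 R pr W" unfolding Omega1_eq by blast
  moreover have "\<forall>L\<in>A. frac_of R (defining_poly R pr W A) \<odot>\<^bsub>forms2 R W\<^esub> wedge R W x (dform R pr W (def_form W L))
       \<in> {frac_of R (pr (linear_poly (def_form W L))) \<odot>\<^bsub>forms2 R W\<^esub> z | z. z \<in> Omega2 R pr W}"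
    unfolding x using y log_condition by (simp add: logv_def sy)
  ultimately show "x \<in> log_forms R pr W A" unfolding log_forms_def by blast
qed

lemma to_form_eq:
  assumes x: "x \<in> LV" and y: "y \<in> LV" and v: "v \<in> W" and eq: "to_form x v = to_form y v"
  shows "ctr x v = ctr y v"
proof -
  have s: "sg (ctr x v) = ctr x v" "sg (ctr y v) = ctr y v"
    using x y by (auto intro!: sg_ctr_closed simp: logv_def)
  have "fr (ctr x v) QA = fr (ctr y v) QA" using eq v by (simp add: to_form_val)
  then have "sg QA * ctr x v = sg QA * ctr y v" using sg_QA s by (simp add: fr_eq mult.commute)
  then show ?thesis using sg_QA by (simp add: mpoly_mult_left_cancel)
qed

lemma module_rep_log_forms: "module_rep al w R pr (log_forms_module R pr W A) LV to_form"
proof unfold_locales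
  show "submod LV" by (rule submod_logv)
  have "inj_on to_form LV"
  proof (rule inj_onI)
    fix x y assume x: "x \<in> LV" and y: "y \<in> LV" and eq: "to_form x = to_form y"
    show "x = y"
      by (rule form_eqI_W) (use x y to_form_eq[OF x y] eq in \<open>auto simp: logv_def\<close>)
  qed
  then show "bij_betw to_form LV (carrier (log_forms_module R pr W A))"
    by (simp add: bij_betw_def log_forms_module_def log_forms_eq)
  show "to_form (\<lambda>v. x v + y v) = to_form x \<oplus>\<^bsub>log_forms_module R pr W A\<^esub> to_form y" for x y
    using sg_QA unfolding to_form_def log_forms_module_def
    by (auto simp: FF.func_space_def fun_eq_iff fr_add fr_eq mpoly_mult_eq_0 ctr_add_left algebra_simps)
  show "to_form (\<lambda>v. r * x v) = pr r \<odot>\<^bsub>log_forms_module R pr W A\<^esub> to_form x" for r x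
    using sg_QA unfolding to_form_def log_forms_module_def
    by (auto simp: FF.func_space_def fun_eq_iff frac_of_pr fr_mult ctr_smult)
  show "to_form (\<lambda>v. 0) = \<zero>\<^bsub>log_forms_module R pr W A\<^esub>"
    using sg_QA unfolding to_form_def log_forms_module_def
    by (auto simp: FF.func_space_def fun_eq_iff zero_FF fr_eq)
qed

lemma free_arrangement_iff: "free_arrangement R pr W A \<longleftrightarrow> (\<exists>B. is_basis LV B)"
proof -
  interpret module_rep al w R pr "log_forms_module R pr W A" LV to_form by (rule module_rep_log_forms)
  show ?thesis
    unfolding free_arrangement_def
    using free_if_is_basis is_basis_if_free[OF almost_generated_logv[OF finite_A form_nz]] by blast
qed

end

subsection \<open>Residues of logarithmic forms\<close>

text \<open>The basis of the space dual to a basis \<open>B\<close> of linear forms. It turns the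
  coefficient of a form at \<open>d b\<close> into a contraction.\<close>

definition dual_vector :: "('k::field^'n) set \<Rightarrow> 'k^'n \<Rightarrow> 'k^'n" where
  "dual_vector B b = (\<chi> i. vec.representation B (axis i 1) b)"

lemma pairing_dual_vector:
  assumes "vec.independent B" "vec.span B = UNIV"
  shows "pairing a (dual_vector B b) = vec.representation B a b"
proof -
  have "vec.representation B (\<Sum>i\<in>UNIV. a $ i *s axis i 1) b = (\<Sum>i\<in>UNIV. vec.representation B (a $ i *s axis i 1) b)"
    by (subst vec.representation_sum[OF assms(1)]) (simp_all add: assms(2))
  also have "\<dots> = pairing a (dual_vector B b)"
    using assms by (simp add: pairing_def dual_vector_def vec.representation_scale)
  finally show ?thesis by (simp add: basis_expansion)
qed

lemma dual_vector_expansion: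
  assumes B: "vec.independent B" "vec.span B = UNIV"
  shows "(\<Sum>b\<in>B. pairing b v *s dual_vector B b) = v"
proof -
  have "(\<Sum>b\<in>B. pairing b v *s dual_vector B b) $ i = v $ i" for i
  proof -
    have "(\<Sum>b\<in>B. vec.representation B (axis i 1) b *s b) = axis i 1"
      using B vec.finiteI_independent[OF B(1)] by (intro vec.sum_representation_eq) auto
    from arg_cong[OF this, of "\<lambda>a. pairing a v"]
    show ?thesis by (simp add: dual_vector_def pairing_sum_left pairing_scale_left pairing_axis_left mult.commute)
  qed
  then show ?thesis by (simp add: vec_eq_iff)
qed

lemma ctr_sum_right: "ctr x (\<Sum>i\<in>I. v i) = (\<Sum>i\<in>I. ctr x (v i))"
  by (induction I rule: infinite_finite_induct) (simp_all add: ctr_add_right)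

lemma ctr_dual_expansion:
  assumes "vec.independent B" "vec.span B = UNIV"
  shows "(\<Sum>b\<in>B. ctr x (dual_vector B b) * const_poly (pairing b v)) = ctr x v"
proof -
  have "ctr x v = ctr x (\<Sum>b\<in>B. pairing b v *s dual_vector B b)"
    by (simp only: dual_vector_expansion[OF assms])
  then show ?thesis by (simp add: ctr_sum_right ctr_scale mult.commute)
qed

text \<open>A basis of \<open>L\<close> together with one vector \<open>b\<close> outside is a basis
  of the space; the coordinate at \<open>b\<close> is a defining form.\<close>

lemma hyperplane_form:
  assumes "hyperplane UNIV L"
  shows "\<exists>a. a \<noteq> 0 \<and> (\<forall>v. v \<in> L \<longleftrightarrow> pairing a v = 0)"
proof -
  have L: "vec.subspace L" "vec.dim (UNIV :: ('a^'b) set) = vec.dim L + 1" using assms by (auto simp: hyperplane_def)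
  obtain C where C: "C \<subseteq> L" "vec.independent C" "L \<subseteq> vec.span C" "card C = vec.dim L"
    by (rule vec.basis_exists)
  have span_C: "vec.span C = L" using vec.span_minimal[OF C(1) L(1)] C(3) by auto
  have "L \<noteq> UNIV" using L(2) by auto
  then obtain b where b: "b \<notin> L" by auto
  let ?B = "insert b C"
  have "finite C" by (rule vec.finiteI_independent[OF C(2)])
  moreover have "b \<notin> C" using b C(1) by auto
  ultimately have card: "card ?B = vec.dim (UNIV :: ('a^'b) set)" using L(2) C(4) by simp
  have B: "vec.independent ?B" using b C(2) by (intro vec.independent_insertI) (simp add: span_C)
  have span: "vec.span ?B = UNIV" using vec.card_ge_dim_independent[OF subset_UNIV B] card by auto
  let ?a = "dual_vector ?B b"
  have a: "pairing ?a v = vec.representation ?B v b" for v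
    by (subst pairing_commute) (rule pairing_dual_vector[OF B span])
  have "v \<in> L \<longleftrightarrow> pairing ?a v = 0" for v
  proof
    assume "v \<in> L"
    then have "vec.representation ?B v = vec.representation C v"
      by (intro vec.representation_extend[OF B]) (auto simp: span_C)
    then show "pairing ?a v = 0" using vec.representation_ne_zero[of C v b] \<open>b \<notin> C\<close> by (auto simp: a)
  next
    assume "pairing ?a v = 0"
    moreover have "v = (\<Sum>x\<in>?B. vec.representation ?B v x *s x)"
      using \<open>finite C\<close> span by (intro vec.sum_representation_eq[symmetric] B) auto
    ultimately have "v = (\<Sum>x\<in>C. vec.representation ?B v x *s x)"
      using \<open>finite C\<close> \<open>b \<notin> C\<close> by (simp add: a)
    also have "\<dots> \<in> L" using C(1) L(1) by (intro vec.subspace_sum vec.subspace_scale) auto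
    finally show "v \<in> L" .
  qed
  moreover have "?a \<noteq> 0" using b calculation[of b] by auto
  ultimately show ?thesis by blast
qed

lemma alpha_form:
  assumes "hyperplane UNIV L"
  shows "v \<in> L \<longleftrightarrow> pairing (alpha L) v = 0" "alpha L \<noteq> 0"
proof -
  obtain a where "\<And>v. v \<in> L \<longleftrightarrow> pairing a v = 0" using hyperplane_form[OF assms] by blast
  then have "L = {v \<in> UNIV. pairing a v = 0}" by auto
  from someI[of "\<lambda>a. L = {v \<in> UNIV. pairing a v = 0}", OF this]
  have L: "L = {v \<in> UNIV. pairing (alpha L) v = 0}" unfolding def_form_def .
  have *: "v \<in> L \<longleftrightarrow> pairing (alpha L) v = 0" for v using eqset_imp_iff[OF L, of v] by simp
  then show "v \<in> L \<longleftrightarrow> pairing (alpha L) v = 0" .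
  show "alpha L \<noteq> 0"
  proof
    assume "alpha L = 0"
    then have "L = UNIV" using * by auto
    then show False using assms by (simp add: hyperplane_def)
  qed
qed

text \<open>The form of \<open>L\<close> itself shows that the choice in \<open>def_form\<close>
  succeeds for the restricted hyperplane.\<close>

lemma def_form_restriction:
  assumes "hyperplane UNIV L"
  shows "v \<in> H \<inter> L \<longleftrightarrow> v \<in> H \<and> pairing (def_form H (H \<inter> L)) v = 0"
proof -
  have "H \<inter> L = {v \<in> H. pairing (alpha L) v = 0}" using alpha_form(1)[OF assms] by auto
  from someI[of "\<lambda>a. H \<inter> L = {v \<in> H. pairing a v = 0}", OF this]
  have L: "H \<inter> L = {v \<in> H. pairing (def_form H (H \<inter> L)) v = 0}" unfolding def_form_def .
  show ?thesis using eqset_imp_iff[OF L, of v] by simp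
qed

lemma ring_rep_poly_ring: "ring_rep (0 :: 'k::field^'n) 0 (poly_ring :: ('k, 'n) mpoly ring) id"
  by unfold_locales (simp_all add: poly_ring_def elim_pair_def)

text \<open>Two cosets agree if and only if the form of \<open>H\<close> divides the difference,
  which is the kernel condition for elimination.\<close>

lemma ring_rep_Sbar:
  fixes H :: "('k::field^'n) set"
  assumes w: "pairing (alpha H) w = 1"
  shows "ring_rep (alpha H) w (Sbar H) (proj_Sbar H)"
proof -
  let ?R = "poly_ring :: ('k, 'n) mpoly ring" and ?t = "linear_poly (alpha H)"
  interpret S: ring_rep "0 :: 'k^'n" 0 ?R id by (rule ring_rep_poly_ring)
  let ?I = "PIdl\<^bsub>?R\<^esub> ?t"
  have car: "carrier ?R = UNIV" by (simp add: poly_ring_def)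
  have I: "ideal ?I ?R" by (rule S.R.cgenideal_ideal) (simp add: car)
  have hom: "proj_Sbar H \<in> ring_hom ?R (Sbar H)"
    using ideal.rcos_ring_hom[OF I] unfolding proj_Sbar_def[abs_def] Sbar_def .
  have ring: "ring (Sbar H)" unfolding Sbar_def by (rule ideal.quotient_is_ring[OF I])
  have ep: "elim_pair (alpha H) w" using w by (simp add: elim_pair_def)
  show ?thesis
  proof unfold_locales
    show "elim_pair (alpha H) w" by (rule ep)
    show "carrier (Sbar H) = range (proj_Sbar H)"
      by (auto simp: Sbar_def proj_Sbar_def FactRing_def A_RCOSETS_def' car)
    show "proj_Sbar H (p + q) = proj_Sbar H p \<oplus>\<^bsub>Sbar H\<^esub> proj_Sbar H q" for p q
      using ring_hom_add[OF hom, of p q] by (simp add: poly_ring_def)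
    show "proj_Sbar H (p * q) = proj_Sbar H p \<otimes>\<^bsub>Sbar H\<^esub> proj_Sbar H q" for p q
      using ring_hom_mult[OF hom, of p q] by (simp add: poly_ring_def)
    show "proj_Sbar H 1 = \<one>\<^bsub>Sbar H\<^esub>"
      using ring_hom_one[OF hom] by (simp add: poly_ring_def)
    show "proj_Sbar H 0 = \<zero>\<^bsub>Sbar H\<^esub>"
      using ring_hom_zero[OF hom S.R.ring_axioms ring] by (simp add: poly_ring_def)
    fix p q
    have "proj_Sbar H p = proj_Sbar H q \<longleftrightarrow> p \<ominus>\<^bsub>?R\<^esub> q \<in> ?I"
      unfolding proj_Sbar_def using S.R.quotient_eq_iff_same_a_r_cos[OF I, of p q] by (simp add: car)
    also have "p \<ominus>\<^bsub>?R\<^esub> q = p - q" using S.pr_minus[of p q] by simp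
    also have "p - q \<in> ?I \<longleftrightarrow> ?t dvd p - q"
      by (auto simp: cgenideal_def poly_ring_def dvd_def mult.commute)
    finally show "proj_Sbar H p = proj_Sbar H q \<longleftrightarrow> elim (alpha H) w p = elim (alpha H) w q"
      unfolding elim_eq_iff[OF ep] .
  qed
qed

locale residue_setup =
  fixes A :: "('k::field^'n) set set" and H :: "('k^'n) set" and w :: "'k^'n"
  assumes arr: "arrangement UNIV A" and HA: "H \<in> A" and w: "pairing (alpha H) w = 1"

sublocale residue_setup \<subseteq> restricted_arrangement "alpha H" w A H alpha "def_form H"
proof
  have hyp: "hyperplane UNIV L" if "L \<in> A" for L using arr that by (auto simp: arrangement_def)
  show "elim_pair (alpha H) w" using w by (simp add: elim_pair_def)
  show "finite A" using arr by (simp add: arrangement_def)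
  show "H \<in> A" by (rule HA)
  show "alpha H = alpha H" ..
  show "pairing (alpha H) w = 1" by (rule w)
  show "v \<in> L \<longleftrightarrow> pairing (alpha L) v = 0" if "L \<in> A" for L v by (rule alpha_form(1)[OF hyp[OF that]])
  show "alpha L \<noteq> 0" if "L \<in> A" for L by (rule alpha_form(2)[OF hyp[OF that]])
  show "v \<in> X \<longleftrightarrow> v \<in> H \<and> pairing (def_form H X) v = 0" if X: "X \<in> restriction A H" for X v
  proof -
    obtain L where L: "L \<in> A" "X = H \<inter> L" using X by (auto simp: restriction_def)
    show ?thesis unfolding L(2) by (rule def_form_restriction[OF hyp[OF L(1)]])
  qed
qed

sublocale residue_setup \<subseteq> VA: arrangement_rep "0 :: 'k::field^'n" 0 poly_ring id UNIV A
proof -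
  interpret S: ring_rep "0 :: 'k^'n" 0 poly_ring id by (rule ring_rep_poly_ring)
  show "arrangement_rep (0 :: 'k::field^'n) 0 poly_ring id UNIV A"
    by unfold_locales (use finA mem_A a_nz in auto)
qed

sublocale residue_setup \<subseteq> VD: arrangement_rep "0 :: 'k::field^'n" 0 poly_ring id UNIV "A - {H}"
  by unfold_locales (use finA mem_A a_nz in auto)

sublocale residue_setup \<subseteq> AH: arrangement_rep "alpha H" w "Sbar H" "proj_Sbar H" H "restriction A H"
proof -
  interpret S: ring_rep "alpha H" w "Sbar H" "proj_Sbar H" by (rule ring_rep_Sbar[OF w])
  show "arrangement_rep (alpha H) w (Sbar H) (proj_Sbar H) H (restriction A H)"
    by unfold_locales (use finAH mem_AH mem_H b'_nz in \<open>auto simp: sg_b\<close>)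
qed

context residue_setup
begin

lemma forms1_expansion:
  assumes "finite B" "f \<in> B \<rightarrow> carrier VA.FF"
  shows "(\<Oplus>\<^bsub>forms1 poly_ring UNIV\<^esub> \<beta>\<in>B. f \<beta> \<odot>\<^bsub>forms1 poly_ring UNIV\<^esub> dform poly_ring id UNIV \<beta>) v =
    (\<Oplus>\<^bsub>VA.FF\<^esub>\<beta>\<in>B. f \<beta> \<otimes>\<^bsub>VA.FF\<^esub> VA.fr (const_poly (pairing \<beta> v)) 1)"
proof -
  have "(\<Oplus>\<^bsub>forms1 poly_ring UNIV\<^esub> \<beta>\<in>B. f \<beta> \<odot>\<^bsub>forms1 poly_ring UNIV\<^esub> dform poly_ring id UNIV \<beta>) =
      (\<lambda>v\<in>UNIV. \<Oplus>\<^bsub>VA.FF\<^esub>\<beta>\<in>B. (f \<beta> \<odot>\<^bsub>forms1 poly_ring UNIV\<^esub> dform poly_ring id UNIV \<beta>) v)"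
    using assms by (intro VA.FF.func_space_finsum) (auto simp: VA.smult_forms VA.dform_eq VA.FF.func_space_def Pi_iff)
  then show ?thesis by (simp add: VA.smult_forms VA.dform_eq)
qed

lemma (in ring_rep) fr_sum: "sg q \<noteq> 0 \<Longrightarrow> (\<Oplus>\<^bsub>FF\<^esub>i\<in>I. fr (p i) q) = fr (\<Sum>i\<in>I. p i) q"
proof (induction I rule: infinite_finite_induct)
  case (insert i I)
  then show ?case by (simp add: fr_add fr_eq mpoly_mult_eq_0 Pi_iff algebra_simps)
qed (auto simp: zero_FF fr_eq FF.finsum_infinite)

text \<open>In a basis \<open>B\<close> the coefficient at the differential of
  \<open>alpha H\<close> is the contraction with the dual vector, on which \<open>alpha H\<close>
  takes the value 1. Any basis containing \<open>alpha H\<close> supplies a witness, and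
  \<open>ctr_eq\<close> shows that all of them give the same residue.\<close>

lemma residue_to_form:
  assumes x: "x \<in> MA"
  shows "residue A H (VA.to_form x) = proj_Sbar H (res x)"
  unfolding residue_def
proof (rule the_equality)
  let ?Q = "VA.QA" and ?pr = "proj_Sbar H"
  have nz: "?Q \<noteq> 0" using VA.sg_QA by simp
  have "sg AH.QA = QH" by (simp add: QH_def elim_prod sg_b)
  then have "?pr AH.QA = ?pr QH" by (simp add: AH.pr_eq)
  then have def_AH: "defining_poly (Sbar H) ?pr H AH = ?pr QH" by (simp add: AH.defining_poly_eq)
  \<comment> \<open>Two such vectors differ by an element of \<open>H\<close>, and the contraction
    of a logarithmic form with it is divisible by the form of \<open>H\<close>.\<close>
  have ctr_eq: "?pr (ctr x d) = ?pr QH \<otimes>\<^bsub>Sbar H\<^esub> ?pr (res x)" if d: "pairing (alpha H) d = 1" for d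
  proof -
    have "d - w \<in> H" using d by (simp add: mem_H pairing_simps w)
    then have "linear_poly (alpha H) dvd ctr x (d - w)" using x HA by (auto simp: V_logv)
    then have "sg (ctr x d) = sg (ctr x w)" by (simp add: elim_eq_iff[OF elim_pair] ctr_diff_right)
    also have "\<dots> = sg (QH * res x)" using res[OF x] sg_res[OF x] elim_pair by simp
    finally have "?pr (ctr x d) = ?pr (QH * res x)" by (simp add: AH.pr_eq)
    then show ?thesis by (simp add: AH.pr_mult)
  qed
  {
    let ?B = "vec.extend_basis {alpha H}"
    have i: "vec.independent {alpha H}" by (simp add: vec.dependent_single al_nz)
    have B: "vec.independent ?B" "vec.span ?B = UNIV" "alpha H \<in> ?B"
      using vec.independent_extend_basis[OF i] vec.span_extend_basis[OF i] vec.extend_basis_superset[OF i] by auto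
    let ?f = "\<lambda>\<beta>. VA.fr (ctr x (dual_vector ?B \<beta>)) ?Q" and ?p = "ctr x (dual_vector ?B (alpha H))"
    have f: "?f \<in> ?B \<rightarrow> carrier VA.FF" using nz by auto
    have "VA.to_form x v = (\<Oplus>\<^bsub>forms1 poly_ring UNIV\<^esub> \<beta>\<in>?B. ?f \<beta> \<odot>\<^bsub>forms1 poly_ring UNIV\<^esub> dform poly_ring id UNIV \<beta>) v" for v
      unfolding forms1_expansion[OF vec.finiteI_independent[OF B(1)] f]
      using nz by (simp add: VA.to_form_val VA.fr_mult VA.fr_sum ctr_dual_expansion[OF B(1,2)])
    then have "VA.to_form x = (\<Oplus>\<^bsub>forms1 poly_ring UNIV\<^esub> \<beta>\<in>?B. ?f \<beta> \<odot>\<^bsub>forms1 poly_ring UNIV\<^esub> dform poly_ring id UNIV \<beta>)" ..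
    moreover have "frac_of poly_ring ?p =
        frac_of poly_ring (defining_poly poly_ring id UNIV A) \<otimes>\<^bsub>VA.FF\<^esub> ?f (alpha H)"
      using VA.frac_of_pr[of ?p] VA.frac_of_pr[of ?Q] nz
      by (simp add: VA.defining_poly_eq VA.fr_mult VA.fr_eq mult.commute)
    moreover have "pairing (alpha H) (dual_vector ?B (alpha H)) = 1"
      unfolding pairing_dual_vector[OF B(1,2)] vec.representation_basis[OF B(1,3)] by simp
    from ctr_eq[OF this] have "defining_poly (Sbar H) ?pr H AH \<otimes>\<^bsub>Sbar H\<^esub> ?pr (res x) = ?pr ?p"
      unfolding def_AH ..
    ultimately show "?pr (res x) \<in> carrier (Sbar H) \<and>
      (\<exists>B f p. vec.independent B \<and> vec.span B = UNIV \<and> alpha H \<in> B \<and> f \<in> B \<rightarrow> carrier VA.FF \<and>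
        VA.to_form x = (\<Oplus>\<^bsub>forms1 poly_ring UNIV\<^esub> \<beta>\<in>B. f \<beta> \<odot>\<^bsub>forms1 poly_ring UNIV\<^esub> dform poly_ring id UNIV \<beta>) \<and>
        frac_of poly_ring p = frac_of poly_ring (defining_poly poly_ring id UNIV A) \<otimes>\<^bsub>VA.FF\<^esub> f (alpha H) \<and>
        defining_poly (Sbar H) ?pr H AH \<otimes>\<^bsub>Sbar H\<^esub> ?pr (res x) = ?pr p)"
      using B f by (intro conjI exI[of _ ?B] exI[of _ ?f] exI[of _ ?p] AH.pr_closed)
  }
  fix g
  assume "g \<in> carrier (Sbar H) \<and>
      (\<exists>B f p. vec.independent B \<and> vec.span B = UNIV \<and> alpha H \<in> B \<and> f \<in> B \<rightarrow> carrier VA.FF \<and>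
        VA.to_form x = (\<Oplus>\<^bsub>forms1 poly_ring UNIV\<^esub> \<beta>\<in>B. f \<beta> \<odot>\<^bsub>forms1 poly_ring UNIV\<^esub> dform poly_ring id UNIV \<beta>) \<and>
        frac_of poly_ring p = frac_of poly_ring (defining_poly poly_ring id UNIV A) \<otimes>\<^bsub>VA.FF\<^esub> f (alpha H) \<and>
        defining_poly (Sbar H) ?pr H AH \<otimes>\<^bsub>Sbar H\<^esub> g = ?pr p)"
  then obtain B f p where g: "g \<in> carrier (Sbar H)"
    and B: "vec.independent B" "vec.span B = UNIV" "alpha H \<in> B" and f: "f \<in> B \<rightarrow> carrier VA.FF"
    and xf: "VA.to_form x = (\<Oplus>\<^bsub>forms1 poly_ring UNIV\<^esub> \<beta>\<in>B. f \<beta> \<odot>\<^bsub>forms1 poly_ring UNIV\<^esub> dform poly_ring id UNIV \<beta>)"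
    and p: "frac_of poly_ring p = frac_of poly_ring (defining_poly poly_ring id UNIV A) \<otimes>\<^bsub>VA.FF\<^esub> f (alpha H)"
    and gp: "defining_poly (Sbar H) ?pr H AH \<otimes>\<^bsub>Sbar H\<^esub> g = ?pr p"
    by (elim conjE exE)
  let ?d = "dual_vector B (alpha H)"
  have fin: "finite B" by (rule vec.finiteI_independent[OF B(1)])
  have d: "pairing \<beta> ?d = (if alpha H = \<beta> then 1 else 0)" if "\<beta> \<in> B" for \<beta>
    unfolding pairing_dual_vector[OF B(1,2)] vec.representation_basis[OF B(1) that] by simp
  have fC: "f \<beta> \<in> carrier VA.FF" if "\<beta> \<in> B" for \<beta> using f that by blast
  have one: "VA.fr 1 1 = \<one>\<^bsub>VA.FF\<^esub>" and zero: "VA.fr 0 1 = \<zero>\<^bsub>VA.FF\<^esub>"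
    by (simp_all only: VA.one_FF VA.zero_FF)
  have "VA.fr (ctr x ?d) ?Q = VA.to_form x ?d" by (simp add: VA.to_form_val)
  also have "\<dots> = (\<Oplus>\<^bsub>VA.FF\<^esub>\<beta>\<in>B. f \<beta> \<otimes>\<^bsub>VA.FF\<^esub> VA.fr (const_poly (pairing \<beta> ?d)) 1)"
    unfolding xf by (rule forms1_expansion[OF fin f])
  also have "\<dots> = (\<Oplus>\<^bsub>VA.FF\<^esub>\<beta>\<in>B. if alpha H = \<beta> then f \<beta> else \<zero>\<^bsub>VA.FF\<^esub>)"
    using fC by (intro VA.FF.finsum_cong') (auto simp: d one zero)
  also have "\<dots> = f (alpha H)"
    by (rule VA.FF.finsum_singleton[OF B(3) fin f])
  finally have "VA.fr p 1 = VA.fr ?Q 1 \<otimes>\<^bsub>VA.FF\<^esub> VA.fr (ctr x ?d) ?Q"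
    using p VA.frac_of_pr[of p] VA.frac_of_pr[of ?Q] by (simp add: VA.defining_poly_eq)
  then have "?Q * p = ?Q * ctr x ?d" using nz by (simp add: VA.fr_mult VA.fr_eq mult.commute)
  then have "p = ctr x ?d" using nz by (simp add: mpoly_mult_left_cancel)
  then have "?pr QH \<otimes>\<^bsub>Sbar H\<^esub> g = ?pr QH \<otimes>\<^bsub>Sbar H\<^esub> ?pr (res x)"
    using gp ctr_eq[of ?d] d[OF B(3)] unfolding def_AH by simp
  moreover have "?pr QH \<noteq> \<zero>\<^bsub>Sbar H\<^esub>" using QH_nz by (simp add: AH.pr_eq_0)
  ultimately show "g = ?pr (res x)"
    using domain.m_lcancel[OF AH.domain_R, of "?pr QH" g "?pr (res x)"] g by simp
qed

lemma residue_ideal_eq: "residue_ideal A H = proj_Sbar H ` J"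
  unfolding residue_ideal_def VA.log_forms_eq image_image
  by (intro image_cong refl residue_to_form)

section \<open>The residue ideal as a module over the quotient ring\<close>

abbreviation IM where "IM \<equiv> ideal_module (Sbar H) (residue_ideal A H)"

lemma sg_J: "m \<in> J \<Longrightarrow> sg m = m"
  using sg_res by auto

lemma J_mult: "m \<in> J \<Longrightarrow> sg r = r \<Longrightarrow> r * m \<in> J"
  using J_lincomb[of "{()}" "\<lambda>_. m" "\<lambda>_. r"] by simp

lemma J_add: "m \<in> J \<Longrightarrow> m' \<in> J \<Longrightarrow> m + m' \<in> J"
  using J_lincomb[of UNIV "\<lambda>i. if i then m else m'" "\<lambda>_. 1"] by (simp add: UNIV_bool add.commute)

text \<open>Ring elements are viewed as functions on a one-point type, so that the ideal is a
  submodule in the sense of \<open>submod\<close>.\<close>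

definition const_fun :: "('k, 'n) mpoly \<Rightarrow> unit \<Rightarrow> ('k, 'n) mpoly" where "const_fun m = (\<lambda>_. m)"

lemma const_fun_in_iff: "k \<in> const_fun ` J \<longleftrightarrow> k () \<in> J"
proof
  assume "k () \<in> J"
  moreover have "k = const_fun (k ())" by (simp add: const_fun_def fun_eq_iff)
  ultimately show "k \<in> const_fun ` J" by blast
qed (auto simp: const_fun_def)

lemma module_rep_IM:
  "module_rep (alpha H) w (Sbar H) (proj_Sbar H) IM (const_fun ` J) (\<lambda>k. proj_Sbar H (k ()))"
proof unfold_locales
  have "0 \<in> J" using J_mult[OF P_in_J, of 0] by simp
  then show "submod (const_fun ` J)"
    unfolding submod_def by (intro conjI ballI allI impI) (simp_all add: const_fun_in_iff J_add J_mult sg_J)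
  show "bij_betw (\<lambda>k. proj_Sbar H (k ())) (const_fun ` J) (carrier IM)"
    unfolding bij_betw_def
  proof
    show "inj_on (\<lambda>k. proj_Sbar H (k ())) (const_fun ` J)"
      by (auto intro!: inj_onI simp: const_fun_def AH.pr_eq sg_res)
    show "(\<lambda>k. proj_Sbar H (k ())) ` const_fun ` J = carrier IM"
      by (simp add: ideal_module_def residue_ideal_eq image_image const_fun_def)
  qed
qed (simp_all add: ideal_module_def AH.pr_add AH.pr_mult AH.pr_0)

sublocale IM: module_rep "alpha H" w "Sbar H" "proj_Sbar H" IM "const_fun ` J" "\<lambda>k. proj_Sbar H (k ())"
  by (rule module_rep_IM)

lemma carrier_IM: "carrier IM = proj_Sbar H ` J"
  by (simp add: ideal_module_def residue_ideal_eq)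

lemma evalm_IM:
  assumes "finite I" "\<And>i. i \<in> I \<Longrightarrow> m i \<in> J" "\<And>i. i \<in> I \<Longrightarrow> sg (k i) = k i"
  shows "AH.evalm IM I (\<lambda>i. proj_Sbar H (m i)) k = proj_Sbar H (\<Sum>i\<in>I. k i * m i)"
  unfolding AH.evalm_def
  using IM.h_lincomb[OF assms(1), of "\<lambda>i. const_fun (m i)" k] assms(2,3) by (simp add: const_fun_def)

lemma generates_IM:
  assumes B: "V.is_basis MA B"
  shows "AH.generates IM B (\<lambda>b. proj_Sbar H (res b))"
  unfolding AH.generates_def carrier_IM
proof (intro conjI ballI)
  have fin: "finite B" and sub: "\<And>b. b \<in> B \<Longrightarrow> b \<in> MA" using B by (auto simp: V.is_basis_def)
  show "proj_Sbar H (res b) \<in> proj_Sbar H ` J" if "b \<in> B" for b using sub[OF that] by blast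
  fix z assume "z \<in> proj_Sbar H ` J"
  then obtain x where x: "x \<in> MA" "z = proj_Sbar H (res x)" by blast
  obtain c where c: "x = (\<lambda>v. \<Sum>b\<in>B. c b * b v)" using V.is_basis_rep[OF B x(1)] by blast
  let ?k = "\<lambda>b. if b \<in> B then sg (c b) else 0"
  have "AH.evalm IM B (\<lambda>b. proj_Sbar H (res b)) ?k = proj_Sbar H (\<Sum>b\<in>B. ?k b * res b)"
    using fin sub elim_pair by (intro evalm_IM) auto
  also have "(\<Sum>b\<in>B. ?k b * res b) = res x"
    unfolding c using res_lincomb_set[OF fin sub, of c] by simp
  finally show "\<exists>k. (\<forall>b. sg (k b) = k b) \<and> (\<forall>b. b \<notin> B \<longrightarrow> k b = 0) \<and>
      AH.evalm IM B (\<lambda>b. proj_Sbar H (res b)) k = z"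
    unfolding x(2) using elim_pair by (intro exI[of _ ?k]) simp
qed

lemma relations_IM:
  assumes B: "V.is_basis MA B"
  shows "AH.relations IM B (\<lambda>b. proj_Sbar H (res b)) = syzygies B"
proof -
  have fin: "finite B" and sub: "\<And>b. b \<in> B \<Longrightarrow> b \<in> MA" using B by (auto simp: V.is_basis_def)
  have "AH.evalm IM B (\<lambda>b. proj_Sbar H (res b)) k = \<zero>\<^bsub>IM\<^esub> \<longleftrightarrow> (\<Sum>b\<in>B. k b * res b) = 0"
    if k: "\<And>b. sg (k b) = k b" for k
  proof -
    have "AH.evalm IM B (\<lambda>b. proj_Sbar H (res b)) k = proj_Sbar H (\<Sum>b\<in>B. k b * res b)"
      using fin sub k by (intro evalm_IM) auto
    moreover have "sg (\<Sum>b\<in>B. k b * res b) = (\<Sum>b\<in>B. k b * res b)"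
      using k sg_res[OF sub] by (intro sg_sum_closed) simp
    ultimately show ?thesis by (simp add: ideal_module_def AH.pr_eq_0)
  qed
  then show ?thesis unfolding AH.relations_def syzygies_def by blast
qed

lemma residue_ideal_eq_carrier_iff: "residue_ideal A H = carrier (Sbar H) \<longleftrightarrow> 1 \<in> J"
proof
  assume "residue_ideal A H = carrier (Sbar H)"
  then have "proj_Sbar H 1 \<in> proj_Sbar H ` J" unfolding residue_ideal_eq by simp
  then obtain m where m: "proj_Sbar H 1 = proj_Sbar H m" "m \<in> J" by (rule imageE)
  then show "1 \<in> J" using sg_J[OF m(2)] by (simp add: AH.pr_eq)
next
  assume 1: "1 \<in> J"
  have "proj_Sbar H p \<in> proj_Sbar H ` J" for p
    using J_mult[OF 1, of "sg p"] elim_pair by (intro image_eqI[of _ _ "sg p"]) simp_all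
  then show "residue_ideal A H = carrier (Sbar H)" unfolding residue_ideal_eq AH.carrier_R by auto
qed

text \<open>A functional on an ideal satisfies the exchange rule, since its value at a product of
  two elements of the ideal can be computed by pulling out either factor. So the criterion
  \<open>one_in_J\<close> applies to a dual basis.\<close>

lemma one_in_J_if_proj_dim_0:
  assumes "proj_dim (Sbar H) IM = 0"
  shows "1 \<in> J"
proof -
  obtain I :: "(((('k, 'n) mpoly set \<times> ('k, 'n) mpoly set) list \<Rightarrow> ('k, 'n) mpoly set) \<Rightarrow> ('k, 'n) mpoly set) set"
    and f n where d: "AH.pdual IM I f n"
    using AH.proj_dim_0_dual[OF assms] by (elim exE)
  note D = AH.pdualD[OF d]
  let ?pr = "proj_Sbar H"
  define m where "m i = AH.rep (n i)" for i
  have n: "n i = ?pr (m i)" "m i \<in> J" if i: "i \<in> I" for i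
  proof -
    obtain j where j: "n i = ?pr j" "j \<in> J" using D(1)[OF i] unfolding carrier_IM by (rule imageE)
    then have "m i = j" using sg_J[OF j(2)] by (simp add: m_def)
    then show "n i = ?pr (m i)" "m i \<in> J" using j by simp_all
  qed
  have car: "?pr x \<in> carrier IM" if "x \<in> J" for x using that unfolding carrier_IM by blast
  \<comment> \<open>The dual basis may be infinite, but the criterion needs only the expansion of
    the single element \<open>P\<close>.\<close>
  let ?S = "{i\<in>I. f i (?pr P) \<noteq> 0}"
  have PC: "?pr P \<in> carrier IM" using P_in_J by (rule car)
  have fin: "finite ?S" by (rule D(5)[OF PC])
  have "?pr P = AH.evalm IM ?S n (\<lambda>i. f i (?pr P))" unfolding AH.evalm_def by (rule D(6)[OF PC])
  also have "\<dots> = AH.evalm IM ?S (\<lambda>i. ?pr (m i)) (\<lambda>i. f i (?pr P))"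
    unfolding AH.evalm_def using n car D(2)[OF _ PC]
    by (intro IM.M.finsum_cong') auto
  also have "\<dots> = ?pr (\<Sum>i\<in>?S. f i (?pr P) * m i)"
    using n(2) D(2)[OF _ PC] by (intro evalm_IM fin) auto
  finally have "sg P = sg (\<Sum>i\<in>?S. f i (?pr P) * m i)" by (simp only: AH.pr_eq)
  also have "\<dots> = (\<Sum>i\<in>?S. f i (?pr P) * m i)"
    using n(2) D(2)[OF _ PC] by (intro sg_sum_closed) (auto simp: sg_J)
  finally have P_eq: "P = (\<Sum>i\<in>?S. f i (?pr P) * m i)" by simp
  show ?thesis
  proof (rule one_in_J[where f = "\<lambda>i x. f i (?pr x)" and m = m, OF fin])
    show "P = (\<Sum>i\<in>?S. f i (?pr P) * m i)" by (rule P_eq)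
    show "m i \<in> J" if "i \<in> ?S" for i using that n(2) by simp
    show "sg (f i (?pr x)) = f i (?pr x)" if "i \<in> ?S" "x \<in> J" for i x
      using that D(2)[OF _ car[OF that(2)]] by simp
    show "f i (?pr x) * y = f i (?pr y) * x" if i: "i \<in> ?S" and x: "x \<in> J" and y: "y \<in> J" for i x y
    proof -
      have "f i (?pr (a * b)) = a * f i (?pr b)" if "a \<in> J" "b \<in> J" for a b
        using D(4)[OF _ _ car[OF that(2)], of i "?pr a"] i sg_J[OF that(1)]
        by (simp add: ideal_module_def AH.pr_mult)
      from this[OF x y] this[OF y x] show ?thesis by (simp add: mult.commute)
    qed
  qed
qed

text \<open>The generator 1 has no nonzero relations, so the explicit resolution with an empty basis
  of relations stops in degree zero.\<close>

lemma proj_dim_0_if_one_in_J: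
  assumes 1: "1 \<in> J"
  shows "proj_dim (Sbar H) IM = 0"
proof -
  have e: "AH.evalm IM {()} (\<lambda>_. proj_Sbar H 1) k = proj_Sbar H (k ())" if "sg (k ()) = k ()" for k
    using evalm_IM[of "{()}" "\<lambda>_. 1" k] 1 that by simp
  have "AH.generates IM {()} (\<lambda>_. proj_Sbar H 1)"
    unfolding AH.generates_def carrier_IM
  proof (intro conjI ballI)
    show "proj_Sbar H 1 \<in> proj_Sbar H ` J" using 1 by (rule imageI)
    fix z assume "z \<in> proj_Sbar H ` J"
    then obtain j where j: "z = proj_Sbar H j" "j \<in> J" by (rule imageE)
    show "\<exists>k. (\<forall>b. sg (k b) = k b) \<and> (\<forall>b. b \<notin> {()} \<longrightarrow> k b = 0) \<and> AH.evalm IM {()} (\<lambda>_. proj_Sbar H 1) k = z"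
      using e[of "\<lambda>_. j"] sg_J[OF j(2)] j(1) by (intro exI[of _ "\<lambda>_. j"]) simp
  qed
  moreover have "is_basis (AH.relations IM {()} (\<lambda>_. proj_Sbar H 1)) {}"
    unfolding is_basis_def AH.relations_def
    using e by (auto simp: ideal_module_def AH.pr_eq_0 fun_eq_iff intro!: exI[of _ "\<lambda>_. 0"])
  ultimately show ?thesis
    by (intro AH.proj_dim_if_relations_free(2)[OF IM.module_M]) auto
qed

lemma deletion_free_iff:
  assumes B: "V.is_basis MA B"
  shows "free_arrangement poly_ring id UNIV (A - {H}) \<longleftrightarrow> 1 \<in> J"
  unfolding VD.free_arrangement_iff
  using one_in_J_if_deletion_free[OF B] deletion_free_if_one_in_J[OF B] by blast

text \<open>Along the isomorphism with the syzygies, a basis of \<open>N\<close> yields a resolution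
  of length at most one. Conversely, Schanuel's lemma gives a dual basis of the syzygies, hence of
  \<open>N\<close>, and graded projective modules are free.\<close>

lemma restriction_free_iff:
  assumes B: "V.is_basis MA B"
  shows "free_arrangement (Sbar H) (proj_Sbar H) H (restriction A H) \<longleftrightarrow> proj_dim (Sbar H) IM \<le> 1"
proof
  let ?F = "\<lambda>k. rho (syz_form B k)"
  have iso: "lin_iso ?F (syzygies B) N" by (rule syzygies_iso[OF B])
  have fin: "finite B" using B by (simp add: V.is_basis_def)
  {
    assume "free_arrangement (Sbar H) (proj_Sbar H) H (restriction A H)"
    then obtain C where C: "is_basis N C" unfolding AH.free_arrangement_iff ..
    have "is_basis (syzygies B) (inv_into (syzygies B) ?F ` C)"
      by (rule lin_iso_is_basis[OF submod_logv lin_iso_inv[OF submod_syzygies iso] C])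
    then show "proj_dim (Sbar H) IM \<le> 1"
      by (intro AH.proj_dim_if_relations_free(1)[OF IM.module_M fin generates_IM[OF B]])
        (simp add: relations_IM[OF B])
  next
    assume "proj_dim (Sbar H) IM \<le> 1"
    from AH.proj_dim_le_1_dual[OF this fin generates_IM[OF B]] obtain I :: "(((((('k, 'n) mpoly set \<times> ('k, 'n) mpoly set) list \<Rightarrow>
        ('k, 'n) mpoly set) \<Rightarrow> ('k, 'n) mpoly set)) + ('n \<Rightarrow> ('k, 'n) mpoly)) set"
      and f n where "dual_basis (syzygies B) I f n"
      unfolding relations_IM[OF B] by (elim exE)
    from N_free_if_projective[OF lin_iso_dual_basis[OF submod_syzygies iso this]]
    show "free_arrangement (Sbar H) (proj_Sbar H) H (restriction A H)"
      unfolding AH.free_arrangement_iff .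
  }
qed

end

theorem theorem1p1:
  fixes A :: "('k::field^'n) set set" and H :: "('k^'n) set"
  assumes "arrangement UNIV A"
    and "free_arrangement poly_ring id UNIV A"
    and "H \<in> A"
  shows "((free_arrangement poly_ring id UNIV (A - {H}) \<longleftrightarrow>
             proj_dim (Sbar H) (ideal_module (Sbar H) (residue_ideal A H)) = 0) \<and>
          (proj_dim (Sbar H) (ideal_module (Sbar H) (residue_ideal A H)) = 0 \<longleftrightarrow>
             residue_ideal A H = carrier (Sbar H))) \<and>
         (free_arrangement (Sbar H) (proj_Sbar H) H (restriction A H) \<longleftrightarrow>
             proj_dim (Sbar H) (ideal_module (Sbar H) (residue_ideal A H)) \<le> 1)"
proof -
  have "hyperplane UNIV H" using assms by (simp add: arrangement_def)
  \<comment> \<open>The complement of \<open>H\<close> is an auxiliary choice; none of the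
    statements to be proved refers to it.\<close>
  then obtain w where "pairing (alpha H) w = 1" using ex_pairing_eq_1[OF alpha_form(2)] by blast
  then interpret residue_setup A H w using assms by unfold_locales
  obtain B where B: "V.is_basis MA B" using assms(2) unfolding VA.free_arrangement_iff ..
  show ?thesis
    unfolding deletion_free_iff[OF B] residue_ideal_eq_carrier_iff restriction_free_iff[OF B]
    using one_in_J_if_proj_dim_0 proj_dim_0_if_one_in_J by blast
qed

end
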